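(* Up to isomorphism there are exactly $270$ directed strongly regular graphs with parameters $(22,9,6,3,4)$ that admit an automorphism of order two fixing exactly eight vertices. Among them, exactly $14$ have full automorphism group of order six, isomorphic to the symmetric group $S_3$, and the others have full automorphism group of order two.
   Context: A directed strongly regular graph with parameters $(v,k,t,\lambda,\mu)$ is a loopless directed graph $\Gamma=(V,E)$ on $v$ vertices in which every vertex has in-degree and out-degree $k$, every vertex $x$ has exactly $t$ out-neighbors that are also in-neighbors of $x$, and for any vertices $x,y$ the number of directed paths of length two from $x$ to $y$ is $\lambda$ if $(x,y)\in E$ and $\mu$ if $(x,y)\notin E$. An automorphism is a permutation $\sigma$ of $V$ with $(x,y)\in E\iff(\sigma(x),\sigma(y))\in E$; the full automorphism group is the group of all automorphisms. Two directed graphs are isomorphic if there is a bijection between their vertex sets mapping edges exactly onto edges.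
   Formalization: In the definition of a directed strongly regular graph, the condition on the number of directed paths of length two from x to y is imposed only for distinct x and y; for x = y that number is t = 6, so requiring μ = 4 would leave no graphs. *)

theory Defs
  imports
    "Graph_Theory.Digraph_Isomorphism"
    "Graph_Theory.Pair_Digraph"
    "HOL-Algebra.Multiplicative_Group"
    "HOL-Algebra.Sym_Groups"
begin

text \<open>
  The locale \<open>pair_digraph\<close> supplies a finite loopless digraph whose arcs are ordered pairs of
  vertices. The two-path condition is imposed for distinct \<open>x\<close> and \<open>y\<close>: the number of
  two-paths from \<open>x\<close> to itself is \<open>t\<close>, so requiring it to be \<open>mu\<close> would force \<open>t = mu\<close>.
\<close>

locale dsrg = pair_digraph G for G :: "'a pair_pre_digraph" +
  fixes v k t lam mu :: nat
  assumes num_verts: "card (pverts G) = v"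
    and out_deg: "x \<in> pverts G \<Longrightarrow> out_degree (with_proj G) x = k"
    and in_deg: "x \<in> pverts G \<Longrightarrow> in_degree (with_proj G) x = k"
    and reciprocal: "x \<in> pverts G \<Longrightarrow>
      card {y \<in> pverts G. (x, y) \<in> parcs G \<and> (y, x) \<in> parcs G} = t"
    and two_paths: "\<lbrakk>x \<in> pverts G; y \<in> pverts G; x \<noteq> y\<rbrakk> \<Longrightarrow>
      card {z \<in> pverts G. (x, z) \<in> parcs G \<and> (z, y) \<in> parcs G} =
        (if (x, y) \<in> parcs G then lam else mu)"

definition isomorphic :: "'a pair_pre_digraph \<Rightarrow> 'b pair_pre_digraph \<Rightarrow> bool" where
  "isomorphic G H \<longleftrightarrow> (\<exists>f. bij_betw f (pverts G) (pverts H) \<and>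
     (\<forall>x\<in>pverts G. \<forall>y\<in>pverts G. (x, y) \<in> parcs G \<longleftrightarrow> (f x, f y) \<in> parcs H))"

lemma isomorphic_iff_digraph_iso:
  assumes "pair_wf_digraph G" "pair_wf_digraph H"
  shows "isomorphic G H \<longleftrightarrow> digraph_iso (with_proj G) (with_proj H)"
proof
  interpret G: pair_wf_digraph G by fact
  interpret H: pair_wf_digraph H by fact
  assume "isomorphic G H"
  then obtain f where f: "bij_betw f (pverts G) (pverts H)"
    and e: "\<And>x y. x \<in> pverts G \<Longrightarrow> y \<in> pverts G \<Longrightarrow> (x, y) \<in> parcs G \<longleftrightarrow> (f x, f y) \<in> parcs H"
    by (auto simp: isomorphic_def)
  let ?h = "\<lparr>iso_verts = f, iso_arcs = map_prod f f, iso_head = snd, iso_tail = fst\<rparr>"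
  have inj: "inj_on f (pverts G)" and im: "f ` pverts G = pverts H"
    using f by (auto simp: bij_betw_def)
  have "inj_on (map_prod f f) (parcs G)"
    using G.in_arcsD1 G.in_arcsD2 by (intro inj_on_subset[OF map_prod_inj_on[OF inj inj]]) auto
  then have "pre_digraph.digraph_isomorphism (with_proj G) ?h"
    using inj G.wf_digraph_axioms by (auto simp: pre_digraph.digraph_isomorphism_def)
  moreover have "map_prod f f ` parcs G = parcs H"
  proof
    show "map_prod f f ` parcs G \<subseteq> parcs H"
    proof (rule image_subsetI)
      fix p assume "p \<in> parcs G"
      then show "map_prod f f p \<in> parcs H"
        using e[of "fst p" "snd p"] G.in_arcsD1[of "fst p" "snd p"] G.in_arcsD2[of "fst p" "snd p"]
        by (simp add: map_prod_def split_beta)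
    qed
    show "parcs H \<subseteq> map_prod f f ` parcs G"
    proof
      fix p assume p: "p \<in> parcs H"
      then obtain a b where ab: "p = (f a, f b)" "a \<in> pverts G" "b \<in> pverts G"
        using im H.in_arcsD1 H.in_arcsD2 by (metis imageE surj_pair)
      then have "(a, b) \<in> parcs G" using e[of a b] p by simp
      then have "map_prod f f (a, b) \<in> map_prod f f ` parcs G" by (rule imageI)
      then show "p \<in> map_prod f f ` parcs G" using ab by simp
    qed
  qed
  then have "with_proj H = app_iso ?h (with_proj G)"
    using im by (simp add: app_iso_def with_proj_def)
  ultimately show "digraph_iso (with_proj G) (with_proj H)"
    by (auto simp: digraph_iso_def)
next
  interpret G: pair_wf_digraph G by fact
  assume "digraph_iso (with_proj G) (with_proj H)"
  then obtain h where h: "pre_digraph.digraph_isomorphism (with_proj G) h"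
    and H: "with_proj H = app_iso h (with_proj G)"
    by (auto simp: digraph_iso_def)
  have inj: "inj_on (iso_verts h) (pverts G)"
    and im: "pverts H = iso_verts h ` pverts G" "parcs H = iso_arcs h ` parcs G"
    and ht: "iso_tail h = fst" "iso_head h = snd"
    using h H by (auto simp: pre_digraph.digraph_isomorphism_def app_iso_def with_proj_def)
  have ar: "iso_arcs h a = (iso_verts h (fst a), iso_verts h (snd a))" if "a \<in> parcs G" for a
    using h that ht by (auto simp: pre_digraph.digraph_isomorphism_def intro: prod_eqI)
  have "(x, y) \<in> parcs G \<longleftrightarrow> (iso_verts h x, iso_verts h y) \<in> parcs H"
    if "x \<in> pverts G" "y \<in> pverts G" for x y
  proof
    assume "(x, y) \<in> parcs G"
    then show "(iso_verts h x, iso_verts h y) \<in> parcs H"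
      using ar im by force
  next
    assume "(iso_verts h x, iso_verts h y) \<in> parcs H"
    then obtain a b where ab: "(a, b) \<in> parcs G"
      "iso_verts h x = iso_verts h a" "iso_verts h y = iso_verts h b"
      using ar im by auto
    then show "(x, y) \<in> parcs G"
      using inj that G.in_arcsD1 G.in_arcsD2 by (metis inj_onD)
  qed
  then show "isomorphic G H"
    using inj im by (auto simp: isomorphic_def bij_betw_def)
qed

definition iso_classes :: "'a pair_pre_digraph set \<Rightarrow> 'a pair_pre_digraph set set" where
  "iso_classes S = S // {(G, H). G \<in> S \<and> H \<in> S \<and> isomorphic G H}"

lemma isomorphic_refl: "isomorphic G G"
  unfolding isomorphic_def by (intro exI[of _ id]) auto

lemma isomorphic_sym:
  assumes "isomorphic G H" shows "isomorphic H G"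
proof -
  obtain f where f: "bij_betw f (pverts G) (pverts H)"
    and e: "\<forall>x\<in>pverts G. \<forall>y\<in>pverts G. (x, y) \<in> parcs G \<longleftrightarrow> (f x, f y) \<in> parcs H"
    using assms by (auto simp: isomorphic_def)
  let ?g = "inv_into (pverts G) f"
  have "bij_betw ?g (pverts H) (pverts G)" using f by (rule bij_betw_inv_into)
  moreover from this have "?g x \<in> pverts G" "f (?g x) = x" if "x \<in> pverts H" for x
    using that f by (auto dest: bij_betwE simp: bij_betw_inv_into_right)
  ultimately show ?thesis
    unfolding isomorphic_def using e by (intro exI[of _ ?g]) auto
qed

lemma isomorphic_trans:
  assumes "isomorphic G H" "isomorphic H K" shows "isomorphic G K"
proof -
  obtain f g where f: "bij_betw f (pverts G) (pverts H)"
    and e: "\<forall>x\<in>pverts G. \<forall>y\<in>pverts G. (x, y) \<in> parcs G \<longleftrightarrow> (f x, f y) \<in> parcs H"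
    and g: "bij_betw g (pverts H) (pverts K)"
    and e': "\<forall>x\<in>pverts H. \<forall>y\<in>pverts H. (x, y) \<in> parcs H \<longleftrightarrow> (g x, g y) \<in> parcs K"
    using assms by (auto simp: isomorphic_def)
  have "f x \<in> pverts H" if "x \<in> pverts G" for x
    using that f by (auto dest: bij_betwE)
  then show ?thesis
    unfolding isomorphic_def using e e' bij_betw_trans[OF f g]
    by (intro exI[of _ "g \<circ> f"]) auto
qed

lemma equiv_isomorphic: "equiv S {(G, H). G \<in> S \<and> H \<in> S \<and> isomorphic G H}"
  by (rule equivI)
    (auto intro: refl_onI symI transI isomorphic_refl isomorphic_sym isomorphic_trans)

text \<open>Automorphisms are extended by the identity outside the vertex set (\<open>permutes\<close>).\<close>

definition automorphisms :: "'a pair_pre_digraph \<Rightarrow> ('a \<Rightarrow> 'a) set" where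
  "automorphisms G = {\<sigma>. \<sigma> permutes pverts G \<and>
     (\<forall>x\<in>pverts G. \<forall>y\<in>pverts G. (x, y) \<in> parcs G \<longleftrightarrow> (\<sigma> x, \<sigma> y) \<in> parcs G)}"

definition aut_group :: "'a pair_pre_digraph \<Rightarrow> ('a \<Rightarrow> 'a) monoid" where
  "aut_group G = \<lparr>carrier = automorphisms G, mult = (\<circ>), one = id\<rparr>"

lemma group_aut_group: "group (aut_group G)"
proof (rule groupI)
  fix s r assume "s \<in> carrier (aut_group G)" "r \<in> carrier (aut_group G)"
  then have p: "s permutes pverts G" "r permutes pverts G"
    and es: "\<And>x y. x \<in> pverts G \<Longrightarrow> y \<in> pverts G \<Longrightarrow> (x, y) \<in> parcs G \<longleftrightarrow> (s x, s y) \<in> parcs G"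
    and er: "\<And>x y. x \<in> pverts G \<Longrightarrow> y \<in> pverts G \<Longrightarrow> (x, y) \<in> parcs G \<longleftrightarrow> (r x, r y) \<in> parcs G"
    by (simp_all add: aut_group_def automorphisms_def)
  have "(x, y) \<in> parcs G \<longleftrightarrow> (s (r x), s (r y)) \<in> parcs G"
    if "x \<in> pverts G" "y \<in> pverts G" for x y
    using that er[of x y] es[of "r x" "r y"] permutes_in_image[OF p(2)] by simp
  then show "s \<otimes>\<^bsub>aut_group G\<^esub> r \<in> carrier (aut_group G)"
    using permutes_compose[OF p(2,1)] by (simp add: aut_group_def automorphisms_def)
next
  show "\<one>\<^bsub>aut_group G\<^esub> \<in> carrier (aut_group G)"
    by (auto simp: aut_group_def automorphisms_def)
next
  fix s assume "s \<in> carrier (aut_group G)"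
  then have s: "s permutes pverts G"
    and e: "\<And>x y. x \<in> pverts G \<Longrightarrow> y \<in> pverts G \<Longrightarrow> (x, y) \<in> parcs G \<longleftrightarrow> (s x, s y) \<in> parcs G"
    by (simp_all add: aut_group_def automorphisms_def)
  have i: "inv' s permutes pverts G" using s by (rule permutes_inv)
  have "(x, y) \<in> parcs G \<longleftrightarrow> (inv' s x, inv' s y) \<in> parcs G"
    if "x \<in> pverts G" "y \<in> pverts G" for x y
    using that e[of "inv' s x" "inv' s y"] permutes_in_image[OF i] permutes_inverses(1)[OF s] by simp
  then have "inv' s \<in> automorphisms G"
    using i by (simp add: automorphisms_def)
  then show "\<exists>r\<in>carrier (aut_group G). r \<otimes>\<^bsub>aut_group G\<^esub> s = \<one>\<^bsub>aut_group G\<^esub>"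
    using permutes_inv_o(2)[OF s] by (auto simp: aut_group_def)
qed (auto simp: aut_group_def comp_assoc)

definition dsrgs_with_involution ::
    "nat \<Rightarrow> nat \<Rightarrow> nat \<Rightarrow> nat \<Rightarrow> nat \<Rightarrow> nat \<Rightarrow> 'a pair_pre_digraph set" where
  "dsrgs_with_involution v k t lam mu f = {G. dsrg G v k t lam mu \<and>
     (\<exists>\<sigma>\<in>carrier (aut_group G). group.ord (aut_group G) \<sigma> = 2 \<and>
        card {x \<in> pverts G. \<sigma> x = x} = f)}"

end

theory Submission
  imports Defs "HOL-Library.List_Lexorder"
begin

text \<open>
  Let \<open>A\<close> be the adjacency matrix, so that \<open>A\<^sup>2 + A = 4 J + 2 I\<close>. With the eight fixed vertices of the involution first and
  the two vertices of the \<open>l\<close>-th transposed pair at the positions \<open>8 + l\<close> and \<open>15 + l\<close>, the rows of \<open>A\<close> are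
  \<open>(M, N, N)\<close>, \<open>(K, P, Q)\<close> and \<open>(K, Q, P)\<close> in block form. Modulo two, \<open>M\<close> is idempotent and its column sums are odd; this leaves eleven
  matrices \<open>M\<close> up to relabelling. Then \<open>N K\<close> and the sums of the rows of \<open>N\<close> and of the columns of \<open>K\<close> are determined by \<open>M\<close>; with the
  orbits in lexicographic order, the pairs consisting of a row of \<open>N\<close> and a column of \<open>K\<close> are found one after the other. There are none
  for four of the matrices \<open>M\<close>, for one of them because \<open>N K\<close> would be invertible modulo two although \<open>N\<close> has only seven columns. Since \<open>2 K N - 2 I\<close> turns out to be the sum of a matrix with constant rows and one with constant columns, the equation for \<open>N (P + Q)\<close> determines
  \<open>P + Q\<close>. Finally \<open>B = P - Q\<close> satisfies \<open>B\<^sup>2 + B = 2 I\<close>, and exchanging the vertices of some pairs conjugates \<open>B\<close> with a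
  diagonal matrix of signs; up to this there are 270 solutions in all.

  The solutions are told apart by a sum over numbers of common out-neighbours. The same numbers single out a set \<open>T\<close> of two or three vertices, two of
  which, once they are fixed, distinguish all the vertices. Hence the automorphism group acts faithfully on \<open>T\<close>, and the involution moves \<open>T\<close>.
\<close>

subsection \<open>Lists of truth values\<close>

text \<open>All searches are universal statements: a pruned branch counts as true, and the predicate
  at the leaves has to hold. For each search it therefore suffices that the matrix at hand survives
  every test on its own branch, and a search with the constant predicate \<open>False\<close>
  refutes existence. Sorting the vertices or the orbits does not select one matrix from each class
  of relabellings; the surplus is removed at the leaves, where precomputed trees name a relabelling
  that is then checked. The trees, the case data and the rotations are only hints, and nothing about
  their origin is assumed. The result is a list of 270 matrices that meets every class; that it
  meets none twice follows from 270 different values of an invariant.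

  Two facts keep the evaluation small. Idempotence turns each chosen row of \<open>M\<close> into a
  linear relation between all the rows, which may force later rows. Moreover, the first seven
  candidates for \<open>M\<close> prescribe the same sums and products for \<open>N\<close> and
  \<open>K\<close>, so that a single search serves them all.\<close>

text \<open>
  Vectors are written as numbers: \<open>bits n\<close> lists the binary digits of \<open>n\<close> after the leading one, the lowest first.
  The searches are evaluated by rewriting. Therefore tests are stated by constructor patterns, and connectives by conditionals, of which
  only the selected branch is evaluated.
\<close>

primrec nbits :: "num \<Rightarrow> bool list" where
  "nbits num.One = []"
| "nbits (num.Bit0 n) = False # nbits n"
| "nbits (num.Bit1 n) = True # nbits n"

definition bits :: "nat \<Rightarrow> bool list" where "bits n = nbits (num_of_nat n)"

lemma bits_numeral: "bits (numeral n) = nbits n"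
  by (simp add: bits_def num_of_nat_numeral_eq)

fun dot :: "bool list \<Rightarrow> bool list \<Rightarrow> nat" where
  "dot (False # xs) (y # ys) = dot xs ys"
| "dot (True # xs) (False # ys) = dot xs ys"
| "dot (True # xs) (True # ys) = Suc (dot xs ys)"
| "dot [] ys = 0"
| "dot (x # xs) [] = 0"

fun dot_is :: "bool list \<Rightarrow> bool list \<Rightarrow> nat \<Rightarrow> bool" where
  "dot_is (False # xs) (y # ys) n = dot_is xs ys n"
| "dot_is (True # xs) (False # ys) n = dot_is xs ys n"
| "dot_is (True # xs) (True # ys) (Suc n) = dot_is xs ys n"
| "dot_is (True # xs) (True # ys) 0 = False"
| "dot_is [] ys 0 = True"
| "dot_is [] ys (Suc n) = False"
| "dot_is (x # xs) [] 0 = True"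
| "dot_is (x # xs) [] (Suc n) = False"

fun eql :: "bool list \<Rightarrow> bool list \<Rightarrow> bool" where
  "eql [] [] = True"
| "eql (True # xs) (True # ys) = eql xs ys"
| "eql (False # xs) (False # ys) = eql xs ys"
| "eql (True # xs) (False # ys) = False"
| "eql (False # xs) (True # ys) = False"
| "eql [] (y # ys) = False"
| "eql (x # xs) [] = False"

fun eqm :: "bool list list \<Rightarrow> bool list list \<Rightarrow> bool" where
  "eqm [] [] = True"
| "eqm (x # xs) (y # ys) = (if eql x y then eqm xs ys else False)"
| "eqm [] (y # ys) = False"
| "eqm (x # xs) [] = False"

primrec sing :: "'a list \<Rightarrow> 'a list list" where
  "sing [] = []"
| "sing (x # xs) = [x] # sing xs"

fun consz :: "'a list \<Rightarrow> 'a list list \<Rightarrow> 'a list list" where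
  "consz (x # xs) (l # ls) = (x # l) # consz xs ls"
| "consz [] ls = []"
| "consz (x # xs) [] = []"

fun transposed :: "'a list list \<Rightarrow> 'a list list" where
  "transposed [] = []"
| "transposed [r] = sing r"
| "transposed (r # r' # rs) = consz r (transposed (r' # rs))"

primrec all_in :: "('a \<Rightarrow> bool) \<Rightarrow> 'a list \<Rightarrow> bool" where
  "all_in f [] = True"
| "all_in f (x # xs) = (if f x then all_in f xs else False)"

primrec pick :: "nat list \<Rightarrow> 'a list \<Rightarrow> 'a list" where
  "pick [] xs = []"
| "pick (q # qs) xs = xs ! q # pick qs xs"

primrec relab :: "nat list \<Rightarrow> nat list \<Rightarrow> 'a list list \<Rightarrow> 'a list list" where
  "relab [] qs X = []"
| "relab (p # ps) qs X = pick qs (X ! p) # relab ps qs X"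

fun eqn :: "nat \<Rightarrow> nat \<Rightarrow> bool" where
  "eqn 0 0 = True"
| "eqn (Suc m) (Suc n) = eqn m n"
| "eqn 0 (Suc n) = False"
| "eqn (Suc m) 0 = False"

primrec memn :: "nat \<Rightarrow> nat list \<Rightarrow> bool" where
  "memn n [] = False"
| "memn n (m # ms) = (if eqn n m then True else memn n ms)"

primrec isperm :: "nat \<Rightarrow> nat list \<Rightarrow> bool" where
  "isperm 0 ps = True"
| "isperm (Suc n) ps = (if memn n ps then isperm n ps else False)"

text \<open>Certificates for the leaves of a search are found by inspecting single entries of the matrix.\<close>

datatype 'c dtree = Lf 'c | Nd nat nat "'c dtree" "'c dtree"

primrec look :: "'c dtree \<Rightarrow> bool list list \<Rightarrow> 'c" where
  "look (Lf c) X = c"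
| "look (Nd i j s t) X = (if X ! i ! j then look t X else look s X)"

subsection \<open>The submatrix of the fixed vertices\<close>

text \<open>The constructor \<open>num.One\<close> ends a word and is not a digit, so the sum of two
  words of equal length keeps their length.\<close>

fun xor_num :: "num \<Rightarrow> num \<Rightarrow> num" where
  "xor_num (num.Bit0 x) (num.Bit0 y) = num.Bit0 (xor_num x y)"
| "xor_num (num.Bit0 x) (num.Bit1 y) = num.Bit1 (xor_num x y)"
| "xor_num (num.Bit1 x) (num.Bit0 y) = num.Bit1 (xor_num x y)"
| "xor_num (num.Bit1 x) (num.Bit1 y) = num.Bit0 (xor_num x y)"
| "xor_num num.One y = num.One"
| "xor_num (num.Bit0 x) num.One = num.One"
| "xor_num (num.Bit1 x) num.One = num.One"

text \<open>Eliminates the chosen rows from the relation that the rows marked in the first argument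
  add up to the last: every chosen row that is marked moves to the other side, and a relation
  between the remaining rows is left.\<close>

fun comb :: "num \<Rightarrow> num list \<Rightarrow> num \<Rightarrow> num \<times> num" where
  "comb (num.Bit1 b) (r # rs) a = comb b rs (xor_num r a)"
| "comb (num.Bit0 b) (r # rs) a = comb b rs a"
| "comb b [] a = (b, a)"
| "comb num.One (r # rs) a = (num.One, a)"

fun zero_mask :: "num \<Rightarrow> bool" where
  "zero_mask num.One = True"
| "zero_mask (num.Bit0 m) = zero_mask m"
| "zero_mask (num.Bit1 m) = False"

text \<open>A pair \<open>(m, w)\<close> states that the sum modulo two of the rows marked in \<open>m\<close> is \<open>w\<close>, where the first digit of \<open>m\<close> belongs to the first
  row that has not been chosen. A span is a list of such relations that is closed under addition.\<close>

type_synonym span = "(num \<times> num) list"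

fun find_row :: "span \<Rightarrow> num option" where
  "find_row [] = None"
| "find_row ((num.Bit1 m, w) # sp) = (if zero_mask m then Some w else find_row sp)"
| "find_row ((num.Bit0 m, w) # sp) = find_row sp"
| "find_row ((num.One, w) # sp) = find_row sp"

text \<open>Meant for a row that is forced. The span is closed under addition and contains the
  relation for this row alone, so each relation involving the row is the sum of that one and of a
  relation that is kept. The span is halved without loss.\<close>

fun red0 :: "span \<Rightarrow> span" where
  "red0 [] = []"
| "red0 ((num.Bit1 m, w) # sp) = red0 sp"
| "red0 ((num.Bit0 m, w) # sp) = (m, w) # red0 sp"
| "red0 ((num.One, w) # sp) = red0 sp"

fun red1 :: "num \<Rightarrow> span \<Rightarrow> span" where
  "red1 x [] = []"
| "red1 x ((num.Bit1 m, w) # sp) = (m, xor_num x w) # red1 x sp"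
| "red1 x ((num.Bit0 m, w) # sp) = (m, w) # red1 x sp"
| "red1 x ((num.One, w) # sp) = red1 x sp"

fun eqnum :: "num \<Rightarrow> num \<Rightarrow> bool" where
  "eqnum num.One num.One = True"
| "eqnum num.One (num.Bit0 n) = False"
| "eqnum num.One (num.Bit1 n) = False"
| "eqnum (num.Bit0 n) num.One = False"
| "eqnum (num.Bit1 n) num.One = False"
| "eqnum (num.Bit0 m) (num.Bit0 n) = eqnum m n"
| "eqnum (num.Bit1 m) (num.Bit1 n) = eqnum m n"
| "eqnum (num.Bit0 m) (num.Bit1 n) = False"
| "eqnum (num.Bit1 m) (num.Bit0 n) = False"

text \<open>Whether a relation \<open>(m, w)\<close> on the rows after \<open>x\<close> agrees with a span in which \<open>x\<close> occurs.\<close>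

fun span_check :: "num \<Rightarrow> num \<Rightarrow> num \<Rightarrow> span \<Rightarrow> bool option" where
  "span_check x m w [] = None"
| "span_check x m w ((num.Bit0 m', w') # sp) = (if eqnum m m' then Some (eqnum w w') else span_check x m w sp)"
| "span_check x m w ((num.Bit1 m', w') # sp) = (if eqnum m m' then Some (eqnum w (xor_num x w')) else span_check x m w sp)"
| "span_check x m w ((num.One, w') # sp) = span_check x m w sp"

fun mulx :: "num \<Rightarrow> num \<Rightarrow> span \<Rightarrow> span" where
  "mulx m w [] = []"
| "mulx m w ((m', w') # sp) = (xor_num m m', xor_num w w') # mulx m w sp"

definition dbl :: "num \<Rightarrow> num \<Rightarrow> span \<Rightarrow> span" where "dbl m w sp = sp @ mulx m w sp"

text \<open>A mask outside the span adds a dimension and doubles the list. A mask inside it must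
  come with the sum that the span prescribes; otherwise the branch is closed.\<close>

definition upd :: "bool option \<Rightarrow> num \<Rightarrow> num \<Rightarrow> num \<Rightarrow> span \<Rightarrow> span option" where
  "upd c x m w sp = (case c of None \<Rightarrow> Some (dbl m w (red1 x sp))
     | Some b \<Rightarrow> if b then Some (red1 x sp) else None)"

definition upd0 :: "bool option \<Rightarrow> num \<Rightarrow> num \<Rightarrow> span \<Rightarrow> span option" where
  "upd0 c m w sp = (case c of None \<Rightarrow> Some (dbl m w sp) | Some b \<Rightarrow> if b then Some sp else None)"

text \<open>By idempotence the rows marked in \<open>x\<close> add up to \<open>x\<close>. The pair
  is this relation after elimination of the earlier rows; its first digit tells whether
  \<open>x\<close> itself takes part. The first argument tells whether the row was forced, which
  decides between \<open>red0\<close> and \<open>red1\<close>.\<close>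

fun stp0 :: "num option \<Rightarrow> num \<times> num \<Rightarrow> span \<Rightarrow> num \<Rightarrow> span option" where
  "stp0 None (num.Bit0 m, w) sp x = upd (span_check x m w sp) x m w sp"
| "stp0 None (num.Bit1 m, w) sp x = upd (span_check x m (xor_num x w) sp) x m (xor_num x w) sp"
| "stp0 (Some u) (num.Bit0 m, w) sp x = upd0 (span_check x m w sp) m w (red0 sp)"
| "stp0 (Some u) (num.Bit1 m, w) sp x = upd0 (span_check x m (xor_num x w) sp) m (xor_num x w) (red0 sp)"
| "stp0 u (num.One, w) sp x = Some []"

text \<open>The first argument marks the adjacent pairs of columns that agree in all rows so far; on these the next row must not decrease.\<close>

fun order_ok :: "bool list \<Rightarrow> bool list \<Rightarrow> bool" where
  "order_ok (False # es) (x # xs) = order_ok es xs"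
| "order_ok (True # es) (False # xs) = order_ok es xs"
| "order_ok (True # es) (True # True # xs) = order_ok es (True # xs)"
| "order_ok (True # es) (True # False # xs) = False"
| "order_ok (True # es) [True] = True"
| "order_ok [] xs = True"
| "order_ok (e # es) [] = True"

fun ties :: "bool list \<Rightarrow> bool list \<Rightarrow> bool list" where
  "ties (False # es) (x # xs) = False # ties es xs"
| "ties (True # es) (True # True # xs) = True # ties es (True # xs)"
| "ties (True # es) (False # False # xs) = True # ties es (False # xs)"
| "ties (True # es) (True # False # xs) = False # ties es (False # xs)"
| "ties (True # es) (False # True # xs) = False # ties es (True # xs)"
| "ties (True # es) [x] = []"
| "ties [] xs = []"
| "ties (e # es) [] = []"

fun lex_le :: "bool list \<Rightarrow> bool list \<Rightarrow> bool" where
  "lex_le (True # xs) (True # ys) = lex_le xs ys"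
| "lex_le (False # xs) (False # ys) = lex_le xs ys"
| "lex_le (False # xs) (True # ys) = True"
| "lex_le (True # xs) (False # ys) = False"
| "lex_le [] ys = True"
| "lex_le (x # xs) [] = False"

primrec weight :: "bool list \<Rightarrow> nat" where
  "weight [] = 0"
| "weight (x # xs) = (if x then Suc (weight xs) else weight xs)"

primrec bool_lists :: "nat \<Rightarrow> bool list list" where
  "bool_lists 0 = [[]]"
| "bool_lists (Suc n) = map (Cons False) (bool_lists n) @ map (Cons True) (bool_lists n)"

text \<open>The argument \<open>n\<close> counts the rows still to be chosen after the present one,
  so that the present one is row \<open>7 - n\<close>.\<close>

definition row_step :: "(nat \<Rightarrow> num list \<Rightarrow> num \<Rightarrow> bool) \<Rightarrow> nat \<Rightarrow> num list \<Rightarrow> span \<Rightarrow> num \<Rightarrow> span option" where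
  "row_step od n rows sp x = (if od n rows x then stp0 (find_row sp) (comb x rows x) sp x else None)"

definition candidates :: "(nat \<Rightarrow> num list) \<Rightarrow> (nat \<Rightarrow> num \<Rightarrow> bool) \<Rightarrow> nat \<Rightarrow> span \<Rightarrow> num list" where
  "candidates cd okw n sp = (case find_row sp of None \<Rightarrow> cd n | Some w \<Rightarrow> if okw n w then [w] else [])"

text \<open>A rejected row counts as success, so a positive result bounds the set of matrices from
  above.\<close>

primrec row_search :: "(num list \<Rightarrow> bool) \<Rightarrow> (nat \<Rightarrow> num list \<Rightarrow> num \<Rightarrow> bool) \<Rightarrow>
    (nat \<Rightarrow> num list) \<Rightarrow> (nat \<Rightarrow> num \<Rightarrow> bool) \<Rightarrow> nat \<Rightarrow> num list \<Rightarrow> span \<Rightarrow> bool" where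
  "row_search P od cd okw 0 rows sp = P rows"
| "row_search P od cd okw (Suc n) rows sp =
     all_in (\<lambda>x. case row_step od n rows sp x of None \<Rightarrow> True | Some sp' \<Rightarrow> row_search P od cd okw n (rows @ [x]) sp')
       (candidates cd okw n sp)"

abbreviation n1 :: nat where "n1 \<equiv> Suc 0"
abbreviation n2 :: nat where "n2 \<equiv> Suc n1"
abbreviation n3 :: nat where "n3 \<equiv> Suc n2"
abbreviation n4 :: nat where "n4 \<equiv> Suc n3"
abbreviation n5 :: nat where "n5 \<equiv> Suc n4"
abbreviation n6 :: nat where "n6 \<equiv> Suc n5"
abbreviation n7 :: nat where "n7 \<equiv> Suc n6"

fun snum :: "num \<Rightarrow> num" where
  "snum num.One = num.One"
| "snum (num.Bit0 x) = x"
| "snum (num.Bit1 x) = x"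

definition drop4 :: "num \<Rightarrow> bool list" where
  "drop4 x = nbits (snum (snum (snum (snum x))))"

definition fl1 :: "num list \<Rightarrow> bool list" where
  "fl1 rows = ties [True, True, True] (drop4 (rows ! n1))"

definition fl2 :: "num list \<Rightarrow> bool list" where
  "fl2 rows = ties (fl1 rows) (drop4 (rows ! n2))"

definition leq4 :: "num \<Rightarrow> num \<Rightarrow> bool" where
  "leq4 x y = lex_le (take n4 (nbits x)) (take n4 (nbits y))"

text \<open>In the search where it is used, row 0 has its ones in the columns 1, 2 and 3, which
  leaves the vertices 4 to 7 interchangeable. They are sorted by their entries in row 1, then in row
  2, and then by the first four entries of their own rows; the last comparison applies only to
  neighbours that are still tied. The argument 6 stands for row 1, the argument 0 for row 7.\<close>

fun ord1 :: "nat \<Rightarrow> num list \<Rightarrow> num \<Rightarrow> bool" where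
  "ord1 0 rows x = (if fl2 rows ! n2 then leq4 (rows ! n6) x else True)"
| "ord1 (Suc 0) rows x = (if fl2 rows ! n1 then leq4 (rows ! n5) x else True)"
| "ord1 (Suc (Suc 0)) rows x = (if fl2 rows ! 0 then leq4 (rows ! n4) x else True)"
| "ord1 (Suc (Suc (Suc 0))) rows x = True"
| "ord1 (Suc (Suc (Suc (Suc 0)))) rows x = True"
| "ord1 (Suc (Suc (Suc (Suc (Suc 0))))) rows x = order_ok (fl1 rows) (drop4 x)"
| "ord1 (Suc (Suc (Suc (Suc (Suc (Suc n)))))) rows x = order_ok [True, True, True] (drop4 x)"

definition ord0 :: "nat \<Rightarrow> num list \<Rightarrow> num \<Rightarrow> bool" where
  "ord0 n rows x = True"

fun diag0 :: "nat \<Rightarrow> bool list \<Rightarrow> bool" where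
  "diag0 0 x = (\<not> x ! n7)"
| "diag0 (Suc 0) x = (\<not> x ! n6)"
| "diag0 (Suc (Suc 0)) x = (\<not> x ! n5)"
| "diag0 (Suc (Suc (Suc 0))) x = (\<not> x ! n4)"
| "diag0 (Suc (Suc (Suc (Suc 0)))) x = (\<not> x ! n3)"
| "diag0 (Suc (Suc (Suc (Suc (Suc 0))))) x = (\<not> x ! n2)"
| "diag0 (Suc (Suc (Suc (Suc (Suc (Suc 0)))))) x = (\<not> x ! n1)"
| "diag0 (Suc (Suc (Suc (Suc (Suc (Suc (Suc n))))))) x = (\<not> x ! 0)"

definition okb :: "nat list \<Rightarrow> nat \<Rightarrow> bool list \<Rightarrow> bool" where
  "okb ws n x = (if diag0 n x then memn (weight x) ws else False)"

text \<open>A row of \<open>M\<close> has odd weight, because the two vertices of an orbit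
  contribute equally to the degree 9, and weight at most seven, because the diagonal is zero. The
  variant \<open>okw0\<close> serves matrices without a row of weight three.\<close>

definition okw1 :: "nat \<Rightarrow> num \<Rightarrow> bool" where "okw1 n x = okb [n1, n3, n5, n7] n (nbits x)"
definition okw0 :: "nat \<Rightarrow> num \<Rightarrow> bool" where "okw0 n x = okb [n1, n5, n7] n (nbits x)"

primrec filt :: "('a \<Rightarrow> bool) \<Rightarrow> 'a list \<Rightarrow> 'a list" where
  "filt f [] = []"
| "filt f (x # xs) = (if f x then x # filt f xs else filt f xs)"

primrec words :: "nat \<Rightarrow> num list" where
  "words 0 = [num.One]"
| "words (Suc n) = map num.Bit0 (words n) @ map num.Bit1 (words n)"

definition words8 :: "num list" where "words8 = words (Suc n7)"
definition cd1 :: "nat \<Rightarrow> num list" where "cd1 n = filt (okw1 n) words8"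
definition cd0 :: "nat \<Rightarrow> num list" where "cd0 n = filt (okw0 n) words8"

text \<open>The numbers 256 and 511 are the words of eight zeros and of eight ones. The initial span
  says that the empty sum vanishes and that all rows together add up to the all-one vector, since
  the column sums are odd.\<close>

definition s1run :: "(num list \<Rightarrow> bool) \<Rightarrow> (nat \<Rightarrow> num list \<Rightarrow> num \<Rightarrow> bool) \<Rightarrow>
    (nat \<Rightarrow> num list) \<Rightarrow> (nat \<Rightarrow> num \<Rightarrow> bool) \<Rightarrow> num \<Rightarrow> bool" where
  "s1run P od cd okw x = (case row_step ord0 n7 [] [(num_of_nat 256, num_of_nat 256), (num_of_nat 511, num_of_nat 511)] x of
     None \<Rightarrow> True | Some sp \<Rightarrow> row_search P od cd okw n7 [x] sp)"

subsection \<open>The arcs between fixed vertices and orbits\<close>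

primrec filter_dot :: "bool list \<Rightarrow> nat \<Rightarrow> bool list list \<Rightarrow> bool list list" where
  "filter_dot k c [] = []"
| "filter_dot k c (x # xs) = (if dot_is x k c then x # filter_dot k c xs else filter_dot k c xs)"

fun filter_dots :: "bool list list \<Rightarrow> nat list \<Rightarrow> bool list list \<Rightarrow> bool list list" where
  "filter_dots (k # ks) (c # cs) xs = filter_dots ks cs (filter_dot k c xs)"
| "filter_dots [] cs xs = xs"
| "filter_dots (k # ks) [] xs = xs"

primrec all_columns :: "(bool list \<Rightarrow> bool list \<Rightarrow> bool) \<Rightarrow> nat \<Rightarrow> bool list \<Rightarrow> bool list \<Rightarrow> bool list list \<Rightarrow> bool" where
  "all_columns h d x es [] = True"
| "all_columns h d x es (k # ks) = (if dot_is x k d then (if order_ok es k then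
     (if h k (ties es k) then all_columns h d x es ks else False) else all_columns h d x es ks) else all_columns h d x es ks)"

primrec all_pairs :: "(bool list \<Rightarrow> bool list \<Rightarrow> bool list \<Rightarrow> bool) \<Rightarrow> nat \<Rightarrow> bool list \<Rightarrow> bool list list \<Rightarrow>
    bool list list \<Rightarrow> bool" where
  "all_pairs g d es [] ks = True"
| "all_pairs g d es (x # xs) ks = (if order_ok es x then (if all_columns (g x) d x (ties es x) ks then all_pairs g d es xs ks else False)
     else all_pairs g d es xs ks)"

definition wds7 :: "nat \<Rightarrow> bool list list" where
  "wds7 k = filt (\<lambda>x. eqn (weight x) k) (bool_lists n7)"

text \<open>An entry of the list gives the weights of a row of \<open>N\<close> and of the
  corresponding column of \<open>K\<close>, the products of the row with the earlier columns, those
  of the column with the earlier rows, and the product of the two. All of them are prescribed by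
  \<open>M\<close>.\<close>

primrec pair_search :: "(bool list list \<Rightarrow> bool list list \<Rightarrow> bool) \<Rightarrow> (nat \<times> nat \<times> nat list \<times> nat list \<times> nat) list \<Rightarrow>
    bool list list \<Rightarrow> bool list list \<Rightarrow> bool list \<Rightarrow> bool" where
  "pair_search P [] Ns Ks es = P Ns Ks"
| "pair_search P (sp # sps) Ns Ks es = (case sp of (rw, cw, rc, cc, d) \<Rightarrow>
     all_pairs (\<lambda>x k es'. pair_search P sps (Ns @ [x]) (Ks @ [k]) es') d es (filter_dots Ks rc (wds7 rw)) (filter_dots Ns cc (wds7 cw)))"

text \<open>The type \<open>num\<close> has no zero, so a natural number \<open>n\<close> is represented by \<open>n + 1\<close> and sums start from one.\<close>

primrec suc_num :: "nat \<Rightarrow> num" where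
  "suc_num 0 = num.One"
| "suc_num (Suc n) = Num.inc (suc_num n)"

fun wsum :: "bool list \<Rightarrow> num list \<Rightarrow> num \<Rightarrow> num" where
  "wsum (True # bs) (x # xs) a = wsum bs xs (a + x)"
| "wsum (False # bs) (x # xs) a = wsum bs xs a"
| "wsum [] xs a = a"
| "wsum (b # bs) [] a = a"

fun nsum :: "num list \<Rightarrow> num \<Rightarrow> num" where
  "nsum [] a = a"
| "nsum (x # xs) a = nsum xs (a + x)"

text \<open>With \<open>e\<^sub>i = 1 + N\<^sub>i\<^sub>j + (M N)\<^sub>i\<^sub>j\<close>, with \<open>n\<close> and \<open>k\<close> the sums of column \<open>j\<close> of \<open>N\<close> and row
  \<open>l\<close> of \<open>K\<close>, the entry \<open>s\<close> of \<open>P + Q\<close> at \<open>(l, j)\<close> satisfies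
  \<open>2 s + 4 n + 2 (\<Sum>i\<in>K\<^sub>l. e\<^sub>i) + 4 = n k + k + (\<Sum>i. e\<^sub>i)\<close>.\<close>

fun ecol :: "bool list list \<Rightarrow> bool list \<Rightarrow> bool list \<Rightarrow> num list" where
  "ecol (m # ms) (x # xs) col = suc_num (dot (x # m) (True # col)) # ecol ms xs col"
| "ecol [] xs col = []"
| "ecol (m # ms) [] col = []"

definition slhs :: "num list \<Rightarrow> bool list \<Rightarrow> bool list \<Rightarrow> num" where
  "slhs e krow ncol = suc_num (weight ncol) + num.Bit0 (num.Bit0 (suc_num (weight ncol))) + num.Bit0 (wsum krow e num.One)"

definition srhs :: "num list \<Rightarrow> bool list \<Rightarrow> bool list \<Rightarrow> num" where
  "srhs e krow ncol = nsum e (suc_num (weight ncol) * suc_num (weight krow) + num.Bit0 num.One)"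

text \<open>If \<open>2 s + l = r\<close> with \<open>s \<le> 2\<close> then \<open>s\<close> is the value of \<open>sval l r\<close>.\<close>

definition sval :: "num \<Rightarrow> num \<Rightarrow> nat" where
  "sval l r = (if eqnum l r then 0 else if eqnum (l + num.Bit0 num.One) r then n1 else n2)"

text \<open>The value two is excluded on the diagonal, because \<open>P\<close> has a zero
  diagonal.\<close>

definition sbad :: "bool \<Rightarrow> num \<Rightarrow> num \<Rightarrow> bool" where
  "sbad dg l r = (if eqnum l r then False else if eqnum (l + num.Bit0 num.One) r then False
     else if dg then True else \<not> eqnum (l + num.Bit0 (num.Bit0 num.One)) r)"

primrec scol :: "num list \<Rightarrow> bool list \<Rightarrow> bool list list \<Rightarrow> nat list" where
  "scol e ncol [] = []"
| "scol e ncol (k # ks) = sval (slhs e k ncol) (srhs e k ncol) # scol e ncol ks"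

text \<open>Entry \<open>j\<close> of the result is column \<open>j\<close> of \<open>P + Q\<close>; the last two arguments are the rows of \<open>K\<close> and the columns of \<open>N\<close>.\<close>

primrec scols :: "bool list list \<Rightarrow> bool list list \<Rightarrow> bool list list \<Rightarrow> nat list list" where
  "scols M Krows [] = []"
| "scols M Krows (c # cs) = scol (ecol M c c) c Krows # scols M Krows cs"

definition bade :: "bool \<Rightarrow> num list \<Rightarrow> bool list \<Rightarrow> bool list \<Rightarrow> bool" where
  "bade dg e k c = sbad dg (slhs e k c) (srhs e k c)"

definition badc :: "bool list list \<Rightarrow> bool list \<Rightarrow> bool list \<Rightarrow> bool \<Rightarrow> bool" where
  "badc M c k dg = bade dg (ecol M c c) k c"

definition bad :: "bool list list \<Rightarrow> bool list list \<Rightarrow> bool list list \<Rightarrow> nat \<Rightarrow> nat \<Rightarrow> bool" where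
  "bad M Ncols Krows l j = badc M (Ncols ! j) (Krows ! l) (eqn l j)"

primrec dblp :: "nat \<Rightarrow> nat \<Rightarrow> nat" where
  "dblp 0 n = n"
| "dblp (Suc m) n = Suc (Suc (dblp m n))"

primrec addn :: "nat \<Rightarrow> nat \<Rightarrow> nat" where
  "addn 0 n = n"
| "addn (Suc m) n = Suc (addn m n)"

text \<open>\<open>2 K N + 4 J = 2 I + n + k\<close>, for the row \<open>l\<close> of \<open>K\<close> and the columns of \<open>N\<close> from \<open>m\<close> on;
  the list has the value \<open>1\<close> exactly at position \<open>l - m\<close>.\<close>

fun knrow :: "bool list \<Rightarrow> bool list list \<Rightarrow> bool list \<Rightarrow> bool" where
  "knrow k (c # cs) (d # ds) = (if eqn (dblp (dot k c) n4) (addn (if d then n2 else 0) (addn (weight c) (weight k)))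
     then knrow k cs ds else False)"
| "knrow k [] ds = True"
| "knrow k (c # cs) [] = True"

fun knok :: "bool list list \<Rightarrow> bool list list \<Rightarrow> bool list list \<Rightarrow> bool" where
  "knok (k # ks) cs (d # ds) = (if knrow k cs d then knok ks cs ds else False)"
| "knok [] cs ds = True"
| "knok (k # ks) cs [] = True"

definition idm7 :: "bool list list" where
  "idm7 = [bits 129, bits 130, bits 132, bits 136, bits 144, bits 160, bits 192]"

subsection \<open>The arcs between orbits\<close>

datatype tri = Ze | Pl | Mi

fun dot_zero :: "tri list \<Rightarrow> tri list \<Rightarrow> nat \<Rightarrow> nat \<Rightarrow> bool" where
  "dot_zero (Ze # xs) (y # ys) p q = dot_zero xs ys p q"
| "dot_zero (Pl # xs) (Ze # ys) p q = dot_zero xs ys p q"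
| "dot_zero (Mi # xs) (Ze # ys) p q = dot_zero xs ys p q"
| "dot_zero (Pl # xs) (Pl # ys) p q = dot_zero xs ys (Suc p) q"
| "dot_zero (Mi # xs) (Mi # ys) p q = dot_zero xs ys (Suc p) q"
| "dot_zero (Pl # xs) (Mi # ys) p q = dot_zero xs ys p (Suc q)"
| "dot_zero (Mi # xs) (Pl # ys) p q = dot_zero xs ys p (Suc q)"
| "dot_zero [] ys p q = eqn p q"
| "dot_zero (x # xs) [] p q = eqn p q"

text \<open>The entries of \<open>P - Q\<close> that are possible for an entry \<open>s\<close> of \<open>P + Q\<close>. An orbit is marked once a nonzero entry connects it to an earlier one;
  exchanging the vertices of an unmarked orbit makes the first such entry positive.\<close>

fun row_signs :: "nat \<Rightarrow> bool \<Rightarrow> tri list" where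
  "row_signs 0 l = [Ze]"
| "row_signs (Suc 0) True = [Pl, Mi]"
| "row_signs (Suc 0) False = [Pl]"
| "row_signs (Suc (Suc n)) l = [Ze]"

fun linked :: "nat \<Rightarrow> bool \<Rightarrow> bool" where
  "linked 0 l = l"
| "linked (Suc 0) l = True"
| "linked (Suc (Suc n)) l = l"

fun ropt :: "nat list \<Rightarrow> bool list \<Rightarrow> tri list list" where
  "ropt (s # ss) (l # ls) = row_signs s l # ropt ss ls"
| "ropt [] ls = []"
| "ropt (s # ss) [] = []"

fun lopt :: "nat list \<Rightarrow> bool list \<Rightarrow> bool list" where
  "lopt (s # ss) (l # ls) = linked s l # lopt ss ls"
| "lopt [] ls = []"
| "lopt (s # ss) [] = []"

primrec tls :: "'a list list \<Rightarrow> 'a list list" where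
  "tls [] = []"
| "tls (x # xs) = tl x # tls xs"

lemma length_tls [simp]: "length (tls xs) = length xs"
  by (induction xs) auto

text \<open>An arm consists of a diagonal entry of \<open>P - Q\<close>, the entries to its right
  and the entries below it. There are no loops, so a nonzero diagonal entry comes from
  \<open>Q\<close> and is negative. The row part is read before the column part, which therefore
  uses the marks already updated by the row.\<close>

fun arm_specs :: "nat list list \<Rightarrow> nat list list \<Rightarrow> bool list \<Rightarrow> (tri list \<times> tri list list \<times> tri list list) list" where
  "arm_specs ((s # r) # rs) ((s' # c) # cs) (l # ls) =
     ((case s of 0 \<Rightarrow> [Ze] | Suc m \<Rightarrow> [Mi]), ropt r ls, ropt c (lopt r ls)) # arm_specs (tls rs) (tls cs) (lopt c (lopt r ls))"
| "arm_specs [] cs ls = []"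
| "arm_specs (r # rs) [] ls = []"
| "arm_specs (r # rs) (c # cs) [] = []"
| "arm_specs ([] # rs) (c # cs) (l # ls) = []"
| "arm_specs ((s # r) # rs) ([] # cs) (l # ls) = []"

primrec conss :: "'a \<Rightarrow> 'a list list \<Rightarrow> 'a list list \<Rightarrow> 'a list list" where
  "conss a [] ys = ys"
| "conss a (x # xs) ys = (a # x) # conss a xs ys"

primrec consa :: "'a list \<Rightarrow> 'a list list \<Rightarrow> 'a list list" where
  "consa [] xs = []"
| "consa (a # as) xs = conss a xs (consa as xs)"

primrec vecs :: "'a list list \<Rightarrow> 'a list list" where
  "vecs [] = [[]]"
| "vecs (os # oss) = consa os (vecs oss)"

primrec pres :: "'a list \<Rightarrow> 'a list list \<Rightarrow> 'a list list" where
  "pres p [] = []"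
| "pres p (x # xs) = (p @ x) # pres p xs"

primrec heads :: "nat \<Rightarrow> 'a list list \<Rightarrow> 'a list" where
  "heads i [] = []"
| "heads i (c # cs) = c ! i # heads i cs"

text \<open>With \<open>B = P - Q\<close>, the extra factors \<open>p\<close> and \<open>Pl\<close>
  contribute the entry of \<open>B\<close> itself; the test says that an entry of
  \<open>B\<^sup>2 + B\<close> off the diagonal vanishes.\<close>

primrec filter_arm :: "tri \<Rightarrow> tri list \<Rightarrow> tri list list \<Rightarrow> tri list list" where
  "filter_arm p c [] = []"
| "filter_arm p c (x # xs) = (if dot_zero (p # x) (Pl # c) 0 0 then x # filter_arm p c xs else filter_arm p c xs)"

fun filter_arms :: "tri list \<Rightarrow> tri list list \<Rightarrow> tri list list \<Rightarrow> tri list list" where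
  "filter_arms (p # ps) (c # cs) xs = filter_arms ps cs (filter_arm p c xs)"
| "filter_arms [] cs xs = xs"
| "filter_arms (p # ps) [] xs = xs"

text \<open>The two leading products subtract two and the third adds the diagonal entry, so the test
  is a diagonal entry of \<open>B\<^sup>2 + B = 2 I\<close>.\<close>

primrec all_arm_columns :: "(tri list \<Rightarrow> bool) \<Rightarrow> tri list \<Rightarrow> tri list \<Rightarrow> tri list list \<Rightarrow> bool" where
  "all_arm_columns h d r [] = True"
| "all_arm_columns h d r (c # cs) = (if dot_zero (Mi # Mi # d @ r) (Pl # Pl # Pl # c) 0 0
     then (if h c then all_arm_columns h d r cs else False) else all_arm_columns h d r cs)"

primrec all_arms :: "(tri list \<Rightarrow> tri list \<Rightarrow> bool) \<Rightarrow> tri list \<Rightarrow> tri list list \<Rightarrow> tri list list \<Rightarrow> bool" where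
  "all_arms g d [] cs = True"
| "all_arms g d (r # rs) cs = (if all_arm_columns (g r) d r cs then all_arms g d rs cs else False)"

primrec arm_search :: "(tri list list \<Rightarrow> bool) \<Rightarrow> nat \<Rightarrow> (tri list \<times> tri list list \<times> tri list list) list \<Rightarrow>
    tri list list \<Rightarrow> tri list list \<Rightarrow> bool" where
  "arm_search P i [] Rs Cs = P Rs"
| "arm_search P i (sp # sps) Rs Cs = (case sp of (d, ros, qs) \<Rightarrow>
     all_arms (\<lambda>r c. arm_search P (Suc i) sps (Rs @ [r]) (Cs @ [c])) d
       (filter_arms (heads i Cs) Cs (pres (heads i Cs @ d) (vecs ros)))
       (filter_arms (heads i Rs) Rs (pres (heads i Rs @ d) (vecs qs))))"

fun pbit :: "nat \<Rightarrow> tri \<Rightarrow> bool" where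
  "pbit 0 b = False"
| "pbit (Suc 0) Pl = True"
| "pbit (Suc 0) Mi = False"
| "pbit (Suc 0) Ze = False"
| "pbit (Suc (Suc n)) b = True"

fun prow :: "nat list \<Rightarrow> tri list \<Rightarrow> bool list" where
  "prow (s # ss) (b # bs) = pbit s b # prow ss bs"
| "prow [] bs = []"
| "prow (s # ss) [] = []"

fun pmat :: "nat list list \<Rightarrow> tri list list \<Rightarrow> bool list list" where
  "pmat (s # ss) (b # bs) = prow s b # pmat ss bs"
| "pmat [] bs = []"
| "pmat (s # ss) [] = []"

definition falses7 :: "bool list" where "falses7 = bits 128"

fun qbit :: "nat \<Rightarrow> bool \<Rightarrow> bool" where
  "qbit 0 b = False"
| "qbit (Suc 0) b = (\<not> b)"
| "qbit (Suc (Suc n)) b = True"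

fun qrow :: "nat list \<Rightarrow> bool list \<Rightarrow> bool list" where
  "qrow (s # ss) (b # bs) = qbit s b # qrow ss bs"
| "qrow [] bs = []"
| "qrow (s # ss) [] = []"

fun qmat :: "nat list list \<Rightarrow> bool list list \<Rightarrow> bool list list" where
  "qmat (s # ss) (b # bs) = qrow s b # qmat ss bs"
| "qmat [] bs = []"
| "qmat (s # ss) [] = []"

fun cat3 :: "'a list list \<Rightarrow> 'a list list \<Rightarrow> 'a list list \<Rightarrow> 'a list list" where
  "cat3 (x # xs) (y # ys) (z # zs) = (x @ y @ z) # cat3 xs ys zs"
| "cat3 [] ys zs = []"
| "cat3 (x # xs) [] zs = []"
| "cat3 (x # xs) (y # ys) [] = []"

definition adj :: "bool list list \<Rightarrow> bool list list \<Rightarrow> bool list list \<Rightarrow> bool list list \<Rightarrow> bool list list \<Rightarrow>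
    bool list list" where
  "adj M N Kr P Q = cat3 M N N @ cat3 Kr P Q @ cat3 Kr Q P"

subsection \<open>Checks on the graphs\<close>

primrec pack :: "bool list \<Rightarrow> num" where
  "pack [] = num.One"
| "pack (x # xs) = (if x then num.Bit1 (pack xs) else num.Bit0 (pack xs))"

primrec packs :: "bool list list \<Rightarrow> num list" where
  "packs [] = []"
| "packs (x # xs) = pack x # packs xs"

fun dtn :: "num \<Rightarrow> num \<Rightarrow> nat" where
  "dtn (num.Bit0 x) (num.Bit0 y) = dtn x y"
| "dtn (num.Bit0 x) (num.Bit1 y) = dtn x y"
| "dtn (num.Bit1 x) (num.Bit0 y) = dtn x y"
| "dtn (num.Bit1 x) (num.Bit1 y) = Suc (dtn x y)"
| "dtn num.One y = 0"
| "dtn (num.Bit0 x) num.One = 0"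
| "dtn (num.Bit1 x) num.One = 0"

fun dqn :: "num \<Rightarrow> num \<Rightarrow> nat \<Rightarrow> bool" where
  "dqn (num.Bit0 x) (num.Bit0 y) n = dqn x y n"
| "dqn (num.Bit0 x) (num.Bit1 y) n = dqn x y n"
| "dqn (num.Bit1 x) (num.Bit0 y) n = dqn x y n"
| "dqn (num.Bit1 x) (num.Bit1 y) (Suc n) = dqn x y n"
| "dqn (num.Bit1 x) (num.Bit1 y) 0 = False"
| "dqn num.One y n = eqn n 0"
| "dqn (num.Bit0 x) num.One n = eqn n 0"
| "dqn (num.Bit1 x) num.One n = eqn n 0"

text \<open>\<open>A\<^sup>2 + A = 4 J + 2 I\<close>, in row \<open>x\<close>.\<close>

fun srow :: "num \<Rightarrow> bool list \<Rightarrow> num list \<Rightarrow> bool list \<Rightarrow> bool" where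
  "srow r (a # as) (c # cs) (d # ds) = (if dqn (if a then num.Bit1 r else num.Bit0 r) (num.Bit1 c) (if d then n6 else n4)
     then srow r as cs ds else False)"
| "srow r [] cs ds = True"
| "srow r (a # as) [] ds = True"
| "srow r (a # as) (c # cs) [] = True"

fun square_ok :: "bool list list \<Rightarrow> num list \<Rightarrow> num list \<Rightarrow> bool list list \<Rightarrow> bool" where
  "square_ok (r # rs) (p # ps) cs (d # ds) = (if eqn (weight r) (Suc (Suc n7)) then if srow p r cs d then square_ok rs ps cs ds
     else False else False)"
| "square_ok [] ps cs ds = True"
| "square_ok (r # rs) [] cs ds = True"
| "square_ok (r # rs) (p # ps) cs [] = True"

primrec wt9 :: "bool list list \<Rightarrow> bool" where
  "wt9 [] = True"
| "wt9 (c # cs) = (if eqn (weight c) (Suc (Suc n7)) then wt9 cs else False)"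

fun offd :: "bool list list \<Rightarrow> bool list list \<Rightarrow> bool" where
  "offd (r # rs) (d # ds) = (if eqn (dot r d) 0 then offd rs ds else False)"
| "offd [] ds = True"
| "offd (r # rs) [] = True"

text \<open>\<open>square_suc c = c\<^sup>2 + 1\<close>\<close>

primrec square_suc :: "nat \<Rightarrow> num" where
  "square_suc 0 = num.One"
| "square_suc (Suc n) = square_suc n + suc_num (n + n)"

fun frow :: "bool list \<Rightarrow> num list \<Rightarrow> num \<Rightarrow> num \<Rightarrow> num" where
  "frow (True # bs) (r # rs) x a = frow bs rs x (a + square_suc (dtn x r))"
| "frow (False # bs) (r # rs) x a = frow bs rs x a"
| "frow [] rs x a = a"
| "frow (b # bs) [] x a = a"

fun fvec :: "bool list list \<Rightarrow> num list \<Rightarrow> num list \<Rightarrow> num list" where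
  "fvec (c # cs) (x # xs) rs = frow c rs x num.One # fvec cs xs rs"
| "fvec [] xs rs = []"
| "fvec (c # cs) [] rs = []"

primrec hvec :: "bool list list \<Rightarrow> num list \<Rightarrow> num list" where
  "hvec [] f = []"
| "hvec (r # rs) f = wsum r f num.One # hvec rs f"

primrec ssum :: "num list \<Rightarrow> num \<Rightarrow> num" where
  "ssum [] a = a"
| "ssum (x # xs) a = ssum xs (a + x * x)"

datatype sgt = Sg bool bool bool bool nat nat num num

fun eqb :: "bool \<Rightarrow> bool \<Rightarrow> bool" where
  "eqb True b = b" | "eqb False b = (\<not> b)"

fun eqs :: "sgt \<Rightarrow> sgt \<Rightarrow> bool" where
  "eqs (Sg a b c d m n f h) (Sg a' b' c' d' m' n' f' h') =
     (if eqnum h h' then if eqb a a' then if eqb b b' then if eqb c c' then if eqb d d' then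
      if eqn m m' then if eqn n n' then eqnum f f' else False else False else False else False else False
      else False else False)"

text \<open>The arguments are the columns and rows for \<open>x\<close>, the indices and rows of two individualised vertices,
  and the values of the vertex invariants.\<close>

fun sgs :: "bool list list \<Rightarrow> bool list list \<Rightarrow> nat \<Rightarrow> nat \<Rightarrow> bool list \<Rightarrow> bool list \<Rightarrow> num list \<Rightarrow> num list \<Rightarrow> sgt list" where
  "sgs (c # cs) (x # xs) p q rp rq (f # fs) (h # hs) =
     Sg (x ! p) (c ! p) (x ! q) (c ! q) (dot x rp) (dot x rq) f h # sgs cs xs p q rp rq fs hs"
| "sgs [] xs p q rp rq fs hs = []"
| "sgs (c # cs) [] p q rp rq fs hs = []"
| "sgs (c # cs) (x # xs) p q rp rq [] hs = []"
| "sgs (c # cs) (x # xs) p q rp rq (f # fs) [] = []"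

primrec mems :: "sgt \<Rightarrow> sgt list \<Rightarrow> bool" where
  "mems x [] = False"
| "mems x (y # ys) = (if eqs x y then True else mems x ys)"

primrec dists :: "sgt list \<Rightarrow> bool" where
  "dists [] = True"
| "dists (x # xs) = (if mems x xs then False else dists xs)"

fun level_set :: "num \<Rightarrow> num list \<Rightarrow> nat \<Rightarrow> nat list" where
  "level_set v [] i = []"
| "level_set v (h # hs) i = (if eqnum v h then i # level_set v hs (Suc i) else level_set v hs (Suc i))"

fun eqns :: "nat list \<Rightarrow> nat list \<Rightarrow> bool" where
  "eqns [] [] = True"
| "eqns (x # xs) (y # ys) = (if eqn x y then eqns xs ys else False)"
| "eqns [] (y # ys) = False"
| "eqns (x # xs) [] = False"

definition idm22 :: "bool list list" where
  "idm22 = [bits 4194305, bits 4194306, bits 4194308, bits 4194312, bits 4194320, bits 4194336,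
    bits 4194368, bits 4194432, bits 4194560, bits 4194816, bits 4195328, bits 4196352, bits 4198400,
    bits 4202496, bits 4210688, bits 4227072, bits 4259840, bits 4325376, bits 4456448, bits 4718592,
    bits 5242880, bits 6291456]"

text \<open>\<open>T\<close> has to be a full level set of the vertex invariant \<open>h\<close>, so
  that automorphisms preserve it, and the signatures relative to its first two vertices have to
  separate all vertices.\<close>

definition ginv :: "bool list list \<Rightarrow> bool list list \<Rightarrow> num list \<Rightarrow> num list \<Rightarrow> num \<Rightarrow> nat list \<Rightarrow> bool" where
  "ginv A C f h v T = (if eqnum (ssum h num.One) v then
     if eqns (level_set (h ! hd T) h 0) T then dists (sgs C A (hd T) (hd (tl T)) (A ! hd T) (A ! hd (tl T)) f h)
     else False else False)"

definition gchk2 :: "bool list list \<Rightarrow> bool list list \<Rightarrow> num list \<Rightarrow> num \<Rightarrow> nat list \<Rightarrow> bool" where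
  "gchk2 A C f v T = ginv A C f (hvec A f) v T"

definition gchk :: "bool list list \<Rightarrow> bool list list \<Rightarrow> num list \<Rightarrow> num list \<Rightarrow> num \<Rightarrow> nat list \<Rightarrow> bool" where
  "gchk A C pA pC v T = (if square_ok A pA pC idm22 then if wt9 C then if offd A idm22
     then gchk2 A C (fvec C pA pA) v T else False else False else False)"

definition gchk1 :: "bool list list \<Rightarrow> bool list list \<Rightarrow> num \<Rightarrow> nat list \<Rightarrow> bool" where
  "gchk1 A C v T = gchk A C (packs A) (packs C) v T"

definition graph_ok :: "bool list list \<Rightarrow> num \<Rightarrow> nat list \<Rightarrow> bool" where
  "graph_ok A v T = gchk1 A (transposed A) v T"

subsection \<open>Assembling the checks\<close>

fun monus :: "nat \<Rightarrow> nat \<Rightarrow> nat" where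
  "monus m 0 = m"
| "monus (Suc m) (Suc n) = monus m n"
| "monus 0 (Suc n) = 0"

fun half :: "nat \<Rightarrow> nat" where
  "half 0 = 0"
| "half (Suc 0) = 0"
| "half (Suc (Suc n)) = Suc (half n)"

text \<open>A row of \<open>N K\<close>, solved from
  \<open>M\<^sup>2 + 2 N K + M = 4 J + 2 I\<close>.\<close>

fun crow :: "bool list \<Rightarrow> bool list \<Rightarrow> bool list list \<Rightarrow> bool list \<Rightarrow> nat list" where
  "crow r (a # as) (c # cs) (d # ds) = half (monus (if d then n6 else n4) (dot (a # r) (True # c))) # crow r as cs ds"
| "crow r [] cs ds = []"
| "crow r (a # as) [] ds = []"
| "crow r (a # as) (c # cs) [] = []"

fun cmat :: "bool list list \<Rightarrow> bool list list \<Rightarrow> bool list list \<Rightarrow> nat list list" where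
  "cmat (r # rs) cs (d # ds) = crow r r cs d # cmat rs cs ds"
| "cmat [] cs ds = []"
| "cmat (r # rs) cs [] = []"

fun pair_specs :: "nat \<Rightarrow> bool list list \<Rightarrow> bool list list \<Rightarrow> nat list list \<Rightarrow> nat list list \<Rightarrow>
    (nat \<times> nat \<times> nat list \<times> nat list \<times> nat) list" where
  "pair_specs i (m # ms) (c # cs) (x # xs) (y # ys) =
     (half (monus (Suc (Suc n7)) (weight m)), half (monus (Suc (Suc n7)) (weight c)), take i x, take i y, x ! i) # pair_specs (Suc i) ms cs xs ys"
| "pair_specs i [] cs xs ys = []"
| "pair_specs i (m # ms) [] xs ys = []"
| "pair_specs i (m # ms) (c # cs) [] ys = []"
| "pair_specs i (m # ms) (c # cs) (x # xs) [] = []"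

definition idm8 :: "bool list list" where
  "idm8 = [bits 257, bits 258, bits 260, bits 264, bits 272, bits 288, bits 320, bits 384]"

definition spec2 :: "bool list list \<Rightarrow> bool list list \<Rightarrow> nat list list \<Rightarrow> (nat \<times> nat \<times> nat list \<times> nat list \<times> nat) list" where
  "spec2 M Mc C = pair_specs 0 M Mc C (transposed C)"

definition spec1 :: "bool list list \<Rightarrow> bool list list \<Rightarrow> (nat \<times> nat \<times> nat list \<times> nat list \<times> nat) list" where
  "spec1 M Mc = spec2 M Mc (cmat M Mc idm8)"

definition spec :: "bool list list \<Rightarrow> (nat \<times> nat \<times> nat list \<times> nat list \<times> nat) list" where
  "spec M = spec1 M (transposed M)"

definition trues6 :: "bool list" where "trues6 = bits 127"

type_synonym item = "nat list \<times> nat \<times> nat list"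
type_synonym case_data = "nat \<times> nat list \<times> nat list \<times> item list"

primrec mbits :: "nat list \<Rightarrow> bool list list" where
  "mbits [] = []"
| "mbits (x # xs) = bits x # mbits xs"

text \<open>The blocks \<open>M\<close>, \<open>N\<close>, \<open>K\<close> and the sum
  \<open>P + Q\<close> are fixed within a case, so a solution is identified by
  \<open>P\<close>.\<close>

fun memp :: "bool list list \<Rightarrow> item list \<Rightarrow> bool" where
  "memp x [] = False"
| "memp x ((P, v, T) # is) = (if eqm x (mbits P) then True else memp x is)"

definition gokp :: "bool list list \<Rightarrow> bool list list \<Rightarrow> bool list list \<Rightarrow> nat list list \<Rightarrow> bool list list \<Rightarrow>
    nat \<Rightarrow> nat list \<Rightarrow> bool" where
  "gokp M N Kr S P v T = graph_ok (adj M N Kr P (qmat S P)) (num_of_nat v) T"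

fun goks :: "bool list list \<Rightarrow> bool list list \<Rightarrow> bool list list \<Rightarrow> nat list list \<Rightarrow> item list \<Rightarrow> bool" where
  "goks M N Kr S [] = True"
| "goks M N Kr S ((P, v, T) # is) = (if gokp M N Kr S (mbits P) v T then goks M N Kr S is else False)"

definition cok3 :: "bool list list \<Rightarrow> bool list list \<Rightarrow> bool list list \<Rightarrow> nat list list \<Rightarrow> nat list list \<Rightarrow>
    item list \<Rightarrow> bool" where
  "cok3 M N Kr S Sc is = (if arm_search (\<lambda>Rs. memp (pmat S Rs) is) 0 (arm_specs S Sc falses7) [] []
     then goks M N Kr S is else False)"

definition cok2 :: "bool list list \<Rightarrow> bool list list \<Rightarrow> bool list list \<Rightarrow> nat list list \<Rightarrow> item list \<Rightarrow> bool" where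
  "cok2 M N Kr Sc is = cok3 M N Kr (transposed Sc) Sc is"

definition cok1 :: "bool list list \<Rightarrow> bool list list \<Rightarrow> bool list list \<Rightarrow> item list \<Rightarrow> bool" where
  "cok1 M N Kr is = cok2 M N Kr (scols M Kr (transposed N)) is"

text \<open>For given \<open>M\<close>, \<open>N\<close> and \<open>K\<close>, either the formula
  for \<open>P + Q\<close> gives an impossible value at some position, or a relabelling of the fixed
  vertices and of the orbits leads to one of the listed cases.\<close>

datatype cert = Bad nat nat | Iso "nat list" "nat list" "unit \<Rightarrow> case_data"

section \<open>Evaluation of the searches by rewriting\<close>

lemma all_in_cong: "xs = ys \<Longrightarrow> all_in f xs = all_in f ys" by simp
lemma filt_cong: "xs = ys \<Longrightarrow> filt f xs = filt f ys" by simp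
lemma all_columns_cong: "\<lbrakk>d = d'; x = x'; es = es'; ks = ks'\<rbrakk> \<Longrightarrow> all_columns h d x es ks = all_columns h d' x' es' ks'" by simp
lemma all_pairs_cong: "\<lbrakk>d = d'; es = es'; xs = xs'; ks = ks'\<rbrakk> \<Longrightarrow> all_pairs h d es xs ks = all_pairs h d' es' xs' ks'" by simp
lemma all_arm_columns_cong: "\<lbrakk>d = d'; r = r'; cs = cs'\<rbrakk> \<Longrightarrow> all_arm_columns h d r cs = all_arm_columns h d' r' cs'" by simp
lemma all_arms_cong: "\<lbrakk>d = d'; rs = rs'; cs = cs'\<rbrakk> \<Longrightarrow> all_arms h d rs cs = all_arms h d' rs' cs'" by simp

lemma row_search_cong: "\<lbrakk>n = n'; rows = rows'; sp = sp'\<rbrakk> \<Longrightarrow> row_search P od cd okw n rows sp = row_search P od cd okw n' rows' sp'" by simp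
lemma pair_search_cong: "\<lbrakk>sps = sps'; Ns = Ns'; Ks = Ks'; es = es'\<rbrakk> \<Longrightarrow> pair_search P sps Ns Ks es = pair_search P sps' Ns' Ks' es'" by simp
lemma arm_search_cong: "\<lbrakk>i = i'; sps = sps'; Rs = Rs'; Cs = Cs'\<rbrakk> \<Longrightarrow> arm_search P i sps Rs Cs = arm_search P i' sps' Rs' Cs'" by simp

text \<open>These congruence rules keep the simplifier out of the functional arguments and of the
  branches that are not yet selected. The continuation of a search is thus rewritten only after it
  has been applied to actual rows.\<close>

lemmas wcongs = row_search_cong pair_search_cong arm_search_cong if_weak_cong option.case_cong_weak all_in_cong filt_cong all_columns_cong all_pairs_cong all_arm_columns_cong all_arms_cong

lemmas base_ev = bits_numeral nbits.simps dot.simps dot_is.simps eql.simps eqm.simps sing.simps consz.simps transposed.simps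
  all_in.simps pick.simps relab.simps eqn.simps memn.simps isperm.simps look.simps nth_Cons_0 nth_Cons_Suc
  if_True if_False option.case prod.case nat.case append.simps take_Suc_Cons take_0 list.sel
  not_True_eq_False not_False_eq_True weight.simps filt.simps

lemmas num_ev = add_num_simps mult_num_simps inc.simps suc_num.simps wsum.simps nsum.simps eqnum.simps

lemmas row_search_ev = base_ev xor_num.simps comb.simps zero_mask.simps find_row.simps red0.simps red1.simps span_check.simps mulx.simps dbl_def
  upd_def upd0_def stp0.simps eqnum.simps
  order_ok.simps ties.simps lex_le.simps snum.simps drop4_def leq4_def fl1_def fl2_def ord1.simps ord0_def diag0.simps row_step_def candidates_def
  row_search.simps okw1_def okw0_def okb_def num_of_nat_numeral_eq

lemmas pair_search_ev = base_ev filter_dot.simps filter_dots.simps all_columns.simps all_pairs.simps pair_search.simps order_ok.simps ties.simps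

lemmas s3_ev = base_ev num_ev ecol.simps slhs_def srhs_def sval_def scol.simps scols.simps

lemmas bad_ev = base_ev num_ev ecol.simps slhs_def srhs_def sbad_def bade_def badc_def bad_def dblp.simps addn.simps
  knrow.simps knok.simps

lemmas arm_search_ev = s3_ev dot_zero.simps row_signs.simps linked.simps ropt.simps lopt.simps tls.simps arm_specs.simps conss.simps consa.simps
  vecs.simps pres.simps heads.simps filter_arm.simps filter_arms.simps all_arm_columns.simps all_arms.simps arm_search.simps pbit.simps prow.simps pmat.simps
  falses7_def

lemmas g_ev = base_ev num_ev qbit.simps qrow.simps qmat.simps cat3.simps adj_def pack.simps packs.simps dtn.simps dqn.simps srow.simps square_ok.simps wt9.simps offd.simps
  square_suc.simps add_Suc add_0 frow.simps fvec.simps hvec.simps ssum.simps eqb.simps eqs.simps sgs.simps mems.simps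
  dists.simps level_set.simps eqns.simps idm22_def ginv_def gchk2_def gchk_def gchk1_def graph_ok_def


lemmas spec_ev = base_ev monus.simps half.simps crow.simps cmat.simps pair_specs.simps idm8_def spec2_def spec1_def spec_def trues6_def

lemmas case_ok_ev = arm_search_ev g_ev mbits.simps memp.simps gokp_def goks.simps cok3_def cok2_def cok1_def num_of_nat_numeral_eq

section \<open>Representatives, cases and certificates\<close>

abbreviation n8 :: nat where "n8 \<equiv> Suc n7"
abbreviation n9 :: nat where "n9 \<equiv> Suc n8"
abbreviation n10 :: nat where "n10 \<equiv> Suc n9"
abbreviation n11 :: nat where "n11 \<equiv> Suc n10"
abbreviation n12 :: nat where "n12 \<equiv> Suc n11"
abbreviation n13 :: nat where "n13 \<equiv> Suc n12"
abbreviation n14 :: nat where "n14 \<equiv> Suc n13"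
abbreviation n15 :: nat where "n15 \<equiv> Suc n14"
abbreviation n16 :: nat where "n16 \<equiv> Suc n15"
abbreviation n17 :: nat where "n17 \<equiv> Suc n16"
abbreviation n18 :: nat where "n18 \<equiv> Suc n17"
abbreviation n19 :: nat where "n19 \<equiv> Suc n18"
abbreviation n20 :: nat where "n20 \<equiv> Suc n19"
abbreviation n21 :: nat where "n21 \<equiv> Suc n20"

text \<open>The leading digit of each number is 256. Representatives 0 to 6 have the same products
  \<open>N K\<close> and the same row and column sums; number 7 is refuted by a rank argument modulo
  two, and 8 to 10 by a search without result.\<close>

definition reps :: "bool list list list" where "reps = [
  [bits 500,bits 377,bits 497,bits 390,bits 267,bits 267,bits 267,bits 270],
  [bits 500,bits 444,bits 497,bits 323,bits 267,bits 267,bits 267,bits 270],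
  [bits 378,bits 500,bits 441,bits 389,bits 267,bits 267,bits 267,bits 326],
  [bits 444,bits 500,bits 441,bits 323,bits 267,bits 267,bits 267,bits 326],
  [bits 476,bits 500,bits 441,bits 291,bits 267,bits 267,bits 267,bits 326],
  [bits 444,bits 497,bits 441,bits 326,bits 267,bits 267,bits 270,bits 323],
  [bits 476,bits 500,bits 473,bits 291,bits 267,bits 267,bits 270,bits 291],
  [bits 500,bits 380,bits 387,bits 387,bits 354,bits 267,bits 277,bits 267],
  [bits 476,bits 492,bits 442,bits 373,bits 291,bits 275,bits 291,bits 275],
  [bits 500,bits 489,bits 474,bits 278,bits 293,bits 267,bits 312,bits 312],
  [bits 350,bits 349,bits 347,bits 423,bits 335,bits 399,bits 432,bits 368]]"

text \<open>The cases are functions on the type \<open>unit\<close> so that their data are unfolded only on demand. A case consists of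
  the index of the fixed submatrix, the rows of \<open>N\<close>, the columns of \<open>K\<close>, and the resulting graphs, each given by the rows of \<open>P\<close>, the value
  that distinguishes it from the others, and the vertices distinguished by a vertex invariant.\<close>

abbreviation case_of :: "unit \<Rightarrow> nat \<Rightarrow> nat list \<Rightarrow> nat list \<Rightarrow> item list \<Rightarrow> case_data" where
  "case_of u r N K its \<equiv> (r, N, K, its)"

definition "c0 u = case_of u 0 [146,133,145,232,165,154,228,202] [162,140,209,168,163,156,212,195]
  [([254,188,195,129,225,158,129],23567113,[n12,n19]),([254,244,139,129,169,214,129],23565289,[n12,n19]),([254,152,153,163,197,196,163],22851177,[n12,n19]),([254,208,209,163,141,140,163],23148041,[n12,n19])]"
definition "c1 u = case_of u 0 [196,176,208,139,177,198,142,169] [133,162,216,131,149,226,156,232]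
  [([206,165,147,147,201,201,165],20042321,[n11,n18]),([206,165,147,165,201,201,147],20879697,[n11,n18]),([206,177,177,135,163,149,177],21330161,[n11,n18]),([206,177,177,177,163,149,135],21330865,[n10,n17])]"
definition "c2 u = case_of u 0 [224,138,162,149,139,141,212,240] [193,152,166,145,195,172,198,184]
  [([220,185,163,226,225,135,157],23586741,[n14,n21]),([220,177,171,240,233,135,135],22982869,[n11,n18])]"
definition "c3 u = case_of u 0 [196,145,193,170,147,226,156,172] [134,176,201,138,135,240,216,165]
  [([254,200,176,131,205,133,179],22518329,[n1,n14,n21]),([254,224,152,131,229,133,155],21932537,[n14,n21])]"
definition "c4 u = case_of u 0 [145,164,161,202,228,150,154,201] [208,140,163,194,240,135,184,141] []"
definition "c5 u = case_of u 0 [224,152,208,135,225,147,172,142] [162,137,212,133,201,178,180,202] []"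
definition "c6 u = case_of u 0 [208,164,224,139,216,170,135,149] [146,140,225,137,204,178,198,177] []"
definition "c7 u = case_of u 0 [146,161,162,204,232,149,141,210] [152,193,166,196,184,180,139,195] []"
definition "c8 u = case_of u 0 [162,148,161,201,212,170,142,209] [194,152,165,200,228,184,135,147] []"
definition "c9 u = case_of u 0 [140,194,133,177,226,156,163,216] [168,146,197,176,228,150,139,201] []"
definition "c10 u = case_of u 0 [137,224,138,150,240,197,178,141] [145,164,202,148,216,195,163,172] []"
definition "c11 u = case_of u 0 [162,152,148,197,202,216,165,163] [224,137,150,193,142,240,172,147] []"
definition "c12 u = case_of u 0 [176,133,137,202,135,240,216,166] [146,196,169,194,147,225,156,172]
  [([206,216,177,167,141,141,167],20799761,[n3,n12,n19]),([206,240,177,165,165,143,143],20526481,[n14,n21])]"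
definition "c13 u = case_of u n1 [194,168,162,149,172,195,156,209] [196,137,178,133,228,139,154,240] []"
definition "c14 u = case_of u n1 [146,193,208,172,197,165,154,170] [134,137,240,140,198,177,153,226] []"
definition "c15 u = case_of u n1 [196,131,194,184,163,156,169,212] [164,145,202,176,166,142,201,209] []"
definition "c16 u = case_of u n1 [152,196,208,163,154,165,197,170] [137,134,240,131,150,180,201,232] []"
definition "c17 u = case_of u n1 [138,133,137,240,202,180,210,165] [162,196,153,224,204,156,147,163]
  [([254,200,131,149,233,148,163],21945145,[n12,n19]),([254,208,131,241,141,140,163],21799793,[n11,n18])]"
definition "c18 u = case_of u n1 [196,162,224,153,212,156,163,139] [133,146,232,145,210,172,165,202]
  [([220,197,169,147,169,209,147],21220149,[n10,n17]),([220,197,177,177,139,201,139],21220213,[n10,n17])]"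
definition "c19 u = case_of u n1 [133,162,134,216,141,153,240,226] [193,168,150,200,172,147,180,195] []"
definition "c20 u = case_of u n1 [193,152,200,166,180,163,156,195] [133,146,232,134,240,169,141,210] []"
definition "c21 u = case_of u n1 [138,133,131,240,212,232,170,149] [152,164,195,176,198,201,166,153] []"
definition "c22 u = case_of u n1 [193,152,137,166,184,210,165,198] [224,148,139,162,232,147,149,204] []"
definition "c23 u = case_of u n1 [161,200,137,150,216,166,149,226] [176,196,139,146,184,172,197,195] []"
definition "c24 u = case_of u n1 [193,164,133,154,226,210,153,172] [200,176,135,138,163,212,177,204] []"
definition "c25 u = case_of u n1 [140,145,133,226,172,225,210,154] [200,176,135,162,180,201,212,139] []"
definition "c26 u = case_of u n1 [193,176,224,142,201,147,172,150] [133,152,226,138,216,163,165,212]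
  [([254,188,195,129,225,158,129],23113809,[n12,n19]),([254,244,139,129,169,214,129],22984961,[n12,n19]),([254,152,153,163,197,196,163],21845385,[n12,n19]),([254,208,209,163,141,140,163],21699449,[n12,n19])]"
definition "c27 u = case_of u n1 [161,146,162,204,169,209,212,142] [133,152,226,200,184,195,180,135] []"
definition "c28 u = case_of u n1 [164,145,133,202,172,210,201,178] [224,152,135,138,156,212,225,163]
  [([254,188,195,129,225,158,129],23439317,[n12,n19]),([254,244,139,129,169,214,129],23133157,[n12,n19]),([254,152,153,163,197,196,163],22054253,[n12,n19]),([254,208,209,163,141,140,163],22054541,[n12,n19])]"
definition "c29 u = case_of u n1 [161,196,224,154,216,135,150,169] [145,140,226,138,209,195,180,172] []"
definition "c30 u = case_of u n1 [162,137,138,212,216,149,226,165] [176,193,142,196,184,147,195,172] []"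
definition "c31 u = case_of u n1 [137,134,138,240,165,228,210,153] [193,148,170,176,163,204,195,156]
  [([254,188,195,129,225,158,129],21837797,[n12,n19]),([254,244,139,129,169,214,129],21884925,[n10,n17]),([254,152,153,163,197,196,163],21119037,[n10,n17]),([254,208,209,163,141,140,163],21045605,[n10,n17])]"
definition "c32 u = case_of u n1 [194,152,162,165,156,195,172,209] [196,137,178,133,150,139,232,240] []"
definition "c33 u = case_of u n1 [148,161,146,202,225,172,195,156] [196,137,178,200,240,166,135,153] []"
definition "c34 u = case_of u n1 [152,194,137,165,198,135,184,240] [148,162,201,164,204,147,170,209] []"
definition "c35 u = case_of u n1 [196,168,208,147,198,142,177,169] [133,162,216,131,226,156,180,201]
  [([206,165,147,147,201,201,165],19528701,[n11,n18]),([206,165,147,165,201,201,147],20354957,[n11,n18]),([206,177,177,135,163,149,177],21645597,[n8,n15]),([206,177,177,177,163,149,135],21638061,[n8,n15])]"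
definition "c36 u = case_of u n1 [200,134,152,177,232,149,135,226] [193,164,154,161,172,212,139,210] []"
definition "c37 u = case_of u n1 [196,131,208,184,204,177,142,163] [164,137,210,168,201,149,150,226]
  [([206,165,147,147,201,201,165],20546721,[n10,n17]),([206,165,147,165,201,201,147],21172121,[n10,n17]),([206,177,177,135,163,149,177],21602585,[n8,n15]),([206,177,177,177,163,149,135],22077569,[n8,n15])]"
definition "c38 u = case_of u n1 [134,193,146,184,204,177,142,225] [164,137,210,168,212,149,139,226]
  [([206,165,147,147,201,201,165],20404401,[n10,n17]),([206,165,147,165,201,201,147],20260161,[n10,n17]),([206,177,177,135,163,149,177],21387769,[n10,n17]),([206,177,177,177,163,149,135],21639385,[n10,n17])]"
definition "c39 u = case_of u n1 [194,152,140,165,178,184,197,195] [224,145,142,161,150,232,212,139] []"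
definition "c40 u = case_of u n1 [224,148,134,139,184,195,156,225] [200,145,166,137,178,210,204,165] []"
definition "c41 u = case_of u n1 [200,176,146,135,180,195,172,201] [196,161,154,133,212,226,170,153] []"
definition "c42 u = case_of u n2 [133,194,193,184,210,141,172,178] [148,138,225,152,212,139,228,163] []"
definition "c43 u = case_of u n2 [133,224,161,154,240,216,135,142] [148,194,169,146,180,201,195,172]
  [([230,216,153,167,141,141,167],20802617,[n14,n21]),([230,240,153,165,165,143,143],21083897,[n14,n21])]"
definition "c44 u = case_of u n2 [152,133,140,226,135,240,216,163] [146,193,172,194,150,180,201,169] []"
definition "c45 u = case_of u n2 [148,193,145,170,180,202,166,201] [140,224,147,168,240,210,135,141] []"
definition "c46 u = case_of u n2 [148,138,140,225,180,177,195,202] [208,162,141,224,166,153,135,216]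
  [([206,185,139,131,228,147,177],24715705,[n11,n18]),([206,241,139,241,172,147,177],24435545,[n8,n15])]"
definition "c47 u = case_of u n2 [140,208,200,163,240,170,135,149] [164,146,201,161,228,154,198,153] []"
definition "c48 u = case_of u n2 [140,162,164,209,226,153,212,139] [200,146,165,193,232,184,150,135] []"
definition "c49 u = case_of u n2 [131,208,146,172,170,197,141,240] [161,200,150,164,202,198,153,177] []"
definition "c50 u = case_of u n2 [137,194,193,180,165,184,154,198] [140,162,209,148,163,232,147,204] []"
definition "c51 u = case_of u n2 [140,224,164,147,202,154,149,225] [137,208,166,131,198,184,212,169] []"
definition "c52 u = case_of u n2 [196,176,164,139,210,154,197,169] [200,145,166,131,226,156,149,232]
  [([218,149,225,163,201,201,141],20214737,[n8,n15]),([218,177,177,135,165,147,169],20567009,[n12,n19])]"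
definition "c53 u = case_of u n2 [138,148,162,225,212,141,139,240] [200,145,166,193,198,172,147,184]
  [([220,185,163,226,225,135,157],21867881,[n8,n15]),([220,177,171,240,233,135,135],21790125,[n8,n15])]"
definition "c54 u = case_of u n2 [176,194,152,141,198,142,177,225] [164,131,216,133,212,170,147,232]
  [([206,165,147,147,201,201,165],20196233,[n6,n11,n18]),([206,165,147,165,201,201,147],19367817,[n11,n18]),([206,177,177,135,163,149,177],20609705,[n11,n18]),([206,177,177,177,163,149,135],20607977,[n14,n21])]"
definition "c55 u = case_of u n2 [162,208,164,141,170,202,149,209] [131,152,228,137,184,198,150,225] []"
definition "c56 u = case_of u n2 [133,176,131,202,141,210,172,240] [196,152,163,200,153,150,166,225] []"
definition "c57 u = case_of u n2 [133,200,131,178,156,226,149,232] [164,208,139,176,142,198,209,169]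
  [([254,141,195,177,140,194,177],21922429,[n9,n16]),([254,197,139,177,196,138,177],21923037,[n9,n16]),([254,153,169,129,230,214,129],22147365,[n9,n16]),([254,209,225,129,174,158,129],22444693,[n9,n16])]"
definition "c58 u = case_of u n2 [162,133,193,216,180,149,170,202] [146,140,225,152,228,147,169,198]
  [([238,232,184,149,197,199,147],20702521,[n11,n18]),([238,240,184,149,139,199,139],20135401,[n11,n18])]"
definition "c59 u = case_of u n2 [148,193,137,170,210,172,180,195] [134,224,153,162,216,204,177,135]
  [([254,200,131,149,233,148,163],21634669,[n14,n21]),([254,208,131,241,141,140,163],21483445,[n14,n21])]"
definition "c60 u = case_of u n2 [176,133,134,202,197,184,170,209] [224,137,150,200,228,156,163,147] []"
definition "c61 u = case_of u n2 [161,208,194,142,216,135,184,165] [137,148,226,140,201,147,178,228]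
  [([230,216,153,167,141,141,167],20617961,[n9,n16]),([230,240,153,165,165,143,143],20193929,[n6,n14,n21])]"
definition "c62 u = case_of u n2 [133,146,176,232,210,172,141,195] [196,138,177,200,212,166,153,163] []"
definition "c63 u = case_of u n2 [176,131,134,204,240,212,169,139] [152,193,166,200,226,149,165,154]
  [([254,173,131,208,196,131,185],23191049,[n8,n15]),([254,173,131,208,200,131,181],23629097,[n2,n8,n15]),([254,173,131,208,224,131,157],23190473,[n8,n15]),([254,129,171,212,200,135,177],23490933,[n10,n17]),([254,129,171,212,224,135,153],23639093,[n10,n17]),([254,129,139,244,196,139,177],23115501,[n10,n17]),([254,129,139,244,224,139,149],23264397,[n10,n17]),([254,129,163,240,196,143,153],23563901,[n10,n17]),([254,129,163,240,200,143,149],23565053,[n10,n17]),([254,129,131,208,236,131,189],24337641,[n10,n17])]"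
definition "c64 u = case_of u n3 [161,134,131,216,198,177,204,184] [224,148,139,208,226,149,141,170]
  [([206,165,147,147,201,201,165],20451537,[n10,n17]),([206,165,147,165,201,201,147],20450961,[n10,n17]),([206,177,177,135,163,149,177],22056913,[n8,n15]),([206,177,177,177,163,149,135],20901457,[n8,n15])]"
definition "c65 u = case_of u n3 [224,148,208,139,149,226,170,141] [161,134,216,131,177,198,184,204]
  [([254,141,195,177,140,194,177],21784713,[n10,n17]),([254,197,139,177,196,138,177],21784745,[n10,n17]),([254,153,169,129,230,214,129],23612649,[n10,n17]),([254,209,225,129,174,158,129],23096137,[n10,n17])]"
definition "c66 u = case_of u n3 [162,196,134,153,204,216,163,177] [168,193,150,137,172,210,195,180]
  [([220,197,169,147,169,209,147],20989853,[n14,n21]),([220,197,177,177,139,201,139],20987357,[n14,n21])]"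
definition "c67 u = case_of u n3 [152,194,200,165,226,149,153,166] [176,131,204,161,240,212,139,142]
  [([230,165,147,195,201,195,153],25248233,[n9,n16]),([230,165,195,147,201,195,153],25098313,[n9,n16]),([230,165,195,195,201,147,153],24649977,[n9,n16]),([230,165,153,165,201,201,153],24522301,[n14,n21]),([230,165,169,149,201,197,153],24881237,[n9,n16]),([230,165,169,197,201,149,153],25046549,[n8,n15]),([230,165,201,165,201,153,153],24683869,[n14,n21]),([230,165,177,225,201,141,153],24661717,[n8,n15]),([230,165,209,209,201,209,153],26381161,[n9,n16]),([230,165,225,177,201,141,153],24661205,[n9,n16])]"
definition "c68 u = case_of u n3 [168,193,137,150,172,210,180,195] [162,196,153,134,204,216,177,163]
  [([254,200,131,149,233,148,163],22037441,[n14,n21]),([254,208,131,241,141,140,163],21889153,[n14,n21])]"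
definition "c69 u = case_of u n3 [196,131,134,184,212,240,169,139] [200,145,166,152,149,226,165,202]
  [([254,173,131,208,196,131,185],23989905,[n9,n16]),([254,173,131,208,200,131,181],24427025,[n9,n16]),([254,173,131,208,224,131,157],23990097,[n9,n16]),([254,129,171,212,200,135,177],24685997,[n13,n20]),([254,129,171,212,224,135,153],24688941,[n13,n20]),([254,129,139,244,196,139,177],24226325,[n13,n20]),([254,129,139,244,224,139,149],24379317,[n13,n20]),([254,129,163,240,196,143,153],24615813,[n13,n20]),([254,129,163,240,200,143,149],24766597,[n13,n20]),([254,129,131,208,236,131,189],25229873,[n9,n16])]"
definition "c70 u = case_of u n3 [137,176,161,198,178,135,216,204] [138,148,225,194,170,149,209,172] []"
definition "c71 u = case_of u n3 [194,164,224,153,165,201,154,150] [131,140,240,145,163,204,170,212]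
  [([254,188,195,129,225,158,129],23038873,[n10,n17]),([254,244,139,129,169,214,129],23365233,[n10,n17]),([254,152,153,163,197,196,163],21720801,[n10,n17]),([254,208,209,163,141,140,163],22221865,[n10,n17])]"
definition "c72 u = case_of u n3 [148,162,134,201,226,184,197,153] [208,161,142,200,210,172,165,147] []"
definition "c73 u = case_of u n3 [224,138,194,149,139,172,180,209] [161,152,198,133,163,204,178,216]
  [([254,200,131,149,233,148,163],20807089,[n11,n18]),([254,208,131,241,141,140,163],20730065,[n11,n18])]"
definition "c74 u = case_of u n3 [146,133,134,232,197,184,226,153] [208,161,142,200,212,180,163,139] []"
definition "c75 u = case_of u n3 [176,193,145,142,154,228,172,195] [162,200,149,134,216,212,169,163]
  [([254,188,195,129,225,158,129],22120577,[n14,n21]),([254,244,139,129,169,214,129],22488721,[n12,n19]),([254,152,153,163,197,196,163],21583361,[n14,n21]),([254,208,209,163,141,140,163],21513105,[n14,n21])]"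
definition "c76 u = case_of u n3 [137,146,145,228,165,232,202,150] [140,162,209,196,163,184,195,156] []"
definition "c77 u = case_of u n3 [164,137,133,210,184,240,198,139] [162,200,149,146,156,225,204,163] []"
definition "c78 u = case_of u n3 [200,145,152,166,202,178,165,197] [224,131,156,134,139,240,169,212] []"
definition "c79 u = case_of u n3 [138,161,137,212,202,166,180,209] [146,224,141,196,232,135,184,147] []"
definition "c80 u = case_of u n3 [137,208,152,166,139,228,225,150] [133,194,184,162,202,204,177,149]
  [([238,172,169,209,197,214,147],21289397,[n14,n21]),([238,180,169,209,139,214,139],21868481,[n14,n21])]"
definition "c81 u = case_of u n3 [134,161,133,216,201,178,198,184] [138,224,149,208,139,147,228,172]
  [([230,229,155,134,133,154,153],26118009,[n14,n21]),([230,229,217,166,165,154,153],26339897,[n3,n13,n20])]"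
definition "c82 u = case_of u n3 [133,152,148,226,169,170,197,210] [131,200,180,224,177,142,204,147] []"
definition "c83 u = case_of u n3 [208,134,224,169,135,216,154,165] [145,140,226,137,195,204,178,180] []"
definition "c84 u = case_of u n3 [145,194,133,172,202,177,142,240] [152,162,197,168,201,163,150,212]
  [([206,165,147,147,201,201,165],21444569,[n9,n16]),([206,165,147,165,201,201,147],20673025,[n9,n16]),([206,177,177,135,163,149,177],21435017,[n8,n15]),([206,177,177,177,163,149,135],22369297,[n8,n15])]"
definition "c85 u = case_of u n3 [138,196,162,177,197,216,154,165] [137,148,226,145,195,232,150,172] []"
definition "c86 u = case_of u n3 [176,200,146,135,204,142,177,225] [164,137,210,133,212,170,153,226]
  [([206,165,147,147,201,201,165],20177369,[n11,n18]),([206,165,147,165,201,201,147],20106353,[n11,n18]),([206,177,177,135,163,149,177],21009025,[n12,n19]),([206,177,177,177,163,149,135],21485049,[n8,n15])]"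
definition "c87 u = case_of u n3 [200,161,196,150,216,184,135,163] [138,145,228,146,209,172,141,226] []"
definition "c88 u = case_of u n3 [161,152,133,198,163,204,216,178] [224,138,149,194,139,172,209,180]
  [([220,197,169,147,169,209,147],20932585,[n11,n18]),([220,197,177,177,139,201,139],20932929,[n10,n17])]"
definition "c89 u = case_of u n3 [196,137,224,178,198,184,135,153] [148,138,225,146,202,172,165,209] []"
definition "c90 u = case_of u n3 [133,176,193,202,166,216,135,184] [140,146,225,138,228,212,147,169] []"
definition "c91 u = case_of u n3 [133,194,162,184,212,210,141,169] [145,200,166,152,228,147,142,225]
  [([220,233,163,178,205,135,177],21509605,[n14,n21]),([220,225,171,240,135,135,185],20772001,[n14,n21])]"
definition "c92 u = case_of u n3 [224,145,131,142,216,166,228,153] [168,148,195,140,210,178,197,169] []"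
definition "c93 u = case_of u n3 [146,133,140,232,197,178,184,195] [208,161,142,224,212,166,153,139] []"
definition "c94 u = case_of u n3 [140,208,194,163,240,135,141,184] [164,145,202,161,228,150,201,154] []"
definition "c95 u = case_of u n3 [146,137,133,228,210,212,170,169] [176,200,135,224,195,156,142,177]
  [([254,169,169,129,194,214,149],24522161,[n10,n17]),([254,137,137,167,194,208,181],24483569,[0,n12,n19])]"
definition "c96 u = case_of u n4 [134,208,194,169,240,135,141,184] [164,145,202,161,228,147,204,154] []"
definition "c97 u = case_of u n4 [161,140,164,210,156,154,225,195] [145,200,166,208,149,170,232,135] []"
definition "c98 u = case_of u n4 [224,148,196,139,149,153,170,226] [161,146,204,131,165,216,172,210] []"
definition "c99 u = case_of u n4 [224,133,164,154,141,210,240,139] [200,145,166,152,204,198,177,163] []"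
definition "c100 u = case_of u n4 [161,152,137,198,163,216,212,166] [224,146,141,194,147,232,149,172]
  [([220,197,169,147,169,209,147],21210385,[n12,n19]),([220,197,177,177,139,201,139],21210545,[n12,n19])]"
definition "c101 u = case_of u n4 [193,146,208,172,197,178,141,170] [161,134,216,164,198,177,153,202] []"
definition "c102 u = case_of u n4 [152,161,145,198,216,166,204,163] [138,224,149,194,240,180,141,139] []"
definition "c103 u = case_of u n4 [131,200,137,180,240,216,135,166] [146,196,169,148,225,154,197,170]
  [([206,216,177,167,141,141,167],22957113,[n14,n21]),([206,240,177,165,165,143,143],22598793,[n14,n21])]"
definition "c104 u = case_of u n4 [134,200,194,177,169,150,180,201] [133,152,226,145,170,154,228,197] []"
definition "c105 u = case_of u n4 [200,133,196,178,154,165,216,163] [168,145,198,176,142,172,209,195] []"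
definition "c106 u = case_of u n4 [131,176,145,204,240,201,166,142] [194,168,149,196,210,169,165,154] []"
definition "c107 u = case_of u n4 [133,194,193,184,226,177,156,142] [164,146,201,168,228,147,212,139] []"
definition "c108 u = case_of u n4 [176,200,152,135,201,228,166,147] [161,194,156,133,169,212,170,210] []"
definition "c109 u = case_of u n4 [176,133,148,202,141,226,216,163] [168,193,150,138,172,228,209,147] []"
definition "c110 u = case_of u n4 [193,146,145,172,165,178,202,204] [224,134,153,168,135,240,139,212] []"
definition "c111 u = case_of u n4 [164,146,162,201,232,154,197,149] [140,208,163,137,240,142,198,177] []"
definition "c112 u = case_of u n4 [196,146,208,169,232,135,141,178] [164,138,209,161,202,195,156,180] []"
definition "c113 u = case_of u n4 [193,140,133,178,177,226,202,156] [208,168,135,146,169,228,139,212]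
  [([206,141,147,195,225,195,177],23132221,[n8,n15]),([206,141,195,147,225,195,177],23354893,[n8,n15]),([206,141,195,195,225,147,177],23801053,[n8,n15]),([206,141,153,165,225,201,177],23430785,[n2,n11,n18]),([206,141,169,149,225,197,177],23347317,[n11,n18]),([206,141,169,197,225,149,177],23197205,[n11,n18]),([206,141,201,165,225,153,177],23350097,[n11,n18]),([206,141,177,225,225,141,177],23277709,[n11,n18]),([206,141,209,209,225,209,177],23915565,[n8,n15]),([206,141,225,177,225,141,177],23347133,[n11,n18])]"
definition "c114 u = case_of u n4 [140,176,148,195,169,240,198,139] [200,162,149,193,165,216,166,154] []"
definition "c115 u = case_of u n4 [176,131,146,204,165,139,228,216] [168,193,150,140,149,170,226,209] []"
definition "c116 u = case_of u n4 [194,145,193,172,150,232,166,153] [138,176,197,140,212,240,163,139] []"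
definition "c117 u = case_of u n4 [162,137,168,212,150,201,240,135] [194,145,172,196,154,202,177,165] []"
definition "c118 u = case_of u n4 [131,176,145,204,142,201,166,240] [194,168,149,196,154,169,165,210] []"
definition "c119 u = case_of u n4 [133,176,145,202,135,210,232,172] [196,162,153,138,163,212,225,156]
  [([248,141,195,163,201,201,149],21818133,[n13,n20]),([248,169,147,135,165,147,177],22190221,[n13,n20])]"
definition "c120 u = case_of u n4 [168,145,137,198,232,150,180,195] [162,208,141,196,216,154,165,163] []"
definition "c121 u = case_of u n4 [193,164,224,154,184,142,209,135] [137,148,226,146,169,204,212,163] []"
definition "c122 u = case_of u n4 [200,134,138,177,197,178,216,165] [224,148,139,145,195,226,156,172] []"
definition "c123 u = case_of u n4 [194,152,138,165,177,198,240,141] [193,148,170,164,147,150,232,201] []"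
definition "c124 u = case_of u n4 [161,140,133,210,202,212,177,170] [224,152,135,146,201,228,153,166] []"
definition "c125 u = case_of u n4 [133,146,164,232,210,141,139,240] [193,152,166,200,198,156,163,177]
  [([220,185,163,226,225,135,157],20936981,[n12,n19]),([220,177,171,240,233,135,135],20854985,[n12,n19])]"
definition "c126 u = case_of u n4 [131,164,193,216,180,142,139,240] [146,168,197,152,149,198,169,226]
  [([238,172,169,209,197,214,147],21218781,[n13,n20]),([238,180,169,209,139,214,139],20996717,[n3,n13,n20])]"
definition "c127 u = case_of u n4 [145,194,152,172,198,142,177,225] [133,162,216,164,212,139,178,201]
  [([206,165,147,147,201,201,165],21545405,[n14,n21]),([206,165,147,165,201,201,147],20766229,[n14,n21]),([206,177,177,135,163,149,177],23094589,[n8,n15]),([206,177,177,177,163,149,135],22870293,[n14,n21])]"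
definition "c128 u = case_of u n4 [224,146,200,141,150,156,163,225] [164,145,202,133,198,184,170,209] []"
definition "c129 u = case_of u n4 [168,133,224,210,170,149,139,212] [152,134,225,146,166,177,201,204]
  [([238,232,184,149,197,199,147],20532241,[n8,n15]),([238,240,184,149,139,199,139],21309885,[n11,n18])]"
definition "c130 u = case_of u n4 [200,176,196,135,201,153,166,178] [138,161,212,131,225,156,172,210] []"
definition "c131 u = case_of u n4 [161,134,137,216,177,204,198,178] [224,148,139,208,149,172,195,170]
  [([206,165,147,147,201,201,165],20319069,[n9,n16]),([206,165,147,165,201,201,147],20177173,[n9,n16]),([206,177,177,135,163,149,177],21600813,[n8,n15]),([206,177,177,177,163,149,135],20897541,[n8,n15])]"
definition "c132 u = case_of u n4 [196,161,194,154,204,147,172,177] [148,137,226,152,201,135,166,240] []"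
definition "c133 u = case_of u n4 [193,134,208,184,163,142,225,156] [137,164,210,168,147,202,228,149] []"
definition "c134 u = case_of u n4 [168,208,164,135,201,169,150,210] [138,145,228,131,204,177,156,226] []"
definition "c135 u = case_of u n4 [131,224,133,156,178,204,147,232] [138,208,165,152,166,198,209,169] []"
definition "c136 u = case_of u n4 [193,152,194,166,178,184,197,141] [161,148,202,164,147,232,212,139] []"
definition "c137 u = case_of u n4 [194,176,200,141,169,198,150,177] [131,164,216,133,170,228,154,209] []"
definition "c138 u = case_of u n4 [148,224,146,139,202,165,149,232] [140,193,178,137,198,166,209,184] []"
definition "c139 u = case_of u n4 [193,138,168,180,210,154,197,165] [145,134,232,148,226,153,204,163]
  [([218,149,225,163,201,201,141],22559873,[n9,n16]),([218,177,177,135,165,147,169],22431601,[n9,n16])]"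
definition "c140 u = case_of u n4 [168,193,145,150,202,180,172,195] [162,196,153,134,216,240,141,163]
  [([254,200,131,149,233,148,163],20880097,[n11,n18]),([254,208,131,241,141,140,163],21302721,[n11,n18])]"
definition "c141 u = case_of u n4 [137,194,208,180,198,142,169,177] [133,162,216,164,197,154,232,147] []"
definition "c142 u = case_of u n4 [194,152,140,165,184,240,135,195] [162,145,204,161,170,212,150,201]
  [([230,216,153,167,141,141,167],21070921,[n12,n19]),([230,240,153,165,165,143,143],21559161,[n12,n19])]"
definition "c143 u = case_of u n4 [148,194,224,169,202,149,177,142] [152,131,228,137,216,197,178,166]
  [([234,141,147,195,197,195,177],21990121,[n8,n15]),([234,141,195,147,197,195,177],21501801,[n8,n15]),([234,141,195,195,197,147,177],21988329,[n8,n15]),([234,141,153,165,197,201,177],20746957,[n8,n15]),([234,141,169,149,197,197,177],21332117,[n8,n15]),([234,141,169,197,197,149,177],21959581,[n8,n15]),([234,141,201,165,197,153,177],22315181,[n8,n15]),([234,141,177,225,197,141,177],21172149,[n8,n15]),([234,141,209,209,197,209,177],23106569,[n8,n15]),([234,141,225,177,197,141,177],22116573,[n8,n15])]"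
definition "c144 u = case_of u n4 [224,152,145,135,156,163,204,226] [164,138,209,134,180,169,201,210]
  [([220,197,169,147,169,209,147],20514409,[n11,n18]),([220,197,177,177,139,201,139],20511033,[n11,n18])]"
definition "c145 u = case_of u n4 [194,164,168,153,165,154,210,197] [131,148,232,145,163,142,240,204]
  [([254,188,195,129,225,158,129],21740521,[n12,n19]),([254,244,139,129,169,214,129],21736425,[n12,n19]),([254,152,153,163,197,196,163],19956569,[n12,n19]),([254,208,209,163,141,140,163],20505625,[n12,n19])]"
definition "c146 u = case_of u n4 [200,133,134,178,216,165,154,225] [168,145,198,176,212,172,139,195] []"
definition "c147 u = case_of u n4 [137,164,134,210,147,232,153,228] [193,176,142,208,163,170,156,197] []"
definition "c148 u = case_of u n4 [164,146,194,201,197,154,165,184] [140,145,226,137,212,142,163,240] []"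
definition "c149 u = case_of u n5 [164,193,196,154,195,172,147,184] [162,137,212,138,226,141,149,240] []"
definition "c150 u = case_of u n5 [193,152,200,166,154,178,197,165] [131,148,232,134,139,240,212,169] []"
definition "c151 u = case_of u n5 [176,193,224,142,197,154,184,135] [148,137,226,140,212,210,169,163]
  [([206,201,153,135,225,201,177],26018185,[n8,n15]),([206,225,177,135,225,135,177],25800585,[n8,n15])]"
definition "c152 u = case_of u n5 [148,193,145,170,156,226,172,195] [134,200,177,138,216,240,165,135]
  [([254,200,176,131,205,133,179],23116905,[n12,n19]),([254,224,152,131,229,133,155],22524457,[n12,n19])]"
definition "c153 u = case_of u n5 [164,137,140,210,166,178,209,201] [224,131,156,194,135,184,149,232] []"
definition "c154 u = case_of u n5 [200,176,168,135,178,209,142,197] [194,148,169,131,226,153,156,228] []"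
definition "c155 u = case_of u n5 [140,145,133,226,177,202,228,154] [168,208,135,162,169,201,212,150] []"
definition "c156 u = case_of u n5 [176,133,145,202,210,172,232,135] [162,196,153,138,212,156,225,163]
  [([254,188,195,129,225,158,129],23007513,[n12,n19]),([254,244,139,129,169,214,129],23007929,[n12,n19]),([254,152,153,163,197,196,163],22607993,[n1,n12,n19]),([254,208,209,163,141,140,163],22314393,[n13,n20])]"
definition "c157 u = case_of u n5 [200,162,138,149,141,212,240,163] [193,164,154,145,172,198,184,195]
  [([220,185,163,226,225,135,157],23066917,[n9,n16]),([220,177,171,240,233,135,135],22293897,[n9,n16])]"
definition "c158 u = case_of u n5 [164,208,176,139,198,142,169,209] [133,200,178,131,226,156,232,149]
  [([206,165,147,147,201,201,165],19461341,[n11,n18]),([206,165,147,165,201,201,147],20285869,[n11,n18]),([206,177,177,135,163,149,177],21435437,[n8,n15]),([206,177,177,177,163,149,135],21442077,[n8,n15])]"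
definition "c159 u = case_of u n5 [176,193,208,142,178,202,141,165] [168,131,212,134,147,232,153,228] []"
definition "c160 u = case_of u n5 [138,148,140,225,202,147,228,177] [162,208,141,193,216,135,166,184]
  [([254,200,176,133,205,131,179],21458265,[n12,n19]),([254,224,152,133,229,131,155],21745625,[n3,n12,n19])]"
definition "c161 u = case_of u n5 [164,193,196,154,172,177,147,202] [162,137,212,152,141,240,135,226] []"
definition "c162 u = case_of u n5 [137,148,152,226,139,228,165,210] [193,134,184,162,142,204,177,209]
  [([238,232,184,149,197,199,147],21067009,[n10,n17]),([238,240,184,149,139,199,139],21773217,[n11,n18])]"
definition "c163 u = case_of u n5 [224,146,176,141,153,198,225,142] [200,131,180,133,216,212,163,170]
  [([206,141,147,195,225,195,177],23464169,[n9,n16]),([206,141,195,147,225,195,177],23463545,[n9,n16]),([206,141,195,195,225,147,177],23608217,[n3,n9,n16]),([206,141,153,165,225,201,177],23254589,[n8,n15]),([206,141,169,149,225,197,177],23176333,[n8,n15]),([206,141,169,197,225,149,177],23482893,[n9,n16]),([206,141,201,165,225,153,177],23403613,[n9,n16]),([206,141,177,225,225,141,177],23201677,[n9,n16]),([206,141,209,209,225,209,177],24837945,[n9,n16]),([206,141,225,177,225,141,177],23046285,[n9,n16])]"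
definition "c164 u = case_of u n5 [134,224,162,153,212,216,135,169] [140,193,178,145,180,202,195,172]
  [([220,197,169,147,169,209,147],20193729,[n11,n18]),([220,197,177,177,139,201,139],20188833,[n14,n21])]"
definition "c165 u = case_of u n5 [146,196,145,169,204,178,201,166] [138,224,149,168,156,240,195,135] []"
definition "c166 u = case_of u n5 [140,194,148,177,195,232,172,147] [137,162,212,161,197,216,166,154] []"
definition "c167 u = case_of u n5 [133,200,131,178,216,154,165,228] [148,168,195,176,209,142,169,198] []"
definition "c168 u = case_of u n5 [200,162,193,149,216,184,135,166] [140,146,225,148,210,169,139,228] []"
definition "c169 u = case_of u n5 [133,168,196,210,153,226,149,170] [131,176,204,146,201,225,180,142] []"
definition "c170 u = case_of u n5 [161,200,196,150,139,180,177,202] [162,152,197,146,141,172,209,226]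
  [([248,185,225,198,163,135,157],21070641,[n10,n17]),([248,177,233,212,171,135,135],21018041,[n10,n17])]"
definition "c171 u = case_of u n6 [148,168,140,195,232,149,226,147] [208,161,142,193,216,165,166,154] []"
definition "c172 u = case_of u n6 [164,146,162,201,210,216,165,141] [196,145,170,193,198,184,177,142] []"
definition "c173 u = case_of u n6 [224,146,194,141,147,172,232,149] [161,152,198,137,163,166,216,212]
  [([254,200,131,149,233,148,163],21837009,[n12,n19]),([254,208,131,241,141,140,163],21988097,[n12,n19])]"
definition "c174 u = case_of u n6 [137,146,145,228,141,210,226,172] [200,134,177,196,135,216,163,184] []"
definition "c175 u = case_of u n6 [138,161,137,212,202,180,177,198] [146,224,141,208,232,172,147,135] []"
definition "c176 u = case_of u n6 [200,145,152,166,202,165,198,177] [224,131,156,162,139,141,212,240] []"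
definition "c177 u = case_of u n6 [161,200,224,150,165,135,154,216] [145,140,226,148,172,195,170,209] []"
definition "c178 u = case_of u n6 [134,176,148,201,225,142,240,139] [194,168,149,200,165,172,210,147] []"
definition "c179 u = case_of u n6 [145,196,148,170,202,169,177,198] [131,224,156,162,216,141,240,135]
  [([254,200,176,133,205,131,179],22948761,[n14,n21]),([254,224,152,133,229,131,155],23538457,[n14,n21])]"
definition "c180 u = case_of u n6 [200,145,208,166,142,163,204,177] [168,133,210,164,154,195,197,184] []"
definition "c181 u = case_of u n6 [152,162,168,197,226,204,147,149] [208,134,169,193,240,142,139,180] []"
definition "c182 u = case_of u n6 [138,161,131,212,225,210,156,172] [200,176,135,196,201,178,153,166] []"
definition "c183 u = case_of u n6 [200,134,138,177,166,212,169,209] [224,133,154,176,226,156,141,195]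
  [([248,185,225,198,163,135,157],21244905,[n8,n15]),([248,177,233,212,171,135,135],20450089,[n8,n15])]"
definition "c184 u = case_of u n6 [168,146,138,197,147,228,240,141] [161,148,202,193,163,166,216,156]
  [([254,188,195,129,225,158,129],22170709,[n10,n17]),([254,244,139,129,169,214,129],22055237,[n10,n17]),([254,152,153,163,197,196,163],21165557,[n10,n17]),([254,208,209,163,141,140,163],21165029,[n10,n17])]"
definition "c185 u = case_of u n6 [196,145,133,170,142,153,240,226] [200,146,165,168,150,201,180,195] []"
definition "c186 u = case_of u n6 [138,224,200,149,141,178,228,147] [134,161,216,148,169,184,198,195]
  [([220,185,163,226,225,135,157],21090897,[n8,n15]),([220,177,171,240,233,135,135],21163245,[n8,n15])]"
definition "c187 u = case_of u n6 [137,208,152,166,142,225,165,210] [131,196,184,162,204,232,149,147]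
  [([238,172,169,209,197,214,147],22239869,[n2,n14,n21]),([238,180,169,209,139,214,139],22002405,[n14,n21])]"
definition "c188 u = case_of u n6 [133,162,164,216,156,201,195,178] [145,138,228,208,142,169,198,177]
  [([254,141,195,177,140,194,177],22664725,[n11,n18]),([254,197,139,177,196,138,177],23029429,[n11,n18]),([254,153,169,129,230,214,129],23916885,[n9,n16]),([254,209,225,129,174,158,129],24094821,[n9,n16])]"
definition "c189 u = case_of u n6 [131,148,133,232,210,169,180,202] [162,152,197,224,209,153,166,142] []"
definition "c190 u = case_of u n6 [164,145,161,202,150,232,198,153] [140,208,163,138,178,240,197,141] []"
definition "c191 u = case_of u n6 [161,152,168,198,147,135,228,216] [193,148,170,194,178,141,180,201] []"
definition "c192 u = case_of u n6 [138,145,131,228,204,226,177,156] [168,208,135,164,201,210,169,150] []"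
definition "c193 u = case_of u n6 [200,162,168,149,209,156,195,166] [196,146,169,133,240,154,139,228] []"
definition "c194 u = case_of u n6 [137,164,168,210,147,149,202,228] [193,134,184,208,163,156,142,225] []"
definition "c195 u = case_of u n6 [164,138,134,209,180,210,169,201] [224,152,135,145,156,226,163,204]
  [([254,200,131,149,233,148,163],21637717,[n11,n18]),([254,208,131,241,141,140,163],21493445,[n11,n18])]"
definition "c196 u = case_of u n6 [161,146,162,204,169,202,212,149] [193,152,166,140,184,195,240,135]
  [([254,200,176,133,205,131,179],21860477,[n12,n19]),([254,224,152,133,229,131,155],22292573,[n12,n19])]"
definition "c197 u = case_of u n6 [137,194,200,180,169,147,150,228] [133,162,216,176,170,209,142,197] []"
definition "c198 u = case_of u n6 [224,131,162,156,240,141,154,197] [200,145,166,148,177,169,202,198]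
  [([254,173,146,193,196,131,185],22225145,[n9,n16]),([254,173,146,193,200,131,181],22227993,[n9,n16]),([254,173,146,193,224,131,157],22011913,[n14,n21]),([254,129,186,197,200,135,177],22626317,[n14,n21]),([254,129,186,197,224,135,153],22263677,[n14,n21]),([254,129,154,229,196,139,177],22408477,[n14,n21]),([254,129,154,229,224,139,149],22482573,[n14,n21]),([254,129,178,225,196,143,153],22408101,[n14,n21]),([254,129,178,225,200,143,149],22845381,[n14,n21]),([254,129,146,193,236,131,189],23076969,[n14,n21])]"
definition "c199 u = case_of u n6 [161,134,131,216,177,204,172,210] [224,148,139,152,149,197,170,226]
  [([206,165,147,147,201,201,165],20533929,[n12,n19]),([206,165,147,165,201,201,147],19979497,[n12,n19]),([206,177,177,135,163,149,177],21243849,[n12,n19]),([206,177,177,177,163,149,135],21250761,[n12,n19])]"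
definition "c200 u = case_of u n6 [200,145,208,166,180,163,204,139] [168,133,210,134,184,225,197,154] []"
definition "c201 u = case_of u n6 [193,176,208,142,163,197,170,156] [137,164,210,134,147,228,232,153] []"
definition "c202 u = case_of u n6 [140,162,138,209,228,240,141,147] [148,161,202,193,198,184,169,150] []"
definition "c203 u = case_of u n6 [162,196,134,153,216,163,232,149] [176,193,142,137,210,195,172,180]
  [([220,197,169,147,169,209,147],21175685,[n14,n21]),([220,197,177,177,139,201,139],20488461,[n14,n21])]"
definition "c204 u = case_of u n6 [200,134,138,177,180,212,201,163] [224,133,154,145,172,210,141,226]
  [([248,185,225,198,163,135,157],21862853,[n10,n17]),([248,177,233,212,171,135,135],21705345,[n10,n17])]"
definition "c205 u = case_of u n6 [208,168,193,135,170,212,180,139] [146,140,225,134,226,204,177,153]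
  [([254,173,131,131,196,208,185],22594293,[n11,n18]),([254,173,131,131,200,208,181],22665813,[n11,n18]),([254,173,131,131,224,208,157],23036789,[n11,n18]),([254,129,171,135,200,212,177],22766917,[n11,n18]),([254,129,171,135,224,212,153],22839813,[n11,n18]),([254,129,139,167,196,216,177],22766897,[n11,n18]),([254,129,139,167,224,216,149],22766081,[n3,n11,n18]),([254,129,163,163,196,220,153],22780173,[n11,n18]),([254,129,163,163,200,220,149],22706317,[n11,n18]),([254,129,131,131,236,208,189],23924117,[n11,n18])]"
definition "c206 u = case_of u n6 [194,140,193,177,172,210,169,150] [162,152,197,176,228,216,139,135] []"
definition "c207 u = case_of u n6 [200,146,168,165,147,198,204,177] [193,148,170,133,139,226,156,240] []"
definition "c208 u = case_of u n6 [148,200,146,163,232,226,149,141] [164,193,154,161,184,198,209,142] []"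
definition "c209 u = case_of u n6 [140,162,133,209,156,226,225,154] [200,176,135,208,180,198,169,139] []"
definition "c210 u = case_of u n6 [194,176,196,141,202,154,177,165] [131,168,212,137,232,150,209,166] []"
definition "c211 u = case_of u n6 [148,193,164,170,156,163,195,216] [146,137,228,138,141,177,198,240] []"
definition "c212 u = case_of u n6 [145,196,176,170,147,172,195,204] [137,134,240,138,150,165,225,216] []"
definition "c213 u = case_of u n6 [194,176,196,141,154,202,177,165] [131,168,212,137,150,232,209,166] []"
definition "c214 u = case_of u n6 [194,145,196,172,154,165,202,177] [162,137,212,168,150,135,201,240] []"
definition "c215 u = case_of u n6 [200,145,194,166,163,177,204,156] [168,133,210,164,139,240,197,154] []"
definition "c216 u = case_of u n6 [133,176,196,202,232,135,184,147] [137,162,212,138,225,166,156,209] []"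
definition "c217 u = case_of u n6 [200,162,193,149,165,154,216,166] [140,176,195,148,169,139,240,198] []"
definition "c218 u = case_of u n6 [208,162,134,141,225,216,163,156] [145,168,198,137,228,202,147,180] []"
definition "c219 u = case_of u n6 [162,200,140,149,210,165,163,216] [176,193,142,145,198,228,139,184] []"
definition "c220 u = case_of u n6 [148,224,162,139,232,149,204,147] [152,193,166,137,184,165,198,210] []"
definition "c221 u = case_of u n6 [193,148,134,170,180,139,201,240] [161,152,198,168,165,147,204,210]
  [([222,156,153,225,230,197,163],21116141,[n12,n19]),([222,180,153,225,230,139,139],21219261,[n12,n19])]"
definition "c222 u = case_of u n6 [137,164,162,210,153,147,204,228] [193,148,170,208,184,135,142,225] []"
definition "c223 u = case_of u n6 [224,148,145,139,195,172,226,156] [200,134,177,138,197,165,178,216] []"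

definition all_cases :: "(unit \<Rightarrow> case_data) list" where "all_cases = [
    c0, c1, c2, c3, c4, c5, c6, c7, c8, c9, c10, c11, c12, c13, c14, c15, c16, c17, c18, c19, c20, c21, c22, c23, c24, c25, c26, c27, c28, c29, c30,
    c31, c32, c33, c34, c35, c36, c37, c38, c39, c40, c41, c42, c43, c44, c45, c46, c47, c48, c49, c50, c51, c52, c53, c54, c55, c56, c57, c58, c59,
    c60, c61, c62, c63, c64, c65, c66, c67, c68, c69, c70, c71, c72, c73, c74, c75, c76, c77, c78, c79, c80, c81, c82, c83, c84, c85, c86, c87, c88,
    c89, c90, c91, c92, c93, c94, c95, c96, c97, c98, c99, c100, c101, c102, c103, c104, c105, c106, c107, c108, c109, c110, c111, c112, c113, c114,
    c115, c116, c117, c118, c119, c120, c121, c122, c123, c124, c125, c126, c127, c128, c129, c130, c131, c132, c133, c134, c135, c136, c137, c138,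
    c139, c140, c141, c142, c143, c144, c145, c146, c147, c148, c149, c150, c151, c152, c153, c154, c155, c156, c157, c158, c159, c160, c161, c162,
    c163, c164, c165, c166, c167, c168, c169, c170, c171, c172, c173, c174, c175, c176, c177, c178, c179, c180, c181, c182, c183, c184, c185, c186,
    c187, c188, c189, c190, c191, c192, c193, c194, c195, c196, c197, c198, c199, c200, c201, c202, c203, c204, c205, c206, c207, c208, c209, c210,
    c211, c212, c213, c214, c215, c216, c217, c218, c219, c220, c221, c222, c223]"

fun case_ok :: "case_data \<Rightarrow> bool" where
  "case_ok (r, N, K, its) = cok1 (reps ! r) (mbits N) (transposed (mbits K)) its"

text \<open>A predicate of its own, so that membership of a named case is settled by one rewrite
  rule without unfolding its data.\<close>

definition is_case :: "(unit \<Rightarrow> case_data) \<Rightarrow> bool" where "is_case c \<longleftrightarrow> c \<in> set all_cases"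

fun isoc :: "nat \<Rightarrow> bool list list \<Rightarrow> bool list list \<Rightarrow> nat list \<Rightarrow> nat list \<Rightarrow> case_data \<Rightarrow> bool" where
  "isoc r N K ps qs (r', N', K', its) = (if eqn r r' then if eqm (relab ps qs N) (mbits N')
     then eqm (relab ps qs K) (mbits K') else False else False)"

text \<open>The permutation of the fixed vertices has to stabilise \<open>M\<close>, because a case
  refers to the representative itself and not to a relabelled copy.\<close>

fun cert_holds :: "nat \<Rightarrow> bool list list \<Rightarrow> bool list list \<Rightarrow> bool list list \<Rightarrow> bool list list \<Rightarrow> bool list list \<Rightarrow> cert \<Rightarrow> bool" where
  "cert_holds r M N K Nc Kr (Bad l j) = bad M Nc Kr l j"
| "cert_holds r M N K Nc Kr (Iso ps qs c) = (if is_case c then if isperm n8 ps then if isperm n7 qs then if eqm (relab ps ps M) M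
     then isoc r N K ps qs (c ()) else False else False else False else False)"

fun certs_ok :: "nat \<Rightarrow> bool list list list \<Rightarrow> bool list list \<Rightarrow> bool list list \<Rightarrow> bool list list \<Rightarrow> bool list list \<Rightarrow>
    cert list \<Rightarrow> bool" where
  "certs_ok r (M # Ms) N K Nc Kr (c # cs) = (if cert_holds r M N K Nc Kr c then certs_ok (Suc r) Ms N K Nc Kr cs else False)"
| "certs_ok r Ms N K Nc Kr [] = True"
| "certs_ok r [] N K Nc Kr (c # cs) = True"

definition leaf2b :: "bool list list \<Rightarrow> bool list list \<Rightarrow> bool list list \<Rightarrow> bool list list \<Rightarrow> cert list \<Rightarrow> bool" where
  "leaf2b N K Nc Kr cs = (if knok Kr Nc idm7 then certs_ok 0 reps N K Nc Kr cs else False)"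

text \<open>In the tree the indices below 8 address the rows of \<open>N\<close>, and those from 8
  on the columns of \<open>K\<close>.\<close>

definition leaf2a :: "cert list dtree \<Rightarrow> bool list list \<Rightarrow> bool list list \<Rightarrow> bool" where
  "leaf2a t N K = leaf2b N K (transposed N) (transposed K) (look t (N @ K))"

definition leaf1a :: "bool list list \<Rightarrow> nat list \<times> nat \<Rightarrow> bool" where
  "leaf1a X pr = (if memn (snd pr) [0, n1, n2, n3, n4, n5, n6, n7, n8, n9, n10] then if isperm n8 (fst pr)
     then eqm (relab (fst pr) (fst pr) X) (reps ! snd pr) else False else False)"

definition leaf1b :: "(nat list \<times> nat) dtree \<Rightarrow> bool list list \<Rightarrow> bool" where
  "leaf1b t X = leaf1a X (look t X)"

definition leaf1 :: "(nat list \<times> nat) dtree \<Rightarrow> num list \<Rightarrow> bool" where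
  "leaf1 t rows = leaf1b t (map nbits rows)"

abbreviation "Iso0 \<equiv> Iso [0,n1,n2,n3,n4,n5,n6,n7]"
abbreviation "Iso1 \<equiv> Iso [0,n1,n2,n3,n5,n4,n6,n7]"

text \<open>Each leaf holds seven certificates, one for each of the representatives 0 to 6. The tree
  only selects them; what they claim is tested at the leaf of the search.\<close>

definition tree2 :: "cert list dtree" where "tree2 = (Nd n4 n1 (Nd n4 0 (Nd n5 0 (Nd n2 n5 (Nd n4 n2 (Nd n5 n1 (Nd n6 0 (Lf [Bad n5 n5, Bad n3 0,
  Iso0 [n2,n6,n3,n1,n4,n5,0] c58, Iso0 [n6,n2,n5,n1,n4,0,n3] c91, Iso0 [n6,n3,n1,n2,n4,0,n5] c139, Bad n3 0, Bad n1 n2]) (Lf [Iso0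
  [n1,n5,0,n3,n2,n6,n4] c11, Iso0 [n1,n5,0,n2,n3,n4,n6] c39, Bad n1 n4, Bad n1 n4, Bad n1 n2, Bad n1 n4, Bad 0 0])) (Nd n6 0 (Lf [Bad n5 n5, Bad n3
  0, Bad n3 n2, Bad n3 n2, Bad n3 n2, Bad n3 0, Iso0 [n4,n2,0,n1,n6,n3,n5] c218]) (Lf [Bad n3 n2, Bad n5 n5, Bad n5 n5, Bad n5 n5, Bad n5 n5, Bad n5
  n5, Bad 0 0]))) (Nd n5 n1 (Nd n6 0 (Lf [Bad n5 n5, Bad n3 0, Iso1 [n2,n6,n3,n1,n4,n5,0] c58, Iso1 [n6,n2,n5,n1,n4,0,n3] c91, Iso0
  [n6,n3,n4,n5,0,n1,n2] c141, Bad n3 0, Bad n3 n3]) (Lf [Iso1 [n1,n5,0,n3,n2,n6,n4] c11, Iso1 [n1,n5,0,n2,n3,n4,n6] c39, Bad n1 n4, Bad n1 n4, Iso0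
  [n1,n6,0,n2,n3,n4,n5] c142, Bad n1 n4, Bad 0 0])) (Nd n6 0 (Lf [Bad n5 n5, Bad n3 0, Bad n3 n3, Bad n3 n3, Bad n3 n3, Bad n3 n3, Iso0
  [n1,0,n5,n4,n6,n2,n3] c220]) (Lf [Iso0 [n2,n4,n3,0,n6,n5,n1] c12, Bad n3 n6, Iso0 [n3,0,n2,n1,n5,n6,n4] c60, Iso0 [n3,n5,n2,0,n6,n1,n4] c93, Iso0
  [n1,n3,n5,n4,n6,0,n2] c143, Bad n5 n5, Bad n5 n5])))) (Nd n2 0 (Nd n5 n4 (Nd n6 n1 (Lf [Iso0 [n2,n6,n3,n1,n5,n4,0] c0, Iso0 [n1,n5,n4,n3,0,n2,n6]
  c13, Bad n6 n3, Iso0 [n5,n2,n3,0,n1,n6,n4] c64, Bad n6 n6, Iso0 [n3,n4,n5,n1,0,n6,n2] c149, Iso0 [n1,0,n5,n2,n6,n3,n4] c171]) (Lf [Iso0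
  [n4,n1,n6,0,n2,n3,n5] c1, Bad n3 n6, Iso0 [n5,n3,n6,n1,n4,0,n2] c42, Iso0 [n4,n1,n3,0,n2,n6,n5] c65, Iso0 [n1,n5,n6,0,n3,n4,n2] c96, Bad n3 n6, Bad
  n6 n6])) (Nd n6 n1 (Lf [Iso0 [n2,n4,n6,0,n3,n1,n5] c3, Bad 0 n6, Bad 0 n3, Iso0 [n5,n4,n1,n6,n3,n2,0] c70, Iso0 [n5,n6,0,n1,n2,n3,n4] c106, Bad n1
  n6, Iso0 [0,n3,n1,n5,n6,n2,n4] c181]) (Lf [Bad n1 n1, Bad n3 n6, Iso0 [0,n1,n6,n5,n3,n4,n2] c47, Iso0 [n4,n6,n3,n1,0,n2,n5] c71, Iso0
  [n5,n3,n6,0,n1,n4,n2] c107, Bad n3 n6, Iso0 [n2,n5,0,n6,n1,n3,n4] c182]))) (Nd n5 n2 (Nd n6 0 (Lf [Iso0 [0,n6,n2,n1,n3,n5,n4] c8, Bad n3 0, Bad n6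
  n2, Iso0 [n4,n2,n3,n1,n6,0,n5] c83, Iso0 [n6,n2,n5,n1,n3,0,n4] c125, Bad n3 0, Iso0 [0,n4,n1,n3,n6,n2,n5] c205]) (Lf [Iso0 [0,n3,n5,n6,n1,n4,n2]
  c9, Iso0 [n1,n5,n4,n3,n2,0,n6] c32, Bad n6 n3, Iso0 [n5,n3,0,n4,n6,n1,n2] c84, Bad n6 0, Iso0 [0,n6,n2,n4,n5,n1,n3] c165, Iso0
  [0,n6,n2,n3,n1,n4,n5] c206])) (Nd n6 0 (Lf [Iso [0,n1,n2,n3,n4,n6,n5,n7] [0,n6,n2,n1,n3,n5,n4] c8, Bad n3 0, Iso0 [n1,n5,n2,n6,n3,0,n4] c53, Iso0
  [n4,n5,n3,n6,n1,0,n2] c85, Iso0 [n5,n6,n2,n1,n4,n3,0] c126, Iso0 [n4,n3,n5,n6,0,n1,n2] c166, Iso0 [n4,n2,n1,n5,n3,0,n6] c207]) (Lf [Iso0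
  [n6,0,n1,n5,n4,n3,n2] c10, Iso0 [n3,0,n6,n1,n5,n2,n4] c33, Bad n1 n5, Bad n1 n3, Bad n3 n3, Bad n1 n3, Bad 0 0]))))) (Nd n2 0 (Nd n5 n1 (Nd n5 n4
  (Nd n6 0 (Lf [Iso [0,n1,n2,n3,n4,n6,n5,n7] [n2,n4,n6,0,n3,n1,n5] c3, Iso0 [n5,0,n1,n2,n3,n4,n6] c22, Bad 0 0, Iso0 [n1,n2,n5,0,n6,n3,n4] c72, Bad 0
  0, Iso0 [0,n4,n1,n5,n3,n2,n6] c154, Iso0 [n1,n2,n3,n5,0,n4,n6] c183]) (Lf [Iso0 [n5,0,n3,n1,n6,n2,n4] c4, Bad 0 n6, Bad 0 n5, Iso0
  [n4,n2,0,n3,n1,n6,n5] c73, Iso0 [n4,n1,0,n2,n5,n6,n3] c108, Bad n3 n6, Bad n3 n3])) (Nd n6 0 (Lf [Iso [0,n1,n2,n3,n4,n6,n5,n7]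
  [n2,n6,n3,n1,n5,n4,0] c0, Iso0 [n3,n6,n4,n1,n5,0,n2] c14, Iso0 [n5,n1,n6,0,n4,n2,n3] c43, Iso0 [n1,n5,n2,n4,0,n6,n3] c66, Iso0
  [n6,0,n2,n3,n4,n5,n1] c97, Iso0 [n6,n4,n1,n2,n3,0,n5] c150, Iso0 [n1,n2,n6,0,n3,n5,n4] c172]) (Lf [Iso0 [n4,n2,0,n3,n1,n5,n6] c2, Bad n3 n6, Bad n1
  n4, Bad n1 n4, Iso0 [n4,n1,n2,0,n3,n6,n5] c98, Bad n1 n4, Bad n1 n3]))) (Nd n6 0 (Nd n6 n4 (Lf [Iso [0,n1,n2,n3,n4,n6,n5,n7] [n4,n1,n6,0,n2,n3,n5]
  c1, Bad n3 n6, Iso0 [n3,n4,n2,n5,n6,0,n1] c44, Iso0 [n1,n3,0,n5,n6,n4,n2] c67, Iso0 [n3,0,n2,n4,n1,n5,n6] c99, Iso0 [n3,0,n4,n1,n6,n5,n2] c151,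
  Iso0 [n4,n2,0,n1,n3,n6,n5] c173]) (Lf [Bad n1 n1, Iso0 [n5,0,n1,n2,n4,n6,n3] c23, Iso0 [0,n3,n5,n6,n1,n2,n4] c48, Iso0 [n3,n5,n2,0,n6,n1,n4] c74,
  Iso0 [n3,0,n2,n4,n5,n6,n1] c109, Iso0 [n2,0,n5,n6,n3,n4,n1] c155, Bad 0 n6])) (Nd n6 n4 (Lf [Iso [0,n1,n2,n3,n4,n6,n5,n7] [n5,0,n3,n1,n6,n2,n4] c4,
  Bad 0 n6, Bad 0 n3, Bad n3 n3, Bad n3 n3, Bad n1 n6, Iso0 [n4,n2,n1,n5,n3,n6,0] c184]) (Lf [Iso [0,n1,n2,n3,n4,n6,n5,n7] [n4,n2,0,n3,n1,n5,n6] c2,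
  Iso0 [n3,n2,n6,0,n1,n4,n5] c15, Bad n1 n5, Bad n1 n3, Bad n3 n3, Bad n1 n3, Bad n1 n4])))) (Nd n14 n1 (Nd n2 n2 (Lf [Iso [0,n1,n2,n3,n4,n6,n5,n7]
  [n6,0,n1,n5,n4,n3,n2] c10, Bad n3 0, Bad n1 n4, Bad n1 n2, Iso0 [n1,n2,n4,0,n3,n6,n5] c128, Bad 0 0, Bad n1 n3]) (Nd n4 n2 (Lf [Iso
  [0,n1,n2,n3,n4,n6,n5,n7] [n1,n5,0,n3,n2,n6,n4] c11, Iso0 [n1,0,n2,n4,n3,n5,n6] c40, Bad 0 n2, Bad 0 n2, Bad 0 n2, Bad 0 n2, Bad n1 n4]) (Lf [Iso
  [0,n1,n2,n3,n6,n4,n5,n7] [n1,n5,0,n3,n2,n6,n4] c11, Iso0 [n1,0,n4,n5,n2,n3,n6] c41, Iso0 [n6,0,n1,n4,n3,n5,n2] c61, Bad n1 n3, Iso0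
  [0,n1,n4,n3,n2,n6,n5] c144, Bad 0 0, Bad n1 n4]))) (Nd n2 n2 (Lf [Iso [0,n1,n2,n3,n4,n6,n5,n7] [0,n3,n5,n6,n1,n4,n2] c9, Iso0 [0,n3,n4,n5,n6,n1,n2]
  c34, Iso0 [n1,n3,n4,0,n5,n6,n2] c54, Iso0 [n1,0,n4,n3,n5,n6,n2] c86, Iso0 [n6,n3,n4,0,n5,n1,n2] c127, Iso0 [n5,0,n6,n3,n4,n1,n2] c167, Iso0
  [n1,0,n6,n2,n5,n4,n3] c208]) (Nd n4 n2 (Lf [Bad n3 n2, Bad n5 n5, Iso0 [n2,n4,n6,0,n5,n1,n3] c59, Iso0 [n2,0,n1,n4,n3,n6,n5] c92, Iso0
  [n2,n4,n1,n5,0,n6,n3] c140, Iso0 [n5,n4,0,n3,n1,n6,n2] c170, Iso0 [n1,n5,0,n2,n4,n6,n3] c219]) (Lf [Iso [0,n1,n2,n3,n4,n6,n5,n7]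
  [n2,n4,n3,0,n6,n5,n1] c12, Bad n3 0, Iso0 [n5,n3,n6,n1,n2,0,n4] c62, Iso0 [n1,0,n6,n5,n3,n4,n2] c94, Iso0 [n4,n6,n3,0,n1,n2,n5] c145, Bad n3 0,
  Iso0 [n6,0,n2,n1,n3,n4,n5] c221])))))) (Nd n5 n4 (Nd n5 n5 (Nd n6 n2 (Nd n11 0 (Nd n2 0 (Lf [Bad n3 n2, Iso0 [n2,n5,n3,n6,n4,n1,0] c21, Bad 0 0,
  Bad 0 0, Bad 0 0, Bad 0 0, Iso0 [n6,n4,n2,0,n5,n1,n3] c179]) (Lf [Bad n4 n6, Iso1 [n3,n5,n6,n1,0,n4,n2] c38, Iso1 [n5,0,n6,n2,n1,n4,n3] c57, Iso1
  [n5,n1,n6,n4,n3,n2,0] c90, Iso0 [n1,0,n6,n4,n5,n2,n3] c138, Iso1 [n6,n4,n5,n2,n1,n3,0] c169, Iso0 [0,n2,n4,n6,n1,n3,n5] c217])) (Nd n4 n4 (Lf [Bad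
  n1 n1, Iso0 [n5,0,n2,n4,n1,n3,n6] c24, Iso0 [n4,0,n5,n6,n1,n2,n3] c51, Iso0 [n2,n4,n5,n3,0,n6,n1] c77, Bad 0 0, Iso0 [n4,0,n6,n1,n2,n5,n3] c158,
  Iso0 [n6,0,n1,n2,n3,n5,n4] c191]) (Lf [Bad n3 n2, Bad 0 n6, Iso1 [n1,0,n5,n4,n3,n2,n6] c52, Iso1 [n6,n4,n5,n3,n2,0,n1] c82, Bad 0 0, Iso1
  [n1,n5,n6,n4,0,n2,n3] c164, Iso0 [n1,n2,n3,n5,0,n4,n6] c204]))) (Nd n11 0 (Nd n2 0 (Lf [Iso [0,n1,n2,n3,n6,n4,n5,n7] [n4,n2,0,n3,n1,n5,n6] c2, Iso0
  [n6,n1,n4,n2,n3,0,n5] c20, Bad 0 0, Bad 0 0, Bad 0 0, Bad 0 0, Bad n1 n4]) (Lf [Iso [0,n1,n2,n3,n6,n5,n4,n7] [n6,0,n1,n5,n4,n3,n2] c10, Bad n3 0,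
  Bad n1 n5, Bad n1 n2, Bad n1 n2, Bad n1 0, Bad n1 0])) (Nd n4 n4 (Lf [Iso [0,n1,n2,n3,n6,n4,n5,n7] [n5,0,n3,n1,n6,n2,n4] c4, Bad n1 n1, Bad 0 n2,
  Bad n1 n2, Bad 0 0, Bad n3 n3, Bad n6 n6]) (Lf [Iso [0,n1,n2,n3,n6,n5,n4,n7] [n3,n5,0,n4,n6,n2,n1] c7, Iso1 [n6,n2,n3,n5,n1,0,n4] c31, Bad 0 n2,
  Bad n1 0, Bad 0 0, Bad n1 0, Bad n1 n3])))) (Nd n6 n1 (Nd n6 0 (Nd n2 0 (Lf [Iso [0,n1,n2,n3,n6,n5,n4,n7] [n2,n6,n3,n1,n5,n4,0] c0, Iso1
  [n4,n1,n3,n6,n5,0,n2] c16, Bad n5 n2, Bad n5 n2, Bad n5 n2, Bad n4 n2, Iso0 [0,n6,n5,n1,n2,n3,n4] c178]) (Lf [Iso [0,n1,n2,n3,n6,n5,n4,n7]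
  [0,n3,n5,n6,n1,n4,n2] c9, Iso1 [n4,n2,n3,n5,0,n1,n6] c36, Bad n6 n3, Iso1 [n5,n1,0,n3,n2,n6,n4] c88, Bad n6 n6, Bad n4 0, Iso0
  [n6,n1,n5,n4,n2,n3,0] c216])) (Nd n4 n4 (Lf [Bad n3 n2, Iso1 [n6,n2,n4,n1,n3,n5,0] c27, Bad 0 n3, Iso1 [n2,n6,0,n5,n4,n3,n1] c79, Bad 0 n6, Iso1
  [n3,n4,n5,n1,0,n6,n2] c161, Iso0 [n6,0,n1,n4,n2,n3,n5] c201]) (Lf [Bad n3 n2, Bad 0 n6, Bad 0 n3, Iso1 [n6,n1,n4,n5,n2,0,n3] c80, Iso0
  [n4,n5,n1,n2,n3,0,n6] c123, Iso1 [n6,n1,n3,n5,n2,0,n4] c162, Iso0 [n1,n5,n2,0,n4,n6,n3] c203]))) (Nd n6 n4 (Nd n2 0 (Lf [Bad n3 n2, Iso1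
  [n2,n6,n3,n5,0,n4,n1] c17, Iso1 [n2,0,n6,n4,n5,n1,n3] c45, Iso1 [n2,n4,n1,n5,0,n6,n3] c68, Iso0 [n4,n5,n6,n3,n1,0,n2] c104, Iso1
  [n2,n4,n6,n1,n5,0,n3] c152, Bad 0 0]) (Lf [Bad n4 n6, Iso1 [n3,n2,n6,n1,0,n4,n5] c37, Iso1 [n5,0,n6,n1,n3,n2,n4] c56, Iso1 [n2,n1,n6,n3,n4,0,n5]
  c89, Iso0 [n4,n6,n1,0,n2,n3,n5] c137, Bad 0 0, Bad 0 0])) (Nd n4 n4 (Lf [Iso [0,n1,n2,n3,n5,n6,n4,n7] [n1,n4,0,n3,n2,n6,n5] c5, Iso1
  [n6,0,n4,n1,n3,n2,n5] c26, Bad 0 0, Bad n3 n2, Bad 0 n2, Iso1 [0,n6,n2,n5,n3,n4,n1] c160, Bad n6 n6]) (Lf [Iso [0,n1,n2,n3,n5,n6,n4,n7]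
  [0,n4,n3,n1,n6,n2,n5] c6, Iso1 [n2,0,n5,n1,n3,n6,n4] c28, Bad n4 n4, Bad n5 n2, Bad n4 n4, Bad n5 n2, Bad 0 n6]))))) (Nd n14 n2 (Nd n4 n4 (Nd n5 n1
  (Nd n5 0 (Lf [Iso [0,n1,n2,n3,n5,n6,n4,n7] [n2,n4,n6,0,n3,n1,n5] c3, Iso1 [n5,0,n1,n2,n3,n4,n6] c22, Bad 0 0, Iso1 [n1,n2,n5,0,n6,n3,n4] c72, Iso0
  [0,n1,n5,n6,n2,n3,n4] c114, Iso1 [0,n4,n1,n5,n3,n2,n6] c154, Bad n1 n2]) (Lf [Bad n3 n2, Bad 0 n6, Iso0 [n1,0,n5,n4,n3,n2,n6] c52, Iso0
  [n6,n4,n5,n3,n2,0,n1] c82, Bad 0 0, Iso0 [n1,n5,n6,n4,0,n2,n3] c164, Iso0 [n1,n2,n6,n5,n4,n3,0] c202])) (Nd n6 0 (Lf [Iso [0,n1,n2,n3,n6,n5,n4,n7]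
  [n1,n4,0,n3,n2,n6,n5] c5, Bad 0 n6, Bad 0 0, Iso1 [n2,n6,n5,n4,0,n3,n1] c81, Iso0 [0,n2,n3,n5,n1,n4,n6] c122, Iso1 [n1,n3,0,n4,n2,n5,n6] c163, Bad
  n1 n2]) (Lf [Iso1 [n3,n5,0,n4,n6,n2,n1] c7, Iso1 [n6,0,n3,n1,n4,n5,n2] c29, Bad 0 n3, Bad n1 n3, Bad n1 n2, Bad n1 n3, Bad n1 0]))) (Nd n2 0 (Nd n5
  n1 (Lf [Iso [0,n1,n2,n3,n5,n6,n4,n7] [n2,n6,n3,n1,n5,n4,0] c0, Iso1 [n3,n6,n4,n1,n5,0,n2] c14, Iso1 [n5,n1,n6,0,n4,n2,n3] c43, Iso1
  [n1,n5,n2,n4,0,n6,n3] c66, Iso0 [n5,n6,n1,n2,n4,0,n3] c103, Iso1 [n6,n4,n1,n2,n3,0,n5] c150, Bad n1 n2]) (Lf [Iso [0,n1,n2,n3,n6,n5,n4,n7]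
  [0,n4,n3,n1,n6,n2,n5] c6, Iso1 [n3,n5,0,n2,n4,n6,n1] c30, Bad n4 n4, Bad n4 n4, Iso0 [n5,0,n2,n3,n1,n6,n4] c124, Bad n4 n4, Bad n1 n2])) (Lf [Iso
  [0,n1,n2,n3,n5,n6,n4,n7] [0,n3,n5,n6,n1,n4,n2] c9, Iso1 [0,n3,n4,n5,n6,n1,n2] c34, Iso1 [n1,n3,n4,0,n5,n6,n2] c54, Iso1 [n1,0,n4,n3,n5,n6,n2] c86,
  Iso0 [n6,0,n1,n2,n3,n4,n5] c136, Iso1 [n5,0,n6,n3,n4,n1,n2] c167, Iso0 [n3,0,n1,n6,n2,n4,n5] c215]))) (Nd n4 n4 (Nd n5 n1 (Nd n5 0 (Lf [Iso1
  [n5,0,n3,n1,n6,n2,n4] c4, Bad 0 n6, Bad 0 n5, Iso1 [n4,n2,0,n3,n1,n6,n5] c73, Iso0 [n3,n2,0,n4,n5,n6,n1] c115, Bad n3 n6, Bad n1 n2]) (Lf [Iso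
  [0,n1,n2,n3,n6,n4,n5,n7] [n3,n5,0,n4,n6,n2,n1] c7, Iso0 [n6,n2,n3,n5,n1,0,n4] c31, Bad 0 n2, Bad n1 0, Bad 0 0, Bad n1 0, Bad n1 n3])) (Nd n6 0 (Lf
  [Iso [0,n1,n2,n3,n6,n5,n4,n7] [n2,n4,n6,0,n3,n1,n5] c3, Bad n1 n1, Bad 0 0, Bad n1 n2, Bad 0 n2, Bad n4 n2, Iso0 [n5,n6,n2,n1,n3,n4,0] c189]) (Lf
  [Bad n1 n1, Bad 0 n6, Iso1 [n6,n5,0,n1,n2,n4,n3] c49, Iso1 [n2,n4,0,n1,n5,n6,n3] c75, Iso0 [n2,n6,0,n4,n3,n1,n5] c116, Iso1 [n2,n4,n3,0,n5,n6,n1]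
  c156, Iso0 [n2,0,n6,n4,n3,n5,n1] c190]))) (Nd n2 0 (Nd n5 n1 (Lf [Iso1 [n4,n2,0,n3,n1,n5,n6] c2, Bad n3 n6, Bad n1 n4, Bad n1 n4, Bad n1 n2, Bad n1
  n4, Bad 0 0]) (Lf [Iso [0,n1,n2,n3,n5,n6,n4,n7] [n3,n5,0,n4,n6,n2,n1] c7, Bad 0 n6, Bad 0 n3, Bad n1 n3, Bad n1 n2, Bad n1 n3, Bad n1 0])) (Lf [Iso
  [0,n1,n2,n3,n5,n6,n4,n7] [n6,0,n1,n5,n4,n3,n2] c10, Bad n3 0, Bad n1 n4, Bad n1 n2, Bad n1 n2, Bad 0 0, Bad 0 0])))))) (Nd n4 n5 (Nd n2 0 (Nd n5 0
  (Nd n14 0 (Nd n5 n1 (Nd n6 n4 (Lf [Iso [0,n1,n2,n3,n5,n6,n4,n7] [n4,n1,n6,0,n2,n3,n5] c1, Bad n3 n6, Iso1 [n3,n4,n2,n5,n6,0,n1] c44, Iso1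
  [n1,n3,0,n5,n6,n4,n2] c67, Iso0 [n3,0,n2,n6,n1,n4,n5] c105, Iso1 [n3,0,n4,n1,n6,n5,n2] c151, Bad n1 n2]) (Lf [Bad n1 n1, Iso1 [n5,0,n1,n2,n4,n6,n3]
  c23, Iso1 [0,n3,n5,n6,n1,n2,n4] c48, Iso1 [n3,n5,n2,0,n6,n1,n4] c74, Iso0 [n3,n6,0,n2,n1,n5,n4] c117, Iso1 [n2,0,n5,n6,n3,n4,n1] c155, Bad n3 n2]))
  (Nd n4 0 (Lf [Iso1 [0,n4,n3,n1,n6,n2,n5] c6, Iso1 [n2,0,n5,n6,n3,n1,n4] c25, Bad n4 n4, Iso1 [n3,n1,0,n5,n2,n4,n6] c78, Bad n4 n4, Iso1
  [n3,n1,0,n4,n5,n6,n2] c159, Bad 0 n6]) (Nd n5 n4 (Lf [Iso [0,n1,n2,n3,n6,n5,n4,n7] [n4,n1,n6,0,n2,n3,n5] c1, Iso1 [n4,n3,n6,0,n1,n2,n5] c18, Bad n3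
  n2, Bad n3 n2, Bad n3 n2, Bad n3 n3, Bad n6 n6]) (Lf [Bad n1 n1, Bad n1 n1, Bad n3 n2, Bad n3 n2, Bad n3 n2, Bad n3 n3, Iso0 [n2,n5,0,n6,n3,n4,n1]
  c192])))) (Nd n5 n1 (Nd n6 n4 (Lf [Iso [0,n1,n2,n3,n5,n6,n4,n7] [n5,0,n3,n1,n6,n2,n4] c4, Bad 0 n6, Bad 0 n3, Bad n3 n3, Bad n3 n3, Bad n1 n6, Bad
  n3 n2]) (Lf [Iso [0,n1,n2,n3,n5,n6,n4,n7] [n4,n2,0,n3,n1,n5,n6] c2, Iso1 [n3,n2,n6,0,n1,n4,n5] c15, Bad n1 n5, Bad n1 n3, Bad n1 n2, Bad n1 n3, Bad
  0 0])) (Nd n4 0 (Lf [Iso1 [n1,n4,0,n3,n2,n6,n5] c5, Bad 0 n6, Bad n3 n3, Bad n3 n3, Bad n3 n3, Bad n3 n3, Bad n6 n6]) (Nd n5 n4 (Lf [Bad n3 n2,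
  Iso1 [n6,n2,n5,n1,0,n3,n4] c19, Iso1 [0,n3,n5,n2,n6,n1,n4] c46, Iso1 [n3,n2,n5,n4,n1,0,n6] c69, Bad n6 n6, Iso1 [n3,n1,n5,n2,0,n6,n4] c153, Bad 0
  0]) (Lf [Bad n1 n1, Bad 0 n6, Iso1 [n5,n3,n4,n6,0,n1,n2] c50, Iso1 [n5,n3,n4,n6,n2,n1,0] c76, Iso0 [n5,n6,0,n1,n2,n3,n4] c118, Iso1
  [n4,n2,n1,n5,0,n3,n6] c157, Iso0 [0,n3,n4,n5,n1,n2,n6] c193]))))) (Nd n4 0 (Nd n5 n4 (Nd n6 0 (Lf [Iso [0,n1,n2,n3,n6,n4,n5,n7]
  [n1,n4,0,n3,n2,n6,n5] c5, Bad 0 n6, Bad 0 0, Iso0 [n2,n6,n5,n4,0,n3,n1] c81, Bad 0 0, Iso0 [n1,n3,0,n4,n2,n5,n6] c163, Bad n3 n3]) (Lf [Iso0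
  [n3,n5,0,n4,n6,n2,n1] c7, Iso0 [n6,0,n3,n1,n4,n5,n2] c29, Bad 0 n3, Bad n1 n3, Bad 0 n6, Bad n1 n3, Bad n1 n3])) (Nd n6 0 (Lf [Iso
  [0,n1,n2,n3,n6,n4,n5,n7] [0,n4,n3,n1,n6,n2,n5] c6, Iso0 [n3,n5,0,n2,n4,n6,n1] c30, Bad n4 n4, Bad n4 n4, Iso0 [n6,0,n3,n4,n1,n2,n5] c121, Bad n4
  n4, Iso0 [n3,0,n1,n6,n2,n4,n5] c200]) (Lf [Iso [0,n1,n2,n3,n4,n6,n5,n7] [n3,n5,0,n4,n6,n2,n1] c7, Bad 0 n6, Bad 0 n3, Bad n1 n3, Bad n1 n3, Bad n1
  n3, Bad n1 n3]))) (Nd n5 n4 (Nd n6 n1 (Lf [Iso [0,n1,n2,n3,n6,n5,n4,n7] [n5,0,n3,n1,n6,n2,n4] c4, Bad n1 n1, Bad 0 n2, Bad n1 n2, Bad 0 0, Bad n3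
  n3, Bad n3 n3]) (Lf [Bad n1 n1, Iso1 [n5,0,n2,n4,n1,n3,n6] c24, Iso1 [n4,0,n5,n6,n1,n2,n3] c51, Iso1 [n2,n4,n5,n3,0,n6,n1] c77, Bad 0 0, Iso1
  [n4,0,n6,n1,n2,n5,n3] c158, Iso0 [n6,n1,n3,n5,0,n2,n4] c194])) (Nd n6 n1 (Lf [Iso [0,n1,n2,n3,n6,n5,n4,n7] [n4,n2,0,n3,n1,n5,n6] c2, Iso1
  [n6,n1,n4,n2,n3,0,n5] c20, Bad 0 0, Bad 0 0, Bad 0 0, Bad 0 0, Bad n1 n3]) (Lf [Bad n3 n2, Iso1 [n2,n5,n3,n6,n4,n1,0] c21, Bad 0 0, Bad 0 0, Bad 0
  0, Bad 0 0, Iso0 [n3,0,n1,n6,n2,n4,n5] c180]))))) (Nd n2 n2 (Nd n5 0 (Nd n5 n1 (Nd n6 0 (Lf [Iso [0,n1,n2,n3,n5,n6,n4,n7] [0,n6,n2,n1,n3,n5,n4] c8,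
  Bad n3 0, Iso1 [n1,n5,n2,n6,n3,0,n4] c53, Iso1 [n4,n5,n3,n6,n1,0,n2] c85, Iso0 [n6,n2,n3,n4,0,n1,n5] c133, Iso1 [n4,n3,n5,n6,0,n1,n2] c166, Bad n3
  n3]) (Lf [Iso1 [n6,0,n1,n5,n4,n3,n2] c10, Iso1 [n3,0,n6,n1,n5,n2,n4] c33, Bad n1 n5, Bad n1 n3, Bad n1 n3, Bad n1 n3, Bad 0 0])) (Nd n6 0 (Lf [Iso
  [0,n1,n2,n3,n6,n5,n4,n7] [0,n6,n2,n1,n3,n5,n4] c8, Bad n3 0, Bad n3 n3, Bad n3 n3, Bad n3 n3, Bad n3 0, Iso0 [n4,n6,0,n1,n2,n3,n5] c213]) (Lf [Bad
  n4 n6, Iso1 [n4,n1,n6,n2,0,n3,n5] c35, Iso1 [n4,n6,0,n1,n3,n5,n2] c55, Iso1 [n3,n4,0,n6,n1,n2,n5] c87, Iso0 [n1,n4,0,n6,n3,n5,n2] c134, Iso1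
  [0,n3,n4,n6,n1,n2,n5] c168, Bad 0 0]))) (Nd n6 n1 (Lf [Iso [0,n1,n2,n3,n6,n4,n5,n7] [n6,0,n1,n5,n4,n3,n2] c10, Bad n3 0, Bad n1 n5, Bad n1 n2, Bad
  n1 n3, Bad n1 0, Bad n1 n3]) (Lf [Bad n4 n6, Iso0 [n3,n5,n6,n1,0,n4,n2] c38, Iso0 [n5,0,n6,n2,n1,n4,n3] c57, Iso0 [n5,n1,n6,n4,n3,n2,0] c90, Iso0
  [n5,n6,0,n4,n1,n2,n3] c135, Iso0 [n6,n4,n5,n2,n1,n3,0] c169, Iso0 [n3,n6,0,n1,n2,n4,n5] c214]))) (Nd n5 n1 (Nd n5 n2 (Nd n6 n1 (Lf [Iso
  [0,n1,n2,n3,n5,n6,n4,n7] [n1,n5,0,n3,n2,n6,n4] c11, Iso1 [n1,0,n2,n4,n3,n5,n6] c40, Bad 0 n2, Bad 0 n2, Bad 0 n2, Bad 0 n2, Bad n1 0]) (Lf [Bad n3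
  n2, Bad n5 n5, Iso1 [n2,n4,n6,0,n5,n1,n3] c59, Iso1 [n2,0,n1,n4,n3,n6,n5] c92, Iso0 [n6,0,n2,n5,n1,n3,n4] c147, Iso1 [n5,n4,0,n3,n1,n6,n2] c170,
  Iso0 [0,n1,n3,n4,n2,n5,n6] c223])) (Nd n6 n1 (Lf [Iso [0,n1,n2,n3,n6,n5,n4,n7] [n1,n5,0,n3,n2,n6,n4] c11, Iso1 [n1,0,n4,n5,n2,n3,n6] c41, Iso1
  [n6,0,n1,n4,n3,n5,n2] c61, Bad n1 n3, Bad n1 n2, Bad 0 0, Bad 0 0]) (Lf [Iso [0,n1,n2,n3,n5,n6,n4,n7] [n2,n4,n3,0,n6,n5,n1] c12, Bad n3 0, Iso1
  [n5,n3,n6,n1,n2,0,n4] c62, Iso1 [n1,0,n6,n5,n3,n4,n2] c94, Iso0 [n1,n2,n6,n4,n3,n5,0] c148, Bad n3 0, Bad n1 n2]))) (Nd n6 n2 (Lf [Bad n3 n2, Bad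
  n5 n5, Iso1 [n3,n2,0,n4,n6,n5,n1] c63, Iso1 [n2,n5,0,n3,n6,n4,n1] c95, Bad n6 n6, Bad 0 0, Bad 0 0]) (Lf [Iso [0,n1,n2,n3,n6,n5,n4,n7]
  [n2,n4,n3,0,n6,n5,n1] c12, Bad n3 0, Bad n3 n2, Bad n3 n2, Bad n3 n2, Bad n3 0, Bad n5 n5]))))) (Nd n5 0 (Nd n6 n4 (Nd n2 0 (Nd n4 n4 (Nd n5 n1 (Lf
  [Iso1 [n4,n1,n6,0,n2,n3,n5] c1, Bad n3 n6, Iso1 [n5,n3,n6,n1,n4,0,n2] c42, Iso1 [n4,n1,n3,0,n2,n6,n5] c65, Iso0 [n6,n3,n1,0,n2,n4,n5] c101, Bad n3
  n6, Bad n3 n3]) (Lf [Iso0 [n1,n4,0,n3,n2,n6,n5] c5, Bad 0 n6, Bad n3 n3, Bad n3 n3, Bad n3 n3, Bad n3 n3, Iso0 [0,n2,n5,n3,n1,n6,n4] c195])) (Nd n6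
  n1 (Lf [Iso1 [n2,n4,n6,0,n3,n1,n5] c3, Bad 0 n6, Bad 0 n3, Iso1 [n5,n4,n1,n6,n3,n2,0] c70, Iso0 [n5,n3,n1,0,n2,n4,n6] c110, Bad n1 n6, Iso0
  [n2,n1,n5,n4,n3,0,n6] c185]) (Lf [Bad n1 n1, Bad n3 n6, Iso1 [0,n1,n6,n5,n3,n4,n2] c47, Iso1 [n4,n6,n3,n1,0,n2,n5] c71, Iso0 [0,n2,n6,n4,n3,n5,n1]
  c111, Bad n3 n6, Bad n3 n3]))) (Nd n2 n2 (Lf [Iso1 [0,n6,n2,n1,n3,n5,n4] c8, Bad n3 0, Bad n6 n2, Iso1 [n4,n2,n3,n1,n6,0,n5] c83, Iso0
  [n2,n1,n3,n6,n4,n5,0] c129, Bad n3 0, Bad n3 n3]) (Nd n5 n2 (Lf [Bad n3 n2, Bad n5 n5, Bad n5 n5, Bad n5 n5, Bad n5 n5, Bad n5 n5, Bad 0 0]) (Lf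
  [Iso1 [n2,n4,n3,0,n6,n5,n1] c12, Bad n3 n6, Iso1 [n3,0,n2,n1,n5,n6,n4] c60, Iso1 [n3,n5,n2,0,n6,n1,n4] c93, Iso0 [n3,0,n2,n6,n1,n4,n5] c146, Bad n5
  n5, Bad n3 n2])))) (Nd n2 n2 (Nd n5 n1 (Lf [Iso1 [0,n3,n5,n6,n1,n4,n2] c9, Iso1 [n1,n5,n4,n3,n2,0,n6] c32, Bad n6 n3, Iso1 [n5,n3,0,n4,n6,n1,n2]
  c84, Bad n6 0, Iso1 [0,n6,n2,n4,n5,n1,n3] c165, Iso0 [0,n2,n5,n6,n1,n3,n4] c209]) (Nd n6 0 (Lf [Iso [0,n1,n2,n3,n6,n4,n5,n7] [0,n6,n2,n1,n3,n5,n4]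
  c8, Bad n3 0, Bad n3 n3, Bad n3 n3, Bad n3 n3, Bad n3 0, Iso0 [n4,n6,0,n1,n2,n3,n5] c210]) (Lf [Bad n4 n6, Iso0 [n4,n1,n6,n2,0,n3,n5] c35, Iso0
  [n4,n6,0,n1,n3,n5,n2] c55, Iso0 [n3,n4,0,n6,n1,n2,n5] c87, Iso0 [n1,n4,0,n6,n2,n3,n5] c130, Iso0 [0,n3,n4,n6,n1,n2,n5] c168, Bad 0 0]))) (Nd n2 0
  (Nd n5 n1 (Lf [Iso1 [n2,n6,n3,n1,n5,n4,0] c0, Iso1 [n1,n5,n4,n3,0,n2,n6] c13, Bad n6 n3, Iso1 [n5,n2,n3,0,n1,n6,n4] c64, Iso0 [n5,n1,0,n2,n3,n6,n4]
  c100, Iso1 [n3,n4,n5,n1,0,n6,n2] c149, Iso0 [n5,n3,n1,n6,n2,0,n4] c174]) (Lf [Iso0 [0,n4,n3,n1,n6,n2,n5] c6, Iso0 [n2,0,n5,n6,n3,n1,n4] c25, Bad n4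
  n4, Iso0 [n3,n1,0,n5,n2,n4,n6] c78, Iso0 [n5,n1,n6,0,n2,n3,n4] c119, Iso0 [n3,n1,0,n4,n5,n6,n2] c159, Iso0 [n6,n2,0,n1,n3,n5,n4] c196])) (Nd n5 n2
  (Lf [Bad n5 n5, Bad n3 0, Bad n3 n2, Bad n3 n2, Bad n3 n2, Bad n3 0, Bad n3 n3]) (Lf [Bad n5 n5, Bad n3 0, Bad n3 n3, Bad n3 n3, Bad n3 n3, Bad n3
  n3, Bad n3 n2]))))) (Nd n11 0 (Nd n2 0 (Nd n5 n1 (Nd n6 0 (Lf [Iso [0,n1,n2,n3,n6,n4,n5,n7] [n2,n6,n3,n1,n5,n4,0] c0, Iso0 [n4,n1,n3,n6,n5,0,n2]
  c16, Bad n5 n2, Bad n5 n2, Bad n5 n2, Bad n4 n2, Iso0 [n2,n6,0,n5,n4,n3,n1] c175]) (Lf [Bad n3 n2, Iso0 [n2,n6,n3,n5,0,n4,n1] c17, Iso0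
  [n2,0,n6,n4,n5,n1,n3] c45, Iso0 [n2,n4,n1,n5,0,n6,n3] c68, Iso0 [n2,n4,0,n6,n5,n3,n1] c102, Iso0 [n2,n4,n6,n1,n5,0,n3] c152, Iso0
  [n3,n1,0,n5,n2,n4,n6] c176])) (Nd n6 0 (Lf [Iso [0,n1,n2,n3,n6,n4,n5,n7] [n4,n1,n6,0,n2,n3,n5] c1, Iso0 [n4,n3,n6,0,n1,n2,n5] c18, Bad n3 n2, Bad
  n3 n2, Bad n3 n2, Bad n3 n3, Bad n6 n6]) (Lf [Bad n3 n2, Iso0 [n6,n2,n5,n1,0,n3,n4] c19, Iso0 [0,n3,n5,n2,n6,n1,n4] c46, Iso0 [n3,n2,n5,n4,n1,0,n6]
  c69, Bad n6 n6, Iso0 [n3,n1,n5,n2,0,n6,n4] c153, Iso0 [n6,0,n1,n3,n4,n5,n2] c177]))) (Nd n2 n2 (Nd n6 n1 (Lf [Iso [0,n1,n2,n3,n6,n4,n5,n7]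
  [0,n3,n5,n6,n1,n4,n2] c9, Iso0 [n4,n2,n3,n5,0,n1,n6] c36, Bad n6 n3, Iso0 [n5,n1,0,n3,n2,n6,n4] c88, Iso0 [n5,n2,n3,0,n1,n6,n4] c131, Bad n4 0,
  Iso0 [n3,n4,n5,n1,n6,0,n2] c211]) (Lf [Bad n4 n6, Iso0 [n3,n2,n6,n1,0,n4,n5] c37, Iso0 [n5,0,n6,n1,n3,n2,n4] c56, Iso0 [n2,n1,n6,n3,n4,0,n5] c89,
  Iso0 [n3,0,n6,n1,n4,n2,n5] c132, Bad 0 0, Iso0 [n6,n1,n3,n4,n5,0,n2] c212])) (Nd n6 n2 (Lf [Bad n3 n2, Bad n5 n5, Iso0 [n3,n2,0,n4,n6,n5,n1] c63,
  Iso0 [n2,n5,0,n3,n6,n4,n1] c95, Bad n6 n6, Bad 0 0, Iso0 [n6,0,n3,n5,n1,n2,n4] c222]) (Lf [Iso [0,n1,n2,n3,n6,n4,n5,n7] [n2,n4,n3,0,n6,n5,n1] c12,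
  Bad n3 0, Bad n3 n2, Bad n3 n2, Bad n3 n2, Bad n3 0, Bad n5 n5])))) (Nd n4 n4 (Nd n5 n4 (Nd n6 0 (Lf [Iso [0,n1,n2,n3,n4,n6,n5,n7]
  [n1,n4,0,n3,n2,n6,n5] c5, Iso0 [n6,0,n4,n1,n3,n2,n5] c26, Bad 0 0, Bad n3 n2, Bad 0 0, Iso0 [0,n6,n2,n5,n3,n4,n1] c160, Bad n3 n3]) (Lf [Bad n3 n2,
  Iso0 [n6,n2,n4,n1,n3,n5,0] c27, Bad 0 n3, Iso0 [n2,n6,0,n5,n4,n3,n1] c79, Bad 0 n6, Iso0 [n3,n4,n5,n1,0,n6,n2] c161, Iso0 [n6,n3,n4,n5,0,n1,n2]
  c197])) (Nd n6 0 (Lf [Iso [0,n1,n2,n3,n4,n6,n5,n7] [0,n4,n3,n1,n6,n2,n5] c6, Iso0 [n2,0,n5,n1,n3,n6,n4] c28, Bad n4 n4, Bad n5 n2, Bad n5 n2, Bad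
  n5 n2, Iso0 [n3,n2,0,n4,n1,n5,n6] c198]) (Lf [Bad n3 n2, Bad 0 n6, Bad 0 n3, Iso0 [n6,n1,n4,n5,n2,0,n3] c80, Iso0 [n2,n4,0,n5,n3,n6,n1] c120, Iso0
  [n6,n1,n3,n5,n2,0,n4] c162, Iso0 [n5,n2,n3,0,n1,n6,n4] c199]))) (Nd n5 n1 (Nd n6 0 (Lf [Iso [0,n1,n2,n3,n6,n4,n5,n7] [n2,n4,n6,0,n3,n1,n5] c3, Bad
  n1 n1, Bad 0 0, Bad n1 n2, Bad 0 0, Bad n4 n2, Iso0 [n1,n6,n4,n5,0,n3,n2] c186]) (Lf [Bad n1 n1, Bad 0 n6, Iso0 [n6,n5,0,n1,n2,n4,n3] c49, Iso0
  [n2,n4,0,n1,n5,n6,n3] c75, Iso0 [0,n3,n6,n1,n2,n4,n5] c112, Iso0 [n2,n4,n3,0,n5,n6,n1] c156, Iso0 [n6,n4,n1,n5,n2,0,n3] c187])) (Nd n6 0 (Lf [Bad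
  n1 n1, Bad n1 n1, Bad n3 n2, Bad n3 n2, Bad n3 n2, Bad n3 n3, Bad 0 n6]) (Lf [Bad n1 n1, Bad 0 n6, Iso0 [n5,n3,n4,n6,0,n1,n2] c50, Iso0
  [n5,n3,n4,n6,n2,n1,0] c76, Iso0 [n5,0,n2,n3,n4,n1,n6] c113, Iso0 [n4,n2,n1,n5,0,n3,n6] c157, Iso0 [n6,n3,n5,n1,n4,n2,0] c188]))))))))"

text \<open>A leaf names a permutation of the eight fixed vertices and the representative to which
  it leads.\<close>

definition tree1 :: "(nat list \<times> nat) dtree" where "tree1 = (Nd n1 n2 (Nd n2 n4 (Nd n4 n6 (Nd n2 n1 (Nd n2 0 (Nd n4 n1 (Nd n1 n4 (Lf
  ([n3,n7,n2,n4,n1,n6,0,n5], n7)) (Nd n4 0 (Lf ([n7,n3,n1,n2,n4,n5,n6,0], n1)) (Lf ([n1,n3,n6,n2,n7,0,n4,n5], n9)))) (Nd n6 n1 (Nd n6 n4 (Lf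
  ([n1,n3,n7,n2,0,n4,n5,n6], 0)) (Lf ([n3,n1,n6,n2,n4,n5,0,n7], n2))) (Nd n6 n4 (Lf ([n3,n1,n7,n2,0,n4,n5,n6], n2)) (Lf ([n3,n1,n7,n2,0,n5,n4,n6],
  n2))))) (Nd n5 n1 (Nd n5 n6 (Nd n5 n3 (Lf ([n1,n2,n7,n4,n6,n3,n5,0], n6)) (Lf ([n1,n2,n7,n3,0,n6,n4,n5], n1))) (Nd n6 n3 (Lf
  ([n1,n2,n5,n7,n4,n3,0,n6], n8)) (Lf ([n2,n1,n5,n3,n6,n4,0,n7], n4)))) (Nd n5 n6 (Nd n5 n3 (Lf ([n2,n1,n7,n3,0,n6,n4,n5], n3)) (Lf
  ([n2,n1,n7,n3,0,n4,n5,n6], n6))) (Nd n6 n3 (Lf ([n1,n2,n6,n3,n7,0,n5,n4], n7)) (Lf ([n2,n1,n7,n3,0,n4,n6,n5], n4)))))) (Nd n2 n7 (Nd n5 n1 (Nd n4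
  n1 (Nd n5 0 (Lf ([n7,n3,n1,n2,n4,n5,n6,0], 0)) (Lf ([n7,n3,n1,0,n5,n6,n2,n4], n5))) (Nd n5 n2 (Lf ([n1,n3,n6,0,n7,n2,n5,n4], n6)) (Lf
  ([n1,n3,n5,n7,0,n2,n4,n6], n8)))) (Nd n4 n2 (Nd n4 n1 (Lf ([n1,n3,n7,0,n6,n2,n5,n4], n4)) (Lf ([n3,n1,n7,n2,n6,0,n5,n4], n4))) (Nd n4 n5 (Lf
  ([n1,n3,n7,n2,n5,n6,0,n4], n1)) (Lf ([n1,n3,n5,0,n6,n7,n2,n4], n3))))) (Nd n5 n7 (Nd n2 0 (Nd n1 0 (Lf ([n5,n7,n6,n1,n3,n2,0,n4], n9)) (Lf
  ([n3,n1,n6,n2,0,n7,n5,n4], n6))) (Nd n4 n1 (Lf ([n5,n2,n1,n4,n6,n7,n3,0], n4)) (Lf ([n2,n1,n5,n3,0,n6,n7,n4], n2)))) (Nd n6 n1 (Nd n6 n3 (Lf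
  ([n5,n2,n1,n4,n6,n7,n3,0], n3)) (Lf ([n5,n2,n1,n3,n6,n7,n4,0], n1))) (Nd n6 n3 (Lf ([n1,n2,n5,n4,n6,n7,n3,0], n5)) (Lf ([n1,n2,n5,n3,0,n6,n7,n4],
  0))))))) (Nd n4 n2 (Nd n2 n1 (Nd n6 n2 (Nd n1 0 (Lf ([n3,n7,n1,n4,n2,n5,0,n6], n7)) (Nd n6 n4 (Lf ([n7,n3,n1,n6,n4,n5,n2,0], n4)) (Lf
  ([n7,n3,n1,n6,n5,n4,n2,0], n4)))) (Nd n4 n1 (Nd n6 n4 (Lf ([n7,n3,n1,n6,n4,n5,n2,0], n3)) (Lf ([n6,n3,n1,n7,n4,n5,n2,0], n2))) (Nd n4 0 (Lf
  ([n1,n3,n7,n6,n4,n5,n2,0], n5)) (Lf ([n1,n6,n3,0,n4,n5,n7,n2], n2))))) (Nd n2 0 (Nd n4 n5 (Nd n4 n1 (Lf ([n1,n3,n6,n7,n5,n2,n4,0], n6)) (Lf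
  ([n3,n1,n6,n2,0,n5,n7,n4], n3))) (Nd n5 n2 (Lf ([n1,n3,n5,n2,n6,0,n4,n7], n7)) (Lf ([n3,n1,n6,n2,0,n7,n5,n4], n4)))) (Nd n4 n1 (Nd n4 n5 (Lf
  ([n1,n3,n7,0,n5,n2,n6,n4], n4)) (Lf ([n1,n3,n7,n2,n4,n6,n5,0], n7))) (Nd n2 n6 (Lf ([n3,n1,n7,n2,n5,0,n6,n4], n4)) (Lf ([n2,n1,n5,n3,0,n7,n6,n4],
  n2)))))) (Nd n5 0 (Nd n2 n7 (Nd n5 n3 (Nd n6 n3 (Lf ([n4,n1,n3,n2,n5,n6,0,n7], n5)) (Lf ([n3,n1,n4,n2,n6,0,n5,n7], n6))) (Nd n5 n1 (Lf
  ([n4,n5,n6,n7,n3,n1,n2,0], n10)) (Lf ([n3,n1,n4,n2,n5,n6,0,n7], n3)))) (Nd n4 n7 (Nd n1 n4 (Lf ([n2,n6,n3,n4,n1,n7,0,n5], n7)) (Lf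
  ([n1,n3,n6,n2,0,n5,n7,n4], n1))) (Nd n5 n2 (Lf ([n1,n3,n4,n6,n7,n2,0,n5], n8)) (Lf ([n3,n1,n4,n2,n5,n7,0,n6], n4))))) (Nd n6 n5 (Nd n2 n6 (Nd n6 n3
  (Lf ([n4,n1,n3,0,n5,n6,n7,n2], 0)) (Lf ([n3,n1,n4,0,n6,n7,n2,n5], n1))) (Nd n6 0 (Lf ([n2,n1,n4,n3,n6,n7,0,n5], n2)) (Lf ([n1,n4,n2,0,n6,n7,n5,n3],
  n2)))) (Nd n5 n7 (Nd n6 0 (Lf ([n4,n2,n1,n5,n6,n7,n3,0], n2)) (Lf ([n1,n2,n4,n3,n5,0,n6,n7], n9))) (Nd n2 n6 (Lf ([n5,n6,n7,n4,n1,n3,0,n2], n10))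
  (Lf ([n5,n2,n1,n4,n7,n6,n3,0], n4)))))))) (Nd n4 n1 (Nd n2 0 (Nd n6 n3 (Nd n7 n4 (Nd n4 n3 (Nd n4 n6 (Lf ([n1,n2,n5,0,n6,n3,n7,n4], n4)) (Lf
  ([n1,n2,n5,0,n7,n3,n6,n4], n4))) (Nd n4 n6 (Lf ([n1,n2,n5,0,n6,n7,n3,n4], n3)) (Lf ([n2,n1,n4,0,n6,n7,n3,n5], n1)))) (Nd n6 n2 (Nd n5 n6 (Lf
  ([n4,n1,n2,0,n5,n6,n7,n3], 0)) (Lf ([n5,n6,n7,n4,n1,n2,0,n3], n10))) (Nd n1 n3 (Lf ([n7,n2,n1,0,n5,n6,n3,n4], n5)) (Lf ([n4,n1,n3,n2,n6,n7,0,n5],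
  n6))))) (Nd n5 n2 (Nd n4 n7 (Nd n1 n3 (Lf ([n1,n2,n7,n3,n4,n6,n5,0], n7)) (Lf ([n3,n1,n4,n2,0,n6,n7,n5], n5))) (Nd n6 n2 (Lf
  ([n4,n1,n2,n3,n5,n6,0,n7], n5)) (Lf ([n2,n1,n4,n3,n6,0,n5,n7], n6)))) (Nd n4 n5 (Nd n5 n1 (Lf ([n7,n2,n1,n3,n4,n5,n6,0], 0)) (Lf
  ([n1,n2,n7,n3,n5,n6,0,n4], n1))) (Nd n5 n1 (Lf ([n4,n5,n6,n7,n2,n1,n3,0], n10)) (Lf ([n2,n1,n4,n3,n5,n6,0,n7], n3)))))) (Nd n1 n5 (Nd n7 n1 (Nd n4
  n2 (Nd n6 n4 (Lf ([n7,n3,n2,n6,n4,n5,n1,0], n3)) (Lf ([n6,n3,n2,n7,n4,n5,n1,0], n2))) (Nd n4 0 (Lf ([n2,n3,n7,n6,n4,n5,n1,0], n5)) (Lf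
  ([n2,n6,n3,0,n4,n5,n7,n1], n2)))) (Nd n2 n1 (Nd n6 n4 (Lf ([n7,n3,n2,n6,n4,n5,n1,0], n4)) (Lf ([n7,n3,n2,n6,n5,n4,n1,0], n4))) (Nd n4 n2 (Lf
  ([n7,n3,n2,n1,n5,n6,0,n4], n6)) (Lf ([n2,n3,n7,n1,0,n5,n6,n4], n5))))) (Nd n4 n3 (Nd n4 n5 (Lf ([n1,n2,n7,n3,n5,0,n6,n4], n4)) (Nd n5 n2 (Lf
  ([n1,n2,n6,0,n4,n7,n5,n3], n7)) (Lf ([n1,n2,n7,n3,n6,0,n5,n4], n4)))) (Nd n1 0 (Nd n4 n5 (Lf ([n6,n2,n1,n3,n4,n5,0,n7], n5)) (Lf
  ([n1,n2,n5,n3,n6,0,n4,n7], n6))) (Nd n6 n1 (Lf ([n5,n2,n1,n3,n7,n4,0,n6], n6)) (Lf ([n1,n2,n5,n3,0,n7,n4,n6], n5))))))) (Nd n4 n2 (Nd n4 n6 (Nd n4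
  n5 (Nd n1 n4 (Nd n4 0 (Lf ([n7,n3,n2,n1,n4,n5,n6,0], n1)) (Lf ([n2,n3,n6,n1,n7,0,n4,n5], n9))) (Nd n5 n2 (Lf ([n7,n1,n2,n3,n4,n5,n6,0], 0)) (Lf
  ([n2,n1,n7,n3,n5,n6,0,n4], n1)))) (Nd n4 n3 (Nd n1 0 (Lf ([n2,n1,n5,0,n6,n3,n7,n4], n4)) (Lf ([n2,n1,n7,n3,n6,0,n5,n4], n4))) (Nd n6 n2 (Lf
  ([n5,n1,n2,0,n6,n7,n3,n4], n5)) (Lf ([n2,n1,n5,0,n6,n7,n3,n4], n3))))) (Nd n5 0 (Nd n1 0 (Nd n5 n2 (Lf ([n4,n5,n6,n7,n1,n2,n3,0], n10)) (Lf
  ([n1,n2,n4,n3,n5,n6,0,n7], n3))) (Lf ([n2,n1,n7,n3,n5,0,n6,n4], n4))) (Nd n5 n7 (Nd n6 n1 (Lf ([n4,n2,n1,0,n5,n6,n7,n3], 0)) (Lf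
  ([n1,n2,n4,0,n6,n7,n3,n5], n1))) (Nd n4 n3 (Lf ([n2,n1,n5,0,n7,n3,n6,n4], n4)) (Lf ([n5,n6,n7,n4,n2,n1,0,n3], n10)))))) (Nd n3 0 (Nd n5 n1 (Nd n5
  n6 (Nd n5 n3 (Lf ([n1,n2,n7,n3,0,n6,n4,n5], n3)) (Lf ([n1,n2,n7,n3,0,n4,n5,n6], n6))) (Nd n6 n3 (Lf ([n1,n2,0,n4,n5,n6,n7,n3], n7)) (Lf
  ([n1,n2,n7,n3,0,n4,n6,n5], n4)))) (Nd n5 n6 (Nd n5 n3 (Lf ([n2,n1,n7,n4,n6,n3,n5,0], n6)) (Lf ([n2,n1,n7,n3,0,n6,n4,n5], n1))) (Nd n6 n3 (Lf
  ([n1,n2,n7,n5,n3,n4,n6,0], n8)) (Lf ([n1,n2,n5,n3,n6,n4,0,n7], n4))))) (Nd n1 n4 (Nd n6 n1 (Nd n6 n4 (Lf ([n3,n2,n7,n1,0,n4,n5,n6], n2)) (Lf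
  ([n3,n2,n7,n1,0,n5,n4,n6], n2))) (Nd n6 n4 (Lf ([n2,n3,n7,n1,0,n4,n5,n6], 0)) (Lf ([n3,n2,n6,n1,n4,n5,0,n7], n2)))) (Nd n1 0 (Nd n5 n3 (Lf
  ([n2,n1,n5,0,n7,n3,n6,n4], n6)) (Lf ([n1,n2,n5,n6,n3,0,n7,n4], n8))) (Nd n5 n3 (Lf ([n1,n2,n6,0,n7,n3,n5,n4], n6)) (Lf ([n1,n2,n5,n6,0,n3,n4,n7],
  n8))))))))) (Nd n4 n6 (Nd n2 n7 (Nd n5 n2 (Nd n4 n3 (Nd n1 0 (Nd n1 n4 (Lf ([n2,n6,n3,n7,0,n1,n4,n5], n9)) (Nd n6 n3 (Lf ([n5,n1,n3,0,n6,n7,n2,n4],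
  n5)) (Lf ([n3,n1,n5,0,n6,n7,n2,n4], n3)))) (Nd n6 n2 (Nd n6 n3 (Lf ([n5,n1,n3,n4,n6,n7,n2,0], n3)) (Lf ([n3,n1,n5,n4,n6,n7,n2,0], n5))) (Nd n6 n3
  (Lf ([n5,n1,n3,n2,n6,n7,n4,0], n1)) (Lf ([n3,n1,n5,n2,0,n6,n7,n4], 0))))) (Nd n5 n1 (Nd n5 n4 (Nd n6 n2 (Lf ([n1,n3,0,n4,n5,n6,n7,n2], n7)) (Lf
  ([n1,n3,n7,n2,0,n4,n6,n5], n4))) (Nd n1 0 (Lf ([n3,n1,n5,0,n7,n2,n6,n4], n6)) (Lf ([n1,n3,n7,n2,0,n6,n4,n5], n3)))) (Nd n1 0 (Nd n1 n3 (Lf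
  ([n1,n3,n6,0,n4,n7,n5,n2], n7)) (Lf ([n2,n3,n6,n1,0,n7,n5,n4], n6))) (Nd n5 n3 (Lf ([n3,n1,n7,n4,n6,n2,n5,0], n6)) (Lf ([n1,n3,n7,n6,n2,n4,n5,0],
  n8)))))) (Nd n1 n5 (Nd n4 n7 (Nd n6 n1 (Nd n6 n4 (Lf ([n2,n3,n7,n1,0,n4,n5,n6], n2)) (Lf ([n2,n3,n7,n1,0,n5,n4,n6], n2))) (Nd n6 n4 (Lf
  ([n3,n2,n7,n1,0,n4,n5,n6], 0)) (Lf ([n2,n3,n6,n1,n4,n5,0,n7], n2)))) (Nd n1 0 (Nd n1 n3 (Lf ([n7,n2,n3,n1,n4,n5,n6,0], n1)) (Lf
  ([n2,n3,n6,n5,n1,n7,n4,0], n8))) (Nd n4 n1 (Lf ([n1,n3,n5,n2,0,n6,n7,n4], n2)) (Lf ([n5,n1,n3,n4,n6,n7,n2,0], n4))))) (Nd n4 n7 (Nd n1 0 (Nd n4 n1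
  (Lf ([n1,n3,n5,n2,n6,0,n4,n7], n6)) (Lf ([n1,n3,n5,n7,n2,0,n6,n4], n8))) (Nd n5 n1 (Lf ([n1,n3,n7,n2,0,n4,n5,n6], n6)) (Nd n5 n4 (Lf
  ([n3,n1,n7,n2,0,n6,n4,n5], n1)) (Lf ([n1,n3,n5,n2,n6,n4,0,n7], n4))))) (Nd n4 n2 (Nd n4 n1 (Lf ([n1,n3,n7,n2,n6,0,n5,n4], n4)) (Lf
  ([n3,n1,n5,0,n6,n2,n7,n4], n4))) (Nd n5 n3 (Lf ([n7,n1,n3,n2,n4,n5,n6,0], 0)) (Lf ([n3,n1,n7,n2,n5,n6,0,n4], n1))))))) (Nd n3 0 (Nd n1 n6 (Nd n6 n1
  (Nd n4 n5 (Nd n4 n2 (Lf ([n7,n3,n2,0,n5,n6,n1,n4], n5)) (Lf ([n2,n3,n6,0,n7,n1,n5,n4], n6))) (Nd n4 n1 (Lf ([n2,n3,n7,0,n6,n1,n5,n4], n4)) (Lf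
  ([n2,n3,n5,0,n6,n7,n1,n4], n3)))) (Nd n4 n2 (Nd n5 n2 (Lf ([n7,n3,n2,n1,n4,n5,n6,0], 0)) (Lf ([n2,n3,n7,n1,n5,n6,0,n4], n1))) (Nd n4 n1 (Lf
  ([n3,n2,n7,n1,n6,0,n5,n4], n4)) (Lf ([n2,n3,n6,n7,0,n1,n4,n5], n8))))) (Nd n5 n3 (Nd n6 n2 (Nd n6 n3 (Lf ([n5,n1,n2,n4,n6,n7,n3,0], n3)) (Lf
  ([n5,n1,n2,n3,n6,n7,n4,0], n1))) (Nd n6 n3 (Lf ([n2,n1,n5,n4,n6,n7,n3,0], n5)) (Lf ([n2,n1,n5,n3,0,n6,n7,n4], 0)))) (Nd n1 0 (Lf
  ([n5,n6,n7,n1,n2,n3,0,n4], n9)) (Nd n4 n1 (Lf ([n1,n2,n5,n3,0,n6,n7,n4], n2)) (Lf ([n5,n1,n2,n4,n6,n7,n3,0], n4)))))) (Nd n4 n1 (Nd n5 n4 (Nd n1 0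
  (Nd n1 n3 (Lf ([n3,n2,n6,n1,0,n5,n7,n4], n5)) (Lf ([n3,n2,n6,n1,0,n7,n5,n4], n6))) (Nd n4 n2 (Lf ([n2,n3,n7,n1,n6,0,n5,n4], n4)) (Lf
  ([n3,n2,n7,0,n6,n1,n5,n4], n4)))) (Nd n1 n3 (Nd n5 n1 (Lf ([n7,n3,n1,n2,n6,n4,0,n5], n6)) (Lf ([n1,n3,n7,n2,0,n6,n4,n5], n5))) (Nd n1 0 (Lf
  ([n2,n3,n5,n6,n7,n1,0,n4], n8)) (Lf ([n2,n3,n6,0,n4,n7,n5,n1], n7))))) (Nd n4 n5 (Nd n4 n3 (Nd n5 n3 (Lf ([n7,n2,n3,n1,n4,n5,n6,0], 0)) (Lf
  ([n3,n2,n7,n1,n5,n6,0,n4], n1))) (Nd n5 n2 (Lf ([n3,n2,n5,0,n7,n1,n6,n4], n6)) (Lf ([n2,n3,n6,n7,n1,0,n5,n4], n8)))) (Nd n4 n2 (Nd n1 n6 (Lf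
  ([n2,n3,n5,n1,n6,0,n4,n7], n6)) (Lf ([n1,n5,n2,n4,n3,n6,0,n7], n7))) (Nd n6 n3 (Lf ([n5,n2,n3,0,n6,n7,n1,n4], n5)) (Lf ([n3,n2,n5,0,n6,n7,n1,n4],
  n3)))))))) (Nd n1 n6 (Nd n2 n1 (Nd n6 n1 (Nd n1 0 (Nd n4 n1 (Nd n4 n2 (Lf ([n2,n3,n6,n7,n5,n1,n4,0], n6)) (Lf ([n2,n3,n5,n1,n6,0,n4,n7], n7))) (Nd
  n4 n5 (Lf ([n2,n3,n6,n1,0,n5,n7,n4], n1)) (Lf ([n3,n2,n4,n1,n5,n7,0,n6], n4)))) (Nd n6 n3 (Nd n5 n6 (Lf ([n4,n2,n3,0,n5,n6,n7,n1], 0)) (Lf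
  ([n5,n6,n7,n4,n2,n3,0,n1], n10))) (Nd n4 n1 (Lf ([n2,n3,n7,0,n5,n1,n6,n4], n4)) (Lf ([n3,n2,n4,0,n6,n7,n1,n5], n1))))) (Nd n4 n1 (Nd n1 0 (Nd n4 n5
  (Lf ([n3,n2,n6,n1,0,n5,n7,n4], n3)) (Lf ([n3,n2,n6,n1,0,n7,n5,n4], n4))) (Nd n4 n2 (Lf ([n2,n3,n7,n1,n4,n6,n5,0], n7)) (Lf
  ([n3,n2,n7,n1,n5,0,n6,n4], n4)))) (Nd n5 n3 (Nd n6 n3 (Lf ([n4,n2,n3,n1,n5,n6,0,n7], n5)) (Lf ([n3,n2,n4,n1,n6,0,n5,n7], n6))) (Nd n5 n2 (Lf
  ([n4,n5,n6,n7,n3,n2,n1,0], n10)) (Lf ([n3,n2,n4,n1,n5,n6,0,n7], n3)))))) (Nd n1 0 (Nd n4 n2 (Nd n4 n5 (Lf ([n2,n3,n6,n1,0,n5,n7,n4], n3)) (Nd n5 n1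
  (Lf ([n2,n3,0,n7,n4,n5,n6,n1], n7)) (Lf ([n2,n3,n6,n1,0,n7,n5,n4], n4)))) (Nd n4 n1 (Lf ([n3,n2,n6,n7,n5,n1,n4,0], n6)) (Nd n4 n5 (Lf
  ([n3,n2,n6,n1,0,n5,n7,n4], n1)) (Lf ([n2,n3,n4,n1,n5,n7,0,n6], n4))))) (Nd n5 0 (Nd n4 n2 (Nd n4 n1 (Lf ([n2,n3,n7,n1,n5,0,n6,n4], n4)) (Lf
  ([n6,n3,n2,n1,n4,n5,0,n7], n5))) (Nd n5 n3 (Lf ([n4,n5,n6,n7,n2,n3,n1,0], n10)) (Lf ([n2,n3,n4,n1,n5,n6,0,n7], n3)))) (Nd n6 n2 (Nd n5 n6 (Lf
  ([n4,n3,n2,0,n5,n6,n7,n1], 0)) (Lf ([n5,n6,n7,n4,n3,n2,0,n1], n10))) (Nd n4 n1 (Lf ([n3,n2,n7,0,n5,n1,n6,n4], n4)) (Lf ([n2,n3,n4,0,n6,n7,n1,n5],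
  n1))))))) (Nd n1 0 (Nd n1 n4 (Nd n5 n7 (Nd n2 n7 (Nd n4 0 (Lf ([n3,n2,n7,n6,n4,n5,n1,0], n5)) (Lf ([n3,n6,n2,0,n4,n5,n7,n1], n2))) (Nd n2 n1 (Lf
  ([n6,n2,n3,n1,n5,n7,0,n4], n6)) (Lf ([n2,n6,n1,n4,n3,n5,0,n7], n7)))) (Nd n6 n1 (Nd n6 n4 (Lf ([n7,n2,n3,n6,n4,n5,n1,0], n4)) (Lf
  ([n7,n2,n3,n6,n5,n4,n1,0], n4))) (Nd n6 n4 (Lf ([n7,n2,n3,n6,n4,n5,n1,0], n3)) (Lf ([n6,n2,n3,n7,n4,n5,n1,0], n2))))) (Nd n5 0 (Nd n4 n1 (Nd n4 n2
  (Lf ([n1,n3,n7,n2,n5,0,n6,n4], n4)) (Lf ([n6,n3,n1,n2,n4,n5,0,n7], n5))) (Nd n5 n3 (Lf ([n4,n5,n6,n7,n1,n3,n2,0], n10)) (Lf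
  ([n1,n3,n4,n2,n5,n6,0,n7], n3)))) (Nd n5 n7 (Nd n6 n1 (Lf ([n4,n3,n1,0,n5,n6,n7,n2], 0)) (Lf ([n1,n3,n4,0,n6,n7,n2,n5], n1))) (Nd n4 n2 (Lf
  ([n3,n1,n5,0,n7,n2,n6,n4], n4)) (Lf ([n5,n6,n7,n4,n3,n1,0,n2], n10)))))) (Nd n2 n6 (Nd n4 n2 (Nd n2 0 (Nd n4 n1 (Lf ([n1,n3,n5,n2,0,n7,n6,n4], n2))
  (Lf ([n5,n1,n3,n4,n7,n6,n2,0], n4))) (Lf ([n1,n5,n3,n4,n2,n7,0,n6], n7))) (Nd n6 0 (Nd n6 n2 (Lf ([n4,n1,n3,n5,n6,n7,n2,0], n2)) (Lf
  ([n1,n3,n4,n2,n6,n7,0,n5], n2))) (Nd n6 n2 (Lf ([n3,n4,n1,0,n6,n7,n5,n2], n2)) (Lf ([n1,n4,n3,n5,0,n2,n6,n7], n9))))) (Nd n5 n3 (Nd n6 0 (Nd n6 n2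
  (Lf ([n4,n1,n2,n5,n6,n7,n3,0], n2)) (Lf ([n1,n2,n4,n3,n6,n7,0,n5], n2))) (Nd n6 n2 (Lf ([n1,n4,n2,n5,0,n3,n6,n7], n9)) (Lf
  ([n2,n4,n1,0,n6,n7,n5,n3], n2)))) (Nd n1 n3 (Nd n6 n2 (Lf ([n4,n1,n2,n3,n7,n5,0,n6], n6)) (Lf ([n2,n1,n4,n3,0,n7,n5,n6], n5))) (Nd n4 n1 (Lf
  ([n1,n2,n5,n3,0,n7,n6,n4], n2)) (Lf ([n5,n1,n2,n4,n7,n6,n3,0], n4))))))))))"

section \<open>The list functions as operations on matrices\<close>

lemma dot_map: "dot (map f xs) (map g xs) = (\<Sum>x\<leftarrow>xs. of_bool (f x \<and> g x))"
proof (induction xs)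
  case (Cons x xs)
  then show ?case by (cases "f x"; cases "g x") auto
qed simp

lemma sum_upt: "(\<Sum>x\<leftarrow>[0..<n]. f x) = (\<Sum>x<n. f x)" for f :: "nat \<Rightarrow> 'a :: comm_monoid_add"
  by (induction n) (auto simp: add.commute)

lemma dot_upt: "dot (map f [0..<n]) (map g [0..<n]) = (\<Sum>x<n. of_bool (f x \<and> g x))"
  by (simp add: dot_map sum_upt)

lemma dot_is_iff: "dot_is xs ys n \<longleftrightarrow> dot xs ys = n"
  by (induction xs ys n rule: dot_is.induct) auto

lemma eql_iff: "eql xs ys \<longleftrightarrow> xs = ys"
  by (induction xs ys rule: eql.induct) auto

lemma eqm_iff: "eqm xs ys \<longleftrightarrow> xs = ys"
  by (induction xs ys rule: eqm.induct) (auto simp: eql_iff)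

lemma eqn_iff: "eqn m n \<longleftrightarrow> m = n"
  by (induction m n rule: eqn.induct) auto

lemma eqnum_iff: "eqnum m n \<longleftrightarrow> m = n"
  by (induction m n rule: eqnum.induct) auto

lemma memn_iff: "memn n ms \<longleftrightarrow> n \<in> set ms"
  by (induction ms) (auto simp: eqn_iff)

lemma isperm_iff: "isperm n ps \<longleftrightarrow> {..<n} \<subseteq> set ps"
  by (induction n) (auto simp: memn_iff lessThan_Suc)

lemma all_in_iff: "all_in f xs \<longleftrightarrow> (\<forall>x\<in>set xs. f x)"
  by (induction xs) auto

lemma sing_map: "sing (map f xs) = map (\<lambda>x. [f x]) xs"
  by (induction xs) auto

lemma consz_map: "consz (map f xs) (map g xs) = map (\<lambda>x. f x # g x) xs"
  by (induction xs) auto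

lemma transposed_map: "xs \<noteq> [] \<Longrightarrow> transposed (map (\<lambda>i. map (f i) ys) xs) = map (\<lambda>j. map (\<lambda>i. f i j) xs) ys"
proof (induction xs rule: induct_list012)
  case (3 x y zs)
  then show ?case by (simp add: consz_map)
qed (auto simp: sing_map)

lemma pick_map: "pick qs X = map ((!) X) qs"
  by (induction qs) auto

lemma relab_map: "relab ps qs X = map (\<lambda>p. map ((!) (X ! p)) qs) ps"
  by (induction ps) (auto simp: pick_map)

lemma weight_map: "weight (map f xs) = (\<Sum>x\<leftarrow>xs. of_bool (f x))"
  by (induction xs) auto

lemma weight_upt: "weight (map f [0..<n]) = (\<Sum>x<n. of_bool (f x))"
  by (simp add: weight_map sum_upt)

lemma filt_filter: "filt f xs = filter f xs"
  by (induction xs) auto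

lemma set_wds: "set (bool_lists n) = {xs. length xs = n}"
proof (induction n)
  case (Suc n)
  have "xs \<in> Cons False ` {xs. length xs = n} \<union> Cons True ` {xs. length xs = n}" if "length xs = Suc n" for xs
    using that by (cases xs; cases "hd xs") auto
  then show ?case using Suc by auto
qed auto

definition bmat :: "nat \<Rightarrow> nat \<Rightarrow> (nat \<Rightarrow> nat \<Rightarrow> 'a) \<Rightarrow> 'a list list" where
  "bmat m n f = map (\<lambda>i. map (f i) [0..<n]) [0..<m]"

lemma length_bmat [simp]: "length (bmat m n f) = m"
  by (simp add: bmat_def)

lemma nth_bmat [simp]: "i < m \<Longrightarrow> bmat m n f ! i = map (f i) [0..<n]"
  by (simp add: bmat_def)

lemma transposed_bmat: "m > 0 \<Longrightarrow> transposed (bmat m n f) = bmat n m (\<lambda>i j. f j i)"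
  unfolding bmat_def by (subst transposed_map) auto

lemma bmat_cong: "(\<And>i j. i < m \<Longrightarrow> j < n \<Longrightarrow> f i j = g i j) \<Longrightarrow> bmat m n f = bmat m n g"
  by (auto simp: bmat_def)

lemma bmat_eq_iff: "bmat m n f = bmat m n g \<longleftrightarrow> (\<forall>i<m. \<forall>j<n. f i j = g i j)"
  by (auto simp: bmat_def list_eq_iff_nth_eq)

lemma relab_bmat:
  assumes "set ps \<subseteq> {..<m}" "set qs \<subseteq> {..<n}" "length ps = m" "length qs = n"
  shows "relab ps qs (bmat m n f) = bmat m n (\<lambda>i j. f (ps ! i) (qs ! j))"
  using assms by (auto simp: relab_map list_eq_iff_nth_eq bmat_def subset_iff)

lemma bmat_nth: "length X = m \<Longrightarrow> (\<And>i. i < m \<Longrightarrow> length (X ! i) = n) \<Longrightarrow> bmat m n (\<lambda>i j. X ! i ! j) = X"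
  by (auto simp: list_eq_iff_nth_eq bmat_def)

subsection \<open>Adjacency matrices with an involution\<close>

definition swap_orbits :: "nat \<Rightarrow> nat" where
  "swap_orbits x = (if x < 8 then x else if x < 15 then x + 7 else if x < 22 then x - 7 else x)"

text \<open>Since \<open>lam + 1 = mu = 4\<close>, arcs and non-arcs satisfy the same equation off
  the diagonal; the value 6 on the diagonal is \<open>t\<close>.\<close>

definition nice :: "(nat \<Rightarrow> nat \<Rightarrow> bool) \<Rightarrow> bool" where
  "nice a \<longleftrightarrow> (\<forall>x<22. \<not> a x x) \<and> (\<forall>x<22. \<forall>y<22. a (swap_orbits x) (swap_orbits y) = a x y) \<and>
     (\<forall>x<22. (\<Sum>z<22. of_bool (a x z)) = (9::nat)) \<and> (\<forall>x<22. (\<Sum>z<22. of_bool (a z x)) = (9::nat)) \<and>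
     (\<forall>x<22. \<forall>y<22. (\<Sum>z<22. of_bool (a x z \<and> a z y)) + of_bool (a x y) = (if x = y then 6 else 4 :: nat))"

lemma nice_comp:
  assumes "nice a" "p permutes {..<22}" "\<And>x. x < 22 \<Longrightarrow> p (swap_orbits x) = swap_orbits (p x)"
  shows "nice (\<lambda>x y. a (p x) (p y))"
proof -
  have l: "p x < 22 \<longleftrightarrow> x < 22" for x
    using permutes_in_image[OF assms(2), of x] by simp
  have i: "p x = p y \<longleftrightarrow> x = y" for x y
    using permutes_inj[OF assms(2)] by (auto dest: injD)
  have s: "(\<Sum>z<22. f (p z)) = (\<Sum>z<22. f z)" for f :: "nat \<Rightarrow> nat"
    using sum.permute[OF assms(2), of f] by (simp add: comp_def)
  show ?thesis
    using assms(1,3) unfolding nice_def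
    by (simp add: l i s[of "\<lambda>z. of_bool (a _ z)"] s[of "\<lambda>z. of_bool (a z _)"]
      s[of "\<lambda>z. of_bool (a _ z \<and> a z _)"])
qed

definition reach :: "(nat \<Rightarrow> nat \<Rightarrow> bool) \<Rightarrow> (nat \<Rightarrow> nat \<Rightarrow> bool) \<Rightarrow> bool" where
  "reach a b \<longleftrightarrow> nice b \<and> (\<exists>p. p permutes {..<22} \<and> b = (\<lambda>x y. a (p x) (p y)))"

lemma reach_trans:
  assumes "reach a b" "reach b c" shows "reach a c"
proof -
  obtain p q where "p permutes {..<22}" "q permutes {..<22}"
    "b = (\<lambda>x y. a (p x) (p y))" "c = (\<lambda>x y. b (q x) (q y))" "nice c"
    using assms unfolding reach_def by auto
  then show ?thesis
    unfolding reach_def by (intro conjI exI[of _ "p \<circ> q"]) (auto intro: permutes_compose)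
qed

lemma reach_nice: "reach a b \<Longrightarrow> nice b" by (simp add: reach_def)

lemma reach_refl: "nice a \<Longrightarrow> reach a a"
  unfolding reach_def by (auto intro!: exI[of _ id])

text \<open>The permutations that commute with \<open>swap_orbits\<close> and map the fixed vertices to themselves.\<close>

definition lift :: "(nat \<Rightarrow> nat) \<Rightarrow> (nat \<Rightarrow> nat) \<Rightarrow> (nat \<Rightarrow> bool) \<Rightarrow> nat \<Rightarrow> nat" where
  "lift p r e x = (if x < 8 then p x else if x < 15 then (if e (x - 8) then 15 else 8) + r (x - 8)
     else if x < 22 then (if e (x - 15) then 8 else 15) + r (x - 15) else x)"

lemma lift_swp:
  assumes "p permutes {..<8}" "r permutes {..<7}" "x < 22"
  shows "lift p r e (swap_orbits x) = swap_orbits (lift p r e x)" "lift p r e x < 22"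
proof -
  have P: "p x < 8" if "x < 8" for x using permutes_in_image[OF assms(1), of x] that by simp
  have R: "r x < 7" if "x < 7" for x using permutes_in_image[OF assms(2), of x] that by simp
  consider "x < 8" | "8 \<le> x" "x < 15" | "15 \<le> x" using assms(3) by linarith
  then have "lift p r e (swap_orbits x) = swap_orbits (lift p r e x) \<and> lift p r e x < 22"
  proof cases
    case 1 then show ?thesis using P[of x] by (simp add: lift_def swap_orbits_def)
  next
    case 2
    then have "r (x - 8) < 7" by (intro R) auto
    with 2 show ?thesis by (auto simp: lift_def swap_orbits_def)
  next
    case 3
    then have "r (x - 15) < 7" using assms(3) by (intro R) auto
    with 3 assms(3) show ?thesis by (auto simp: lift_def swap_orbits_def)
  qed
  then show "lift p r e (swap_orbits x) = swap_orbits (lift p r e x)" "lift p r e x < 22" by auto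
qed

lemma lift_permutes:
  assumes "p permutes {..<8}" "r permutes {..<7}"
  shows "lift p r e permutes {..<22}"
proof -
  have P: "p x < 8" if "x < 8" for x using permutes_in_image[OF assms(1), of x] that by simp
  have R: "r x < 7" if "x < 7" for x using permutes_in_image[OF assms(2), of x] that by simp
  have Pi: "p x = p y \<longleftrightarrow> x = y" for x y using permutes_inj[OF assms(1)] by (auto dest: injD)
  have Ri: "r x = r y \<longleftrightarrow> x = y" for x y using permutes_inj[OF assms(2)] by (auto dest: injD)
  have inj: "inj_on (lift p r e) {..<22}"
  proof (rule inj_onI)
    fix x y assume xy: "x \<in> {..<22}" "y \<in> {..<22}" and eq: "lift p r e x = lift p r e y"
    have R1: "r (z - 8) < 7" if "\<not> z < 8" "z < 15" for z using that by (intro R) auto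
    have R2: "r (z - 15) < 7" if "\<not> z < 15" "z < 22" for z using that by (intro R) auto
    show "x = y"
      using eq xy P[of x] P[of y] R1[of x] R1[of y] R2[of x] R2[of y] Pi[of x y] Ri[of "x - 8" "y - 8"]
        Ri[of "x - 8" "y - 15"] Ri[of "x - 15" "y - 8"] Ri[of "x - 15" "y - 15"]
      unfolding lift_def lessThan_iff by (auto split: if_split_asm)
  qed
  have "lift p r e ` {..<22} \<subseteq> {..<22}"
    using lift_swp(2)[OF assms] by auto
  then have "bij_betw (lift p r e) {..<22} {..<22}"
    using inj by (simp add: bij_betw_def endo_inj_surj)
  then show ?thesis
    by (rule bij_imp_permutes) (auto simp: lift_def)
qed

lemma reach_lift:
  assumes "nice a" "p permutes {..<8}" "r permutes {..<7}"
  shows "reach a (\<lambda>x y. a (lift p r e x) (lift p r e y))"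
  unfolding reach_def
  using nice_comp[OF assms(1) lift_permutes[OF assms(2,3)] lift_swp(1)[OF assms(2,3)]] lift_permutes[OF assms(2,3)]
  by blast

text \<open>Counts stay sums of truth values instead of becoming cardinalities, so that they can be
  split, reindexed and exchanged.\<close>

declare sum_of_bool_eq [simp del]

lemma sum_22: "(\<Sum>z<22. f z) = (\<Sum>z<8. f z) + (\<Sum>z<7. f (8 + z)) + (\<Sum>z<7. f (15 + z))"
  for f :: "nat \<Rightarrow> nat"
  by (simp add: eval_nat_numeral)

lemma swap_orbits_simps: "i < 8 \<Longrightarrow> swap_orbits i = i" "l < 7 \<Longrightarrow> swap_orbits (8 + l) = 15 + l" "l < 7 \<Longrightarrow> swap_orbits (15 + l) = 8 + l"
  by (auto simp: swap_orbits_def)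

lemma nice_blocks:
  assumes "nice a"
  shows "i < 8 \<Longrightarrow> j < 7 \<Longrightarrow> a i (15 + j) = a i (8 + j)"
    "l < 7 \<Longrightarrow> j < 8 \<Longrightarrow> a (15 + l) j = a (8 + l) j"
    "l < 7 \<Longrightarrow> j < 7 \<Longrightarrow> a (15 + l) (15 + j) = a (8 + l) (8 + j)"
    "l < 7 \<Longrightarrow> j < 7 \<Longrightarrow> a (15 + l) (8 + j) = a (8 + l) (15 + j)"
proof -
  have s: "a (swap_orbits x) (swap_orbits y) = a x y" if "x < 22" "y < 22" for x y
    using assms that unfolding nice_def by blast
  show "i < 8 \<Longrightarrow> j < 7 \<Longrightarrow> a i (15 + j) = a i (8 + j)" using s[of i "8 + j"] by (simp add: swap_orbits_simps)
  show "l < 7 \<Longrightarrow> j < 8 \<Longrightarrow> a (15 + l) j = a (8 + l) j" using s[of "8 + l" j] by (simp add: swap_orbits_simps)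
  show "l < 7 \<Longrightarrow> j < 7 \<Longrightarrow> a (15 + l) (15 + j) = a (8 + l) (8 + j)" using s[of "8 + l" "8 + j"] by (simp add: swap_orbits_simps)
  show "l < 7 \<Longrightarrow> j < 7 \<Longrightarrow> a (15 + l) (8 + j) = a (8 + l) (15 + j)" using s[of "8 + l" "15 + j"] by (simp add: swap_orbits_simps)
qed

lemma nice_sq: "nice a \<Longrightarrow> x < 22 \<Longrightarrow> y < 22 \<Longrightarrow>
    (\<Sum>z<22. of_bool (a x z \<and> a z y)) + of_bool (a x y) = (if x = y then 6 else 4 :: nat)"
  by (simp add: nice_def)

text \<open>The equation \<open>M\<^sup>2 + 2 N K + M = 4 J + 2 I\<close>: paths through the two
  vertices of an orbit are exchanged by the involution, hence the factor two.\<close>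

lemma nice_FF:
  assumes "nice a" "i < 8" "j < 8"
  shows "(\<Sum>k<8. of_bool (a i k \<and> a k j)) + 2 * (\<Sum>l<7. of_bool (a i (8 + l) \<and> a (8 + l) j)) + of_bool (a i j)
    = (if i = j then 6 else 4 :: nat)"
proof -
  have "(\<Sum>l<7. of_bool (a i (15 + l) \<and> a (15 + l) j)) = (\<Sum>l<7. of_bool (a i (8 + l) \<and> a (8 + l) j) :: nat)"
    by (intro sum.cong refl) (use nice_blocks[OF assms(1)] assms in simp)
  with nice_sq[OF assms(1), of i j] assms(2,3) show ?thesis by (simp add: sum_22)
qed

lemma nice_FO:
  assumes "nice a" "i < 8" "j < 7"
  shows "(\<Sum>k<8. of_bool (a i k \<and> a k (8 + j))) + (\<Sum>l<7. of_bool (a i (8 + l) \<and> a (8 + l) (8 + j)))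
    + (\<Sum>l<7. of_bool (a i (8 + l) \<and> a (8 + l) (15 + j))) + of_bool (a i (8 + j)) = (4 :: nat)"
proof -
  have "(\<Sum>l<7. of_bool (a i (15 + l) \<and> a (15 + l) (8 + j)))
      = (\<Sum>l<7. of_bool (a i (8 + l) \<and> a (8 + l) (15 + j)) :: nat)"
    by (intro sum.cong refl) (use nice_blocks[OF assms(1)] assms in simp)
  with nice_sq[OF assms(1), of i "8 + j"] assms(2,3) show ?thesis by (simp add: sum_22)
qed

text \<open>The entries at \<open>(8 + l, 8 + j)\<close> and \<open>(8 + l, 15 + j)\<close> are
  compared. Paths through fixed vertices contribute equally to both and cancel, and what remains is
  \<open>B\<^sup>2 + B = 2 I\<close> for \<open>B = P - Q\<close>, written without
  subtraction.\<close>

lemma nice_OO: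
  assumes "nice a" "l < 7" "j < 7"
  shows "(\<Sum>x<7. of_bool (a (8 + l) (8 + x) \<and> a (8 + x) (8 + j))) + (\<Sum>x<7. of_bool (a (8 + l) (15 + x) \<and> a (8 + x) (15 + j)))
      + of_bool (a (8 + l) (8 + j))
    = (\<Sum>x<7. of_bool (a (8 + l) (8 + x) \<and> a (8 + x) (15 + j))) + (\<Sum>x<7. of_bool (a (8 + l) (15 + x) \<and> a (8 + x) (8 + j)))
      + of_bool (a (8 + l) (15 + j)) + (if l = j then 2 else 0 :: nat)"
proof -
  have 1: "(\<Sum>x<7. of_bool (a (8 + l) (15 + x) \<and> a (15 + x) (8 + j)))
      = (\<Sum>x<7. of_bool (a (8 + l) (15 + x) \<and> a (8 + x) (15 + j)) :: nat)"
    by (intro sum.cong refl) (use nice_blocks[OF assms(1)] assms in simp)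
  have 2: "(\<Sum>x<7. of_bool (a (8 + l) (15 + x) \<and> a (15 + x) (15 + j)))
      = (\<Sum>x<7. of_bool (a (8 + l) (15 + x) \<and> a (8 + x) (8 + j)) :: nat)"
    by (intro sum.cong refl) (use nice_blocks[OF assms(1)] assms in simp)
  have 3: "(\<Sum>x<8. of_bool (a (8 + l) x \<and> a x (15 + j))) = (\<Sum>x<8. of_bool (a (8 + l) x \<and> a x (8 + j)) :: nat)"
    by (intro sum.cong refl) (use nice_blocks[OF assms(1)] assms in simp)
  have e1: "(\<Sum>x<8. of_bool (a (8 + l) x \<and> a x (8 + j))) + (\<Sum>x<7. of_bool (a (8 + l) (8 + x) \<and> a (8 + x) (8 + j)))
      + (\<Sum>x<7. of_bool (a (8 + l) (15 + x) \<and> a (8 + x) (15 + j))) + of_bool (a (8 + l) (8 + j)) = (if l = j then 6 else 4 :: nat)"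
    using nice_sq[OF assms(1), of "8 + l" "8 + j"] assms(2,3) unfolding sum_22 1 by simp
  have e2: "(\<Sum>x<8. of_bool (a (8 + l) x \<and> a x (8 + j))) + (\<Sum>x<7. of_bool (a (8 + l) (8 + x) \<and> a (8 + x) (15 + j)))
      + (\<Sum>x<7. of_bool (a (8 + l) (15 + x) \<and> a (8 + x) (8 + j))) + of_bool (a (8 + l) (15 + j)) = (4 :: nat)"
    using nice_sq[OF assms(1), of "8 + l" "15 + j"] assms(2,3) unfolding sum_22 2 3 by simp
  have "(if l = j then 6 else 4 :: nat) = 4 + (if l = j then 2 else 0)" by simp
  with e1 e2 show ?thesis by linarith
qed

lemma nice_row:
  assumes "nice a" "i < 8"
  shows "(\<Sum>k<8. of_bool (a i k)) + 2 * (\<Sum>l<7. of_bool (a i (8 + l))) = (9 :: nat)"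
proof -
  have "(\<Sum>l<7. of_bool (a i (15 + l))) = (\<Sum>l<7. of_bool (a i (8 + l)) :: nat)"
    by (intro sum.cong refl) (use nice_blocks[OF assms(1)] assms in simp)
  moreover have "(\<Sum>z<22. of_bool (a i z)) = (9 :: nat)" using assms unfolding nice_def by simp
  ultimately show ?thesis by (simp add: sum_22)
qed

lemma nice_col:
  assumes "nice a" "i < 8"
  shows "(\<Sum>k<8. of_bool (a k i)) + 2 * (\<Sum>l<7. of_bool (a (8 + l) i)) = (9 :: nat)"
proof -
  have "(\<Sum>l<7. of_bool (a (15 + l) i)) = (\<Sum>l<7. of_bool (a (8 + l) i) :: nat)"
    by (intro sum.cong refl) (use nice_blocks[OF assms(1)] assms in simp)
  moreover have "(\<Sum>z<22. of_bool (a z i)) = (9 :: nat)" using assms unfolding nice_def by simp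
  ultimately show ?thesis by (simp add: sum_22)
qed

lemma nice_colO:
  assumes "nice a" "j < 7"
  shows "(\<Sum>k<8. of_bool (a k (8 + j))) + (\<Sum>l<7. of_bool (a (8 + l) (8 + j))) + (\<Sum>l<7. of_bool (a (8 + l) (15 + j))) = (9 :: nat)"
proof -
  have "(\<Sum>l<7. of_bool (a (15 + l) (8 + j))) = (\<Sum>l<7. of_bool (a (8 + l) (15 + j)) :: nat)"
    by (intro sum.cong refl) (use nice_blocks[OF assms(1)] assms in simp)
  moreover have "(\<Sum>z<22. of_bool (a z (8 + j))) = (9 :: nat)" using assms unfolding nice_def by simp
  ultimately show ?thesis by (simp add: sum_22)
qed

lemma nice_diag: "nice a \<Longrightarrow> x < 22 \<Longrightarrow> \<not> a x x"
  by (simp add: nice_def)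

subsection \<open>Sorting by relabelling\<close>

lemma sorting_permutation:
  fixes key :: "nat \<Rightarrow> 'k :: linorder"
  obtains p where "p permutes {l..<h}" "\<And>i j. l \<le> i \<Longrightarrow> i \<le> j \<Longrightarrow> j < h \<Longrightarrow> key (p i) \<le> key (p j)"
proof -
  define xs where "xs = sort_key key [l..<h]"
  define p where "p i = (if l \<le> i \<and> i < h then xs ! (i - l) else i)" for i
  have xs: "distinct xs" "set xs = {l..<h}" "length xs = h - l" "sorted (map key xs)"
    by (simp_all add: xs_def)
  have "inj_on p {l..<h}"
    using xs by (intro inj_onI) (auto simp: p_def nth_eq_iff_index_eq)
  moreover have "p ` {l..<h} \<subseteq> {l..<h}"
  proof
    fix y assume "y \<in> p ` {l..<h}"
    then obtain x where "l \<le> x" "x < h" "y = xs ! (x - l)" by (auto simp: p_def)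
    then have "y \<in> set xs" using xs(3) by auto
    then show "y \<in> {l..<h}" by (simp add: xs)
  qed
  ultimately have "bij_betw p {l..<h} {l..<h}" by (simp add: bij_betw_def endo_inj_surj)
  then have "p permutes {l..<h}" by (rule bij_imp_permutes) (auto simp: p_def)
  moreover have "key (p i) \<le> key (p j)" if "l \<le> i" "i \<le> j" "j < h" for i j
    using sorted_nth_mono[OF xs(4), of "i - l" "j - l"] that xs(3) by (simp add: p_def)
  ultimately show ?thesis by (rule that)
qed

definition perm_of :: "nat list \<Rightarrow> nat \<Rightarrow> nat" where
  "perm_of ps i = (if i < length ps then ps ! i else i)"

text \<open>A list of length \<open>n\<close> that covers all numbers below \<open>n\<close>
  contains nothing else and has no repetition.\<close>

lemma perm_of_permutes:
  assumes "isperm n ps" "length ps = n"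
  shows "perm_of ps permutes {..<n}" "set ps \<subseteq> {..<n}"
proof -
  have sub: "{..<n} \<subseteq> set ps" using assms by (simp add: isperm_iff)
  have c: "card (set ps) \<le> n" using assms card_length[of ps] by simp
  have eq: "set ps = {..<n}"
    using card_seteq[of "set ps" "{..<n}"] sub c by simp
  have d: "distinct ps" using assms eq by (intro card_distinct) simp
  show "set ps \<subseteq> {..<n}" by (simp add: eq)
  have "inj_on (perm_of ps) {..<n}"
    using d assms by (auto simp: perm_of_def inj_on_def nth_eq_iff_index_eq)
  moreover have "perm_of ps ` {..<n} = {..<n}"
    using eq assms by (auto simp: perm_of_def set_conv_nth image_iff)
  ultimately show "perm_of ps permutes {..<n}"
    by (intro bij_imp_permutes) (auto simp: bij_betw_def perm_of_def assms)
qed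

subsection \<open>Linear relations between the rows\<close>

lemma nbits_pk [simp]: "nbits (pack xs) = xs"
  by (induction xs) auto

lemma nbits_eq_Nil [simp]: "nbits x = [] \<longleftrightarrow> x = num.One"
  by (cases x) auto

primrec bit_at :: "num \<Rightarrow> nat \<Rightarrow> bool" where
  "bit_at num.One i = False"
| "bit_at (num.Bit0 x) i = (case i of 0 \<Rightarrow> False | Suc k \<Rightarrow> bit_at x k)"
| "bit_at (num.Bit1 x) i = (case i of 0 \<Rightarrow> True | Suc k \<Rightarrow> bit_at x k)"

abbreviation len :: "num \<Rightarrow> nat" where "len x \<equiv> length (nbits x)"

lemma bit_at_pk: "bit_at (pack xs) i \<longleftrightarrow> i < length xs \<and> xs ! i"
proof (induction xs arbitrary: i)
  case (Cons x xs) then show ?case by (cases i) auto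
qed simp

lemma len_xr: "len x = len y \<Longrightarrow> len (xor_num x y) = len x"
  by (induction x y rule: xor_num.induct) auto

lemma bit_at_xr: "len x = len y \<Longrightarrow> bit_at (xor_num x y) i \<longleftrightarrow> bit_at x i \<noteq> bit_at y i"
  by (induction x y arbitrary: i rule: xor_num.induct) (auto split: nat.splits)

lemma bit_at_ext: "len x = len y \<Longrightarrow> (\<And>i. i < len x \<Longrightarrow> bit_at x i = bit_at y i) \<Longrightarrow> x = y"
proof (induction x arbitrary: y)
  case One then show ?case by (cases y) auto
next
  case (Bit0 x)
  from Bit0.prems(2)[of 0] Bit0.prems(1) obtain z where y: "y = num.Bit0 z" by (cases y) auto
  have "bit_at x i = bit_at z i" if "i < len x" for i using Bit0.prems(2)[of "Suc i"] that y by simp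
  then show ?case using Bit0.IH[of z] Bit0.prems(1) y by simp
next
  case (Bit1 x)
  from Bit1.prems(2)[of 0] Bit1.prems(1) obtain z where y: "y = num.Bit1 z" by (cases y) auto
  have "bit_at x i = bit_at z i" if "i < len x" for i using Bit1.prems(2)[of "Suc i"] that y by simp
  then show ?case using Bit1.IH[of z] Bit1.prems(1) y by simp
qed

context
  fixes m :: "nat \<Rightarrow> nat \<Rightarrow> bool"
begin

definition row :: "nat \<Rightarrow> num" where "row i = pack (map (m i) [0..<8])"

lemma len_row [simp]: "len (row i) = 8" by (simp add: row_def)

lemma bit_at_row: "bit_at (row i) c \<longleftrightarrow> c < 8 \<and> m i c"
  by (auto simp: row_def bit_at_pk)

primrec row_comb :: "num \<Rightarrow> nat \<Rightarrow> nat \<Rightarrow> bool" where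
  "row_comb num.One j c = False"
| "row_comb (num.Bit0 x) j c = row_comb x (Suc j) c"
| "row_comb (num.Bit1 x) j c = (m j c \<noteq> row_comb x (Suc j) c)"

lemma row_comb_xr: "len x = len y \<Longrightarrow> row_comb (xor_num x y) j c \<longleftrightarrow> row_comb x j c \<noteq> row_comb y j c"
  by (induction x y arbitrary: j rule: xor_num.induct) auto

lemma row_comb_pk: "row_comb (pack xs) j c \<longleftrightarrow> odd (\<Sum>t<length xs. of_bool (xs ! t \<and> m (j + t) c) :: nat)"
proof (induction xs arbitrary: j)
  case (Cons x xs)
  show ?case
    by (cases x) (simp_all add: Cons.IH sum.lessThan_Suc_shift del: sum.lessThan_Suc)
qed simp

text \<open>The mask has one digit for each of the rows \<open>j\<close> to 7, so it becomes shorter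
  as rows are chosen, while the sum always has eight digits.\<close>

definition valid :: "nat \<Rightarrow> num \<times> num \<Rightarrow> bool" where
  "valid j e \<longleftrightarrow> len (fst e) = 8 - j \<and> len (snd e) = 8 \<and> (\<forall>c<8. row_comb (fst e) j c = bit_at (snd e) c)"

lemma row_comb_nob: "zero_mask x \<Longrightarrow> \<not> row_comb x j c"
  by (induction x arbitrary: j rule: zero_mask.induct) auto

lemma find_row_valid: "find_row sp = Some w \<Longrightarrow> \<forall>e\<in>set sp. valid j e \<Longrightarrow> w = row j"
proof (induction sp rule: find_row.induct)
  case (2 m' w' sp)
  show ?case
  proof (cases "zero_mask m'")
    case True
    with 2 have "w' = w" "valid j (num.Bit1 m', w)" by auto
    with row_comb_nob[OF True] show ?thesis
      by (intro bit_at_ext) (auto simp: valid_def bit_at_row)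
  qed (use 2 in auto)
qed auto

lemma valid_Bit0: "valid j (num.Bit0 x, w) \<Longrightarrow> valid (Suc j) (x, w)"
  by (auto simp: valid_def)

lemma valid_Bit1: "valid j (num.Bit1 x, w) \<Longrightarrow> valid (Suc j) (x, xor_num (row j) w)"
  by (auto simp: valid_def len_xr bit_at_xr bit_at_row)

lemma red0_valid: "\<forall>e\<in>set sp. valid j e \<Longrightarrow> \<forall>e\<in>set (red0 sp). valid (Suc j) e"
  by (induction sp rule: red0.induct) (auto dest: valid_Bit0)

lemma red1_valid: "\<forall>e\<in>set sp. valid j e \<Longrightarrow> \<forall>e\<in>set (red1 (row j) sp). valid (Suc j) e"
  by (induction "row j" sp rule: red1.induct) (auto dest: valid_Bit0 valid_Bit1)

lemma valid_unique: "valid j (x, w) \<Longrightarrow> valid j (x, w') \<Longrightarrow> w = w'"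
  by (intro bit_at_ext) (auto simp: valid_def)

text \<open>Valid relations with equal masks have equal sums, so the actual matrix can never
  disagree with its span.\<close>

lemma span_check_valid:
  assumes "span_check (row j) x w sp = Some b" "\<forall>e\<in>set sp. valid j e" "valid (Suc j) (x, w)"
  shows b
  using assms
proof (induction "row j" x w sp rule: span_check.induct)
  case (2 x w m' w' sp)
  show ?case
  proof (cases "x = m'")
    case True
    have "valid (Suc j) (x, w')" using 2(3) True valid_Bit0 by simp
    then have "w = w'" using 2(4) by (rule valid_unique[rotated])
    then show ?thesis using 2(2) True by (simp add: eqnum_iff)
  next
    case False
    then show ?thesis using 2 by (simp add: eqnum_iff)
  qed
next
  case (3 x w m' w' sp)
  show ?case
  proof (cases "x = m'")
    case True
    have "valid (Suc j) (x, xor_num (row j) w')" using 3(3) True valid_Bit1 by simp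
    then have "w = xor_num (row j) w'" using 3(4) by (rule valid_unique[rotated])
    then show ?thesis using 3(2) True by (simp add: eqnum_iff)
  next
    case False
    then show ?thesis using 3 by (simp add: eqnum_iff)
  qed
qed simp_all

lemma valid_xr:
  assumes "valid j (x, w)" "valid j (y, v)"
  shows "valid j (xor_num x y, xor_num w v)"
proof -
  have l: "len x = len y" "len w = len v" using assms by (simp_all add: valid_def)
  show ?thesis using assms by (simp add: valid_def len_xr[OF l(1)] len_xr[OF l(2)] bit_at_xr[OF l(2)] row_comb_xr[OF l(1)])
qed

lemma dbl_valid:
  assumes "\<forall>e\<in>set sp. valid j e" "valid j (x, w)"
  shows "\<forall>e\<in>set (dbl x w sp). valid j e"
proof -
  have "\<forall>e\<in>set (mulx x w sp). valid j e"
    using assms by (induction x w sp rule: mulx.induct) (auto intro: valid_xr)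
  then show ?thesis using assms(1) by (auto simp: dbl_def)
qed

text \<open>The difference between the marked sum and the claimed value is invariant: a chosen row
  leaves the mask and is added to the value at the same time.\<close>

lemma comb_spec:
  "comb b rows a = (b', a') \<Longrightarrow> rows = map row [i..<i + k] \<Longrightarrow> k \<le> len b \<Longrightarrow> len a = 8 \<Longrightarrow>
    len b' = len b - k \<and> len a' = 8 \<and> (\<forall>c<8. (row_comb b i c \<noteq> bit_at a c) = (row_comb b' (i + k) c \<noteq> bit_at a' c))"
proof (induction b rows a arbitrary: i k rule: comb.induct)
  case (1 b r rs a)
  from 1(3) obtain k' where k: "k = Suc k'" by (cases k) auto
  have r: "r = row i" "rs = map row [Suc i..<Suc i + k']" using 1(3) k by (simp_all add: upt_rec)
  have "len (xor_num r a) = 8" using r 1(5) by (simp add: len_xr)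
  from 1(1)[OF _ r(2) _ this] 1(2,4) k
  have "len b' = len b - k' \<and> len a' = 8 \<and> (\<forall>c<8. (row_comb b (Suc i) c \<noteq> bit_at (xor_num r a) c) = (row_comb b' (Suc i + k') c \<noteq> bit_at a' c))"
    by simp
  then show ?case using k r 1(5) by (auto simp: bit_at_xr bit_at_row)
next
  case (2 b r rs a)
  from 2(3) obtain k' where k: "k = Suc k'" by (cases k) auto
  have r: "rs = map row [Suc i..<Suc i + k']" using 2(3) k by (simp add: upt_rec)
  from 2(1)[OF _ r _ 2(5)] 2(2,4) k show ?case by simp
next
  case (3 b a) then show ?case by (cases k) auto
next
  case (4 r rs a) then show ?case by simp
qed

context
  assumes idem: "\<And>i c. i < 8 \<Longrightarrow> c < 8 \<Longrightarrow> row_comb (row i) 0 c = m i c"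
begin

text \<open>Idempotence says that \<open>row j\<close> is at once a mask and the sum it marks;
  eliminating the earlier rows and then row \<open>j\<close> leaves a relation between the later
  rows. Hence the step is neither refused nor does it produce a false relation.\<close>

lemma stp0_valid:
  assumes j: "j < 8" and v: "\<forall>e\<in>set sp. valid j e" and u: "u = find_row sp"
  shows "\<exists>sp'. stp0 u (comb (row j) (map row [0..<j]) (row j)) sp (row j) = Some sp' \<and> (\<forall>e\<in>set sp'. valid (Suc j) e)"
proof -
  obtain b' a' where e: "comb (row j) (map row [0..<j]) (row j) = (b', a')" by fastforce
  have "valid j (b', a')"
    using comb_spec[OF e, of 0 j] j by (auto simp: valid_def idem bit_at_row)
  then have v0: "b' = num.Bit0 x \<Longrightarrow> valid (Suc j) (x, a')"
    and v1: "b' = num.Bit1 x \<Longrightarrow> valid (Suc j) (x, xor_num (row j) a')" for x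
    using valid_Bit0 valid_Bit1 by auto
  have U: "\<exists>sp'. upd (span_check (row j) x w sp) (row j) x w sp = Some sp' \<and> (\<forall>e\<in>set sp'. valid (Suc j) e)"
    if w: "valid (Suc j) (x, w)" for x w
  proof (cases "span_check (row j) x w sp")
    case None
    then have "upd (span_check (row j) x w sp) (row j) x w sp = Some (dbl x w (red1 (row j) sp))" by (simp add: upd_def)
    with dbl_valid[OF red1_valid[OF v] w] show ?thesis by blast
  next
    case (Some b)
    then have b by (rule span_check_valid[OF _ v w])
    with Some have "upd (span_check (row j) x w sp) (row j) x w sp = Some (red1 (row j) sp)" by (simp add: upd_def)
    with red1_valid[OF v] show ?thesis by blast
  qed
  have U0: "\<exists>sp'. upd0 (span_check (row j) x w sp) x w (red0 sp) = Some sp' \<and> (\<forall>e\<in>set sp'. valid (Suc j) e)"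
    if w: "valid (Suc j) (x, w)" for x w
  proof (cases "span_check (row j) x w sp")
    case None
    then have "upd0 (span_check (row j) x w sp) x w (red0 sp) = Some (dbl x w (red0 sp))" by (simp add: upd0_def)
    with dbl_valid[OF red0_valid[OF v] w] show ?thesis by blast
  next
    case (Some b)
    then have b by (rule span_check_valid[OF _ v w])
    with Some have "upd0 (span_check (row j) x w sp) x w (red0 sp) = Some (red0 sp)" by (simp add: upd0_def)
    with red0_valid[OF v] show ?thesis by blast
  qed
  show ?thesis
  proof (cases b')
    \<comment> \<open>The default result contains no relation at all and is therefore sound.\<close>
    case One
    then show ?thesis by (simp add: e)
  next
    case (Bit0 x)
    show ?thesis
    proof (cases u)
      case None
      show ?thesis unfolding e Bit0 None stp0.simps by (rule U[OF v0[OF Bit0]])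
    next
      case (Some y)
      show ?thesis unfolding e Bit0 Some stp0.simps by (rule U0[OF v0[OF Bit0]])
    qed
  next
    case (Bit1 x)
    show ?thesis
    proof (cases u)
      case None
      show ?thesis unfolding e Bit1 None stp0.simps by (rule U[OF v1[OF Bit1]])
    next
      case (Some y)
      show ?thesis unfolding e Bit1 Some stp0.simps by (rule U0[OF v1[OF Bit1]])
    qed
  qed
qed

text \<open>The branch that follows the actual rows is never cut off: a forced row equals the actual
  one, and the span stays valid along the branch.\<close>

lemma row_search_complete:
  assumes "row_search P od cd okw n (map row [0..<8 - n]) sp" "n \<le> 8" "\<forall>e\<in>set sp. valid (8 - n) e"
    and "\<And>i. 8 - n \<le> i \<Longrightarrow> i < 8 \<Longrightarrow>
      od (7 - i) (map row [0..<i]) (row i) \<and> row i \<in> set (cd (7 - i)) \<and> okw (7 - i) (row i)"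
  shows "P (map row [0..<8])"
  using assms
proof (induction n arbitrary: sp)
  case (Suc n)
  let ?j = "8 - Suc n"
  have j: "?j < 8" "7 - ?j = n" "8 - n = Suc ?j" using Suc.prems(2) by auto
  have c: "od n (map row [0..<?j]) (row ?j) \<and> row ?j \<in> set (cd n) \<and> okw n (row ?j)"
    using Suc.prems(4)[of ?j] j by simp
  have "row ?j \<in> set (candidates cd okw n sp)"
    using c find_row_valid[OF _ Suc.prems(3)] by (auto simp: candidates_def split: option.split)
  moreover obtain sp' where "row_step od n (map row [0..<?j]) sp (row ?j) = Some sp'" "\<forall>e\<in>set sp'. valid (Suc ?j) e"
    using stp0_valid[OF j(1) Suc.prems(3) refl] c by (auto simp: row_step_def)
  ultimately have "row_search P od cd okw n (map row [0..<8 - n]) sp'" "\<forall>e\<in>set sp'. valid (8 - n) e"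
    using Suc.prems(1) unfolding row_search.simps all_in_iff j(3) by force+
  then show ?case
    using Suc.IH Suc.prems(2,4) by auto
qed simp

lemma s1run_complete:
  assumes "s1run P od cd okw (row 0)" and o: "\<And>c. c < 8 \<Longrightarrow> row_comb (num_of_nat 511) 0 c"
    and c: "\<And>i. 1 \<le> i \<Longrightarrow> i < 8 \<Longrightarrow>
      od (7 - i) (map row [0..<i]) (row i) \<and> row i \<in> set (cd (7 - i)) \<and> okw (7 - i) (row i)"
  shows "P (map row [0..<8])"
proof -
  define e0 e1 where "e0 = num_of_nat 256" and "e1 = num_of_nat 511"
  have e: "e0 = pack (replicate 8 False)" "e1 = pack (replicate 8 True)"
    unfolding e0_def e1_def num_of_nat_numeral_eq by (simp_all add: numeral_eq_Suc)
  have n: "\<not> row_comb e0 0 c" for c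
    unfolding e row_comb_pk by (simp add: sum.neutral)
  have "valid 0 (e0, e0)" "valid 0 (e1, e1)"
    using n o unfolding e1_def[symmetric] by (simp_all add: valid_def e bit_at_pk)
  then have v: "\<forall>e\<in>set [(e0, e0), (e1, e1)]. valid 0 e" by simp
  obtain sp' where sp': "stp0 (find_row [(e0, e0), (e1, e1)]) (comb (row 0) [] (row 0)) [(e0, e0), (e1, e1)] (row 0) = Some sp'"
      "\<forall>e\<in>set sp'. valid 1 e"
    using stp0_valid[OF _ v refl] by auto
  then have "row_step ord0 n7 [] [(e0, e0), (e1, e1)] (row 0) = Some sp'" by (simp add: row_step_def ord0_def)
  then have "row_search P od cd okw n7 [row 0] sp'"
    using assms(1) by (simp only: s1run_def e0_def e1_def option.case)
  then have "row_search P od cd okw n7 (map row [0..<8 - n7]) sp'" by simp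
  then show ?thesis
    by (rule row_search_complete) (use sp'(2) c in auto)
qed

end

end

section \<open>The evaluated searches\<close>

lemmas words_ev = words8_def words.simps list.map append.simps
schematic_goal cd1_ev0: "cd1 0 = ?x"
  by (simp only: cd1_def words_ev row_search_ev cong: wcongs)
schematic_goal cd1_ev1: "cd1 n1 = ?x"
  by (simp only: cd1_def words_ev row_search_ev cong: wcongs)
schematic_goal cd1_ev2: "cd1 n2 = ?x"
  by (simp only: cd1_def words_ev row_search_ev cong: wcongs)
schematic_goal cd1_ev3: "cd1 n3 = ?x"
  by (simp only: cd1_def words_ev row_search_ev cong: wcongs)
schematic_goal cd1_ev4: "cd1 n4 = ?x"
  by (simp only: cd1_def words_ev row_search_ev cong: wcongs)
schematic_goal cd1_ev5: "cd1 n5 = ?x"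
  by (simp only: cd1_def words_ev row_search_ev cong: wcongs)
schematic_goal cd1_ev6: "cd1 n6 = ?x"
  by (simp only: cd1_def words_ev row_search_ev cong: wcongs)
schematic_goal cd0_ev0: "cd0 0 = ?x"
  by (simp only: cd0_def words_ev row_search_ev cong: wcongs)
schematic_goal cd0_ev1: "cd0 n1 = ?x"
  by (simp only: cd0_def words_ev row_search_ev cong: wcongs)
schematic_goal cd0_ev2: "cd0 n2 = ?x"
  by (simp only: cd0_def words_ev row_search_ev cong: wcongs)
schematic_goal cd0_ev3: "cd0 n3 = ?x"
  by (simp only: cd0_def words_ev row_search_ev cong: wcongs)
schematic_goal cd0_ev4: "cd0 n4 = ?x"
  by (simp only: cd0_def words_ev row_search_ev cong: wcongs)
schematic_goal cd0_ev5: "cd0 n5 = ?x"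
  by (simp only: cd0_def words_ev row_search_ev cong: wcongs)
schematic_goal cd0_ev6: "cd0 n6 = ?x"
  by (simp only: cd0_def words_ev row_search_ev cong: wcongs)
lemmas cd_ev = cd1_ev0 cd1_ev1 cd1_ev2 cd1_ev3 cd1_ev4 cd1_ev5 cd1_ev6 cd0_ev0 cd0_ev1 cd0_ev2 cd0_ev3 cd0_ev4 cd0_ev5 cd0_ev6
text \<open>The word 270 is a zero, three ones and four zeros: the first row when a row of weight
  three has been put first and its out-neighbours directly after it.\<close>

lemma start1: "s1run (leaf1 tree1) ord1 cd1 okw1 (num_of_nat 270) = True"
  by (simp only: s1run_def row_search_ev cd_ev leaf1_def leaf1b_def leaf1a_def list.map fst_conv snd_conv tree1_def reps_def cong: wcongs)
text \<open>The words 258, 504 and 510 have the weights one, five and seven. With rows of these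
  weights only, no matrix exists.\<close>

lemma start2: "s1run (\<lambda>_. False) ord0 cd0 okw0 (num_of_nat 258) = True"
  by (simp only: s1run_def row_search_ev cd_ev leaf1_def leaf1b_def leaf1a_def list.map fst_conv snd_conv tree1_def reps_def cong: wcongs)
lemma start3: "s1run (\<lambda>_. False) ord0 cd0 okw0 (num_of_nat 504) = True"
  by (simp only: s1run_def row_search_ev cd_ev leaf1_def leaf1b_def leaf1a_def list.map fst_conv snd_conv tree1_def reps_def cong: wcongs)
lemma start4: "s1run (\<lambda>_. False) ord0 cd0 okw0 (num_of_nat 510) = True"
  by (simp only: s1run_def row_search_ev cd_ev leaf1_def leaf1b_def leaf1a_def list.map fst_conv snd_conv tree1_def reps_def cong: wcongs)

text \<open>The weights two and three in \<open>N\<close> and \<open>K\<close> belong to rows and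
  columns of weight five and three in \<open>M\<close>.\<close>

lemma wds7_ev2: "wds7 n2 = [bits 224, bits 208, bits 176, bits 200, bits 168, bits 152, bits 196, bits 164, bits 148, bits 140, bits 194, bits 162, bits 146, bits 138, bits 134, bits 193, bits 161, bits 145, bits 137, bits 133, bits 131]"
  by (simp only: wds7_def bool_lists.simps list.map base_ev cong: wcongs)
lemma wds7_ev3: "wds7 n3 = [bits 240, bits 232, bits 216, bits 184, bits 228, bits 212, bits 180, bits 204, bits 172, bits 156, bits 226, bits 210, bits 178, bits 202, bits 170, bits 154, bits 198, bits 166, bits 150, bits 142, bits 225, bits 209, bits 177, bits 201, bits 169, bits 153, bits 197, bits 165, bits 149, bits 141, bits 195, bits 163, bits 147, bits 139, bits 135]"
  by (simp only: wds7_def bool_lists.simps list.map base_ev cong: wcongs)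
lemma is_case_casl: "list_all is_case all_cases"
  by (simp add: list_all_iff is_case_def)
lemmas is_case_ev = is_case_casl[unfolded all_cases_def list.pred_inject]
lemmas c_def =
    c0_def c1_def c2_def c3_def c4_def c5_def c6_def c7_def c8_def c9_def c10_def c11_def c12_def c13_def c14_def c15_def c16_def c17_def c18_def
    c19_def c20_def c21_def c22_def c23_def c24_def c25_def c26_def c27_def c28_def c29_def c30_def c31_def c32_def c33_def c34_def c35_def c36_def
    c37_def c38_def c39_def c40_def c41_def c42_def c43_def c44_def c45_def c46_def c47_def c48_def c49_def c50_def c51_def c52_def c53_def c54_def
    c55_def c56_def c57_def c58_def c59_def c60_def c61_def c62_def c63_def c64_def c65_def c66_def c67_def c68_def c69_def c70_def c71_def c72_def
    c73_def c74_def c75_def c76_def c77_def c78_def c79_def c80_def c81_def c82_def c83_def c84_def c85_def c86_def c87_def c88_def c89_def c90_def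
    c91_def c92_def c93_def c94_def c95_def c96_def c97_def c98_def c99_def c100_def c101_def c102_def c103_def c104_def c105_def c106_def c107_def
    c108_def c109_def c110_def c111_def c112_def c113_def c114_def c115_def c116_def c117_def c118_def c119_def c120_def c121_def c122_def c123_def
    c124_def c125_def c126_def c127_def c128_def c129_def c130_def c131_def c132_def c133_def c134_def c135_def c136_def c137_def c138_def c139_def
    c140_def c141_def c142_def c143_def c144_def c145_def c146_def c147_def c148_def c149_def c150_def c151_def c152_def c153_def c154_def c155_def
    c156_def c157_def c158_def c159_def c160_def c161_def c162_def c163_def c164_def c165_def c166_def c167_def c168_def c169_def c170_def c171_def
    c172_def c173_def c174_def c175_def c176_def c177_def c178_def c179_def c180_def c181_def c182_def c183_def c184_def c185_def c186_def c187_def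
    c188_def c189_def c190_def c191_def c192_def c193_def c194_def c195_def c196_def c197_def c198_def c199_def c200_def c201_def c202_def c203_def
    c204_def c205_def c206_def c207_def c208_def c209_def c210_def c211_def c212_def c213_def c214_def c215_def c216_def c217_def c218_def c219_def
    c220_def c221_def c222_def c223_def
lemmas leaf2_ev = pair_search_ev bad_ev idm7_def look.simps mbits.simps isoc.simps cert_holds.simps certs_ok.simps leaf2b_def leaf2a_def wds7_ev2 wds7_ev3
lemma pair_search_0: "pair_search (leaf2a tree2) (spec (reps ! 0)) [] [] trues6 = True"
  by (simp only: spec_ev leaf2_ev is_case_ev c_def tree2_def reps_def cong: wcongs)
text \<open>Equality of the specifications transfers the search for representative 0 to the next
  six. The matrices \<open>M\<close> still differ and enter again through the formula for
  \<open>P + Q\<close>.\<close>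

lemma spec_1: "spec (reps ! n1) = spec (reps ! 0)"
  by (simp only: reps_def spec_ev cong: wcongs)
lemma spec_2: "spec (reps ! n2) = spec (reps ! 0)"
  by (simp only: reps_def spec_ev cong: wcongs)
lemma spec_3: "spec (reps ! n3) = spec (reps ! 0)"
  by (simp only: reps_def spec_ev cong: wcongs)
lemma spec_4: "spec (reps ! n4) = spec (reps ! 0)"
  by (simp only: reps_def spec_ev cong: wcongs)
lemma spec_5: "spec (reps ! n5) = spec (reps ! 0)"
  by (simp only: reps_def spec_ev cong: wcongs)
lemma spec_6: "spec (reps ! n6) = spec (reps ! 0)"
  by (simp only: reps_def spec_ev cong: wcongs)
lemma pair_search_8: "pair_search (\<lambda>_ _. False) (spec (reps ! n8)) [] [] trues6 = True"
  by (simp only: spec_ev reps_def pair_search_ev wds7_ev2 wds7_ev3 cong: wcongs)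
lemma pair_search_9: "pair_search (\<lambda>_ _. False) (spec (reps ! n9)) [] [] trues6 = True"
  by (simp only: spec_ev reps_def pair_search_ev wds7_ev2 wds7_ev3 cong: wcongs)
lemma pair_search_10: "pair_search (\<lambda>_ _. False) (spec (reps ! n10)) [] [] trues6 = True"
  by (simp only: spec_ev reps_def pair_search_ev wds7_ev2 wds7_ev3 cong: wcongs)

lemma case_ok_0: "\<forall>c\<in>set [
    c0, c1, c2, c3, c4, c5, c6, c7, c8, c9, c10, c11, c12, c13, c14, c15, c16, c17, c18, c19, c20, c21, c22, c23, c24, c25, c26, c27].
    case_ok (c ())"
  unfolding list.set ball_simps
  by (intro conjI TrueI; simp only: c_def case_ok.simps reps_def case_ok_ev cong: wcongs)

lemma case_ok_1: "\<forall>c\<in>set [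
    c28, c29, c30, c31, c32, c33, c34, c35, c36, c37, c38, c39, c40, c41, c42, c43, c44, c45, c46, c47, c48, c49, c50, c51, c52, c53, c54, c55].
    case_ok (c ())"
  unfolding list.set ball_simps
  by (intro conjI TrueI; simp only: c_def case_ok.simps reps_def case_ok_ev cong: wcongs)

lemma case_ok_2: "\<forall>c\<in>set [
    c56, c57, c58, c59, c60, c61, c62, c63, c64, c65, c66, c67, c68, c69, c70, c71, c72, c73, c74, c75, c76, c77, c78, c79, c80, c81, c82, c83].
    case_ok (c ())"
  unfolding list.set ball_simps
  by (intro conjI TrueI; simp only: c_def case_ok.simps reps_def case_ok_ev cong: wcongs)

lemma case_ok_3: "\<forall>c\<in>set [
    c84, c85, c86, c87, c88, c89, c90, c91, c92, c93, c94, c95, c96, c97, c98, c99, c100, c101, c102, c103, c104, c105, c106, c107, c108, c109, c110,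
    c111].
    case_ok (c ())"
  unfolding list.set ball_simps
  by (intro conjI TrueI; simp only: c_def case_ok.simps reps_def case_ok_ev cong: wcongs)

lemma case_ok_4: "\<forall>c\<in>set [
    c112, c113, c114, c115, c116, c117, c118, c119, c120, c121, c122, c123, c124, c125, c126, c127, c128, c129, c130, c131, c132, c133, c134, c135,
    c136, c137, c138, c139].
    case_ok (c ())"
  unfolding list.set ball_simps
  by (intro conjI TrueI; simp only: c_def case_ok.simps reps_def case_ok_ev cong: wcongs)

lemma case_ok_5: "\<forall>c\<in>set [
    c140, c141, c142, c143, c144, c145, c146, c147, c148, c149, c150, c151, c152, c153, c154, c155, c156, c157, c158, c159, c160, c161, c162, c163,
    c164, c165, c166, c167].
    case_ok (c ())"
  unfolding list.set ball_simps
  by (intro conjI TrueI; simp only: c_def case_ok.simps reps_def case_ok_ev cong: wcongs)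

lemma case_ok_6: "\<forall>c\<in>set [
    c168, c169, c170, c171, c172, c173, c174, c175, c176, c177, c178, c179, c180, c181, c182, c183, c184, c185, c186, c187, c188, c189, c190, c191,
    c192, c193, c194, c195].
    case_ok (c ())"
  unfolding list.set ball_simps
  by (intro conjI TrueI; simp only: c_def case_ok.simps reps_def case_ok_ev cong: wcongs)

lemma case_ok_7: "\<forall>c\<in>set [
    c196, c197, c198, c199, c200, c201, c202, c203, c204, c205, c206, c207, c208, c209, c210, c211, c212, c213, c214, c215, c216, c217, c218, c219,
    c220, c221, c222, c223].
    case_ok (c ())"
  unfolding list.set ball_simps
  by (intro conjI TrueI; simp only: c_def case_ok.simps reps_def case_ok_ev cong: wcongs)

section \<open>Completeness of the search for the fixed submatrix\<close>

lemma nice_lin: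
  assumes "nice a" "i < 8" "c < 8"
  shows "row_comb a (row a i) 0 c = a i c"
proof -
  have "row_comb a (row a i) 0 c \<longleftrightarrow> odd (\<Sum>t<8. of_bool (a i t \<and> a t c) :: nat)"
    by (simp add: row_def row_comb_pk)
  also have "\<dots> \<longleftrightarrow> odd (of_bool (a i c) :: nat)"
    using nice_FF[OF assms] by presburger
  finally show ?thesis by simp
qed

lemma nice_lin_col:
  assumes "nice a" "c < 8"
  shows "row_comb a (num_of_nat 511) 0 c"
proof -
  have "num_of_nat 511 = pack (replicate 8 True)"
    unfolding num_of_nat_numeral_eq by (simp add: numeral_eq_Suc)
  then have "row_comb a (num_of_nat 511) 0 c \<longleftrightarrow> odd (\<Sum>t<8. of_bool (a t c) :: nat)"
    by (simp add: row_comb_pk)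
  then show ?thesis using nice_col[OF assms] by presburger
qed

lemma reach_fixed:
  assumes "nice a" "p permutes {..<8}"
  obtains b where "reach a b" "\<And>i j. i < 8 \<Longrightarrow> j < 8 \<Longrightarrow> b i j = a (p i) (p j)"
  by (rule that[OF reach_lift[OF assms permutes_id, of "\<lambda>_. False"]]) (simp add: lift_def)

lemma set_words: "set (words n) = {x. len x = n}"
proof (induction n)
  case (Suc n)
  have "x \<in> num.Bit0 ` {x. len x = n} \<union> num.Bit1 ` {x. len x = n}" if "len x = Suc n" for x
    using that by (cases x) auto
  then show ?case using Suc by auto
qed auto

lemma diag0_row: "i < 8 \<Longrightarrow> diag0 (7 - i) (nbits (row a i)) \<longleftrightarrow> \<not> a i i"
proof -
  assume "i < 8"
  then consider "i = 0" | "i = 1" | "i = 2" | "i = 3" | "i = 4" | "i = 5" | "i = 6" | "i = 7" by linarith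
  then show ?thesis
    by cases (simp_all add: row_def numeral_eq_Suc)
qed

lemma weight_row: "weight (nbits (row a i)) = (\<Sum>k<8. of_bool (a i k))"
  by (simp add: row_def weight_upt)

lemma nice_wt:
  assumes "nice a" "i < 8"
  shows "weight (nbits (row a i)) \<in> {1, 3, 5, 7}"
proof -
  have "(\<Sum>k<8. of_bool (a i k)) = (\<Sum>k\<in>{..<8} - {i}. of_bool (a i k) :: nat)"
    using nice_diag[OF assms(1), of i] assms(2) by (intro sum.mono_neutral_right) auto
  also have "\<dots> \<le> (\<Sum>k\<in>{..<8} - {i}. 1)" by (intro sum_mono) simp
  also have "\<dots> = 7" using assms(2) by simp
  finally have "weight (nbits (row a i)) \<le> 7" unfolding weight_row .
  moreover have "odd (weight (nbits (row a i)))"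
    using nice_row[OF assms] unfolding weight_row by presburger
  moreover have "w \<in> {1, 3, 5, 7}" if "w \<le> 7" "odd w" for w :: nat
    using that by (simp; presburger)
  ultimately show ?thesis by blast
qed

lemma okb_row:
  assumes "nice a" "i < 8" "weight (nbits (row a i)) \<in> set ws"
  shows "okb ws (7 - i) (nbits (row a i))"
  using assms nice_diag[OF assms(1), of i] by (simp add: okb_def diag0_row memn_iff)

lemma row_in_cd:
  assumes "nice a" "i < 8"
  shows "okw1 (7 - i) (row a i)" "row a i \<in> set (cd1 (7 - i))"
    "weight (nbits (row a i)) \<noteq> 3 \<Longrightarrow> okw0 (7 - i) (row a i)"
    "weight (nbits (row a i)) \<noteq> 3 \<Longrightarrow> row a i \<in> set (cd0 (7 - i))"
  using nice_wt[OF assms] assms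
  by (auto simp: okw1_def okw0_def cd1_def cd0_def filt_filter words8_def set_words simp del: words.simps
    intro!: okb_row)

lemma first_row:
  assumes "nice a" "i0 < 8"
  shows "\<exists>b. reach a b \<and> (\<forall>i j. 1 \<le> i \<longrightarrow> i \<le> j \<longrightarrow> j < 8 \<longrightarrow> b 0 j = f \<longrightarrow> b 0 i = f) \<and>
    (\<Sum>k<8. of_bool (b 0 k)) = (\<Sum>k<8. of_bool (a i0 k) :: nat) \<and>
    (\<forall>i<8. \<exists>i'<8. weight (nbits (row b i)) = weight (nbits (row a i')))"
proof -
  \<comment> \<open>The vertex \<open>i0\<close> comes first; \<open>f\<close> decides whether the
    ones of its row are moved to the front or to the back.\<close>
  define key :: "nat \<Rightarrow> nat" where "key j = (if j = i0 then 0 else if a i0 j = f then 1 else 2)" for j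
  obtain p where p: "p permutes {0..<8}" and s: "\<And>i j. 0 \<le> i \<Longrightarrow> i \<le> j \<Longrightarrow> j < 8 \<Longrightarrow> key (p i) \<le> key (p j)"
    using sorting_permutation[of 0 8 key] by blast
  have p': "p permutes {..<8}" using p by (simp add: atLeast0LessThan)
  have im: "p i < 8" if "i < 8" for i using permutes_in_image[OF p', of i] that by simp
  obtain k where "p k = i0" using permutes_surj[OF p'] by (metis surj_def)
  moreover have "k < 8" using permutes_in_image[OF p', of k] \<open>p k = i0\<close> assms by simp
  ultimately have "key (p 0) = 0" using s[of 0 k] by (simp add: key_def)
  then have p0: "p 0 = i0" by (auto simp: key_def split: if_splits)
  have pn: "p i \<noteq> i0" if "i \<noteq> 0" for i
    using that p0 permutes_inj[OF p'] by (metis injD)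
  obtain b where b: "reach a b" "\<And>i j. i < 8 \<Longrightarrow> j < 8 \<Longrightarrow> b i j = a (p i) (p j)"
    using reach_fixed[OF assms(1) p'] by blast
  have S: "(\<Sum>k<8. of_bool (b i k)) = (\<Sum>k<8. of_bool (a (p i) k) :: nat)" if "i < 8" for i
  proof -
    have "(\<Sum>k<8. of_bool (b i k) :: nat) = (\<Sum>k<8. of_bool (a (p i) (p k)))"
      by (intro sum.cong) (use b(2) that in auto)
    also have "\<dots> = (\<Sum>k<8. of_bool (a (p i) k))"
      by (rule sum.permute[OF p', of "\<lambda>k. of_bool (a (p i) k)", unfolded comp_def, symmetric])
    finally show ?thesis .
  qed
  have "\<forall>i j. 1 \<le> i \<longrightarrow> i \<le> j \<longrightarrow> j < 8 \<longrightarrow> b 0 j = f \<longrightarrow> b 0 i = f"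
  proof (intro allI impI)
    fix i j :: nat assume ij: "1 \<le> i" "i \<le> j" "j < 8" "b 0 j = f"
    then show "b 0 i = f"
      using s[of i j] pn[of i] pn[of j] by (auto simp: key_def b(2) p0 split: if_splits)
  qed
  moreover have "(\<Sum>k<8. of_bool (b 0 k)) = (\<Sum>k<8. of_bool (a i0 k) :: nat)" using S[of 0] p0 by simp
  moreover have "\<exists>i'<8. weight (nbits (row b i)) = weight (nbits (row a i'))" if "i < 8" for i
    using S[OF that] im[OF that] unfolding weight_row by blast
  ultimately show ?thesis using b(1) by blast
qed

lemma row_eq: "row a i = pack [a i 0, a i 1, a i 2, a i 3, a i 4, a i 5, a i 6, a i 7]"
  by (simp add: row_def numeral_eq_Suc upt_rec)

lemma monotone_count:
  "(x2 = f \<longrightarrow> x1 = f) \<Longrightarrow> (x3 = f \<longrightarrow> x2 = f) \<Longrightarrow> (x4 = f \<longrightarrow> x3 = f) \<Longrightarrow> (x5 = f \<longrightarrow> x4 = f) \<Longrightarrow>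
   (x6 = f \<longrightarrow> x5 = f) \<Longrightarrow> (x7 = f \<longrightarrow> x6 = f) \<Longrightarrow>
   of_bool x1 + of_bool x2 + of_bool x3 + of_bool x4 + of_bool x5 + of_bool x6 + of_bool x7 = (w :: nat) \<Longrightarrow>
   [x1, x2, x3, x4, x5, x6, x7] = (if f then replicate w True @ replicate (7 - w) False
     else replicate (7 - w) False @ replicate w True)"
  by (cases f; cases x1; cases x2; cases x3; cases x4; cases x5; cases x6; cases x7; simp; (elim subst)?)
    (auto simp: numeral_eq_Suc)

lemma row0_cases:
  assumes "nice b" "\<forall>i j. 1 \<le> i \<longrightarrow> i \<le> j \<longrightarrow> j < 8 \<longrightarrow> b 0 j = f \<longrightarrow> b 0 i = f"
    and w: "(\<Sum>k<8. of_bool (b 0 k)) = (w :: nat)" and wf: "(w, f) \<in> {(1, True), (3, True), (5, False), (7, True)}"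
  shows "row b 0 = num_of_nat (if w = 1 then 258 else if w = 3 then 270 else if w = 5 then 504 else 510)"
proof -
  have z: "\<not> b 0 0" using nice_diag[OF assms(1), of 0] by simp
  have s: "of_bool (b 0 1) + of_bool (b 0 2) + of_bool (b 0 3) + of_bool (b 0 4) + of_bool (b 0 5)
    + of_bool (b 0 6) + of_bool (b 0 7) = w" using w z by (simp add: numeral_eq_Suc)
  have "[b 0 1, b 0 2, b 0 3, b 0 4, b 0 5, b 0 6, b 0 7] = (if f then replicate w True @ replicate (7 - w) False
     else replicate (7 - w) False @ replicate w True)"
    by (rule monotone_count[OF _ _ _ _ _ _ s]; (rule impI, erule assms(2)[rule_format, rotated 3], simp_all))
  then have "row b 0 = pack (False # (if f then replicate w True @ replicate (7 - w) False
     else replicate (7 - w) False @ replicate w True))"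
    unfolding row_eq using z by simp
  note r = this
  have n: "num_of_nat 258 = pack [False, True, False, False, False, False, False, False]"
    "num_of_nat 270 = pack [False, True, True, True, False, False, False, False]"
    "num_of_nat 504 = pack [False, False, False, True, True, True, True, True]"
    "num_of_nat 510 = pack [False, True, True, True, True, True, True, True]"
    unfolding num_of_nat_numeral_eq by simp_all
  from wf consider "w = 1" f | "w = 3" f | "w = 5" "\<not> f" | "w = 7" f by auto
  then show ?thesis
  proof cases
    case 1
    then have "row b 0 = num_of_nat 258" unfolding n r by (simp add: numeral_eq_Suc)
    with 1 show ?thesis by simp
  next
    case 2
    then have "row b 0 = num_of_nat 270" unfolding n r by (simp add: numeral_eq_Suc)
    with 2 show ?thesis by simp
  next
    case 3
    then have "row b 0 = num_of_nat 504" unfolding n r by (simp add: numeral_eq_Suc)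
    with 3 show ?thesis by simp
  next
    case 4
    then have "row b 0 = num_of_nat 510" unfolding n r by (simp add: numeral_eq_Suc)
    with 4 show ?thesis by simp
  qed
qed

text \<open>Otherwise all weights are one, five or seven, also after vertex 0 has been kept in front
  and the others sorted by its row; the three searches without result exclude this.\<close>

lemma weight_3:
  assumes "nice a"
  shows "\<exists>i<8. weight (nbits (row a i)) = 3"
proof (rule ccontr)
  assume "\<not> (\<exists>i<8. weight (nbits (row a i)) = 3)"
  then have n3: "weight (nbits (row a i)) \<noteq> 3" if "i < 8" for i using that by blast
  define w where "w = weight (nbits (row a 0))"
  \<comment> \<open>The starting word 504 of weight five has its ones at the end, those of weight
    one and seven have them directly after the diagonal.\<close>
  define f where "f = (w \<noteq> 5)"
  have w: "w \<in> {1, 5, 7}" using nice_wt[OF assms, of 0] n3[of 0] by (auto simp: w_def)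
  obtain b where b: "reach a b" "\<forall>i j. 1 \<le> i \<longrightarrow> i \<le> j \<longrightarrow> j < 8 \<longrightarrow> b 0 j = f \<longrightarrow> b 0 i = f"
    "(\<Sum>k<8. of_bool (b 0 k)) = w"
    "\<forall>i<8. \<exists>i'<8. weight (nbits (row b i)) = weight (nbits (row a i'))"
    using first_row[OF assms, of 0 f] unfolding w_def weight_row by auto
  note nb = reach_nice[OF b(1)]
  have "row b 0 = num_of_nat (if w = 1 then 258 else if w = 3 then 270 else if w = 5 then 504 else 510)"
    by (rule row0_cases[OF nb b(2,3)]) (use w in \<open>auto simp: f_def\<close>)
  then have "s1run (\<lambda>_. False) ord0 cd0 okw0 (row b 0)"
    using w start2 start3 start4 by auto
  moreover have "weight (nbits (row b i)) \<noteq> 3" if "i < 8" for i using b(4) n3 that by metis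
  ultimately show False
    using nice_lin[OF nb] nice_lin_col[OF nb] row_in_cd[OF nb]
    by (intro s1run_complete[where m = b and P = "\<lambda>_. False"]) (auto simp: ord0_def)
qed

lemma order_ok_iff: "length xs = Suc (length es) \<Longrightarrow> order_ok es xs \<longleftrightarrow> (\<forall>t<length es. es ! t \<longrightarrow> xs ! t \<longrightarrow> xs ! Suc t)"
  by (induction es xs rule: order_ok.induct) (auto simp: nth_Cons All_less_Suc2 split: nat.splits)

lemma length_ne: "length xs = Suc (length es) \<Longrightarrow> length (ties es xs) = length es"
  by (induction es xs rule: ties.induct) auto

lemma ties_nth: "length xs = Suc (length es) \<Longrightarrow> t < length es \<Longrightarrow> ties es xs ! t \<longleftrightarrow> es ! t \<and> xs ! t = xs ! Suc t"
  by (induction es xs arbitrary: t rule: ties.induct) (auto simp: nth_Cons split: nat.splits)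

lemma lex_le_iff: "length xs = length ys \<Longrightarrow> lex_le xs ys \<longleftrightarrow> xs \<le> ys"
  by (induction xs ys rule: lex_le.induct) auto

lemma lex_nth: "x \<le> y \<Longrightarrow> take k x = take k y \<Longrightarrow> k < length x \<Longrightarrow> k < length y \<Longrightarrow> x ! k \<le> y ! k" for x y :: "'a :: linorder list"
proof (induction k arbitrary: x y)
  case 0 then show ?case by (cases x; cases y) auto
next
  case (Suc k) then show ?case by (cases x; cases y) auto
qed

lemma drop4_row: "drop4 (row b i) = [b i 4, b i 5, b i 6, b i 7]"
proof -
  have s: "snum (pack (x # xs)) = pack xs" for x xs by simp
  show ?thesis unfolding row_eq drop4_def s by simp
qed

lemma ck3: "order_ok [e0, e1, e2] [x0, x1, x2, x3] \<longleftrightarrow> (e0 \<longrightarrow> x0 \<le> x1) \<and> (e1 \<longrightarrow> x1 \<le> x2) \<and> (e2 \<longrightarrow> x2 \<le> x3)"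
  by (simp add: order_ok_iff All_less_Suc2 numeral_eq_Suc)

lemma ne3: "ties [e0, e1, e2] [x0, x1, x2, x3] = [e0 \<and> x0 = x1, e1 \<and> x1 = x2, e2 \<and> x2 = x3]"
  by (simp add: list_eq_iff_nth_eq length_ne ties_nth All_less_Suc2 numeral_eq_Suc)

lemma ord1_sorted:
  fixes b
  defines "key t \<equiv> [b 1 t, b 2 t] @ [b t 0, b t 1, b t 2, b t 3]"
  assumes k: "key 4 \<le> key 5" "key 5 \<le> key 6" "key 6 \<le> key 7" and i: "1 \<le> i" "i < 8"
  shows "ord1 (7 - i) (map (row b) [0..<i]) (row b i)"
proof -
  have l4: "leq4 (row b x) (row b y) \<longleftrightarrow> [b x 0, b x 1, b x 2, b x 3] \<le> [b y 0, b y 1, b y 2, b y 3]" for x y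
    unfolding row_eq leq4_def nbits_pk by (simp add: lex_le_iff)
  have K: "b 1 x \<le> b 1 y" "b 1 x = b 1 y \<longrightarrow> b 2 x \<le> b 2 y"
    "b 1 x = b 1 y \<and> b 2 x = b 2 y \<longrightarrow> leq4 (row b x) (row b y)" if "key x \<le> key y" for x y
    using that unfolding key_def l4 by auto
  note K4 = K[OF k(1)] and K5 = K[OF k(2)] and K6 = K[OF k(3)]
  have f1: "fl1 rows = [b 1 4 = b 1 5, b 1 5 = b 1 6, b 1 6 = b 1 7]" if "rows ! n1 = row b 1" for rows
    by (simp add: fl1_def that drop4_row ne3)
  have f2: "fl2 rows = [b 1 4 = b 1 5 \<and> b 2 4 = b 2 5, b 1 5 = b 1 6 \<and> b 2 5 = b 2 6, b 1 6 = b 1 7 \<and> b 2 6 = b 2 7]"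
    if "rows ! n1 = row b 1" "rows ! n2 = row b 2" for rows
    unfolding fl2_def f1[OF that(1)] that(2) drop4_row ne3 ..
  consider "i = 1" | "i = 2" | "i = 3" | "i = 4" | "i = 5" | "i = 6" | "i = 7" using i by linarith
  then show ?thesis
  proof cases
    case 1 then show ?thesis using K4 K5 K6 by (simp add: numeral_eq_Suc ck3 drop4_row)
  next
    case 2
    have "order_ok (fl1 (map (row b) [0..<2])) (drop4 (row b 2))"
      using K4 K5 K6 f1[of "map (row b) [0..<2]"] by (simp add: drop4_row ck3 del: upt_Suc)
    with 2 show ?thesis by (simp add: numeral_eq_Suc)
  next
    case 5
    then show ?thesis using K4(3) f2[of "map (row b) [0..<5]"] by (simp add: numeral_eq_Suc)
  next
    case 6
    then show ?thesis using K5(3) f2[of "map (row b) [0..<6]"] by (simp add: numeral_eq_Suc)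
  next
    case 7
    then show ?thesis using K6(3) f2[of "map (row b) [0..<7]"] by (simp add: numeral_eq_Suc)
  qed (simp_all add: numeral_eq_Suc)
qed

lemma fixed_submatrix:
  assumes "nice a"
  obtains b r where "reach a b" "r \<in> {0, n1, n2, n3, n4, n5, n6, n7, n8, n9, n10}" "bmat 8 8 b = reps ! r"
proof -
  obtain i0 where i0: "i0 < 8" "weight (nbits (row a i0)) = 3" using weight_3[OF assms] by blast
  obtain b where b: "reach a b" "\<forall>i j. 1 \<le> i \<longrightarrow> i \<le> j \<longrightarrow> j < 8 \<longrightarrow> b 0 j = True \<longrightarrow> b 0 i = True"
    and bs: "(\<Sum>k<8. of_bool (b 0 k)) = (\<Sum>k<8. of_bool (a i0 k) :: nat)"
    using first_row[OF assms i0(1), of True] by blast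
  have b3: "(\<Sum>k<8. of_bool (b 0 k)) = (3 :: nat)" using bs i0(2) by (simp add: weight_row)
  note nb = reach_nice[OF b(1)]
  have r0: "row b 0 = num_of_nat 270" using row0_cases[OF nb b(2) b3] by simp
  \<comment> \<open>Row 0 does not distinguish the vertices 4 to 7. Since only these are permuted
    and the key refers to the vertices 0 to 3 otherwise, the key of a vertex moves along with
    it.\<close>
  define key where "key t = [b 1 t, b 2 t, b t 0, b t 1, b t 2, b t 3]" for t
  obtain p where p: "p permutes {4..<8}" and s: "\<And>i j. 4 \<le> i \<Longrightarrow> i \<le> j \<Longrightarrow> j < 8 \<Longrightarrow> key (p i) \<le> key (p j)"
    using sorting_permutation[of 4 8 key] by blast
  have p': "p permutes {..<8}" by (rule permutes_subset[OF p]) auto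
  obtain c where c: "reach b c" "\<And>i j. i < 8 \<Longrightarrow> j < 8 \<Longrightarrow> c i j = b (p i) (p j)"
    using reach_fixed[OF nb p'] by blast
  note nc = reach_nice[OF c(1)]
  have p4: "p i = i" if "i < 4" for i using permutes_not_in[OF p, of i] that by simp
  have p8: "4 \<le> p i \<and> p i < 8" if "4 \<le> i" "i < 8" for i using permutes_in_image[OF p, of i] that by simp
  have "row b 0 = pack [False, True, True, True, False, False, False, False]"
    unfolding r0 by (simp add: num_of_nat_numeral_eq)
  then have b0: "map (b 0) [0..<8] = [False, True, True, True, False, False, False, False]"
    by (metis nbits_pk row_def)
  have b0i: "b 0 i \<longleftrightarrow> 1 \<le> i \<and> i < 4" if "i < 8" for i
    using arg_cong[OF b0, of "\<lambda>l. l ! i"] that by (auto simp: nth_Cons' split: if_splits)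
  have "c 0 i = b 0 i" if "i < 8" for i
    using that p4[of 0] p4[of i] p8[of i] by (cases "i < 4") (auto simp: c(2) b0i)
  then have "row c 0 = row b 0" unfolding row_def by (intro arg_cong[of _ _ pack] map_cong) auto
  then have run: "s1run (leaf1 tree1) ord1 cd1 okw1 (row c 0)" using start1 r0 by simp
  have "[c 1 t, c 2 t] @ [c t 0, c t 1, c t 2, c t 3] = key (p t)" if "4 \<le> t" "t < 8" for t
    using that by (simp add: c(2) p4 key_def)
  then have srt: "ord1 (7 - i) (map (row c) [0..<i]) (row c i)" if "1 \<le> i" "i < 8" for i
    using s by (intro ord1_sorted that) (simp_all del: append.simps)
  have "leaf1 tree1 (map (row c) [0..<8])"
    by (rule s1run_complete[OF nice_lin[OF nc] run nice_lin_col[OF nc]]; (intro conjI srt row_in_cd nc)?) simp_all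
  moreover have "map nbits (map (row c) [0..<8]) = bmat 8 8 c"
    by (simp add: row_def bmat_def)
  ultimately have "leaf1a (bmat 8 8 c) (look tree1 (bmat 8 8 c))" by (simp add: leaf1_def leaf1b_def)
  then obtain ps r where r: "r \<in> {0, n1, n2, n3, n4, n5, n6, n7, n8, n9, n10}" "isperm 8 ps"
    "relab ps ps (bmat 8 8 c) = reps ! r"
    unfolding leaf1a_def by (auto simp: memn_iff eqm_iff eval_nat_numeral split: if_splits)
  have "length (reps ! r) = 8" using r(1) by (auto simp: reps_def)
  then have l: "length ps = 8" using r(3) by (metis length_map relab_map)
  note pp = perm_of_permutes[OF r(2) l]
  obtain d where d: "reach c d" "\<And>i j. i < 8 \<Longrightarrow> j < 8 \<Longrightarrow> d i j = c (perm_of ps i) (perm_of ps j)"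
    using reach_fixed[OF nc pp(1)] by blast
  have "bmat 8 8 d = relab ps ps (bmat 8 8 c)"
    using relab_bmat[OF pp(2) pp(2) l l, of c] d(2) l by (auto simp: bmat_eq_iff perm_of_def)
  then show ?thesis
    using that[of d r] reach_trans[OF reach_trans[OF b(1) c(1)] d(1)] r by simp
qed

subsection \<open>Completeness of the search for the arcs between fixed vertices and orbits\<close>

lemma half_div: "half n = n div 2"
  by (induction n rule: half.induct) auto

lemma monus_diff: "monus m n = m - n"
  by (induction m n rule: monus.induct) auto

lemma dblp_eq: "dblp m n = 2 * m + n"
  by (induction m) auto

lemma addn_eq: "addn m n = m + n"
  by (induction m) auto

lemma dot_Cons_True: "dot (x # xs) (True # ys) = of_bool x + dot xs ys"
  by (cases x) auto

lemma crow_map: "crow r (map f js) (map g js) (map h js) =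
    map (\<lambda>j. ((if h j then 6 else 4) - (of_bool (f j) + dot r (g j))) div 2) js"
  by (induction js) (auto simp: half_div monus_diff dot_Cons_True)

lemma cmat_map: "cmat (map r is) cs (map d is) = map (\<lambda>i. crow (r i) (r i) cs (d i)) is"
  by (induction "is") auto

lemma pair_specs_map: "pair_specs i (map m [i..<n]) (map c [i..<n]) (map x [i..<n]) (map y [i..<n]) =
    map (\<lambda>t. ((9 - weight (m t)) div 2, (9 - weight (c t)) div 2, take t (x t), take t (y t), x t ! t)) [i..<n]"
proof (induction "n - i" arbitrary: i)
  case (Suc k)
  then have "[i..<n] = i # [Suc i..<n]" "k = n - Suc i" by (simp_all add: upt_rec)
  then show ?case using Suc(1)[of "Suc i"] by (simp add: half_div monus_diff numeral_eq_Suc)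
qed simp

lemma idm8_bmat: "idm8 = bmat 8 8 (=)"
  by (simp add: idm8_def bits_numeral bmat_def upt_rec)

lemma idm7_bmat: "idm7 = bmat 7 7 (=)"
  by (simp add: idm7_def bits_numeral bmat_def upt_rec)

definition nrow :: "(nat \<Rightarrow> nat \<Rightarrow> bool) \<Rightarrow> nat \<Rightarrow> bool list" where
  "nrow a i = map (\<lambda>l. a i (8 + l)) [0..<7]"

definition kcol :: "(nat \<Rightarrow> nat \<Rightarrow> bool) \<Rightarrow> nat \<Rightarrow> bool list" where
  "kcol a i = map (\<lambda>l. a (8 + l) i) [0..<7]"

definition nk :: "(nat \<Rightarrow> nat \<Rightarrow> bool) \<Rightarrow> nat \<Rightarrow> nat \<Rightarrow> nat" where
  "nk a i k = dot (nrow a i) (kcol a k)"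

definition spect :: "(nat \<Rightarrow> nat \<Rightarrow> bool) \<Rightarrow> nat \<Rightarrow> nat \<times> nat \<times> nat list \<times> nat list \<times> nat" where
  "spect a i = (weight (nrow a i), weight (kcol a i), map (nk a i) [0..<i], map (\<lambda>k. nk a k i) [0..<i], nk a i i)"

lemma cmat_nice:
  assumes "nice a"
  shows "cmat (bmat 8 8 a) (bmat 8 8 (\<lambda>i j. a j i)) idm8 = bmat 8 8 (nk a)"
proof -
  have D: "((if i = j then 6 else 4) - (of_bool (a i j) + dot (map (a i) [0..<8]) (map (\<lambda>i. a i j) [0..<8]))) div 2 = nk a i j"
    if "i < 8" "j < 8" for i j
    using nice_FF[OF assms that] unfolding nk_def nrow_def kcol_def dot_upt by (auto split: if_splits)
  show ?thesis unfolding idm8_bmat by (auto simp: bmat_def cmat_map crow_map D)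
qed

lemma spec_nice:
  assumes "nice a"
  shows "spec (bmat 8 8 a) = map (spect a) [0..<8]"
proof -
  have w: "(9 - weight (map (a i) [0..<8])) div 2 = weight (nrow a i)" "(9 - weight (map (\<lambda>k. a k i) [0..<8])) div 2 = weight (kcol a i)"
    if "i < 8" for i
    using nice_row[OF assms that] nice_col[OF assms that] unfolding nrow_def kcol_def weight_upt by auto
  have "spec (bmat 8 8 a) = pair_specs 0 (bmat 8 8 a) (bmat 8 8 (\<lambda>i j. a j i)) (bmat 8 8 (nk a)) (bmat 8 8 (\<lambda>i j. nk a j i))"
    by (simp add: spec_def spec1_def spec2_def transposed_bmat cmat_nice[OF assms])
  also have "\<dots> = map (spect a) [0..<8]"
    unfolding bmat_def pair_specs_map spect_def by (auto simp: w take_map)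
  finally show ?thesis .
qed

lemma dot_commute: "dot xs ys = dot ys xs"
proof (induction xs arbitrary: ys)
  case Nil
  show ?case
  proof (cases ys)
    case (Cons y zs) then show ?thesis by (cases y) simp_all
  qed simp
next
  case (Cons x xs)
  show ?case
  proof (cases ys)
    case Nil then show ?thesis by (cases x) simp_all
  next
    case (Cons y zs) then show ?thesis using Cons.IH[of zs] by (cases x; cases y) simp_all
  qed
qed

lemma filter_dot_set: "set (filter_dot k c xs) = {x \<in> set xs. dot x k = c}"
  by (induction xs) (auto simp: dot_is_iff)

lemma filter_dots_set: "length ks = length cs \<Longrightarrow> set (filter_dots ks cs xs) = {x \<in> set xs. \<forall>i<length ks. dot x (ks ! i) = cs ! i}"
proof (induction ks cs xs rule: filter_dots.induct)
  case (1 k ks c cs xs)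
  then show ?case by (auto simp: filter_dot_set All_less_Suc2)
qed auto

lemma all_columns_iff: "all_columns h d x es ks \<longleftrightarrow> (\<forall>k\<in>set ks. dot x k = d \<longrightarrow> order_ok es k \<longrightarrow> h k (ties es k))"
  by (induction ks) (auto simp: dot_is_iff)

lemma all_pairs_iff: "all_pairs g d es xs ks \<longleftrightarrow>
    (\<forall>x\<in>set xs. order_ok es x \<longrightarrow> (\<forall>k\<in>set ks. dot x k = d \<longrightarrow> order_ok (ties es x) k \<longrightarrow> g x k (ties (ties es x) k)))"
  by (induction xs) (auto simp: all_columns_iff)

lemma set_wds7: "set (wds7 k) = {x. length x = 7 \<and> weight x = k}"
  unfolding wds7_def filt_filter set_filter set_wds eqn_iff by (simp add: numeral_eq_Suc)

text \<open>The entries of column \<open>l\<close> of \<open>N\<close> and row \<open>l\<close> of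
  \<open>K\<close> in the order in which the search fixes them: position \<open>2 i\<close> belongs
  to row \<open>i\<close> of \<open>N\<close> and the next one to column \<open>i\<close> of
  \<open>K\<close>. Sorting the orbits by this key makes every intermediate test a comparison of
  prefixes.\<close>

definition okey :: "(nat \<Rightarrow> nat \<Rightarrow> bool) \<Rightarrow> nat \<Rightarrow> bool list" where
  "okey a l = map (\<lambda>m. if even m then a (m div 2) (8 + l) else a (8 + l) (m div 2)) [0..<16]"

definition tied :: "(nat \<Rightarrow> nat \<Rightarrow> bool) \<Rightarrow> nat \<Rightarrow> bool list" where
  "tied a m = map (\<lambda>t. take m (okey a t) = take m (okey a (Suc t))) [0..<6]"

text \<open>Between two keys in lexicographic order that agree in the first \<open>m\<close>
  entries, the next entry cannot decrease.\<close>

lemma tied_step: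
  assumes "\<And>t. t < 6 \<Longrightarrow> okey a t \<le> okey a (Suc t)" "m < 16" "x = map (\<lambda>t. okey a t ! m) [0..<7]"
  shows "order_ok (tied a m) x" "ties (tied a m) x = tied a (Suc m)"
proof -
  have l: "length x = Suc (length (tied a m))" using assms(3) by (simp add: tied_def)
  have x: "x ! t = okey a t ! m" if "t < 7" for t using assms(3) that by simp
  have o: "length (okey a t) = 16" for t by (simp add: okey_def)
  show "order_ok (tied a m) x"
    unfolding order_ok_iff[OF l] using lex_nth[OF assms(1)] assms(2)
    by (auto simp: tied_def x o)
  show "ties (tied a m) x = tied a (Suc m)"
  proof (rule nth_equalityI)
    show len: "length (ties (tied a m) x) = length (tied a (Suc m))" unfolding length_ne[OF l] by (simp add: tied_def)
    fix t assume "t < length (ties (tied a m) x)"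
    then have "t < 6" unfolding len by (simp add: tied_def)
    then show "ties (tied a m) x ! t = tied a (Suc m) ! t"
      using ties_nth[OF l, of t] assms(2) by (simp add: tied_def x take_Suc_conv_app_nth o)
  qed
qed

lemma pair_search_complete:
  assumes "pair_search P (map (spect a) [8 - n..<8]) (map (nrow a) [0..<8 - n]) (map (kcol a) [0..<8 - n]) (tied a (2 * (8 - n)))"
    and "n \<le> 8" "\<And>t. t < 6 \<Longrightarrow> okey a t \<le> okey a (Suc t)"
  shows "P (map (nrow a) [0..<8]) (map (kcol a) [0..<8])"
  using assms
proof (induction n)
  case (Suc n)
  let ?i = "8 - Suc n"
  have i: "?i < 8" "8 - n = Suc ?i" "[?i..<8] = ?i # [Suc ?i..<8]" using Suc.prems(2) by (auto simp: upt_rec)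
  have n: "nrow a ?i = map (\<lambda>t. okey a t ! (2 * ?i)) [0..<7]" using i(1) by (simp add: nrow_def okey_def)
  have k: "kcol a ?i = map (\<lambda>t. okey a t ! Suc (2 * ?i)) [0..<7]" using i(1) by (simp add: kcol_def okey_def)
  note 1 = tied_step[OF Suc.prems(3) _ n]
  note 2 = tied_step[OF Suc.prems(3) _ k]
  have H: "\<forall>x\<in>set (filter_dots (map (kcol a) [0..<?i]) (map (nk a ?i) [0..<?i]) (wds7 (weight (nrow a ?i)))). order_ok (tied a (2 * ?i)) x \<longrightarrow>
      (\<forall>k\<in>set (filter_dots (map (nrow a) [0..<?i]) (map (\<lambda>k. nk a k ?i) [0..<?i]) (wds7 (weight (kcol a ?i)))).
        dot x k = nk a ?i ?i \<longrightarrow> order_ok (ties (tied a (2 * ?i)) x) k \<longrightarrow>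
        pair_search P (map (spect a) [Suc ?i..<8]) (map (nrow a) [0..<?i] @ [x]) (map (kcol a) [0..<?i] @ [k])
          (ties (ties (tied a (2 * ?i)) x) k))"
    using Suc.prems(1) unfolding i(3) list.map pair_search.simps spect_def[of a ?i] prod.case all_pairs_iff .
  have nr: "nrow a ?i \<in> set (filter_dots (map (kcol a) [0..<?i]) (map (nk a ?i) [0..<?i]) (wds7 (weight (nrow a ?i))))"
    by (simp add: filter_dots_set set_wds7 nk_def) (simp add: nrow_def)
  have kc: "kcol a ?i \<in> set (filter_dots (map (nrow a) [0..<?i]) (map (\<lambda>k. nk a k ?i) [0..<?i]) (wds7 (weight (kcol a ?i))))"
    by (simp add: filter_dots_set set_wds7 nk_def dot_commute) (simp add: kcol_def)
  have "pair_search P (map (spect a) [Suc ?i..<8]) (map (nrow a) [0..<?i] @ [nrow a ?i]) (map (kcol a) [0..<?i] @ [kcol a ?i])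
      (ties (ties (tied a (2 * ?i)) (nrow a ?i)) (kcol a ?i))"
    by (rule H[rule_format, OF nr _ kc]) (use 1 2 i(1) in \<open>simp_all add: nk_def\<close>)
  then show ?case
    using Suc.IH Suc.prems(2,3) 1 2 i by simp
qed simp

lemma sorted_orbits:
  assumes "nice a"
  obtains b where "reach a b" "bmat 8 8 b = bmat 8 8 a" "\<And>t. t < 6 \<Longrightarrow> okey b t \<le> okey b (Suc t)"
proof -
  obtain p where p: "p permutes {0..<7}" and s: "\<And>i j. 0 \<le> i \<Longrightarrow> i \<le> j \<Longrightarrow> j < 7 \<Longrightarrow> okey a (p i) \<le> okey a (p j)"
    using sorting_permutation[of 0 7 "okey a"] by blast
  have p': "p permutes {..<7}" using p by (simp add: atLeast0LessThan)
  define b where "b x y = a (lift id p (\<lambda>_. False) x) (lift id p (\<lambda>_. False) y)" for x y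
  have r: "reach a b"
    using reach_lift[OF assms permutes_id p', of "\<lambda>_. False"] unfolding b_def .
  have B: "b i (8 + l) = a i (8 + p l)" "b (8 + l) i = a (8 + p l) i" if "i < 8" "l < 7" for i l
    using that by (simp_all add: b_def lift_def)
  have "okey b t = okey a (p t)" if "t < 7" for t
    using that by (auto simp: okey_def B)
  moreover have "bmat 8 8 b = bmat 8 8 a" by (rule bmat_cong) (simp add: b_def lift_def)
  ultimately show ?thesis using that[OF r] s by simp
qed

definition nmat :: "(nat \<Rightarrow> nat \<Rightarrow> bool) \<Rightarrow> bool list list" where "nmat a = bmat 8 7 (\<lambda>i l. a i (8 + l))"
definition kmat :: "(nat \<Rightarrow> nat \<Rightarrow> bool) \<Rightarrow> bool list list" where "kmat a = bmat 8 7 (\<lambda>i l. a (8 + l) i)"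

lemma pair_search_spec:
  assumes "nice a" "pair_search P (spec (bmat 8 8 a)) [] [] trues6"
  obtains b where "reach a b" "bmat 8 8 b = bmat 8 8 a" "P (nmat b) (kmat b)"
proof -
  obtain b where b: "reach a b" "bmat 8 8 b = bmat 8 8 a" "\<And>t. t < 6 \<Longrightarrow> okey b t \<le> okey b (Suc t)"
    using sorted_orbits[OF assms(1)] by metis
  have "trues6 = tied b 0" by (simp add: trues6_def tied_def bits_numeral upt_rec)
  then have "pair_search P (map (spect b) [8 - 8..<8]) (map (nrow b) [0..<8 - 8]) (map (kcol b) [0..<8 - 8]) (tied b (2 * (8 - 8)))"
    using assms(2) spec_nice[OF reach_nice[OF b(1)]] b(2) by simp
  then have "P (map (nrow b) [0..<8]) (map (kcol b) [0..<8])"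
    by (rule pair_search_complete) (use b(3) in auto)
  moreover have "map (nrow b) [0..<8] = nmat b" "map (kcol b) [0..<8] = kmat b"
    by (auto simp: nmat_def kmat_def bmat_def nrow_def kcol_def)
  ultimately show ?thesis using that b by simp
qed

subsection \<open>The sums of the blocks of arcs between orbits\<close>

definition orbit_sum :: "(nat \<Rightarrow> nat \<Rightarrow> bool) \<Rightarrow> nat \<Rightarrow> nat \<Rightarrow> nat" where
  "orbit_sum a l j = of_bool (a (8 + l) (8 + j)) + of_bool (a (8 + l) (15 + j))"

definition kn_ok :: "(nat \<Rightarrow> nat \<Rightarrow> bool) \<Rightarrow> bool" where
  "kn_ok a \<longleftrightarrow> (\<forall>l<7. \<forall>m<7. 2 * (\<Sum>i<8. of_bool (a (8 + l) i \<and> a i (8 + m))) + 4 =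
     (if l = m then 2 else 0) + (\<Sum>i<8. of_bool (a i (8 + m))) + (\<Sum>i<8. of_bool (a (8 + l) i) :: nat))"

lemma knrow_map: "knrow k (map c is) (map d is) \<longleftrightarrow>
    (\<forall>m\<in>set is. 2 * dot k (c m) + 4 = (if d m then 2 else 0) + weight (c m) + weight k)"
  by (induction "is") (auto simp: eqn_iff dblp_eq addn_eq)

lemma knok_map: "knok (map k is) cs (map d is) \<longleftrightarrow> (\<forall>l\<in>set is. knrow (k l) cs (d l))"
  by (induction "is") auto

lemma transposed_nmat: "transposed (nmat a) = bmat 7 8 (\<lambda>l i. a i (8 + l))" by (simp add: nmat_def transposed_bmat)
lemma transposed_kmat: "transposed (kmat a) = bmat 7 8 (\<lambda>l i. a (8 + l) i)" by (simp add: kmat_def transposed_bmat)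

lemma kn_ok_iff: "knok (transposed (kmat a)) (transposed (nmat a)) idm7 \<longleftrightarrow> kn_ok a"
  unfolding transposed_nmat transposed_kmat idm7_bmat by (simp add: bmat_def knok_map knrow_map dot_upt weight_upt kn_ok_def atLeast0LessThan Ball_def)

text \<open>With \<open>S = P + Q\<close>, the equation \<open>N S = 4 J - N - M N\<close> is
  multiplied by \<open>2 K\<close> from the left, and \<open>2 K N\<close> is replaced by means of
  \<open>kn_ok\<close>. Apart from \<open>2 S\<close>, only the column sums of \<open>S\<close> and
  of \<open>N S\<close> remain, and these are known. With \<open>n\<close> the sum of column
  \<open>j\<close> of \<open>N\<close>, both sides carry an extra \<open>n + 3\<close>, which the
  shifts by one in the evaluated form produce.\<close>

lemma orbit_sum_formula:
  assumes "nice a" "kn_ok a" "l < 7" "j < 7"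
  defines "e \<equiv> \<lambda>i. Suc (of_bool (a i (8 + j)) + (\<Sum>k<8. of_bool (a i k \<and> a k (8 + j))))"
  shows "2 * orbit_sum a l j + 5 * (\<Sum>i<8. of_bool (a i (8 + j))) + 7 + 2 * (\<Sum>i<8. of_bool (a (8 + l) i) * e i)
    = Suc (\<Sum>i<8. of_bool (a i (8 + j))) * Suc (\<Sum>i<8. of_bool (a (8 + l) i)) + 2 + (\<Sum>i<8. e i)"
proof -
  define n where "n m = (\<Sum>i<8. of_bool (a i (8 + m)) :: int)" for m
  define k where "k = (\<Sum>i<8. of_bool (a (8 + l) i) :: int)"
  define s where "s m = int (orbit_sum a m j)" for m
  \<comment> \<open>The constant is 5 and not 4 because \<open>e\<close> contains an additional
    one.\<close>
  have NS: "(\<Sum>m<7. of_bool (a i (8 + m)) * s m) = 5 - int (e i)" if "i < 8" for i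
  proof -
    have "(\<Sum>m<7. of_bool (a i (8 + m)) * s m) = int ((\<Sum>l<7. of_bool (a i (8 + l) \<and> a (8 + l) (8 + j)))
      + (\<Sum>l<7. of_bool (a i (8 + l) \<and> a (8 + l) (15 + j))))"
      unfolding of_nat_add of_nat_sum sum.distrib[symmetric] by (intro sum.cong) (auto simp: s_def orbit_sum_def)
    then show ?thesis using nice_FO[OF assms(1) that assms(4)] unfolding e_def by linarith
  qed
  have KN: "2 * (\<Sum>i<8. of_bool (a (8 + l) i) * of_bool (a i (8 + m))) = (if l = m then 2 else 0) + n m + k - (4 :: int)"
    if "m < 7" for m
  proof -
    have "2 * (\<Sum>i<8. of_bool (a (8 + l) i \<and> a i (8 + m))) + 4 =
     (if l = m then 2 else 0) + (\<Sum>i<8. of_bool (a i (8 + m))) + (\<Sum>i<8. of_bool (a (8 + l) i) :: nat)"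
      using assms(2,3) that unfolding kn_ok_def by blast
    from arg_cong[OF this, of int] show ?thesis
      by (simp add: n_def k_def of_bool_conj split: if_splits)
  qed
  have c: "(\<Sum>m<7. s m) = 9 - n j"
    using arg_cong[OF nice_colO[OF assms(1,4)], of int] by (simp add: s_def orbit_sum_def n_def sum.distrib)
  have "2 * (\<Sum>i<8. of_bool (a (8 + l) i) * (5 - int (e i))) =
      2 * (\<Sum>i<8. of_bool (a (8 + l) i) * (\<Sum>m<7. of_bool (a i (8 + m)) * s m))"
    by (intro arg_cong[of _ _ "(*) 2"] sum.cong refl) (simp only: NS lessThan_iff)
  also have "\<dots> = (\<Sum>m<7. (2 * (\<Sum>i<8. of_bool (a (8 + l) i) * of_bool (a i (8 + m)))) * s m)"
    unfolding sum_distrib_left sum_distrib_right by (subst sum.swap) (simp add: mult_ac)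
  also have "\<dots> = (\<Sum>m<7. ((if l = m then 2 else 0) + n m + k - 4) * s m)"
    by (intro sum.cong refl) (simp only: KN lessThan_iff)
  also have "\<dots> = (\<Sum>m<7. (if l = m then 2 * s m else 0)) + (\<Sum>m<7. n m * s m) + (k - 4) * (\<Sum>m<7. s m)"
    unfolding sum_distrib_left sum.distrib[symmetric] by (intro sum.cong) (auto simp: algebra_simps)
  also have "(\<Sum>m<7. (if l = m then 2 * s m else 0)) = 2 * s l" using assms(3) by simp
  \<comment> \<open>The column sums of \<open>N\<close>, paired with a column of \<open>S\<close>,
    give a column sum of \<open>N S\<close>.\<close>
  also have "(\<Sum>m<7. n m * s m) = (\<Sum>i<8. \<Sum>m<7. of_bool (a i (8 + m)) * s m)"
    unfolding n_def sum_distrib_right by (rule sum.swap)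
  also have "\<dots> = (\<Sum>i<8. 5 - int (e i))" by (intro sum.cong refl) (simp only: NS lessThan_iff)
  also have "\<dots> = 40 - (\<Sum>i<8. int (e i))" by (simp add: sum_subtractf)
  finally have "10 * k - 2 * (\<Sum>i<8. of_bool (a (8 + l) i) * int (e i)) =
      2 * s l + (40 - (\<Sum>i<8. int (e i))) + (k - 4) * (9 - n j)"
    unfolding c by (simp add: right_diff_distrib sum_subtractf k_def sum_distrib_left[symmetric] sum_distrib_right[symmetric])
  then have "2 * s l + 5 * n j + 7 + 2 * (\<Sum>i<8. of_bool (a (8 + l) i) * int (e i)) = (1 + n j) * (1 + k) + 2 + (\<Sum>i<8. int (e i))"
    by (simp add: algebra_simps)
  then have "int (2 * orbit_sum a l j + 5 * (\<Sum>i<8. of_bool (a i (8 + j))) + 7 + 2 * (\<Sum>i<8. of_bool (a (8 + l) i) * e i))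
    = int (Suc (\<Sum>i<8. of_bool (a i (8 + j))) * Suc (\<Sum>i<8. of_bool (a (8 + l) i)) + 2 + (\<Sum>i<8. e i))"
    by (simp add: s_def n_def k_def algebra_simps)
  then show ?thesis by (simp only: of_nat_eq_iff)
qed

lemma nat_of_un: "nat_of_num (suc_num n) = Suc n"
  by (induction n) (auto simp: nat_of_num_inc)

lemma nat_of_wsum: "nat_of_num (wsum (map f is) (map g is) x) = nat_of_num x + (\<Sum>i\<leftarrow>is. of_bool (f i) * nat_of_num (g i))"
proof (induction "is" arbitrary: x)
  case (Cons i "is") then show ?case by (cases "f i") (auto simp: nat_of_num_add)
qed simp

lemma nat_of_nsum: "nat_of_num (nsum (map g is) x) = nat_of_num x + (\<Sum>i\<leftarrow>is. nat_of_num (g i))"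
  by (induction "is" arbitrary: x) (auto simp: nat_of_num_add)

lemma ecol_map: "ecol (map m is) (map f is) c = map (\<lambda>i. suc_num (of_bool (f i) + dot (m i) c)) is"
  by (induction "is") (auto simp: dot_Cons_True)

lemma slhs_srhs:
  assumes "nice a" "kn_ok a" "l < 7" "j < 7"
  defines "c \<equiv> map (\<lambda>i. a i (8 + j)) [0..<8]" and "k \<equiv> map (\<lambda>i. a (8 + l) i) [0..<8]"
  shows "2 * orbit_sum a l j + nat_of_num (slhs (ecol (bmat 8 8 a) c c) k c) = nat_of_num (srhs (ecol (bmat 8 8 a) c c) k c)"
proof -
  have e: "ecol (bmat 8 8 a) c c = map (\<lambda>i. suc_num (of_bool (a i (8 + j)) + (\<Sum>k<8. of_bool (a i k \<and> a k (8 + j))))) [0..<8]"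
    unfolding bmat_def c_def ecol_map dot_upt ..
  show ?thesis
    using orbit_sum_formula[OF assms(1-4)]
    unfolding slhs_def srhs_def e k_def
    by (simp add: nat_of_num_add nat_of_num_mult nat_of_wsum nat_of_nsum nat_of_un sum_upt weight_upt c_def)
qed

lemma eqnum_nat: "eqnum x y \<longleftrightarrow> nat_of_num x = nat_of_num y"
  by (simp add: eqnum_iff num_eq_iff)

lemma orbit_sum_le: "orbit_sum a l j \<le> 2" "nice a \<Longrightarrow> l < 7 \<Longrightarrow> orbit_sum a l l \<le> 1"
  using nice_diag[of a "8 + l"] by (auto simp: orbit_sum_def of_bool_def)

lemma le_2_cases: "(s :: nat) \<le> 2 \<Longrightarrow> s = 0 \<or> s = 1 \<or> s = 2" by auto

lemma sval_eq: "2 * s + nat_of_num l = nat_of_num r \<Longrightarrow> s \<le> 2 \<Longrightarrow> sval l r = s"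
  using le_2_cases[of s] by (auto simp: sval_def eqnum_nat nat_of_num_add)

lemma not_sbad: "2 * s + nat_of_num l = nat_of_num r \<Longrightarrow> s \<le> 2 \<Longrightarrow> (dg \<longrightarrow> s \<le> 1) \<Longrightarrow> \<not> sbad dg l r"
  using le_2_cases[of s] by (auto simp: sbad_def eqnum_nat nat_of_num_add)

lemma not_bad:
  assumes "nice a" "kn_ok a" "l < 7" "j < 7"
  shows "\<not> bad (bmat 8 8 a) (transposed (nmat a)) (transposed (kmat a)) l j"
  using not_sbad[OF slhs_srhs[OF assms] orbit_sum_le(1), of "eqn l j"] orbit_sum_le(2)[OF assms(1,3)] assms(3,4)
  by (auto simp: bad_def badc_def bade_def transposed_nmat transposed_kmat eqn_iff)

lemma scol_map: "scol e c (map k is) = map (\<lambda>l. sval (slhs e (k l) c) (srhs e (k l) c)) is"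
  by (induction "is") auto

lemma scols_map: "scols M Kr (map c is) = map (\<lambda>j. scol (ecol M (c j) (c j)) (c j) Kr) is"
  by (induction "is") auto

lemma scols_ssum2:
  assumes "nice a" "kn_ok a"
  shows "scols (bmat 8 8 a) (transposed (kmat a)) (transposed (nmat a)) = bmat 7 7 (\<lambda>j l. orbit_sum a l j)"
  unfolding transposed_nmat transposed_kmat bmat_def[of 7] scols_map scol_map
  using sval_eq[OF slhs_srhs[OF assms] orbit_sum_le(1)] by simp

text \<open>Index bounds and list lengths are not tested at the leaves of the search; they are
  verified once for the whole tree.\<close>

primrec cert_ok :: "cert \<Rightarrow> bool" where
  "cert_ok (Bad l j) \<longleftrightarrow> l < 7 \<and> j < 7"
| "cert_ok (Iso ps qs c) \<longleftrightarrow> length ps = 8 \<and> length qs = 7"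

lemma look_pred: "pred_dtree P t \<Longrightarrow> P (look t X)"
  by (induction t) auto

lemma tree2_certs: "pred_dtree (\<lambda>cs. length cs = 7 \<and> list_all cert_ok cs) tree2"
  by (simp add: tree2_def)

lemma certs_ok_nth: "certs_ok r Ms N K Nc Kr cs \<Longrightarrow> i < length Ms \<Longrightarrow> i < length cs \<Longrightarrow> cert_holds (r + i) (Ms ! i) N K Nc Kr (cs ! i)"
proof (induction r Ms N K Nc Kr cs arbitrary: i rule: certs_ok.induct)
  case (1 r M Ms N K Nc Kr c cs)
  then show ?case by (cases i) (auto split: if_splits)
qed auto

lemma pair_search_good: "r < 7 \<Longrightarrow> pair_search (leaf2a tree2) (spec (reps ! r)) [] [] trues6"
proof -
  assume "r < 7"
  then consider "r = 0" | "r = n1" | "r = n2" | "r = n3" | "r = n4" | "r = n5" | "r = n6" by linarith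
  then show ?thesis
    by cases (simp_all only: pair_search_0 spec_1 spec_2 spec_3 spec_4 spec_5 spec_6)
qed

text \<open>The identity for \<open>K N\<close> is tested at the leaf, while the listed case belongs
  to a relabelled matrix; the identity has to follow it.\<close>

lemma kn_ok_relabel:
  assumes "kn_ok a" "p permutes {..<8}" "q permutes {..<7}"
    and "\<And>i l. i < 8 \<Longrightarrow> l < 7 \<Longrightarrow> b i (8 + l) = a (p i) (8 + q l)"
    and "\<And>i l. i < 8 \<Longrightarrow> l < 7 \<Longrightarrow> b (8 + l) i = a (8 + q l) (p i)"
  shows "kn_ok b"
  unfolding kn_ok_def
proof (intro allI impI)
  fix l m :: nat assume lm: "l < 7" "m < 7"
  have q: "q l < 7" "q m < 7" "q l = q m \<longleftrightarrow> l = m"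
    using lm permutes_in_image[OF assms(3), of l] permutes_in_image[OF assms(3), of m] permutes_inj[OF assms(3)]
    by (auto dest: injD)
  have s: "(\<Sum>i<8. f (p i)) = (\<Sum>i<8. f i)" for f :: "nat \<Rightarrow> nat"
    using sum.permute[OF assms(2), of f] by (simp add: comp_def)
  have "(\<Sum>i<8. of_bool (b (8 + l) i \<and> b i (8 + m))) = (\<Sum>i<8. of_bool (a (8 + q l) (p i) \<and> a (p i) (8 + q m)) :: nat)"
    "(\<Sum>i<8. of_bool (b i (8 + m))) = (\<Sum>i<8. of_bool (a (p i) (8 + q m)) :: nat)"
    "(\<Sum>i<8. of_bool (b (8 + l) i)) = (\<Sum>i<8. of_bool (a (8 + q l) (p i)) :: nat)"
    by (intro sum.cong; simp add: assms(4,5) lm)+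
  then show "2 * (\<Sum>i<8. of_bool (b (8 + l) i \<and> b i (8 + m))) + 4 =
     (if l = m then 2 else 0) + (\<Sum>i<8. of_bool (b i (8 + m))) + (\<Sum>i<8. of_bool (b (8 + l) i) :: nat)"
    using assms(1) q unfolding kn_ok_def
    by (simp add: s[of "\<lambda>i. of_bool (a _ i \<and> a i _)"] s[of "\<lambda>i. of_bool (a i _)"] s[of "\<lambda>i. of_bool (a _ i)"])
qed

lemma cmat_7: "cmat (reps ! n7) (transposed (reps ! n7)) idm8 = [[n1, 0, n1, n1, n1, n1, n1, n1], [0, n1, n1, n1, n1, n1, n1, n1], [n1, n1, n2, n1, n1, n1, n1, n1], [n1, n1, n1, n2, n1, n1, n1, n1], [n1, n1, n1, n1, n2, n1, n1, n2], [n1, n1, n1, n1, n1, n2, n1, n1], [n1, n1, n1, n2, n1, n1, n2, n1], [n1, n1, n1, n1, n1, n1, n1, n2]]"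
  by (simp only: reps_def spec_ev cong: wcongs)

lemma card_bool_lists: "card {xs :: bool list. length xs = n} = 2 ^ n"
  using card_lists_length_eq[of "UNIV :: bool set" n] by simp

lemma odd_sum_neq: "odd (\<Sum>i<n. of_bool ((x i \<noteq> y i) \<and> z i) :: nat) \<longleftrightarrow>
    odd (\<Sum>i<n. of_bool (x i \<and> z i) :: nat) \<noteq> odd (\<Sum>i<n. of_bool (y i \<and> z i) :: nat)" for n :: nat
  by (induction n) auto

text \<open>The \<open>2\<^sup>8\<close> sums modulo two of the rows of \<open>N\<close> cannot be distinct.\<close>

lemma even_rows:
  obtains d :: "nat \<Rightarrow> bool" and i where "i < 8" "d i" "\<And>j. even (\<Sum>i<8. of_bool (d i) * nk a i j)"
proof -
  let ?X = "{xs :: bool list. length xs = 8}" and ?Y = "{xs :: bool list. length xs = 7}"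
  define par where "par xs = map (\<lambda>l. odd (\<Sum>i<8. of_bool (xs ! i \<and> a i (8 + l)) :: nat)) [0..<7]" for xs
  have "finite ?Y" by (rule card_ge_0_finite) (simp add: card_bool_lists)
  moreover have "par ` ?X \<subseteq> ?Y" by (auto simp: par_def)
  ultimately have "card (par ` ?X) \<le> card ?Y" by (rule card_mono)
  then have "\<not> inj_on par ?X" using card_image[of par ?X] by (auto simp: card_bool_lists)
  then obtain xs ys where xy: "length xs = 8" "length ys = 8" "par xs = par ys" "xs \<noteq> ys" by (auto simp: inj_on_def)
  define d where "d i = (xs ! i \<noteq> ys ! i)" for i
  have e: "even (\<Sum>i<8. of_bool (d i \<and> a i (8 + l)) :: nat)" if "l < 7" for l
    using arg_cong[OF xy(3), of "\<lambda>p. p ! l"] that odd_sum_neq[of "(!) xs" "(!) ys" "\<lambda>i. a i (8 + l)" 8] by (simp add: par_def d_def)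
  have "even (\<Sum>i<8. of_bool (d i) * nk a i j)" for j
  proof -
    have "(\<Sum>i<8. of_bool (d i) * nk a i j) = (\<Sum>l<7. of_bool (a (8 + l) j) * (\<Sum>i<8. of_bool (d i \<and> a i (8 + l))))"
      unfolding nk_def nrow_def kcol_def dot_upt sum_distrib_left
      by (subst sum.swap) (simp add: of_bool_conj mult_ac)
    then show ?thesis by (simp only:) (rule dvd_sum, rule dvd_mult, rule e, simp)
  qed
  moreover obtain i where "i < 8" "d i" using xy(1,2,4) by (auto simp: d_def list_eq_iff_nth_eq)
  ultimately show ?thesis by (intro that)
qed

lemma sum_8: "(\<Sum>i<8. f i) = f 0 + f 1 + f 2 + f 3 + f 4 + f 5 + f 6 + f 7" for f :: "nat \<Rightarrow> nat"
  by (simp add: eval_nat_numeral)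

lemma not_rep_7:
  assumes "nice a"
  shows "bmat 8 8 a \<noteq> reps ! n7"
proof
  assume r: "bmat 8 8 a = reps ! n7"
  have "bmat 8 8 (nk a) = [[n1, 0, n1, n1, n1, n1, n1, n1], [0, n1, n1, n1, n1, n1, n1, n1], [n1, n1, n2, n1, n1, n1, n1, n1], [n1, n1, n1, n2, n1, n1, n1, n1], [n1, n1, n1, n1, n2, n1, n1, n2], [n1, n1, n1, n1, n1, n2, n1, n1], [n1, n1, n1, n2, n1, n1, n2, n1], [n1, n1, n1, n1, n1, n1, n1, n2]]"
    using cmat_7 cmat_nice[OF assms] unfolding r[symmetric] by (simp add: transposed_bmat)
  then have k: "\<forall>i<8. \<forall>j<8. nk a i j = [[n1, 0, n1, n1, n1, n1, n1, n1], [0, n1, n1, n1, n1, n1, n1, n1], [n1, n1, n2, n1, n1, n1, n1, n1], [n1, n1, n1, n2, n1, n1, n1, n1], [n1, n1, n1, n1, n2, n1, n1, n2], [n1, n1, n1, n1, n1, n2, n1, n1], [n1, n1, n1, n2, n1, n1, n2, n1], [n1, n1, n1, n1, n1, n1, n1, n2]] ! i ! j"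
    by (metis bmat_def length_bmat nth_bmat nth_map_upt add_0 diff_zero)
  obtain d i where d: "i < 8" "d i" "\<And>j. even (\<Sum>i<8. of_bool (d i) * nk a i j)" using even_rows by metis
  have e: "even (of_bool (d 0) * nk a 0 j + of_bool (d 1) * nk a 1 j + of_bool (d 2) * nk a 2 j + of_bool (d 3) * nk a 3 j
    + of_bool (d 4) * nk a 4 j + of_bool (d 5) * nk a 5 j + of_bool (d 6) * nk a 6 j + of_bool (d 7) * nk a 7 j)" for j
    using d(3)[of j] unfolding sum_8 .
  \<comment> \<open>The parities of the eight columns are linear equations modulo two for
    \<open>d\<close> with the zero vector as the only solution.\<close>
  have "\<not> d 0 \<and> \<not> d 1 \<and> \<not> d 2 \<and> \<not> d 3 \<and> \<not> d 4 \<and> \<not> d 5 \<and> \<not> d 6 \<and> \<not> d 7"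
    using e[of 0] e[of 1] e[of 2] e[of 3] e[of 4] e[of 5] e[of 6] e[of 7]
    by (simp add: k) (cases "d 0"; cases "d 1"; cases "d 2"; cases "d 3"; cases "d 4"; cases "d 5"; cases "d 6"; cases "d 7"; simp)
  moreover have "i = 0 \<or> i = 1 \<or> i = 2 \<or> i = 3 \<or> i = 4 \<or> i = 5 \<or> i = 6 \<or> i = 7" using d(1) by linarith
  ultimately show False using d(2) by blast
qed

text \<open>Three reductions are chained: to a representative for \<open>M\<close>, to sorted
  orbits, and, through an \<open>Iso\<close> certificate, to the stored labelling. A
  \<open>Bad\<close> certificate contradicts the existence of the matrix.\<close>

lemma case_reached:
  assumes "nice a"
  obtains b c r N K its where "reach a b" "c \<in> set all_cases" "c () = (r, N, K, its)" "bmat 8 8 b = reps ! r"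
    "nmat b = mbits N" "kmat b = mbits K" "kn_ok b"
proof -
  obtain b r where b: "reach a b" "r \<in> {0, n1, n2, n3, n4, n5, n6, n7, n8, n9, n10}" "bmat 8 8 b = reps ! r"
    using fixed_submatrix[OF assms] by metis
  note nb = reach_nice[OF b(1)]
  have "r \<noteq> n7" using not_rep_7[OF nb] b(3) by blast
  moreover have "r \<notin> {n8, n9, n10}"
  proof
    assume "r \<in> {n8, n9, n10}"
    then have "pair_search (\<lambda>_ _. False) (spec (bmat 8 8 b)) [] [] trues6"
      unfolding b(3) using pair_search_8 pair_search_9 pair_search_10 by blast
    then show False using pair_search_spec[OF nb] by metis
  qed
  ultimately have r: "r < 7" using b(2) by auto
  obtain c where c: "reach b c" "bmat 8 8 c = reps ! r" "leaf2a tree2 (nmat c) (kmat c)"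
    using pair_search_spec[OF nb, of "leaf2a tree2"] pair_search_good[OF r] b(3) by metis
  note nc = reach_nice[OF c(1)]
  obtain cs where cs: "length cs = 7" "list_all cert_ok cs"
    "leaf2b (nmat c) (kmat c) (transposed (nmat c)) (transposed (kmat c)) cs"
    using c(3) look_pred[OF tree2_certs] unfolding leaf2a_def by blast
  have kn: "kn_ok c" using cs(3) unfolding leaf2b_def kn_ok_iff by (auto split: if_splits)
  have "certs_ok 0 reps (nmat c) (kmat c) (transposed (nmat c)) (transposed (kmat c)) cs"
    using cs(3) unfolding leaf2b_def by (auto split: if_splits)
  from certs_ok_nth[OF this, of r] have ch: "cert_holds r (reps ! r) (nmat c) (kmat c) (transposed (nmat c)) (transposed (kmat c)) (cs ! r)"
    using r cs(1) by (simp add: reps_def)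
  have ok: "cert_ok (cs ! r)" using cs(1,2) r by (simp add: list_all_length)
  show ?thesis
  proof (cases "cs ! r")
    case (Bad l j)
    then show ?thesis using ch ok not_bad[OF nc kn, of l j] c(2) by simp
  next
    case (Iso ps qs u)
    then have l: "length ps = 8" "length qs = 7" using ok by auto
    obtain r' N K its where u: "u () = (r', N, K, its)" by (cases "u ()") auto
    have h: "u \<in> set all_cases" "isperm 8 ps" "isperm 7 qs" "relab ps ps (reps ! r) = reps ! r" "r' = r"
      "relab ps qs (nmat c) = mbits N" "relab ps qs (kmat c) = mbits K"
      using ch Iso u by (auto simp: is_case_def eqm_iff eqn_iff numeral_eq_Suc split: if_splits)
    note p = perm_of_permutes[OF h(2) l(1)] and q = perm_of_permutes[OF h(3) l(2)]
    define L where "L = lift (perm_of ps) (perm_of qs) (\<lambda>_. False)"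
    define d where "d x y = c (L x) (L y)" for x y
    have r: "reach c d" using reach_lift[OF nc p(1) q(1), of "\<lambda>_. False"] unfolding d_def L_def .
    have L: "i < 8 \<Longrightarrow> L i = perm_of ps i" "j < 7 \<Longrightarrow> L (8 + j) = 8 + perm_of qs j" for i j
      by (simp_all add: L_def lift_def)
    have "bmat 8 8 d = relab ps ps (bmat 8 8 c)"
      using relab_bmat[OF p(2) p(2) l(1) l(1), of c] by (auto simp: bmat_eq_iff d_def L perm_of_def l)
    moreover have "nmat d = relab ps qs (nmat c)" "kmat d = relab ps qs (kmat c)"
      unfolding nmat_def kmat_def relab_bmat[OF p(2) q(2) l] by (auto simp: bmat_eq_iff d_def L perm_of_def l)
    moreover have "kn_ok d" by (rule kn_ok_relabel[OF kn p(1) q(1)]) (simp_all add: d_def L)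
    ultimately show ?thesis
      using that[of d u r' N K its] reach_trans[OF reach_trans[OF b(1) c(1)] r] h u c(2) by simp
  qed
qed

subsection \<open>Completeness of the search for the arcs between orbits\<close>

primrec val :: "tri \<Rightarrow> int" where
  "val Ze = 0" | "val Pl = 1" | "val Mi = -1"

definition sgn_entry :: "(nat \<Rightarrow> nat \<Rightarrow> bool) \<Rightarrow> nat \<Rightarrow> nat \<Rightarrow> tri" where
  "sgn_entry a l j = (if a (8 + l) (8 + j) = a (8 + l) (15 + j) then Ze else if a (8 + l) (8 + j) then Pl else Mi)"

lemma val_ent: "val (sgn_entry a l j) = of_bool (a (8 + l) (8 + j)) - of_bool (a (8 + l) (15 + j))"
  by (simp add: sgn_entry_def)

lemma sgn_entry_Ze: "sgn_entry a l j = Ze \<longleftrightarrow> orbit_sum a l j \<noteq> 1"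
  by (simp add: sgn_entry_def orbit_sum_def)

text \<open>The difference of the two sides of \<open>nice_OO\<close>, in terms of
  \<open>B = P - Q\<close>.\<close>

lemma sgn_entry_sq:
  assumes "nice a" "l < 7" "j < 7"
  shows "(\<Sum>x<7. val (sgn_entry a l x) * val (sgn_entry a x j)) + val (sgn_entry a l j) = (if l = j then 2 else 0)"
proof -
  have "(\<Sum>x<7. val (sgn_entry a l x) * val (sgn_entry a x j)) =
      int ((\<Sum>x<7. of_bool (a (8 + l) (8 + x) \<and> a (8 + x) (8 + j))) + (\<Sum>x<7. of_bool (a (8 + l) (15 + x) \<and> a (8 + x) (15 + j))))
    - int ((\<Sum>x<7. of_bool (a (8 + l) (8 + x) \<and> a (8 + x) (15 + j))) + (\<Sum>x<7. of_bool (a (8 + l) (15 + x) \<and> a (8 + x) (8 + j))))"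
    unfolding of_nat_add of_nat_sum sum.distrib[symmetric] sum_subtractf[symmetric]
    by (intro sum.cong refl) (simp add: val_ent of_bool_conj algebra_simps)
  moreover have "(of_bool p :: int) = int (of_bool p)" for p by simp
  ultimately show ?thesis
    using nice_OO[OF assms] unfolding val_ent by (cases "l = j"; simp only: if_True if_False simp_thms; linarith)
qed

lemma dot_zero_iff: "dot_zero xs ys p q \<longleftrightarrow> int p - int q + (\<Sum>(x, y)\<leftarrow>zip xs ys. val x * val y) = 0"
  by (induction xs ys p q rule: dot_zero.induct) (auto simp: eqn_iff)

lemma zip_sum: "(\<Sum>(x, y)\<leftarrow>zip (map f [0..<n]) (map g [0..<n]). val x * val y) = (\<Sum>i<n. val (f i) * val (g i))"
  unfolding zip_map_map by (simp add: sum_upt[symmetric] zip_same_conv_map comp_def)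

lemma tls_map: "tls (map f is) = map (\<lambda>x. tl (f x)) is"
  by (induction "is") auto

lemma linked_iff: "linked s l \<longleftrightarrow> l \<or> s = 1"
  by (cases "(s, l)" rule: linked.cases) auto

lemma ropt_map: "ropt (map s js) (map l js) = map (\<lambda>j. row_signs (s j) (l j)) js"
  by (induction js) auto

lemma lopt_map: "lopt (map s js) (map l js) = map (\<lambda>j. l j \<or> s j = 1) js"
  by (induction js) (auto simp: linked_iff)

lemma set_conss: "set (conss a xs ys) = Cons a ` set xs \<union> set ys"
  by (induction xs) auto

lemma set_consa: "set (consa as xs) = {a # x |a x. a \<in> set as \<and> x \<in> set xs}"
  by (induction as) (auto simp: set_conss)

lemma map_in_vecs: "(\<And>j. j \<in> set js \<Longrightarrow> f j \<in> set (os j)) \<Longrightarrow> map f js \<in> set (vecs (map os js))"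
  by (induction js) (auto simp: set_consa)

lemma set_pres: "set (pres p xs) = append p ` set xs"
  by (induction xs) auto

lemma heads_map: "heads i (map f is) = map (\<lambda>k. f k ! i) is"
  by (induction "is") auto

lemma set_fz1: "set (filter_arm p c xs) = {x \<in> set xs. dot_zero (p # x) (Pl # c) 0 0}"
  by (induction xs) auto

lemma filter_arms_map: "x \<in> set (filter_arms (map p is) (map c is) xs) \<longleftrightarrow> x \<in> set xs \<and> (\<forall>k\<in>set is. dot_zero (p k # x) (Pl # c k) 0 0)"
  by (induction "is" arbitrary: xs) (auto simp: set_fz1)

lemma all_arm_columns_iff: "all_arm_columns h d r cs \<longleftrightarrow> (\<forall>c\<in>set cs. dot_zero (Mi # Mi # d @ r) (Pl # Pl # Pl # c) 0 0 \<longrightarrow> h c)"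
  by (induction cs) auto

lemma all_arms_iff: "all_arms g d rs cs \<longleftrightarrow> (\<forall>r\<in>set rs. \<forall>c\<in>set cs. dot_zero (Mi # Mi # d @ r) (Pl # Pl # Pl # c) 0 0 \<longrightarrow> g r c)"
  by (induction rs) (auto simp: all_arm_columns_iff)

definition erow :: "(nat \<Rightarrow> nat \<Rightarrow> bool) \<Rightarrow> nat \<Rightarrow> tri list" where "erow a l = map (sgn_entry a l) [0..<7]"
definition ecolm :: "(nat \<Rightarrow> nat \<Rightarrow> bool) \<Rightarrow> nat \<Rightarrow> tri list" where "ecolm a j = map (\<lambda>l. sgn_entry a l j) [0..<7]"

text \<open>The specification that is left when the arms before \<open>i\<close> have been chosen
  and \<open>L\<close> marks the connected orbits; the induction runs over this form.\<close>

definition spcs :: "(nat \<Rightarrow> nat \<Rightarrow> nat) \<Rightarrow> (nat \<Rightarrow> bool) \<Rightarrow> nat \<Rightarrow> (tri list \<times> tri list list \<times> tri list list) list" where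
  "spcs S L i = arm_specs (map (\<lambda>l. map (S l) [i..<7]) [i..<7]) (map (\<lambda>j. map (\<lambda>l. S l j) [i..<7]) [i..<7]) (map L [i..<7])"

lemma spcs_step: "i < 7 \<Longrightarrow> spcs S L i =
    ((case S i i of 0 \<Rightarrow> [Ze] | Suc m \<Rightarrow> [Mi]), map (\<lambda>j. row_signs (S i j) (L j)) [Suc i..<7],
      map (\<lambda>j. row_signs (S j i) (L j \<or> S i j = 1)) [Suc i..<7]) # spcs S (\<lambda>j. (L j \<or> S i j = 1) \<or> S j i = 1) (Suc i)"
proof -
  assume "i < 7"
  then have u: "[i..<7] = i # [Suc i..<7]" by (simp add: upt_rec)
  show ?thesis unfolding spcs_def u list.map arm_specs.simps ropt_map lopt_map tls_map list.sel ..
qed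

definition flip :: "(nat \<Rightarrow> bool) \<Rightarrow> (nat \<Rightarrow> nat \<Rightarrow> bool) \<Rightarrow> nat \<Rightarrow> nat \<Rightarrow> bool" where
  "flip E a = (\<lambda>x y. a (lift id id E x) (lift id id E y))"

primrec neg :: "tri \<Rightarrow> tri" where "neg Ze = Ze" | "neg Pl = Mi" | "neg Mi = Pl"

lemma flip_facts:
  assumes "nice a"
  shows "reach a (flip E a)" "bmat 8 8 (flip E a) = bmat 8 8 a" "nmat (flip E a) = nmat a" "kmat (flip E a) = kmat a"
    "l < 7 \<Longrightarrow> j < 7 \<Longrightarrow> orbit_sum (flip E a) l j = orbit_sum a l j"
    "l < 7 \<Longrightarrow> j < 7 \<Longrightarrow> sgn_entry (flip E a) l j = (if E l = E j then sgn_entry a l j else neg (sgn_entry a l j))"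
proof -
  show "reach a (flip E a)" unfolding flip_def by (rule reach_lift[OF assms permutes_id permutes_id])
  have L: "lift id id E i = i" if "i < 8" for i using that by (simp add: lift_def)
  have O: "lift id id E (8 + l) = (if E l then 15 + l else 8 + l)" "lift id id E (15 + l) = (if E l then 8 + l else 15 + l)"
    if "l < 7" for l using that by (simp_all add: lift_def)
  note nb = nice_blocks[OF assms]
  show "bmat 8 8 (flip E a) = bmat 8 8 a" by (rule bmat_cong) (simp add: flip_def L)
  show "nmat (flip E a) = nmat a" "kmat (flip E a) = kmat a"
    unfolding nmat_def kmat_def by (rule bmat_cong; simp add: flip_def L O nb)+
  show "l < 7 \<Longrightarrow> j < 7 \<Longrightarrow> orbit_sum (flip E a) l j = orbit_sum a l j"
    by (simp add: orbit_sum_def flip_def O nb)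
  show "l < 7 \<Longrightarrow> j < 7 \<Longrightarrow> sgn_entry (flip E a) l j = (if E l = E j then sgn_entry a l j else neg (sgn_entry a l j))"
    by (auto simp: sgn_entry_def flip_def O nb)
qed

text \<open>The induction changes the matrix as well: before each step some orbits are flipped, so
  that the next arm has the signs that the search admits. The last assumption says that an unmarked
  later orbit has only zero entries with the earlier ones, so flipping it leaves the arms already
  chosen intact.\<close>

lemma arm_search_complete:
  assumes "arm_search P (7 - n) (spcs S L (7 - n)) (map (erow a) [0..<7 - n]) (map (ecolm a) [0..<7 - n])" "n \<le> 7" "nice a"
    and "\<And>l j. l < 7 \<Longrightarrow> j < 7 \<Longrightarrow> S l j = orbit_sum a l j"
    and "\<And>k j. k < 7 - n \<Longrightarrow> j < 7 \<Longrightarrow> \<not> L j \<Longrightarrow> 7 - n \<le> j \<Longrightarrow> sgn_entry a k j = Ze \<and> sgn_entry a j k = Ze"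
  shows "\<exists>b. reach a b \<and> bmat 8 8 b = bmat 8 8 a \<and> nmat b = nmat a \<and> kmat b = kmat a \<and>
    (\<forall>l<7. \<forall>j<7. S l j = orbit_sum b l j) \<and> P (map (erow b) [0..<7])"
  using assms
proof (induction n arbitrary: a L)
  case 0
  then show ?case using reach_refl[of a] by (intro exI[of _ a]) (simp add: spcs_def)
next
  case (Suc n)
  define i where "i = 7 - Suc n"
  have i: "i < 7" "7 - n = Suc i" using Suc.prems(2) by (auto simp: i_def)
  note S = Suc.prems(4) and inv = Suc.prems(5)[folded i_def]
  \<comment> \<open>The unmarked orbits whose first nonzero entry with orbit \<open>i\<close>, row
    before column, is negative.\<close>
  define E where "E j \<longleftrightarrow> i < j \<and> \<not> L j \<and> (sgn_entry a i j = Mi \<or> sgn_entry a i j = Ze \<and> sgn_entry a j i = Mi)" for j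
  define c where "c = flip E a"
  note fl = flip_facts[OF Suc.prems(3), where E = E, folded c_def]
  have nc: "nice c" using reach_nice[OF fl(1)] by simp
  have ec: "sgn_entry c l j = (if E l = E j then sgn_entry a l j else neg (sgn_entry a l j))" if "l < 7" "j < 7" for l j
    using fl(6) that by blast
  have Ei: "\<not> E k" if "k \<le> i" for k using that by (simp add: E_def)
  have old: "sgn_entry c k j = sgn_entry a k j" "sgn_entry c j k = sgn_entry a j k" if "k < i" "j < 7" for k j
  proof -
    have "sgn_entry a k j = Ze \<and> sgn_entry a j k = Ze" if "E j"
      using inv[of k j] \<open>k < i\<close> \<open>j < 7\<close> that by (auto simp: E_def)
    then show "sgn_entry c k j = sgn_entry a k j" "sgn_entry c j k = sgn_entry a j k"
      using ec[of k j] ec[of j k] Ei[of k] that i(1) by auto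
  qed
  have Sc: "S l j = orbit_sum c l j" if "l < 7" "j < 7" for l j using S fl(5) that by simp
  let ?L = "\<lambda>j. (L j \<or> S i j = 1) \<or> S j i = 1"
  let ?d = "case S i i of 0 \<Rightarrow> [Ze] | Suc m \<Rightarrow> [Mi]"
  \<comment> \<open>The diagonal of \<open>P\<close> is zero, so the diagonal entries of
    \<open>P + Q\<close> and of \<open>Q - P\<close> agree.\<close>
  have "S i i \<le> 1" "sgn_entry c i i = (if S i i = 0 then Ze else Mi)"
    using nice_diag[OF nc, of "8 + i"] i(1) by (auto simp: Sc orbit_sum_def sgn_entry_def)
  then have d: "?d = [sgn_entry c i i]" by (auto split: nat.splits)
  have rows: "map (erow a) [0..<i] = map (erow c) [0..<i]" "map (ecolm a) [0..<i] = map (ecolm c) [0..<i]"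
    using old by (auto simp: erow_def ecolm_def)
  have hr: "heads i (map (ecolm c) [0..<i]) @ [sgn_entry c i i] @ map (sgn_entry c i) [Suc i..<7] = erow c i"
    "heads i (map (erow c) [0..<i]) @ [sgn_entry c i i] @ map (\<lambda>j. sgn_entry c j i) [Suc i..<7] = ecolm c i"
  proof -
    have u: "[0..<7] = [0..<i] @ [i] @ [Suc i..<7]"
      using i(1) upt_add_eq_append[of 0 i "7 - i"] by (simp add: upt_rec)
    show "heads i (map (ecolm c) [0..<i]) @ [sgn_entry c i i] @ map (sgn_entry c i) [Suc i..<7] = erow c i"
      "heads i (map (erow c) [0..<i]) @ [sgn_entry c i i] @ map (\<lambda>j. sgn_entry c j i) [Suc i..<7] = ecolm c i"
      unfolding heads_map erow_def[of c i] ecolm_def[of c i] u map_append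
      by (auto simp: erow_def ecolm_def i(1))
  qed
  have row_signs_ent: "sgn_entry c i j \<in> set (row_signs (S i j) (L j))" "sgn_entry c j i \<in> set (row_signs (S j i) (L j \<or> S i j = 1))"
    if "i < j" "j < 7" for j
  proof -
    have z: "sgn_entry a i j = Ze \<longleftrightarrow> S i j \<noteq> 1" "sgn_entry a j i = Ze \<longleftrightarrow> S j i \<noteq> 1" using S that i(1) by (auto simp: sgn_entry_Ze)
    have "S i j \<le> 2" "S j i \<le> 2" using S that i(1) orbit_sum_le(1) by auto
    then have c3: "S i j = 0 \<or> S i j = 1 \<or> S i j = 2" "S j i = 0 \<or> S j i = 1 \<or> S j i = 2" by auto
    have e: "sgn_entry c i j = (if E j then neg (sgn_entry a i j) else sgn_entry a i j)" "sgn_entry c j i = (if E j then neg (sgn_entry a j i) else sgn_entry a j i)"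
      using ec[of i j] ec[of j i] Ei[of i] that i(1) by auto
    show "sgn_entry c i j \<in> set (row_signs (S i j) (L j))"
      using c3(1) z e(1) that(1) by (cases "sgn_entry a i j"; cases "L j") (auto simp: E_def numeral_eq_Suc)
    show "sgn_entry c j i \<in> set (row_signs (S j i) (L j \<or> S i j = 1))"
      using c3(2) z e(2) that(1)
      by (cases "sgn_entry a i j"; cases "sgn_entry a j i"; cases "L j") (auto simp: E_def numeral_eq_Suc)
  qed
  have bz0: "dot_zero (sgn_entry c i k # erow c i) (Pl # ecolm c k) 0 0" "dot_zero (sgn_entry c k i # ecolm c i) (Pl # erow c k) 0 0" if "k < i" for k
    using sgn_entry_sq[OF nc, of i k] sgn_entry_sq[OF nc, of k i] i(1) that
    by (auto simp: dot_zero_iff erow_def ecolm_def zip_sum mult.commute simp del: upt_rec_numeral upt_Suc)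
  have bz1: "dot_zero (Mi # Mi # [sgn_entry c i i] @ erow c i) (Pl # Pl # Pl # ecolm c i) 0 0"
    using sgn_entry_sq[OF nc, of i i] i(1)
    by (auto simp: dot_zero_iff erow_def ecolm_def zip_sum simp del: upt_rec_numeral upt_Suc)
  let ?Rs = "filter_arms (heads i (map (ecolm c) [0..<i])) (map (ecolm c) [0..<i])
    (pres (heads i (map (ecolm c) [0..<i]) @ [sgn_entry c i i]) (vecs (map (\<lambda>j. row_signs (S i j) (L j)) [Suc i..<7])))"
  let ?Cs = "filter_arms (heads i (map (erow c) [0..<i])) (map (erow c) [0..<i])
    (pres (heads i (map (erow c) [0..<i]) @ [sgn_entry c i i]) (vecs (map (\<lambda>j. row_signs (S j i) (L j \<or> S i j = 1)) [Suc i..<7])))"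
  have H: "\<forall>r\<in>set ?Rs. \<forall>c'\<in>set ?Cs. dot_zero (Mi # Mi # [sgn_entry c i i] @ r) (Pl # Pl # Pl # c') 0 0 \<longrightarrow>
      arm_search P (Suc i) (spcs S ?L (Suc i)) (map (erow c) [0..<i] @ [r]) (map (ecolm c) [0..<i] @ [c'])"
    using Suc.prems(1) unfolding i_def[symmetric] spcs_step[OF i(1)] arm_search.simps prod.case d rows all_arms_iff .
  have R: "erow c i \<in> set ?Rs"
  proof -
    have "map (sgn_entry c i) [Suc i..<7] \<in> set (vecs (map (\<lambda>j. row_signs (S i j) (L j)) [Suc i..<7]))"
      by (rule map_in_vecs, rule row_signs_ent) simp_all
    then have "erow c i \<in> set (pres (heads i (map (ecolm c) [0..<i]) @ [sgn_entry c i i]) (vecs (map (\<lambda>j. row_signs (S i j) (L j)) [Suc i..<7])))"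
      unfolding set_pres hr(1)[symmetric] append_assoc[symmetric] by (rule imageI)
    moreover have "ecolm c k ! i = sgn_entry c i k" for k using i(1) by (simp add: ecolm_def)
    ultimately show ?thesis unfolding heads_map filter_arms_map using bz0(1) by simp
  qed
  have C: "ecolm c i \<in> set ?Cs"
  proof -
    have "map (\<lambda>j. sgn_entry c j i) [Suc i..<7] \<in> set (vecs (map (\<lambda>j. row_signs (S j i) (L j \<or> S i j = 1)) [Suc i..<7]))"
      by (rule map_in_vecs, rule row_signs_ent) simp_all
    then have "ecolm c i \<in> set (pres (heads i (map (erow c) [0..<i]) @ [sgn_entry c i i]) (vecs (map (\<lambda>j. row_signs (S j i) (L j \<or> S i j = 1)) [Suc i..<7])))"
      unfolding set_pres hr(2)[symmetric] append_assoc[symmetric] by (rule imageI)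
    moreover have "erow c k ! i = sgn_entry c k i" for k using i(1) by (simp add: erow_def)
    ultimately show ?thesis unfolding heads_map filter_arms_map using bz0(2) by simp
  qed
  have "arm_search P (Suc i) (spcs S ?L (Suc i)) (map (erow c) [0..<Suc i]) (map (ecolm c) [0..<Suc i])"
    using H R C bz1 by simp
  moreover have "sgn_entry c k j = Ze \<and> sgn_entry c j k = Ze" if "k < Suc i" "j < 7" "\<not> ?L j" "Suc i \<le> j" for k j
  proof (cases "k = i")
    case True
    then show ?thesis using that i(1) Sc by (simp add: sgn_entry_Ze)
  next
    case False
    then show ?thesis using that old[of k j] inv[of k j] by simp
  qed
  ultimately obtain b where "reach c b" "bmat 8 8 b = bmat 8 8 c" "nmat b = nmat c" "kmat b = kmat c"
    "\<forall>l<7. \<forall>j<7. S l j = orbit_sum b l j" "P (map (erow b) [0..<7])"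
    using Suc.IH[of ?L c] Suc.prems(2) nc Sc unfolding i(2) by auto
  then show ?case
    using reach_trans[OF fl(1)] fl(2-4) by (intro exI[of _ b]) simp
qed

definition item_mat :: "nat \<Rightarrow> nat list \<Rightarrow> nat list \<Rightarrow> nat list \<Rightarrow> bool list list" where
  "item_mat r N K P = adj (reps ! r) (mbits N) (transposed (mbits K)) (mbits P)
     (qmat (transposed (scols (reps ! r) (transposed (mbits K)) (transposed (mbits N)))) (mbits P))"

fun case_items :: "case_data \<Rightarrow> (bool list list \<times> nat \<times> nat list) list" where
  "case_items (r, N, K, its) = map (\<lambda>(P, v, T). (item_mat r N K P, v, T)) its"

definition items :: "(bool list list \<times> nat \<times> nat list) list" where
  "items = concat (map (\<lambda>c. case_items (c ())) all_cases)"

lemma case_ok_casl: "\<forall>c\<in>set all_cases. case_ok (c ())"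
  using case_ok_0 case_ok_1 case_ok_2 case_ok_3 case_ok_4 case_ok_5 case_ok_6 case_ok_7
  unfolding all_cases_def list.set ball_simps by (elim conjE) (intro conjI TrueI; assumption)

lemma goks_iff: "goks M N Kr S is \<longleftrightarrow> (\<forall>(P, v, T)\<in>set is. gokp M N Kr S (mbits P) v T)"
  by (induction M N Kr S "is" rule: goks.induct) auto

lemma memp_iff: "memp X is \<longleftrightarrow> (\<exists>(P, v, T)\<in>set is. X = mbits P)"
  by (induction X "is" rule: memp.induct) (auto simp: eqm_iff)

lemma items_gok:
  assumes "(A, v, T) \<in> set items"
  shows "graph_ok A (num_of_nat v) T"
proof -
  obtain c r N K its P where c: "c \<in> set all_cases" "c () = (r, N, K, its)" "(P, v, T) \<in> set its" "A = item_mat r N K P"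
  proof -
    obtain c where c: "c \<in> set all_cases" "(A, v, T) \<in> set (case_items (c ()))" using assms by (auto simp: items_def)
    moreover obtain r N K its where "c () = (r, N, K, its)" by (cases "c ()") auto
    ultimately show ?thesis using that by auto
  qed
  have "cok1 (reps ! r) (mbits N) (transposed (mbits K)) its" using case_ok_casl c(1,2) by auto
  then show ?thesis
    using c(3,4) unfolding cok1_def cok2_def cok3_def goks_iff gokp_def item_mat_def by (auto split: if_splits)
qed

lemma prow_map: "prow (map s js) (map e js) = map (\<lambda>j. pbit (s j) (e j)) js"
  by (induction js) auto

lemma pmat_map: "pmat (map s is) (map e is) = map (\<lambda>l. prow (s l) (e l)) is"
  by (induction "is") auto

lemma qrow_map: "qrow (map s js) (map e js) = map (\<lambda>j. qbit (s j) (e j)) js"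
  by (induction js) auto

lemma qmat_map: "qmat (map s is) (map e is) = map (\<lambda>l. qrow (s l) (e l)) is"
  by (induction "is") auto

lemma qmat_bmat: "qmat (bmat m n s) (bmat m n e) = bmat m n (\<lambda>l j. qbit (s l j) (e l j))"
  by (simp add: bmat_def qmat_map qrow_map)

lemma cat3_map: "cat3 (map x is) (map y is) (map z is) = map (\<lambda>i. x i @ y i @ z i) is"
  by (induction "is") auto

lemma pbit_ent: "pbit (orbit_sum a l j) (sgn_entry a l j) = a (8 + l) (8 + j)"
  by (simp add: orbit_sum_def sgn_entry_def)

lemma qbit_ssum2: "qbit (orbit_sum a l j) (a (8 + l) (8 + j)) = a (8 + l) (15 + j)"
  by (simp add: orbit_sum_def)

definition blockmat :: "(nat \<Rightarrow> nat \<Rightarrow> bool) \<Rightarrow> (nat \<Rightarrow> nat \<Rightarrow> bool) \<Rightarrow> (nat \<Rightarrow> nat \<Rightarrow> bool) \<Rightarrow> (nat \<Rightarrow> nat \<Rightarrow> bool) \<Rightarrow>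
    (nat \<Rightarrow> nat \<Rightarrow> bool) \<Rightarrow> nat \<Rightarrow> nat \<Rightarrow> bool" where
  "blockmat m n k p q x y =
     (if x < 8 then if y < 8 then m x y else if y < 15 then n x (y - 8) else n x (y - 15)
      else if x < 15 then if y < 8 then k (x - 8) y else if y < 15 then p (x - 8) (y - 8) else q (x - 8) (y - 15)
      else if y < 8 then k (x - 15) y else if y < 15 then q (x - 15) (y - 8) else p (x - 15) (y - 15))"

lemma upt_22: "[0..<22] = [0..<8] @ map ((+) 8) [0..<7] @ map ((+) 15) [0..<7]"
  by (simp add: upt_rec)

lemma adj_bmat: "adj (bmat 8 8 m) (bmat 8 7 n) (bmat 7 8 k) (bmat 7 7 p) (bmat 7 7 q) = bmat 22 22 (blockmat m n k p q)"
  unfolding adj_def bmat_def cat3_map upt_22 map_append map_map comp_def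
  by (intro arg_cong2[of _ _ _ _ "(@)"] map_cong refl) (auto simp: blockmat_def)

lemma adj_nice:
  assumes "nice a"
  shows "adj (bmat 8 8 a) (nmat a) (transposed (kmat a)) (bmat 7 7 (\<lambda>l j. a (8 + l) (8 + j))) (bmat 7 7 (\<lambda>l j. a (8 + l) (15 + j)))
    = bmat 22 22 a"
proof -
  let ?b = "blockmat a (\<lambda>i l. a i (8 + l)) (\<lambda>l i. a (8 + l) i) (\<lambda>l j. a (8 + l) (8 + j)) (\<lambda>l j. a (8 + l) (15 + j))"
  have "?b x y = a x y" if "x < 22" "y < 22" for x y
  proof -
    have X: "x < 8 \<or> (\<exists>l<7. x = 8 + l) \<or> (\<exists>l<7. x = 15 + l)" if "x < 22" for x :: nat
      using that by presburger
    from X[OF that(1)] X[OF that(2)] show ?thesis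
      by (elim disjE exE conjE) (simp_all add: blockmat_def nice_blocks[OF assms])
  qed
  then show ?thesis
    unfolding nmat_def transposed_kmat adj_bmat bmat_eq_iff by blast
qed

lemma items_reached:
  assumes "nice a"
  obtains b v T where "reach a b" "(bmat 22 22 b, v, T) \<in> set items"
proof -
  obtain b c r N K its where b: "reach a b" "c \<in> set all_cases" "c () = (r, N, K, its)" "bmat 8 8 b = reps ! r"
    "nmat b = mbits N" "kmat b = mbits K" "kn_ok b"
    using case_reached[OF assms] by metis
  note nb = reach_nice[OF b(1)]
  define Sc where "Sc = scols (reps ! r) (transposed (mbits K)) (transposed (mbits N))"
  have Sc: "Sc = bmat 7 7 (\<lambda>j l. orbit_sum b l j)" "transposed Sc = bmat 7 7 (orbit_sum b)"
    using scols_ssum2[OF nb b(7)] unfolding Sc_def b(4-6) by (simp_all add: transposed_bmat)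
  have "cok1 (reps ! r) (mbits N) (transposed (mbits K)) its" using case_ok_casl b(2,3) by auto
  then have "arm_search (\<lambda>Rs. memp (pmat (transposed Sc) Rs) its) 0 (arm_specs (transposed Sc) Sc falses7) [] []"
    unfolding cok1_def cok2_def cok3_def Sc_def by (auto split: if_splits)
  \<comment> \<open>At the start no orbit is connected to an earlier one.\<close>
  moreover have "arm_specs (transposed Sc) Sc falses7 = spcs (orbit_sum b) (\<lambda>_. False) 0"
    unfolding Sc spcs_def bmat_def by (simp add: falses7_def bits_numeral upt_rec)
  ultimately have "arm_search (\<lambda>Rs. memp (pmat (transposed Sc) Rs) its) (7 - 7) (spcs (orbit_sum b) (\<lambda>_. False) (7 - 7))
      (map (erow b) [0..<7 - 7]) (map (ecolm b) [0..<7 - 7])" by simp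
  from arm_search_complete[OF this _ nb] obtain d where d: "reach b d" "bmat 8 8 d = reps ! r" "nmat d = mbits N" "kmat d = mbits K"
    "\<forall>l<7. \<forall>j<7. orbit_sum b l j = orbit_sum d l j" "memp (pmat (transposed Sc) (map (erow d) [0..<7])) its"
    unfolding b(4-6) by auto
  have S: "transposed Sc = bmat 7 7 (orbit_sum d)" unfolding Sc(2) bmat_eq_iff using d(5) .
  have P: "pmat (transposed Sc) (map (erow d) [0..<7]) = bmat 7 7 (\<lambda>l j. d (8 + l) (8 + j))"
    unfolding S bmat_def pmat_map erow_def prow_map pbit_ent ..
  obtain P v T where i: "(P, v, T) \<in> set its" "bmat 7 7 (\<lambda>l j. d (8 + l) (8 + j)) = mbits P"
    using d(6) unfolding P memp_iff by auto
  have "item_mat r N K P = bmat 22 22 d"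
    using adj_nice[OF reach_nice[OF d(1)]]
    unfolding item_mat_def Sc_def[symmetric] i(2)[symmetric] S qmat_bmat qbit_ssum2 d(2-4) by simp
  then have "(bmat 22 22 d, v, T) \<in> set (case_items (c ()))"
    using i(1) b(3) by force
  then have "(bmat 22 22 d, v, T) \<in> set items" using b(2) by (auto simp: items_def)
  then show ?thesis using that reach_trans[OF b(1) d(1)] by blast
qed

subsection \<open>The graphs of the classification\<close>

fun case_dims :: "case_data \<Rightarrow> bool" where
  "case_dims (r, N, K, its) \<longleftrightarrow> r < 11 \<and> length N = 8 \<and> length K = 8 \<and> list_all (\<lambda>x. length (bits x) = 7) (N @ K) \<and>
     list_all (\<lambda>(P, v, T). length P = 7 \<and> list_all (\<lambda>x. length (bits x) = 7) P) its"

lemma all_cases_dims: "list_all (\<lambda>c. case_dims (c ())) all_cases"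
  by (simp add: all_cases_def c_def bits_numeral)

lemma reps_dims: "list_all (\<lambda>M. length M = 8 \<and> list_all (\<lambda>x. length x = 8) M) reps" "length reps = 11"
  by (simp_all add: reps_def bits_numeral)

lemma mbits_map: "mbits X = map bits X"
  by (induction X) auto

lemma mbits_bmat: "length X = m \<Longrightarrow> list_all (\<lambda>x. length (bits x) = n) X \<Longrightarrow> \<exists>f. mbits X = bmat m n f"
  by (rule exI[of _ "\<lambda>i j. mbits X ! i ! j"], rule sym, rule bmat_nth) (auto simp: mbits_map list_all_length)

lemma swap_orbits_blockmat: "x < 22 \<Longrightarrow> y < 22 \<Longrightarrow> blockmat m n k p q (swap_orbits x) (swap_orbits y) = blockmat m n k p q x y"
  by (auto simp: blockmat_def swap_orbits_def)

text \<open>The block form makes \<open>swap_orbits\<close> an automorphism whatever the blocks are;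
  this is why \<open>graph_ok\<close> contains no test for it.\<close>

lemma item_mat_bmat:
  assumes "case_dims (r, N, K, its)" "(P, v, T) \<in> set its"
  obtains b where "item_mat r N K P = bmat 22 22 b" "\<And>x y. x < 22 \<Longrightarrow> y < 22 \<Longrightarrow> b (swap_orbits x) (swap_orbits y) = b x y"
proof -
  have "reps ! r \<in> set reps" using assms(1) reps_dims(2) by simp
  then have "length (reps ! r) = 8" "\<forall>x\<in>set (reps ! r). length x = 8" using reps_dims(1) by (auto simp: list_all_iff)
  then have "bmat 8 8 (\<lambda>i j. reps ! r ! i ! j) = reps ! r" by (intro bmat_nth) auto
  then obtain m where M: "reps ! r = bmat 8 8 m" by metis
  obtain n where N: "mbits N = bmat 8 7 n" using mbits_bmat[of N 8 7] assms(1) by auto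
  obtain k where K: "mbits K = bmat 8 7 k" using mbits_bmat[of K 8 7] assms(1) by auto
  have "length P = 7 \<and> list_all (\<lambda>x. length (bits x) = 7) P" using assms by (auto simp: list_all_iff)
  then obtain p where P: "mbits P = bmat 7 7 p" using mbits_bmat[of P 7 7] by auto
  have "\<exists>s. scols (reps ! r) (transposed (mbits K)) (transposed (mbits N)) = bmat 7 7 s"
    unfolding N K by (simp add: transposed_bmat) (auto simp: bmat_def[of 7] scols_map scol_map)
  then obtain s where "scols (reps ! r) (transposed (mbits K)) (transposed (mbits N)) = bmat 7 7 s" by blast
  then have "item_mat r N K P = bmat 22 22 (blockmat m n (\<lambda>i j. k j i) p (\<lambda>l j. qbit (s j l) (p l j)))"
    unfolding item_mat_def M by (simp add: P N K transposed_bmat qmat_bmat adj_bmat)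
  then show ?thesis using swap_orbits_blockmat that by blast
qed

lemma items_bmat:
  assumes "(A, v, T) \<in> set items"
  obtains b where "A = bmat 22 22 b" "\<And>x y. x < 22 \<Longrightarrow> y < 22 \<Longrightarrow> b (swap_orbits x) (swap_orbits y) = b x y"
proof -
  obtain c where c: "c \<in> set all_cases" "(A, v, T) \<in> set (case_items (c ()))" using assms by (auto simp: items_def)
  obtain r N K its where d: "c () = (r, N, K, its)" by (cases "c ()") auto
  then obtain P where "(P, v, T) \<in> set its" "A = item_mat r N K P" using c(2) by auto
  moreover have "case_dims (r, N, K, its)" using all_cases_dims c(1) d by (auto simp: list_all_iff simp del: case_dims.simps)
  ultimately show ?thesis using item_mat_bmat that by metis
qed

lemma dtn_nbits: "dtn x y = dot (nbits x) (nbits y)"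
  by (induction x y rule: dtn.induct) auto

lemma dqn_iff: "dqn x y n \<longleftrightarrow> dtn x y = n"
  by (induction x y n rule: dqn.induct) (auto simp: eqn_iff)

lemma packs_map: "packs xs = map pack xs"
  by (induction xs) auto

lemma srow_map: "srow (pack r) (map f is) (map (\<lambda>i. pack (c i)) is) (map d is) \<longleftrightarrow>
    (\<forall>i\<in>set is. of_bool (f i) + dot r (c i) = (if d i then 6 else 4))"
  by (induction "is") (auto simp: dqn_iff dtn_nbits numeral_eq_Suc)

lemma square_ok_map: "square_ok (map r is) (map p is) cs (map d is) \<longleftrightarrow> (\<forall>i\<in>set is. weight (r i) = 9 \<and> srow (p i) (r i) cs (d i))"
  by (induction "is") (auto simp: eqn_iff numeral_eq_Suc)

lemma wt9_iff: "wt9 cs \<longleftrightarrow> (\<forall>c\<in>set cs. weight c = 9)"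
  by (induction cs) (auto simp: eqn_iff numeral_eq_Suc)

lemma offd_map: "offd (map r is) (map d is) \<longleftrightarrow> (\<forall>i\<in>set is. dot (r i) (d i) = 0)"
  by (induction "is") (auto simp: eqn_iff)

lemma idm22_bmat: "idm22 = bmat 22 22 (=)"
  by (simp add: idm22_def bits_numeral bmat_def upt_rec)

definition common :: "(nat \<Rightarrow> nat \<Rightarrow> bool) \<Rightarrow> nat \<Rightarrow> nat \<Rightarrow> nat" where
  "common a x y = (\<Sum>z<22. of_bool (a x z \<and> a y z))"

text \<open>The ones added here and below match the evaluation in the type \<open>num\<close>, where
  sums start from one and a square is represented with one added. They change nothing about the
  invariance.\<close>

definition fval :: "(nat \<Rightarrow> nat \<Rightarrow> bool) \<Rightarrow> nat \<Rightarrow> nat" where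
  "fval a x = Suc (\<Sum>y<22. of_bool (a y x) * ((common a x y)\<^sup>2 + 1))"

definition hval :: "(nat \<Rightarrow> nat \<Rightarrow> bool) \<Rightarrow> nat \<Rightarrow> nat" where
  "hval a x = Suc (\<Sum>y<22. of_bool (a x y) * fval a y)"

definition vval :: "(nat \<Rightarrow> nat \<Rightarrow> bool) \<Rightarrow> nat" where
  "vval a = Suc (\<Sum>x<22. (hval a x)\<^sup>2)"

text \<open>Every component is preserved by the automorphisms that fix \<open>p\<close> and
  \<open>q\<close>.\<close>

definition sgn_at :: "(nat \<Rightarrow> nat \<Rightarrow> bool) \<Rightarrow> nat \<Rightarrow> nat \<Rightarrow> nat \<Rightarrow> bool \<times> bool \<times> bool \<times> bool \<times> nat \<times> nat \<times> nat \<times> nat" where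
  "sgn_at a p q x = (a x p, a p x, a x q, a q x, common a x p, common a x q, fval a x, hval a x)"

lemma nat_of_isq: "nat_of_num (square_suc c) = c\<^sup>2 + 1"
  by (induction c) (auto simp: nat_of_num_add nat_of_un power2_eq_square)

lemma nat_of_frow: "nat_of_num (frow (map f is) (map r is) x acc) =
    nat_of_num acc + (\<Sum>i\<leftarrow>is. of_bool (f i) * ((dtn x (r i))\<^sup>2 + 1))"
proof (induction "is" arbitrary: acc)
  case (Cons i "is") then show ?case by (cases "f i") (auto simp: nat_of_num_add nat_of_isq)
qed simp

lemma fvec_map: "fvec (map c is) (map x is) rs = map (\<lambda>i. frow (c i) rs (x i) num.One) is"
  by (induction "is") auto

lemma hvec_map: "hvec (map r is) f = map (\<lambda>i. wsum (r i) f num.One) is"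
  by (induction "is") auto

lemma nat_of_ssum: "nat_of_num (ssum (map h is) acc) = nat_of_num acc + (\<Sum>i\<leftarrow>is. (nat_of_num (h i))\<^sup>2)"
  by (induction "is" arbitrary: acc) (auto simp: nat_of_num_add nat_of_num_mult power2_eq_square)

lemma eqb_iff: "eqb a b \<longleftrightarrow> a = b"
  by (cases a) auto

lemma eqs_iff: "eqs x y \<longleftrightarrow> x = y"
  by (induction x y rule: eqs.induct) (auto simp: eqnum_iff eqn_iff eqb_iff)

lemma mems_iff: "mems x xs \<longleftrightarrow> x \<in> set xs"
  by (induction xs) (auto simp: eqs_iff)

lemma dists_iff: "dists xs \<longleftrightarrow> distinct xs"
  by (induction xs) (auto simp: mems_iff)

lemma eqns_iff: "eqns xs ys \<longleftrightarrow> xs = ys"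
  by (induction xs ys rule: eqns.induct) (auto simp: eqn_iff)

lemma level_set_map: "level_set v (map h [i..<i + n]) i = filter (\<lambda>x. h x = v) [i..<i + n]"
proof (induction n arbitrary: i)
  case (Suc n)
  have u: "[i..<i + Suc n] = i # [Suc i..<Suc i + n]" by (simp add: upt_rec)
  show ?case unfolding u list.map level_set.simps filter.simps eqnum_iff Suc.IH[of "Suc i"] by simp
qed simp

lemma sgs_map: "sgs (map c is) (map x is) p q rp rq (map f is) (map h is) =
    map (\<lambda>i. Sg (x i ! p) (c i ! p) (x i ! q) (c i ! q) (dot (x i) rp) (dot (x i) rq) (f i) (h i)) is"
  by (induction "is") auto

lemma graph_ok_facts:
  assumes g: "graph_ok (bmat 22 22 a) (num_of_nat v) T" and v: "v > 0" and T: "T \<noteq> []" "length T \<ge> 2"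
    and sw: "\<forall>x<22. \<forall>y<22. a (swap_orbits x) (swap_orbits y) = a x y"
  shows "nice a" "vval a = v" "T = filter (\<lambda>x. hval a x = hval a (T ! 0)) [0..<22]" "inj_on (sgn_at a (T ! 0) (T ! 1)) {..<22}"
proof -
  define A where "A = bmat 22 22 a"
  define C where "C = bmat 22 22 (\<lambda>x y. a y x)"
  define fs where "fs = fvec C (packs A) (packs A)"
  define hs where "hs = hvec A fs"
  have C: "transposed A = C" by (simp add: A_def C_def transposed_bmat)
  have pA: "packs A = map (\<lambda>x. pack (map (a x) [0..<22])) [0..<22]" and pC: "packs C = map (\<lambda>y. pack (map (\<lambda>x. a x y) [0..<22])) [0..<22]"
    by (simp_all add: A_def C_def bmat_def packs_map)
  have k: "square_ok A (packs A) (packs C) idm22" "wt9 C" "offd A idm22" "ginv A C fs hs (num_of_nat v) T"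
    using g unfolding A_def[symmetric] graph_ok_def C gchk1_def gchk_def gchk2_def fs_def hs_def by (auto split: if_splits)
  have s: "\<forall>x<22. weight (map (a x) [0..<22]) = 9 \<and> (\<forall>y<22. of_bool (a x y) + (\<Sum>z<22. of_bool (a x z \<and> a z y)) = (if x = y then 6 else 4 :: nat))"
    using k(1) unfolding pA pC idm22_bmat by (simp add: A_def bmat_def square_ok_map srow_map dot_upt atLeast0LessThan Ball_def)
  have w: "\<forall>y<22. weight (map (\<lambda>x. a x y) [0..<22]) = 9"
    using k(2) by (simp add: C_def bmat_def wt9_iff)
  have d: "\<forall>x<22. (\<Sum>z<22. of_bool (a x z \<and> x = z)) = (0 :: nat)"
    using k(3) unfolding idm22_bmat by (simp add: A_def bmat_def offd_map dot_upt atLeast0LessThan Ball_def)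
  have "\<not> a x x" if "x < 22" for x
    using d[rule_format, OF that] that by (auto simp: sum_eq_0_iff)
  then show "nice a"
    using s w sw unfolding nice_def weight_upt by (simp add: add.commute)
  have f: "fs = map (\<lambda>x. frow (map (\<lambda>y. a y x) [0..<22]) (packs A) (pack (map (a x) [0..<22])) num.One) [0..<22]"
    unfolding fs_def pA by (simp add: C_def bmat_def fvec_map)
  define fn where "fn x = frow (map (\<lambda>y. a y x) [0..<22]) (packs A) (pack (map (a x) [0..<22])) num.One" for x
  have fn: "nat_of_num (fn x) = fval a x" for x
    unfolding fn_def pA nat_of_frow fval_def by (simp add: dtn_nbits dot_upt common_def sum_upt)
  have f': "fs = map fn [0..<22]" unfolding f fn_def ..
  define hn where "hn x = wsum (map (a x) [0..<22]) fs num.One" for x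
  have h': "hs = map hn [0..<22]" unfolding hs_def A_def bmat_def hvec_map hn_def ..
  have hn: "nat_of_num (hn x) = hval a x" for x
    unfolding hn_def f' nat_of_wsum hval_def by (simp add: fn sum_upt)
  \<comment> \<open>The evaluation compares numerals, and \<open>nat_of_num\<close> is injective;
    hence level sets and signatures carry over to the invariants.\<close>
  have heq: "hn x = hn y \<longleftrightarrow> hval a x = hval a y" for x y unfolding num_eq_iff hn ..
  have feq: "fn x = fn y \<longleftrightarrow> fval a x = fval a y" for x y unfolding num_eq_iff fn ..
  have g: "eqnum (ssum hs num.One) (num_of_nat v)" "level_set (hs ! hd T) hs 0 = T"
    "dists (sgs C A (hd T) (hd (tl T)) (A ! hd T) (A ! hd (tl T)) fs hs)"
    using k(4) unfolding ginv_def by (auto simp: eqns_iff split: if_splits)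
  show "vval a = v"
    using g(1) v unfolding eqnum_nat h' nat_of_ssum vval_def by (simp add: hn sum_upt num_of_nat_inverse)
  have hdT: "hd T = T ! 0" "hd (tl T) = T ! 1" using T(2) by (cases T; cases "tl T"; auto)+
  have "T = filter (\<lambda>x. hn x = hs ! hd T) [0..<22]"
    using g(2) level_set_map[of "hs ! hd T" hn 0 22, unfolded add_0] unfolding h' by simp
  then have sub: "set T \<subseteq> {..<22}" by (metis atLeast0LessThan filter_is_subset set_upt)
  have T22: "T ! 0 < 22" "T ! 1 < 22" using subsetD[OF sub nth_mem[of 0 T]] subsetD[OF sub nth_mem[of 1 T]] T by auto
  show "T = filter (\<lambda>x. hval a x = hval a (T ! 0)) [0..<22]"
    using g(2) T22(1) unfolding h' level_set_map[of _ _ 0 22, unfolded add_0] hdT by (simp add: heq)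
  have "sgs C A (hd T) (hd (tl T)) (A ! hd T) (A ! hd (tl T)) fs hs =
    map (\<lambda>x. Sg (a x (T ! 0)) (a (T ! 0) x) (a x (T ! 1)) (a (T ! 1) x) (common a x (T ! 0)) (common a x (T ! 1)) (fn x) (hn x)) [0..<22]"
    unfolding f' h' hdT A_def C_def using T22
    by (simp add: bmat_def sgs_map dot_upt common_def)
  then have "inj_on (\<lambda>x. Sg (a x (T ! 0)) (a (T ! 0) x) (a x (T ! 1)) (a (T ! 1) x) (common a x (T ! 0)) (common a x (T ! 1)) (fn x) (hn x)) {..<22}"
    using g(3) unfolding dists_iff by (simp add: distinct_map atLeast0LessThan)
  then show "inj_on (sgn_at a (T ! 0) (T ! 1)) {..<22}"
    unfolding inj_on_def sgn_at_def by (simp add: heq feq)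
qed

section \<open>Automorphisms of order three and the list of values\<close>

abbreviation n22 :: nat where "n22 \<equiv> Suc n21"

text \<open>Two images suffice: an automorphism preserves the three-element set \<open>T\<close>, so
  the third vertex goes back to the first.\<close>

definition rotates :: "bool list list \<Rightarrow> nat list \<Rightarrow> nat list \<Rightarrow> bool" where
  "rotates A T ps = (if isperm n22 ps then if eqn (ps ! (T ! 0)) (T ! n1) then if eqn (ps ! (T ! n1)) (T ! n2)
     then eqm (relab ps ps A) A else False else False else False)"

fun size2 :: "nat list \<Rightarrow> bool" where
  "size2 [p, q] = True" | "size2 [] = False" | "size2 [p] = False" | "size2 (p # q # s # T) = False"

fun size3 :: "nat list \<Rightarrow> bool" where
  "size3 [p, q, s] = True" | "size3 [] = False" | "size3 [p] = False" | "size3 [p, q] = False" | "size3 (p # q # s # t # T) = False"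

fun sizes_ok :: "(nat list \<Rightarrow> bool list list) \<Rightarrow> item list \<Rightarrow> nat list \<Rightarrow> bool" where
  "sizes_ok f [] ps = True"
| "sizes_ok f ((P, v, T) # is) ps = (if size2 T then sizes_ok f is ps else if size3 T then
     if rotates (f P) T ps then sizes_ok f is ps else False else False)"

fun case_sizes_ok :: "case_data \<Rightarrow> nat list \<Rightarrow> bool" where
  "case_sizes_ok (r, N, K, its) ps = sizes_ok (item_mat r N K) its ps"

lemma sizes_ok_cong: "is = is' \<Longrightarrow> sizes_ok f is ps = sizes_ok f is' ps" by simp

lemmas sizes_ev = case_sizes_ok.simps sizes_ok.simps size2.simps size3.simps

text \<open>Each of these fourteen cases contains exactly one graph with three vertices in
  \<open>T\<close>, so one permutation per case is enough.\<close>

lemma rotations: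
  "case_sizes_ok (c3 ()) [n13,n14,n19,n9,n18,n5,n8,n17,n15,n16,n7,n4,n2,n20,n21,n6,n3,n10,n11,n12,0,n1]"
  "case_sizes_ok (c12 ()) [n14,n20,n8,n12,n18,n5,n9,n10,n15,n16,n17,n4,n19,n1,n21,n2,n6,n7,n11,n3,n13,0]"
  "case_sizes_ok (c54 ()) [n21,n17,n19,n9,n4,n15,n11,n13,n5,n16,n1,n18,n2,n20,0,n8,n3,n10,n6,n12,n7,n14]"
  "case_sizes_ok (c61 ()) [n8,n9,n12,n10,n13,n5,n14,n18,n15,n16,n17,n7,n19,n20,n21,0,n1,n3,n11,n2,n4,n6]"
  "case_sizes_ok (c63 ()) [n12,n17,n8,n14,n11,n5,n16,n13,n15,n6,n1,n18,n19,n20,n21,n2,n9,n10,n4,0,n7,n3]"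
  "case_sizes_ok (c81 ()) [n9,n19,n8,n13,n17,n5,n11,n14,n15,n16,n4,n18,n1,n20,n21,n2,0,n10,n6,n12,n3,n7]"
  "case_sizes_ok (c95 ()) [n12,n10,n18,n14,n20,n5,n8,n16,n15,n7,n17,n2,n19,n4,n21,n6,n9,n1,n11,0,n13,n3]"
  "case_sizes_ok (c113 ()) [n13,n15,n11,n19,n4,n21,n17,n16,n1,n7,n6,n18,n3,n20,n5,n8,n9,n10,n2,n12,0,n14]"
  "case_sizes_ok (c126 ()) [n10,n12,n8,n13,n4,n9,n21,n11,n15,n16,n17,n18,n19,n20,n6,n2,n5,0,n7,n1,n3,n14]"
  "case_sizes_ok (c156 ()) [n14,n12,n17,n9,n4,n8,n20,n18,n15,n16,n2,n7,n19,n6,n21,n5,n3,n10,n11,n1,n13,0]"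
  "case_sizes_ok (c160 ()) [n16,n15,n10,n12,n20,n5,n18,n21,n1,0,n17,n6,n19,n4,n7,n8,n9,n2,n11,n3,n13,n14]"
  "case_sizes_ok (c163 ()) [n21,n17,n19,n9,n13,n5,n11,n15,n7,n16,n1,n18,n2,n20,0,n8,n3,n10,n6,n12,n4,n14]"
  "case_sizes_ok (c187 ()) [n17,n11,n14,n9,n4,n19,n8,n20,n15,n16,0,n18,n5,n7,n21,n6,n3,n10,n1,n12,n13,n2]"
  "case_sizes_ok (c205 ()) [n13,n9,n21,n11,n4,n8,n19,n17,n15,n16,n7,n18,n6,n20,n2,n5,n1,n10,n3,n12,0,n14]"
  by (simp_all only: c_def sizes_ev rotates_def item_mat_def case_ok_ev reps_def cong: wcongs sizes_ok_cong)

lemma all_cases_sizes: "\<forall>c\<in>set all_cases. \<exists>ps. case_sizes_ok (c ()) ps"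
  unfolding all_cases_def list.set ball_simps
  \<comment> \<open>Where every \<open>T\<close> in the case has two elements, the empty list serves
    as witness.\<close>
  by (intro conjI TrueI; (rule exI, rule rotations)?; (rule exI[of _ "[]"], simp only: c_def sizes_ev if_True cong: wcongs sizes_ok_cong)?)

fun case_values :: "case_data \<Rightarrow> (nat \<times> nat list) list" where
  "case_values (r, N, K, its) = map snd its"

lemma map_snd_items: "map snd items = concat (map (\<lambda>c. case_values (c ())) all_cases)"
proof -
  have "map snd (case_items d) = case_values d" for d by (cases d) auto
  then show ?thesis by (simp add: items_def map_concat comp_def)
qed

\<comment> \<open>Counting and distinctness are read off from the values and the sets
  \<open>T\<close> alone; the matrices are not expanded.\<close>
schematic_goal item_values: "map snd items = ?x"
  by (simp only: map_snd_items all_cases_def list.map c_def case_values.simps concat.simps append.simps snd_conv)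

lemma length_items: "length items = 270"
proof -
  have "length (map snd items) = 270" unfolding item_values by simp
  then show ?thesis by simp
qed

lemma count_size3: "length (filter (\<lambda>(A, v, T). size3 T) items) = 14"
proof -
  have "length (filter (\<lambda>(v, T). size3 T) (map snd items)) = 14"
    unfolding item_values by (simp only: filter.simps prod.case size3.simps if_True if_False cong: if_weak_cong) simp
  then show ?thesis by (simp add: filter_map comp_def case_prod_beta')
qed

lemma items_values: "(A, v, T) \<in> set items \<Longrightarrow> v > 0" "distinct (map (\<lambda>(A, v, T). v) items)"
proof -
  have "list_all (\<lambda>(v, T). v > 0) (map snd items)" unfolding item_values by simp
  then show "(A, v, T) \<in> set items \<Longrightarrow> v > 0" by (auto simp: list_all_iff)
  have "distinct (map fst (map snd items))" unfolding item_values by simp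
  then show "distinct (map (\<lambda>(A, v, T). v) items)" by (simp add: comp_def case_prod_beta')
qed

lemma sizes_ok_iff: "sizes_ok f is ps \<Longrightarrow> (P, v, T) \<in> set is \<Longrightarrow> size2 T \<or> size3 T \<and> rotates (f P) T ps"
  by (induction f "is" ps rule: sizes_ok.induct) (auto split: if_splits)

lemma items_size:
  assumes "(A, v, T) \<in> set items"
  shows "size2 T \<or> size3 T \<and> (\<exists>ps. rotates A T ps)"
proof -
  obtain c where c: "c \<in> set all_cases" "(A, v, T) \<in> set (case_items (c ()))" using assms by (auto simp: items_def)
  obtain r N K its where d: "c () = (r, N, K, its)" by (cases "c ()") auto
  then obtain P where P: "(P, v, T) \<in> set its" "A = item_mat r N K P" using c(2) by auto
  obtain ps where "case_sizes_ok (c ()) ps" using all_cases_sizes c(1) by blast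
  then show ?thesis using sizes_ok_iff[OF _ P(1)] P(2) d by auto
qed

lemma size2_iff: "size2 T \<longleftrightarrow> (\<exists>p q. T = [p, q])"
  by (cases T rule: size2.cases) auto

lemma size3_iff: "size3 T \<longleftrightarrow> (\<exists>p q s. T = [p, q, s])"
  by (cases T rule: size3.cases) auto

subsection \<open>Invariants and automorphism groups\<close>

lemma invariants:
  assumes f: "bij_betw f {..<22} {..<22}" and e: "\<And>x y. x < 22 \<Longrightarrow> y < 22 \<Longrightarrow> a x y = b (f x) (f y)"
  shows "x < 22 \<Longrightarrow> y < 22 \<Longrightarrow> common a x y = common b (f x) (f y)"
    "x < 22 \<Longrightarrow> fval a x = fval b (f x)" "x < 22 \<Longrightarrow> hval a x = hval b (f x)" "vval a = vval b"
proof -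
  have s: "(\<Sum>z<22. g (f z)) = (\<Sum>z<22. g z)" for g :: "nat \<Rightarrow> nat"
    by (rule sum.reindex_bij_betw[OF f])
  have c: "common a x y = common b (f x) (f y)" if "x < 22" "y < 22" for x y
    unfolding common_def s[of "\<lambda>z. of_bool (b (f x) z \<and> b (f y) z)", symmetric]
    by (intro sum.cong refl) (simp add: e that)
  have F: "fval a x = fval b (f x)" if "x < 22" for x
    unfolding fval_def s[of "\<lambda>z. of_bool (b z (f x)) * ((common b (f x) z)\<^sup>2 + 1)", symmetric]
    by (intro arg_cong[of _ _ Suc] sum.cong refl) (simp add: e c that)
  have H: "hval a x = hval b (f x)" if "x < 22" for x
    unfolding hval_def s[of "\<lambda>z. of_bool (b (f x) z) * fval b z", symmetric]
    by (intro arg_cong[of _ _ Suc] sum.cong refl) (simp add: e F that)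
  have V: "vval a = vval b"
    unfolding vval_def s[of "\<lambda>z. (hval b z)\<^sup>2", symmetric]
    by (intro arg_cong[of _ _ Suc] sum.cong refl) (simp add: H)
  show "x < 22 \<Longrightarrow> y < 22 \<Longrightarrow> common a x y = common b (f x) (f y)"
    "x < 22 \<Longrightarrow> fval a x = fval b (f x)" "x < 22 \<Longrightarrow> hval a x = hval b (f x)" "vval a = vval b"
    by (fact c F H V)+
qed

definition graph_of :: "(nat \<Rightarrow> nat \<Rightarrow> bool) \<Rightarrow> nat pair_pre_digraph" where
  "graph_of a = \<lparr>pverts = {..<22}, parcs = {(x, y). x < 22 \<and> y < 22 \<and> a x y}\<rparr>"

lemma graph_of_sel [simp]: "pverts (graph_of a) = {..<22}" "(x, y) \<in> parcs (graph_of a) \<longleftrightarrow> x < 22 \<and> y < 22 \<and> a x y"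
  by (auto simp: graph_of_def)

lemma reach_isomorphic: "reach a b \<Longrightarrow> isomorphic (graph_of b) (graph_of a)"
proof -
  assume "reach a b"
  then obtain p where p: "p permutes {..<22}" "b = (\<lambda>x y. a (p x) (p y))" unfolding reach_def by auto
  have "p x < 22 \<longleftrightarrow> x < 22" for x using permutes_in_image[OF p(1), of x] by simp
  then show ?thesis
    unfolding isomorphic_def using permutes_imp_bij[OF p(1)] by (intro exI[of _ p]) (simp add: p(2))
qed

lemma isomorphic_vval: "isomorphic (graph_of a) (graph_of b) \<Longrightarrow> vval a = vval b"
proof -
  assume "isomorphic (graph_of a) (graph_of b)"
  then obtain f where f: "bij_betw f {..<22} {..<22}" "\<forall>x<22. \<forall>y<22. a x y \<longleftrightarrow> f x < 22 \<and> f y < 22 \<and> b (f x) (f y)"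
    unfolding isomorphic_def by auto
  have "f x < 22" if "x < 22" for x using bij_betwE[OF f(1)] that by auto
  then show ?thesis using f by (intro invariants(4)[OF f(1)]) auto
qed

lemma aut_mk: "\<sigma> \<in> automorphisms (graph_of a) \<longleftrightarrow> \<sigma> permutes {..<22} \<and> (\<forall>x<22. \<forall>y<22. a x y = a (\<sigma> x) (\<sigma> y))"
proof (cases "\<sigma> permutes {..<22}")
  case True
  then have "\<sigma> x < 22 \<longleftrightarrow> x < 22" for x using permutes_in_image[OF True, of x] by simp
  then show ?thesis using True by (auto simp: automorphisms_def)
qed (simp add: automorphisms_def)

lemma aut_comp: "\<sigma> \<in> automorphisms G \<Longrightarrow> \<tau> \<in> automorphisms G \<Longrightarrow> \<sigma> \<circ> \<tau> \<in> automorphisms G"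
  using group.is_monoid[OF group_aut_group[of G]] monoid.m_closed[of "aut_group G" \<sigma> \<tau>] by (simp add: aut_group_def)

lemma aut_id: "id \<in> automorphisms G"
  using group.is_monoid[OF group_aut_group[of G]] monoid.one_closed[of "aut_group G"] by (simp add: aut_group_def)

lemma aut_inv: "\<sigma> \<in> automorphisms G \<Longrightarrow> \<exists>\<tau>\<in>automorphisms G. \<tau> \<circ> \<sigma> = id"
  using group.l_inv_ex[OF group_aut_group[of G], of \<sigma>] by (simp add: aut_group_def)

lemma aut_permutes: "\<sigma> \<in> automorphisms G \<Longrightarrow> \<sigma> permutes pverts G"
  by (simp add: automorphisms_def)

lemma swap_orbits_permutes: "swap_orbits permutes {..<22}"
proof -
  have "swap_orbits = lift id id (\<lambda>_. True)" by (auto simp: swap_orbits_def lift_def fun_eq_iff)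
  then show ?thesis using lift_permutes[OF permutes_id permutes_id, of "\<lambda>_. True"] by metis
qed

lemma swap_orbits_aut: "nice a \<Longrightarrow> swap_orbits \<in> automorphisms (graph_of a)"
  by (simp add: aut_mk swap_orbits_permutes nice_def)

lemma swap_orbits_swp: "swap_orbits (swap_orbits x) = x"
  by (auto simp: swap_orbits_def)

lemma swap_orbits_neq_id: "swap_orbits \<noteq> id"
proof
  assume "swap_orbits = id" then have "swap_orbits 8 = 8" by simp
  then show False by (simp add: swap_orbits_def)
qed

context
  fixes a :: "nat \<Rightarrow> nat \<Rightarrow> bool" and T :: "nat list" and p q :: nat
  assumes nice: "nice a" and T: "T = filter (\<lambda>x. hval a x = hval a p) [0..<22]" and pq: "p \<in> set T" "q \<in> set T"
    and sgn: "inj_on (sgn_at a p q) {..<22}"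
begin

lemma aut_T: "\<sigma> \<in> automorphisms (graph_of a) \<Longrightarrow> x \<in> set T \<Longrightarrow> \<sigma> x \<in> set T"
proof -
  assume s: "\<sigma> \<in> automorphisms (graph_of a)" and x: "x \<in> set T"
  then have b: "\<sigma> permutes {..<22}" "\<And>x y. x < 22 \<Longrightarrow> y < 22 \<Longrightarrow> a x y = a (\<sigma> x) (\<sigma> y)" by (auto simp: aut_mk)
  from x have "x < 22" "hval a x = hval a p" by (auto simp: T)
  then show ?thesis
    using invariants(3)[where a = a and b = a and x = x, OF permutes_imp_bij[OF b(1)] b(2)] permutes_in_image[OF b(1), of x] by (simp add: T)
qed

text \<open>The signature relative to the two fixed vertices is preserved, and it determines the
  vertex.\<close>

lemma aut_fixed:
  assumes "\<sigma> \<in> automorphisms (graph_of a)" "\<sigma> p = p" "\<sigma> q = q"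
  shows "\<sigma> = id"
proof
  fix x
  have b: "\<sigma> permutes {..<22}" "\<And>x y. x < 22 \<Longrightarrow> y < 22 \<Longrightarrow> a x y = a (\<sigma> x) (\<sigma> y)" using assms(1) by (auto simp: aut_mk)
  note inv = invariants[where a = a and b = a, OF permutes_imp_bij[OF b(1)] b(2)]
  have p22: "p < 22" "q < 22" using pq by (auto simp: T)
  show "\<sigma> x = id x"
  proof (cases "x < 22")
    case True
    have "sgn_at a p q (\<sigma> x) = sgn_at a p q x"
      using b(2)[of x p] b(2)[of p x] b(2)[of x q] b(2)[of q x] inv(1)[of x p] inv(1)[of x q] inv(2,3)[of x] p22 True assms(2,3)
      by (simp add: sgn_at_def)
    moreover have "\<sigma> x < 22" using permutes_in_image[OF b(1), of x] True by simp
    ultimately show ?thesis using inj_onD[OF sgn, of "\<sigma> x" x] True by simp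
  next
    case False
    then show ?thesis using permutes_not_in[OF b(1), of x] by simp
  qed
qed

lemma aut_eqI:
  assumes "\<sigma> \<in> automorphisms (graph_of a)" "\<tau> \<in> automorphisms (graph_of a)" "\<sigma> p = \<tau> p" "\<sigma> q = \<tau> q"
  shows "\<sigma> = \<tau>"
proof -
  obtain \<rho> where r: "\<rho> \<in> automorphisms (graph_of a)" "\<rho> \<circ> \<tau> = id" using aut_inv[OF assms(2)] by blast
  have "\<rho> (\<tau> x) = x" for x using r(2) by (metis comp_apply id_apply)
  then have "\<rho> \<circ> \<sigma> = id" using assms(3,4) by (intro aut_fixed aut_comp r(1) assms(1)) simp_all
  then have "\<rho> \<circ> \<sigma> = \<rho> \<circ> \<tau>" using r(2) by simp
  moreover have "inj \<rho>" using aut_permutes[OF r(1)] by (rule permutes_inj)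
  ultimately show ?thesis by (auto simp: fun_eq_iff dest: injD)
qed

lemma aut_inj: "\<sigma> \<in> automorphisms (graph_of a) \<Longrightarrow> \<sigma> x = \<sigma> y \<longleftrightarrow> x = y"
  using permutes_inj[OF aut_permutes] by (auto dest: injD)

text \<open>An automorphism is determined by its images of \<open>p\<close> and \<open>q\<close>,
  which lie in \<open>T\<close>. The involution has to exchange the two vertices, since otherwise it
  would be the identity.\<close>

lemma order_2:
  assumes "T = [p, q]"
  shows "order (aut_group (graph_of a)) = 2"
proof -
  have "distinct T" unfolding T by simp
  then have neq: "p \<noteq> q" using assms by simp
  have "swap_orbits p \<noteq> p"
  proof
    assume p: "swap_orbits p = p"
    then have "swap_orbits q = q" using aut_T[OF swap_orbits_aut[OF nice] pq(2)] assms neq aut_inj[OF swap_orbits_aut[OF nice], of p q] by auto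
    with p have "swap_orbits = id" using aut_fixed[OF swap_orbits_aut[OF nice]] by blast
    then show False using swap_orbits_neq_id by blast
  qed
  then have sp: "swap_orbits p = q" "swap_orbits q = p" using aut_T[OF swap_orbits_aut[OF nice] pq(1)] assms swap_orbits_swp[of p] by auto
  have "automorphisms (graph_of a) = {id, swap_orbits}"
  proof (intro equalityI subsetI)
    fix \<sigma> assume s: "\<sigma> \<in> automorphisms (graph_of a)"
    have "\<sigma> p \<in> {p, q}" "\<sigma> q \<in> {p, q}" "\<sigma> p \<noteq> \<sigma> q" using aut_T[OF s] pq assms aut_inj[OF s] neq by auto
    then consider "\<sigma> p = p" "\<sigma> q = q" | "\<sigma> p = q" "\<sigma> q = p" by auto
    then show "\<sigma> \<in> {id, swap_orbits}"
      using aut_eqI[OF s aut_id] aut_eqI[OF s swap_orbits_aut[OF nice]] sp by cases auto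
  qed (use aut_id swap_orbits_aut[OF nice] in auto)
  then show ?thesis using swap_orbits_neq_id by (simp add: order_def aut_group_def)
qed

lemma iso_sym_3:
  assumes T3: "T = [p, q, s]" and r: "\<rho> \<in> automorphisms (graph_of a)" "\<rho> p = q" "\<rho> q = s"
  shows "order (aut_group (graph_of a)) = 6" "aut_group (graph_of a) \<cong> sym_group 3"
proof -
  have "distinct T" unfolding T by simp
  then have d: "p \<noteq> q" "p \<noteq> s" "q \<noteq> s" unfolding T3 by simp_all
  have st: "set T = {p, q, s}" using T3 by auto
  note w = swap_orbits_aut[OF nice]
  have rs: "\<rho> s = p"
    using aut_T[OF r(1), of s] aut_inj[OF r(1), of s p] aut_inj[OF r(1), of s q] r(2,3) d st by auto
  let ?A = "automorphisms (graph_of a)"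
  have fin: "finite ?A"
    by (rule finite_subset[OF _ finite_permutations[of "{..<22 :: nat}"]]) (auto simp: aut_mk)
  let ?ev = "\<lambda>\<sigma>. (\<sigma> p, \<sigma> q)"
  \<comment> \<open>The involution acts on \<open>T\<close> as a transposition: it is its own
    inverse, and it cannot fix both \<open>p\<close> and \<open>q\<close>.\<close>
  have w3: "swap_orbits p = p \<and> swap_orbits q = s \<and> swap_orbits s = q \<or> swap_orbits p = q \<and> swap_orbits q = p \<and> swap_orbits s = s \<or> swap_orbits p = s \<and> swap_orbits q = q \<and> swap_orbits s = p"
  proof -
    have m: "swap_orbits p \<in> {p, q, s}" "swap_orbits q \<in> {p, q, s}" "swap_orbits s \<in> {p, q, s}" using aut_T[OF w] st by auto
    have n: "\<not> (swap_orbits p = p \<and> swap_orbits q = q)" using aut_fixed[OF w] swap_orbits_neq_id by blast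
    have i: "swap_orbits p \<noteq> swap_orbits q" "swap_orbits p \<noteq> swap_orbits s" "swap_orbits q \<noteq> swap_orbits s" using aut_inj[OF w] d by auto
    from m(1) consider "swap_orbits p = p" | "swap_orbits p = q" | "swap_orbits p = s" by blast
    then show ?thesis
    proof cases
      case 1
      then have "swap_orbits q = s" using m(2) n i(1) by auto
      with 1 swap_orbits_swp[of q] show ?thesis by simp
    next
      case 2
      then have "swap_orbits q = p" using swap_orbits_swp[of p] by simp
      with 2 m(3) i show ?thesis by auto
    next
      case 3
      then have "swap_orbits s = p" using swap_orbits_swp[of p] by simp
      with 3 m(2) i show ?thesis by auto
    qed
  qed
  \<comment> \<open>The powers of the rotation and their products with the involution map the pair
    of \<open>p\<close> and \<open>q\<close> to all six ordered pairs of distinct elements of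
    \<open>T\<close>. This gives six automorphisms; the faithful action on \<open>T\<close> allows
    no more.\<close>
  define E where "E = ?ev ` ?A"
  have "{(p, q), (q, s), (s, p), (p, s), (s, q), (q, p)} \<subseteq> E"
  proof -
    have "(p, q) = ?ev id" "(q, s) = ?ev \<rho>" "(s, p) = ?ev (\<rho> \<circ> \<rho>)" using r rs by auto
    then have 1: "{(p, q), (q, s), (s, p)} \<subseteq> E" unfolding E_def using aut_id r(1) aut_comp[OF r(1) r(1)] by blast
    have 2: "?ev swap_orbits \<in> E" "?ev (swap_orbits \<circ> \<rho>) \<in> E" "?ev (swap_orbits \<circ> (\<rho> \<circ> \<rho>)) \<in> E"
      unfolding E_def using w aut_comp[OF w r(1)] aut_comp[OF w aut_comp[OF r(1) r(1)]] by blast+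
    have "(swap_orbits p, swap_orbits q) \<in> E" "(swap_orbits q, swap_orbits s) \<in> E" "(swap_orbits s, swap_orbits p) \<in> E"
      using 2 r rs by simp_all
    then show ?thesis using 1 w3 by auto
  qed
  then have "card {(p, q), (q, s), (s, p), (p, s), (s, q), (q, p)} \<le> card E"
    using fin by (intro card_mono) (auto simp: E_def)
  also have "\<dots> \<le> card ?A" unfolding E_def using fin by (rule card_image_le)
  finally have ge: "6 \<le> card ?A" using d by simp
  \<comment> \<open>The group \<open>sym_group 3\<close> permutes the numbers 1, 2 and 3;
    \<open>t\<close> and \<open>u\<close> translate between these and the vertices of
    \<open>T\<close>.\<close>
  define t where "t i = (if i = 1 then p else if i = 2 then q else s)" for i :: nat
  define u where "u x = (if x = p then 1 else if x = q then 2 else 3 :: nat)" for x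
  have tu: "t (u x) = x" if "x \<in> set T" for x using that d st by (auto simp: t_def u_def)
  have ut: "u (t i) = i" if "i \<in> {1..3}" for i using that d by (auto simp: t_def u_def)
  have uT: "u x \<in> {1..3}" for x by (auto simp: u_def)
  have tT: "t i \<in> set T" for i by (auto simp: t_def st)
  define \<phi> where "\<phi> \<sigma> i = (if i \<in> {1..3} then u (\<sigma> (t i)) else i)" for \<sigma> :: "nat \<Rightarrow> nat" and i
  have perm: "\<phi> \<sigma> permutes {1..3}" if "\<sigma> \<in> ?A" for \<sigma>
  proof -
    have "inj_on (\<phi> \<sigma>) {1..3}"
    proof (rule inj_onI)
      fix i j assume ij: "i \<in> {1..3}" "j \<in> {1..3}" "\<phi> \<sigma> i = \<phi> \<sigma> j"
      then have "u (\<sigma> (t i)) = u (\<sigma> (t j))" by (simp add: \<phi>_def)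
      then have "\<sigma> (t i) = \<sigma> (t j)" using tu aut_T[OF that tT] by metis
      then have "t i = t j" using aut_inj[OF that] by simp
      then show "i = j" using ut ij by metis
    qed
    moreover have "\<phi> \<sigma> ` {1..3} \<subseteq> {1..3}" using uT by (auto simp: \<phi>_def simp del: atLeastAtMost_iff)
    ultimately have "bij_betw (\<phi> \<sigma>) {1..3} {1..3}" by (simp add: bij_betw_def endo_inj_surj)
    then show ?thesis by (rule bij_imp_permutes) (auto simp: \<phi>_def)
  qed
  have inj: "inj_on \<phi> ?A"
  proof (rule inj_onI)
    fix \<sigma> \<tau> assume st': "\<sigma> \<in> ?A" "\<tau> \<in> ?A" "\<phi> \<sigma> = \<phi> \<tau>"
    have e: "\<sigma> x = \<tau> x" if x: "x \<in> set T" for x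
    proof -
      have "u (\<sigma> x) = u (\<tau> x)" using fun_cong[OF st'(3), of "u x"] uT[of x] tu[OF x] by (simp add: \<phi>_def)
      then show ?thesis using tu aut_T[OF st'(1) x] aut_T[OF st'(2) x] by metis
    qed
    show "\<sigma> = \<tau>" using aut_eqI[OF st'(1,2)] e pq by blast
  qed
  have hom: "\<phi> (\<sigma> \<circ> \<tau>) = \<phi> \<sigma> \<circ> \<phi> \<tau>" if "\<sigma> \<in> ?A" "\<tau> \<in> ?A" for \<sigma> \<tau>
  proof
    fix i show "\<phi> (\<sigma> \<circ> \<tau>) i = (\<phi> \<sigma> \<circ> \<phi> \<tau>) i"
      using tu[OF aut_T[OF that(2) tT]] uT by (simp add: \<phi>_def del: atLeastAtMost_iff)
  qed
  let ?S = "{\<pi>. \<pi> permutes {1..3 :: nat}}"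
  have sub: "\<phi> ` ?A \<subseteq> ?S" using perm by auto
  have cS: "card ?S = 6" using card_permutations[of "{1..3 :: nat}" 3] by (simp add: numeral_eq_Suc)
  have cA: "card (\<phi> ` ?A) = card ?A" by (rule card_image[OF inj])
  have "card (\<phi> ` ?A) \<le> 6" using card_mono[OF _ sub] cS finite_permutations[of "{1..3 :: nat}"] by simp
  then have c6: "card ?A = 6" using ge cA by simp
  then show "order (aut_group (graph_of a)) = 6" by (simp add: order_def aut_group_def)
  have "\<phi> ` ?A = ?S" using card_subset_eq[OF _ sub] finite_permutations[of "{1..3 :: nat}"] c6 cA cS by simp
  then have "\<phi> \<in> iso (aut_group (graph_of a)) (sym_group 3)"
    using inj hom sub by (auto simp: iso_def hom_def bij_betw_def aut_group_def sym_group_def)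
  then show "aut_group (graph_of a) \<cong> sym_group 3" by (rule is_isoI)
qed

end

section \<open>Transport of automorphism groups along isomorphisms\<close>

definition conj_by :: "('a \<Rightarrow> 'b) \<Rightarrow> 'a set \<Rightarrow> 'b set \<Rightarrow> ('a \<Rightarrow> 'a) \<Rightarrow> 'b \<Rightarrow> 'b" where
  "conj_by f V W \<sigma> y = (if y \<in> W then f (\<sigma> (inv_into V f y)) else y)"

lemma conj_by_aut:
  assumes f: "bij_betw f (pverts G) (pverts H)"
    and e: "\<forall>x\<in>pverts G. \<forall>y\<in>pverts G. (x, y) \<in> parcs G \<longleftrightarrow> (f x, f y) \<in> parcs H"
    and s: "\<sigma> \<in> automorphisms G"
  shows "conj_by f (pverts G) (pverts H) \<sigma> \<in> automorphisms H"
    and "x \<in> pverts G \<Longrightarrow> conj_by f (pverts G) (pverts H) \<sigma> (f x) = f (\<sigma> x)"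
proof -
  have p: "\<sigma> permutes pverts G" "\<And>x y. x \<in> pverts G \<Longrightarrow> y \<in> pverts G \<Longrightarrow> (x, y) \<in> parcs G \<longleftrightarrow> (\<sigma> x, \<sigma> y) \<in> parcs G"
    using s by (auto simp: automorphisms_def)
  have c: "conj_by f (pverts G) (pverts H) \<sigma> (f x) = f (\<sigma> x)" if "x \<in> pverts G" for x
    using that f by (auto simp: conj_by_def bij_betw_def)
  have m: "\<sigma> x \<in> pverts G" if "x \<in> pverts G" for x using permutes_in_image[OF p(1)] that by simp
  have "conj_by f (pverts G) (pverts H) \<sigma> permutes pverts H"
    using permutes_bij_inv_into[OF p(1) f] unfolding conj_by_def .
  moreover have "(x, y) \<in> parcs H \<longleftrightarrow> (conj_by f (pverts G) (pverts H) \<sigma> x, conj_by f (pverts G) (pverts H) \<sigma> y) \<in> parcs H"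
    if "x \<in> pverts H" "y \<in> pverts H" for x y
  proof -
    obtain x' y' where x': "x' \<in> pverts G" "x = f x'" "y' \<in> pverts G" "y = f y'"
      using \<open>x \<in> pverts H\<close> \<open>y \<in> pverts H\<close> bij_betw_imp_surj_on[OF f] by (metis imageE)
    have "(x, y) \<in> parcs H \<longleftrightarrow> (x', y') \<in> parcs G" using e x' by simp
    also have "\<dots> \<longleftrightarrow> (f (\<sigma> x'), f (\<sigma> y')) \<in> parcs H" using p(2) e m x' by simp
    finally show ?thesis using c x' by simp
  qed
  ultimately show "conj_by f (pverts G) (pverts H) \<sigma> \<in> automorphisms H" by (simp add: automorphisms_def)
  show "x \<in> pverts G \<Longrightarrow> conj_by f (pverts G) (pverts H) \<sigma> (f x) = f (\<sigma> x)" by (rule c)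
qed

lemma aut_eq_on:
  assumes "\<sigma> \<in> automorphisms G" "\<tau> \<in> automorphisms G" "\<And>x. x \<in> pverts G \<Longrightarrow> \<sigma> x = \<tau> x"
  shows "\<sigma> = \<tau>"
proof
  fix x show "\<sigma> x = \<tau> x"
    using assms(3) permutes_not_in[OF aut_permutes[OF assms(1)], of x] permutes_not_in[OF aut_permutes[OF assms(2)], of x]
    by (cases "x \<in> pverts G") auto
qed

lemma aut_group_isomorphic:
  assumes "isomorphic G H"
  shows "aut_group G \<cong> aut_group H"
proof -
  obtain f where f: "bij_betw f (pverts G) (pverts H)"
    and e: "\<forall>x\<in>pverts G. \<forall>y\<in>pverts G. (x, y) \<in> parcs G \<longleftrightarrow> (f x, f y) \<in> parcs H"
    using assms by (auto simp: isomorphic_def)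
  let ?c = "conj_by f (pverts G) (pverts H)"
  let ?g = "inv_into (pverts G) f"
  have g: "bij_betw ?g (pverts H) (pverts G)" using f by (rule bij_betw_inv_into)
  have gf: "f (?g y) = y" "?g y \<in> pverts G" if "y \<in> pverts H" for y
    using that f bij_betwE[OF g] by (auto simp: bij_betw_inv_into_right)
  have fg: "?g (f x) = x" "f x \<in> pverts H" if "x \<in> pverts G" for x
    using that f bij_betwE[OF f] by (auto simp: bij_betw_inv_into_left)
  have e': "\<forall>x\<in>pverts H. \<forall>y\<in>pverts H. (x, y) \<in> parcs H \<longleftrightarrow> (?g x, ?g y) \<in> parcs G"
    using e gf by simp
  let ?d = "conj_by ?g (pverts H) (pverts G)"
  note c = conj_by_aut[OF f e] and d = conj_by_aut[OF g e']
  have m: "\<sigma> x \<in> pverts G" if "\<sigma> \<in> automorphisms G" "x \<in> pverts G" for \<sigma> x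
    using permutes_in_image[OF aut_permutes[OF that(1)]] that(2) by simp
  have m': "\<sigma> x \<in> pverts H" if "\<sigma> \<in> automorphisms H" "x \<in> pverts H" for \<sigma> x
    using permutes_in_image[OF aut_permutes[OF that(1)]] that(2) by simp
  have dc: "?d (?c \<sigma>) = \<sigma>" if s: "\<sigma> \<in> automorphisms G" for \<sigma>
  proof (rule aut_eq_on[OF d(1)[OF c(1)[OF s]] s])
    fix x assume x: "x \<in> pverts G"
    have "?d (?c \<sigma>) (?g (f x)) = ?g (?c \<sigma> (f x))" by (rule d(2)[OF c(1)[OF s] fg(2)[OF x]])
    then show "?d (?c \<sigma>) x = \<sigma> x" using c(2)[OF s x] fg(1)[OF x] fg(1)[OF m[OF s x]] by simp
  qed
  have cd: "?c (?d \<tau>) = \<tau>" if s: "\<tau> \<in> automorphisms H" for \<tau>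
  proof (rule aut_eq_on[OF c(1)[OF d(1)[OF s]] s])
    fix y assume y: "y \<in> pverts H"
    have "?c (?d \<tau>) (f (?g y)) = f (?d \<tau> (?g y))" by (rule c(2)[OF d(1)[OF s] gf(2)[OF y]])
    then show "?c (?d \<tau>) y = \<tau> y" using d(2)[OF s y] gf(1)[OF y] gf(1)[OF m'[OF s y]] by simp
  qed
  have "bij_betw ?c (automorphisms G) (automorphisms H)"
    by (rule bij_betw_byWitness[of _ ?d]) (use cd dc c(1) d(1) in auto)
  moreover have "?c (\<sigma> \<circ> \<tau>) = ?c \<sigma> \<circ> ?c \<tau>" if s: "\<sigma> \<in> automorphisms G" "\<tau> \<in> automorphisms G" for \<sigma> \<tau>
  proof (rule aut_eq_on[OF c(1)[OF aut_comp[OF s]] aut_comp[OF c(1)[OF s(1)] c(1)[OF s(2)]]])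
    fix y assume y: "y \<in> pverts H"
    have "?c (\<sigma> \<circ> \<tau>) (f (?g y)) = (?c \<sigma> \<circ> ?c \<tau>) (f (?g y))"
      using c(2)[OF aut_comp[OF s] gf(2)[OF y]] c(2)[OF s(2) gf(2)[OF y]] c(2)[OF s(1) m[OF s(2) gf(2)[OF y]]] by simp
    then show "?c (\<sigma> \<circ> \<tau>) y = (?c \<sigma> \<circ> ?c \<tau>) y" using gf(1)[OF y] by simp
  qed
  ultimately have "?c \<in> iso (aut_group G) (aut_group H)"
    using c(1) by (auto simp: iso_def hom_def aut_group_def)
  then show ?thesis by (rule is_isoI)
qed

lemma aut_group_invariants:
  assumes "isomorphic G H"
  shows "order (aut_group G) = order (aut_group H)" "aut_group G \<cong> K \<longleftrightarrow> aut_group H \<cong> K"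
proof -
  note i = aut_group_isomorphic[OF assms] aut_group_isomorphic[OF isomorphic_sym[OF assms]]
  show "order (aut_group G) = order (aut_group H)"
    using iso_same_card[OF i(1)] by (simp add: order_def)
  show "aut_group G \<cong> K \<longleftrightarrow> aut_group H \<cong> K"
    using iso_trans[OF i(1)] iso_trans[OF i(2)] by blast
qed

lemma ord_2_iff:
  assumes "\<sigma> \<in> automorphisms G"
  shows "group.ord (aut_group G) \<sigma> = 2 \<longleftrightarrow> \<sigma> \<circ> \<sigma> = id \<and> \<sigma> \<noteq> id"
proof -
  interpret group "aut_group G" by (rule group_aut_group)
  have c: "\<sigma> \<in> carrier (aut_group G)" using assms by (simp add: aut_group_def)
  have o: "\<one>\<^bsub>aut_group G\<^esub> = id" "\<And>x y. x \<otimes>\<^bsub>aut_group G\<^esub> y = x \<circ> y" by (simp_all add: aut_group_def)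
  have "\<sigma> [^]\<^bsub>aut_group G\<^esub> (2 :: nat) = \<sigma> \<circ> \<sigma>"
    using c by (simp add: numeral_2_eq_2 o)
  then have 2: "\<sigma> \<circ> \<sigma> = id \<longleftrightarrow> ord \<sigma> dvd 2" using pow_eq_id[OF c, of 2] o by simp
  have 1: "\<sigma> = id \<longleftrightarrow> ord \<sigma> = 1" using ord_eq_1[OF c] o by simp
  have "n = 1 \<or> n = 2" if "n dvd 2" for n :: nat
    using dvd_imp_le[OF that] that by (cases "n = 0") auto
  then show ?thesis unfolding 2 1 by auto
qed

section \<open>Passage between graphs and matrices\<close>

lemma sum_of_bool_bij:
  assumes "bij_betw f {..<22 :: nat} V"
  shows "(\<Sum>z<22. of_bool (P (f z))) = card {z \<in> V. P z}"
proof -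
  have "finite V" using assms bij_betw_finite by blast
  then have "card {z \<in> V. P z} = (\<Sum>z\<in>V. of_bool (P z))" by (simp add: sum_of_bool_eq Int_def)
  also have "\<dots> = (\<Sum>z<22. of_bool (P (f z)))" by (rule sum.reindex_bij_betw[OF assms, symmetric])
  finally show ?thesis ..
qed

lemma degree_card:
  assumes "pair_wf_digraph G"
  shows "out_degree (with_proj G) x = card {y \<in> pverts G. (x, y) \<in> parcs G}"
    "in_degree (with_proj G) x = card {y \<in> pverts G. (y, x) \<in> parcs G}"
proof -
  interpret pair_wf_digraph G by fact
  have "{e \<in> parcs G. fst e = x} = Pair x ` {y \<in> pverts G. (x, y) \<in> parcs G}"
    using in_arcsD2 by force
  then show "out_degree (with_proj G) x = card {y \<in> pverts G. (x, y) \<in> parcs G}"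
    by (simp add: out_degree_def out_arcs_def card_image inj_on_def)
  have "{e \<in> parcs G. snd e = x} = (\<lambda>y. (y, x)) ` {y \<in> pverts G. (y, x) \<in> parcs G}"
    using in_arcsD1 by force
  then show "in_degree (with_proj G) x = card {y \<in> pverts G. (y, x) \<in> parcs G}"
    by (simp add: in_degree_def in_arcs_def card_image inj_on_def)
qed

lemma involution_labelling:
  assumes V: "card V = 22" and s: "\<sigma> permutes V" "\<sigma> \<circ> \<sigma> = id" and F: "card {x \<in> V. \<sigma> x = x} = 8"
  obtains f where "bij_betw f {..<22} V" "\<And>x. x < 22 \<Longrightarrow> f (swap_orbits x) = \<sigma> (f x)"
proof -
  have fin: "finite V" using V by (metis card.infinite zero_neq_numeral)
  have ss: "\<sigma> (\<sigma> x) = x" for x using s(2) by (metis comp_apply id_apply)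
  have sV: "\<sigma> x \<in> V \<longleftrightarrow> x \<in> V" for x using permutes_in_image[OF s(1)] .
  \<comment> \<open>An arbitrary numbering of the vertices serves to choose one vertex from each
    transposed pair.\<close>
  obtain e :: "'a \<Rightarrow> nat" where e: "inj_on e V" using finite_imp_inj_to_nat_seg[OF fin] by blast
  define R where "R = {x \<in> V. e x < e (\<sigma> x)}"
  have sR: "\<sigma> ` R = {x \<in> V. e (\<sigma> x) < e x}"
  proof (intro equalityI subsetI)
    fix x assume "x \<in> {x \<in> V. e (\<sigma> x) < e x}"
    then have "\<sigma> x \<in> R" "x = \<sigma> (\<sigma> x)" by (auto simp: R_def ss sV)
    then show "x \<in> \<sigma> ` R" by blast
  qed (auto simp: R_def ss sV)
  have "{x \<in> V. \<sigma> x \<noteq> x} = R \<union> \<sigma> ` R"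
    unfolding sR using inj_on_eq_iff[OF e] sV by (auto simp: R_def neq_iff) (metis neq_iff)+
  moreover have "card (R \<union> \<sigma> ` R) = card R + card (\<sigma> ` R)"
    using fin unfolding sR by (intro card_Un_disjoint) (auto simp: R_def)
  moreover have "card (\<sigma> ` R) = card R" using permutes_inj[OF s(1)] by (intro card_image) (auto simp: inj_on_def inj_def)
  moreover have "card V = card {x \<in> V. \<sigma> x = x} + card {x \<in> V. \<sigma> x \<noteq> x}"
    using fin by (subst card_Un_disjoint[symmetric]) (auto intro: arg_cong[of _ _ card])
  ultimately have R7: "card R = 7" using V F by simp
  have VU: "V = {x \<in> V. \<sigma> x = x} \<union> R \<union> \<sigma> ` R" using \<open>{x \<in> V. \<sigma> x \<noteq> x} = R \<union> \<sigma> ` R\<close> by blast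
  obtain g where g: "bij_betw g {..<8 :: nat} {x \<in> V. \<sigma> x = x}"
    using ex_bij_betw_nat_finite[of "{x \<in> V. \<sigma> x = x}"] fin F by (auto simp: atLeast0LessThan)
  obtain h where h: "bij_betw h {..<7 :: nat} R"
    using ex_bij_betw_nat_finite[of R] fin R7 by (auto simp: atLeast0LessThan R_def)
  define f where "f x = (if x < 8 then g x else if x < 15 then h (x - 8) else \<sigma> (h (x - 15)))" for x :: nat
  have u: "{..<22} = {..<8} \<union> (+) 8 ` {..<7} \<union> (+) 15 ` {..<7 :: nat}"
  proof -
    have "x < 8 \<or> (\<exists>l<7. x = 8 + l) \<or> (\<exists>l<7. x = 15 + l)" if "x < 22" for x :: nat
      using that by presburger
    then show ?thesis by auto
  qed
  have "f ` {..<22} = g ` {..<8} \<union> h ` {..<7} \<union> \<sigma> ` h ` {..<7}"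
    unfolding u image_Un image_image by (intro arg_cong2[of _ _ _ _ "(\<union>)"] image_cong) (auto simp: f_def)
  also have "\<dots> = V" using g h VU by (simp add: bij_betw_def)
  finally have im: "f ` {..<22} = V" .
  then have "bij_betw f {..<22} V"
    using eq_card_imp_inj_on[of "{..<22 :: nat}" f] V by (simp add: bij_betw_def)
  moreover have "f (swap_orbits x) = \<sigma> (f x)" if "x < 22" for x
  proof -
    have "\<sigma> (g x) = g x" if "x < 8" using bij_betwE[OF g] that by auto
    then show ?thesis using that by (auto simp: f_def swap_orbits_def ss)
  qed
  ultimately show ?thesis by (rule that)
qed

lemma dsrg_nice:
  assumes "G \<in> dsrgs_with_involution 22 9 6 3 4 8"
  obtains a where "nice a" "isomorphic G (graph_of a)"
proof -
  obtain \<sigma> where d: "dsrg G 22 9 6 3 4" and s: "\<sigma> \<in> automorphisms G" "group.ord (aut_group G) \<sigma> = 2"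
    and F: "card {x \<in> pverts G. \<sigma> x = x} = 8"
    using assms unfolding dsrgs_with_involution_def by (auto simp: aut_group_def)
  interpret dsrg G 22 9 6 3 4 by (rule d)
  have "\<sigma> \<circ> \<sigma> = id" using s ord_2_iff by blast
  then obtain f where f: "bij_betw f {..<22} (pverts G)" "\<And>x. x < 22 \<Longrightarrow> f (swap_orbits x) = \<sigma> (f x)"
    using involution_labelling[OF num_verts aut_permutes[OF s(1)] _ F] by metis
  have fV: "f x \<in> pverts G" if "x < 22" for x using bij_betwE[OF f(1)] that by simp
  have fi: "f x = f y \<longleftrightarrow> x = y" if "x < 22" "y < 22" for x y
    using f(1) that by (auto simp: bij_betw_def inj_on_def)
  define a where "a x y \<longleftrightarrow> (f x, f y) \<in> parcs G" for x y
  have wf: "pair_wf_digraph G" ..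
  have "nice a"
    unfolding nice_def
  proof (intro conjI allI impI)
    fix x :: nat assume x: "x < 22"
    show nl: "\<not> a x x" using pair_no_loops[of "(f x, f x)"] by (auto simp: a_def)
    show "(\<Sum>z<22. of_bool (a x z)) = (9::nat)"
      unfolding a_def sum_of_bool_bij[OF f(1), of "\<lambda>z. (f x, z) \<in> parcs G"]
      using out_deg[OF fV[OF x]] degree_card[OF wf] by simp
    show "(\<Sum>z<22. of_bool (a z x)) = (9::nat)"
      unfolding a_def sum_of_bool_bij[OF f(1), of "\<lambda>z. (z, f x) \<in> parcs G"]
      using in_deg[OF fV[OF x]] degree_card[OF wf] by simp
    fix y :: nat assume y: "y < 22"
    show "a (swap_orbits x) (swap_orbits y) = a x y"
      using s(1) fV x y by (simp add: a_def f(2) automorphisms_def)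
    have S: "(\<Sum>z<22. of_bool (a x z \<and> a z y)) = card {z \<in> pverts G. (f x, z) \<in> parcs G \<and> (z, f y) \<in> parcs G}"
      unfolding a_def by (rule sum_of_bool_bij[OF f(1)])
    show "(\<Sum>z<22. of_bool (a x z \<and> a z y)) + of_bool (a x y) = (if x = y then 6 else 4 :: nat)"
    proof (cases "x = y")
      case True
      then show ?thesis using S reciprocal[OF fV[OF x]] nl by simp
    next
      case False
      then have "f x \<noteq> f y" using fi x y by simp
      then show ?thesis using S two_paths[OF fV[OF x] fV[OF y]] False by (simp add: a_def)
    qed
  qed
  moreover have "isomorphic (graph_of a) G" unfolding isomorphic_def using f(1) by (intro exI[of _ f]) (simp add: a_def)
  ultimately show ?thesis using that isomorphic_sym by blast
qed

text \<open>Any 22 elements of the type can serve as vertices; the involution is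
  \<open>swap_orbits\<close> carried over, and it fixes the vertices with the labels 0 to 7.\<close>

lemma nice_dsrg:
  assumes a: "nice a" and V: "card (V :: 'a set) = 22"
  obtains G :: "'a pair_pre_digraph" where "G \<in> dsrgs_with_involution 22 9 6 3 4 8" "isomorphic G (graph_of a)"
proof -
  have fin: "finite V" using V by (metis card.infinite zero_neq_numeral)
  obtain f where f: "bij_betw f {..<22 :: nat} V"
    using ex_bij_betw_nat_finite[OF fin] V by (auto simp: atLeast0LessThan)
  define G where "G = \<lparr>pverts = V, parcs = {(f x, f y) |x y. x < 22 \<and> y < 22 \<and> a x y}\<rparr>"
  have fV: "f x \<in> V" if "x < 22" for x using bij_betwE[OF f] that by simp
  have fi: "f x = f y \<longleftrightarrow> x = y" if "x < 22" "y < 22" for x y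
    using f that by (auto simp: bij_betw_def inj_on_def)
  have Vf: "\<exists>x<22. v = f x" if "v \<in> V" for v using f that by (auto simp: bij_betw_def)
  have Gv: "pverts G = V" by (simp add: G_def)
  have Ga: "(f x, f y) \<in> parcs G \<longleftrightarrow> a x y" if "x < 22" "y < 22" for x y
    using that fi by (auto simp: G_def)
  have wf: "pair_digraph G"
  proof
    show "finite (pverts G)" using fin Gv by simp
    have "parcs G \<subseteq> V \<times> V" using fV by (auto simp: G_def)
    then show "finite (parcs G)" using fin by (meson finite_SigmaI finite_subset)
    show "fst e \<in> pverts G" "snd e \<in> pverts G" if "e \<in> parcs G" for e using \<open>parcs G \<subseteq> V \<times> V\<close> that Gv by auto
    show "fst e \<noteq> snd e" if "e \<in> parcs G" for e using that nice_diag[OF a] fi by (auto simp: G_def)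
  qed
  then interpret pair_digraph G .
  have wf': "pair_wf_digraph G" ..
  have S: "card {z \<in> V. P z} = (\<Sum>z<22. of_bool (P (f z)))" for P
    by (rule sum_of_bool_bij[OF f, symmetric])
  have sums: "(\<Sum>z<22. of_bool ((f x, f z) \<in> parcs G)) = (\<Sum>z<22. of_bool (a x z) :: nat)"
    "(\<Sum>z<22. of_bool ((f z, f x) \<in> parcs G)) = (\<Sum>z<22. of_bool (a z x) :: nat)"
    "y < 22 \<Longrightarrow> (\<Sum>z<22. of_bool ((f x, f z) \<in> parcs G \<and> (f z, f y) \<in> parcs G)) = (\<Sum>z<22. of_bool (a x z \<and> a z y) :: nat)"
    if "x < 22" for x y
    by (intro sum.cong refl; simp add: Ga that)+
  have dsrg: "dsrg G 22 9 6 3 4"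
  proof
    show "card (pverts G) = 22" using V Gv by simp
    fix v assume "v \<in> pverts G"
    then obtain x where x: "x < 22" "v = f x" using Vf Gv by auto
    show "out_degree (with_proj G) v = 9" "in_degree (with_proj G) v = 9"
      unfolding degree_card[OF wf'] Gv S x(2) sums[OF x(1)] using a x(1) by (simp_all add: nice_def)
    show "card {y \<in> pverts G. (v, y) \<in> parcs G \<and> (y, v) \<in> parcs G} = 6"
      unfolding Gv S x(2) sums(3)[OF x(1) x(1)] using nice_sq[OF a x(1) x(1)] nice_diag[OF a x(1)] by simp
    fix w assume "w \<in> pverts G" and vw: "v \<noteq> w"
    then obtain y where y: "y < 22" "w = f y" using Vf Gv by auto
    show "card {z \<in> pverts G. (v, z) \<in> parcs G \<and> (z, w) \<in> parcs G} = (if (v, w) \<in> parcs G then 3 else 4)"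
      unfolding Gv S x(2) y(2) sums(3)[OF x(1) y(1)]
      using nice_sq[OF a x(1) y(1)] vw x y by (auto simp: Ga split: if_splits)
  qed
  have e: "\<forall>x\<in>pverts (graph_of a). \<forall>y\<in>pverts (graph_of a). (x, y) \<in> parcs (graph_of a) \<longleftrightarrow> (f x, f y) \<in> parcs G"
    by (simp add: Ga)
  have f': "bij_betw f (pverts (graph_of a)) (pverts G)" using f Gv by simp
  have iso: "isomorphic (graph_of a) G" unfolding isomorphic_def using f' e by blast
  define \<sigma> where "\<sigma> = conj_by f (pverts (graph_of a)) (pverts G) swap_orbits"
  note c = conj_by_aut[OF f' e swap_orbits_aut[OF a], folded \<sigma>_def]
  have sf: "\<sigma> (f x) = f (swap_orbits x)" if "x < 22" for x using c(2)[of x] that by simp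
  have sw: "swap_orbits x < 22" if "x < 22" for x using permutes_in_image[OF swap_orbits_permutes, of x] that by simp
  have "\<sigma> \<circ> \<sigma> = id"
  proof (rule aut_eq_on[OF aut_comp[OF c(1) c(1)] aut_id])
    fix v assume "v \<in> pverts G"
    then obtain x where "x < 22" "v = f x" using Vf Gv by auto
    then show "(\<sigma> \<circ> \<sigma>) v = id v" using sf sw swap_orbits_swp by simp
  qed
  moreover have "\<sigma> \<noteq> id"
  proof
    assume "\<sigma> = id"
    then have "f (swap_orbits 8) = f 8" using sf[of 8] by simp
    then show False using fi[of "swap_orbits 8" 8] by (simp add: swap_orbits_def)
  qed
  ultimately have "group.ord (aut_group G) \<sigma> = 2" using ord_2_iff[OF c(1)] by blast
  moreover have "card {v \<in> pverts G. \<sigma> v = v} = 8"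
  proof -
    have "card {v \<in> pverts G. \<sigma> v = v} = (\<Sum>z<22. of_bool (swap_orbits z = z))"
      unfolding Gv S by (intro sum.cong refl) (simp add: sf fi sw)
    also have "\<dots> = 8" unfolding sum_22 by (simp add: swap_orbits_def)
    finally show ?thesis .
  qed
  ultimately have "G \<in> dsrgs_with_involution 22 9 6 3 4 8"
    unfolding dsrgs_with_involution_def using dsrg c(1) by (auto simp: aut_group_def)
  then show ?thesis using that isomorphic_sym[OF iso] by blast
qed

section \<open>The count of isomorphism classes\<close>

abbreviation entries :: "bool list list \<Rightarrow> nat \<Rightarrow> nat \<Rightarrow> bool" where "entries A \<equiv> \<lambda>x y. A ! x ! y"

lemma graph_of_entries: "graph_of (entries (bmat 22 22 b)) = graph_of b"
  by (auto simp: graph_of_def)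

lemma item_facts:
  assumes "(A, v, T) \<in> set items"
  shows "nice (entries A)" "vval (entries A) = v"
    "size2 T \<Longrightarrow> order (aut_group (graph_of (entries A))) = 2"
    "size3 T \<Longrightarrow> order (aut_group (graph_of (entries A))) = 6 \<and> aut_group (graph_of (entries A)) \<cong> sym_group 3"
proof -
  obtain b where b: "A = bmat 22 22 b" "\<And>x y. x < 22 \<Longrightarrow> y < 22 \<Longrightarrow> b (swap_orbits x) (swap_orbits y) = b x y"
    using items_bmat[OF assms] by metis
  have E: "entries A x y = b x y" if "x < 22" "y < 22" for x y using that b(1) by simp
  have A: "bmat 22 22 (entries A) = A" unfolding b(1) by (simp add: bmat_eq_iff)
  have sl: "swap_orbits x < 22 \<longleftrightarrow> x < 22" for x using permutes_in_image[OF swap_orbits_permutes, of x] by simp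
  have sw: "\<forall>x<22. \<forall>y<22. entries A (swap_orbits x) (swap_orbits y) = entries A x y" by (simp add: b E sl)
  have T2: "T \<noteq> []" "2 \<le> length T" using items_size[OF assms] by (auto simp: size2_iff size3_iff)
  note g = graph_ok_facts[of "entries A" v T, unfolded A, OF items_gok[OF assms] items_values(1)[OF assms] T2 sw]
  show "nice (entries A)" "vval (entries A) = v" by (rule g(1), rule g(2))
  have m: "T ! 0 \<in> set T" "T ! 1 \<in> set T" using T2 by simp_all
  show "order (aut_group (graph_of (entries A))) = 2" if "size2 T"
    using order_2[OF g(1,3) m g(4)] that by (auto simp: size2_iff)
  show "order (aut_group (graph_of (entries A))) = 6 \<and> aut_group (graph_of (entries A)) \<cong> sym_group 3" if "size3 T"
  proof -
    obtain p q s where T: "T = [p, q, s]" using \<open>size3 T\<close> by (auto simp: size3_iff)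
    obtain ps where "rotates A T ps" using items_size[OF assms] T by auto
    then have r: "isperm 22 ps" "ps ! p = q" "ps ! q = s" "relab ps ps A = A"
      unfolding rotates_def by (auto simp: T eqn_iff eqm_iff numeral_eq_Suc split: if_splits)
    have "length A = 22" using b(1) by simp
    then have l: "length ps = 22" using r(4) by (metis length_map relab_map)
    note P = perm_of_permutes[OF r(1) l]
    have "bmat 22 22 (\<lambda>x y. entries A (ps ! x) (ps ! y)) = bmat 22 22 (entries A)"
      using relab_bmat[OF P(2) P(2) l l, of "entries A"] r(4) A by simp
    then have "perm_of ps \<in> automorphisms (graph_of (entries A))"
      using P(1) unfolding aut_mk bmat_eq_iff by (simp add: perm_of_def l)
    moreover have "p < 22" "q < 22" using g(3) T by (metis (no_types, lifting) atLeastLessThan_iff filter_is_subset list.set_intros set_upt subsetD)+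
    ultimately show ?thesis
      using iso_sym_3[OF g(1,3) m g(4), of s "perm_of ps"] T r(2,3) by (auto simp: perm_of_def l)
  qed
qed

lemma isomorphic_iff: "isomorphic G K \<Longrightarrow> isomorphic G H \<longleftrightarrow> isomorphic H K"
  using isomorphic_trans[OF isomorphic_sym, of G H K] isomorphic_trans[OF _ isomorphic_sym, of G K H] by auto

theorem theorem4p10:
  assumes "\<exists>V :: 'a set. card V = 22"
  shows "card (iso_classes (dsrgs_with_involution 22 9 6 3 4 8 :: 'a pair_pre_digraph set)) = 270
    \<and> card {C \<in> iso_classes (dsrgs_with_involution 22 9 6 3 4 8 :: 'a pair_pre_digraph set).
          \<forall>G\<in>C. order (aut_group G) = 6 \<and> aut_group G \<cong> sym_group 3} = 14
    \<and> (\<forall>G \<in> (dsrgs_with_involution 22 9 6 3 4 8 :: 'a pair_pre_digraph set).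
          \<not> (order (aut_group G) = 6 \<and> aut_group G \<cong> sym_group 3)
            \<longrightarrow> order (aut_group G) = 2)"
proof -
  obtain V :: "'a set" where V: "card V = 22" using assms by blast
  define S where "S = (dsrgs_with_involution 22 9 6 3 4 8 :: 'a pair_pre_digraph set)"
  define g where "g it = graph_of (entries (fst it))" for it :: "bool list list \<times> nat \<times> nat list"
  define Q where "Q G \<longleftrightarrow> order (aut_group G) = 6 \<and> aut_group G \<cong> sym_group 3" for G :: "'a pair_pre_digraph"
  \<comment> \<open>The listed graphs live on the natural numbers, while the classes consist of
    graphs over \<open>'a\<close>; each item therefore stands for the set of its copies.\<close>
  define \<phi> where "\<phi> it = {G \<in> S. isomorphic G (g it)}" for it
  have covered: "\<exists>it\<in>set items. isomorphic G (g it)" if "G \<in> S" for G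
  proof -
    obtain a where a: "nice a" "isomorphic G (graph_of a)" using dsrg_nice \<open>G \<in> S\<close> unfolding S_def by metis
    obtain b v T where b: "reach a b" "(bmat 22 22 b, v, T) \<in> set items" using items_reached[OF a(1)] by metis
    have "isomorphic G (g (bmat 22 22 b, v, T))"
      using isomorphic_trans[OF a(2) isomorphic_sym[OF reach_isomorphic[OF b(1)]]] by (simp add: g_def graph_of_entries)
    then show ?thesis using b(2) by blast
  qed
  have nonempty: "\<exists>G\<in>S. isomorphic G (g it)" if "it \<in> set items" for it
  proof -
    obtain A v T where it: "it = (A, v, T)" by (cases it) auto
    have "nice (entries A)" using item_facts(1) that it by blast
    then obtain G where "G \<in> S" "isomorphic G (graph_of (entries A))" using nice_dsrg[OF _ V] unfolding S_def by metis
    then show ?thesis by (auto simp: g_def it)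
  qed
  have v: "vval (entries (fst it)) = fst (snd it)" if "it \<in> set items" for it
    using item_facts(2)[of "fst it" "fst (snd it)" "snd (snd it)"] that by simp
  have dist: "distinct (map (\<lambda>it. fst (snd it)) items)"
    using items_values(2) by (simp add: case_prod_beta')
  have classes: "iso_classes S = \<phi> ` set items"
  proof (intro equalityI subsetI)
    fix C assume "C \<in> iso_classes S"
    then obtain G where G: "G \<in> S" "C = {H \<in> S. isomorphic G H}" unfolding iso_classes_def quotient_def by auto
    obtain it where it: "it \<in> set items" "isomorphic G (g it)" using covered[OF G(1)] by blast
    have "C = \<phi> it"
      unfolding G(2) \<phi>_def isomorphic_iff[OF it(2)] ..
    then show "C \<in> \<phi> ` set items" using it(1) by blast
  next
    fix C assume "C \<in> \<phi> ` set items"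
    then obtain it where it: "it \<in> set items" "C = \<phi> it" by blast
    obtain G where G: "G \<in> S" "isomorphic G (g it)" using nonempty[OF it(1)] by blast
    have "C = {H \<in> S. isomorphic G H}"
      unfolding it(2) \<phi>_def isomorphic_iff[OF G(2)] ..
    then show "C \<in> iso_classes S" unfolding iso_classes_def quotient_def using G(1) by auto
  qed
  have inj: "inj_on \<phi> (set items)"
  proof (rule inj_onI)
    fix i j assume ij: "i \<in> set items" "j \<in> set items" "\<phi> i = \<phi> j"
    obtain G where "G \<in> \<phi> i" using nonempty[OF ij(1)] by (auto simp: \<phi>_def)
    then have "isomorphic G (g i)" "isomorphic G (g j)" using ij(3) by (auto simp: \<phi>_def)
    then have "isomorphic (g i) (g j)" by (rule isomorphic_trans[OF isomorphic_sym])
    \<comment> \<open>The stored value is the invariant \<open>vval\<close>, and the 270 stored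
      values are distinct.\<close>
    then have "fst (snd i) = fst (snd j)" using isomorphic_vval v ij(1,2) unfolding g_def by metis
    then show "i = j" using dist ij(1,2) by (simp add: distinct_map inj_on_def)
  qed
  have Q: "Q G \<longleftrightarrow> size3 (snd (snd it))" "\<not> Q G \<Longrightarrow> order (aut_group G) = 2" if "it \<in> set items" "isomorphic G (g it)" for it G
  proof -
    obtain A v T where it: "it = (A, v, T)" by (cases it) auto
    have i: "(A, v, T) \<in> set items" using that(1) it by simp
    have iso: "isomorphic G (graph_of (entries A))" using that(2) by (simp add: g_def it)
    note t = aut_group_invariants(1)[OF iso] aut_group_invariants(2)[OF iso, of "sym_group 3"]
    have "\<not> (size2 T \<and> size3 T)" by (auto simp: size2_iff)
    then show "Q G \<longleftrightarrow> size3 (snd (snd it))" "\<not> Q G \<Longrightarrow> order (aut_group G) = 2"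
      using items_size[OF i] item_facts(3,4)[OF i] t by (auto simp: Q_def it)
  qed
  have "card (iso_classes S) = 270"
    unfolding classes card_image[OF inj] using distinct_card[of items] dist length_items by (simp add: distinct_map)
  moreover have "card {C \<in> iso_classes S. \<forall>G\<in>C. Q G} = 14"
  proof -
    \<comment> \<open>Each class is nonempty, and all its members have isomorphic automorphism
      groups, so the condition depends on the item alone.\<close>
    have "(\<forall>G\<in>\<phi> it. Q G) \<longleftrightarrow> size3 (snd (snd it))" if "it \<in> set items" for it
      using Q(1)[OF that] nonempty[OF that] unfolding \<phi>_def by auto
    then have "{C \<in> iso_classes S. \<forall>G\<in>C. Q G} = \<phi> ` {it \<in> set items. size3 (snd (snd it))}"
      unfolding classes by auto
    also have "card \<dots> = card {it \<in> set items. size3 (snd (snd it))}"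
      by (rule card_image, rule inj_on_subset[OF inj]) auto
    also have "\<dots> = length (filter (\<lambda>it. size3 (snd (snd it))) items)"
      using distinct_card[of "filter (\<lambda>it. size3 (snd (snd it))) items"] dist by (simp add: distinct_map)
    also have "\<dots> = 14" using count_size3 by (simp add: case_prod_beta')
    finally show ?thesis .
  qed
  moreover have "\<forall>G\<in>S. \<not> Q G \<longrightarrow> order (aut_group G) = 2" using covered Q(2) by blast
  ultimately show ?thesis unfolding S_def Q_def by blast
qed

end
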